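(* (Total correctness of $\mathsf{Pure}$.) Let $S$ be a (well-formed) signature of the calculus $\mathrm{EMF}^\star$ and let $e$ be a closed term with $S;\cdot\vdash e:\mathsf{Pure}\,t\,wp$. Then for every $p$ such that $S;\cdot\vdash p:t\to\mathsf{Type}_0$ and $S;\cdot\models wp\,p$, there is a value $v$ such that $S\vdash\mathsf{run}\,e\longrightarrow^{*}v$ and $S;\cdot\models p\,v$.
   Context: **Syntax of $\mathrm{EMF}^\star$.** Expressions $e$, types $t$, predicate transformers $wp$ and formulas $\phi$ are all terms: $e,t,wp,\phi ::= x \mid T \mid x{:}t\{\phi\}$ (refinement type) $\mid \lambda x{:}t.e \mid x{:}t\to c$ (dependent product) $\mid e_1\,e_2 \mid \mathsf{case}_t(e\ \mathsf{as}\ y)\,x.e_1\,x.e_2 \mid \mathsf{run}\,e\mid \mathsf{reify}\,e\mid\mathsf{reflect}\,e\mid M.\mathsf{lift}_{M'}\,t\,wp\,e\mid F.\mathsf{act}\,\bar e\mid M.\mathsf{return}\,t\,e\mid M.\mathsf{bind}\,t_1\,t_2\,wp_1\,e_1\,wp_2\,x.e_2$. Constants $T$ include universes $\mathsf{Type}_i$ ($i\in\mathbb N$, predicative, non-cumulative), unit, non-dependent pairs ($\times$, pairing, $\mathsf{fst},\mathsf{snd}$) and disjoint sums ($+,\mathsf{inl},\mathsf{inr}$). Computation types: $c::=\mathsf{Tot}\,t\mid M\,t\,wp$ with $M$ either $\mathsf{Pure}$ or a user-defined effect $F$. $t\to t'$ abbreviates $t\to\mathsf{Tot}\,t'$, and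 $e:t$ abbreviates $e:\mathsf{Tot}\,t$. Values $v$ are fully evaluated (irreducible) terms. **Signatures.** $S$ is a list of effect definitions $D$ and lifts $L$. A definition $D$ of an effect $F$ is a record with fields $repr$, $wp\_type$, $\underline{return}$, $return^\star$, $\underline{bind}$, $bind^\star$, and for each action $\underline{act}_j$ and its type $act_j^\star=\overline{x_j{:}t_j}\to c_j$. A lift is a pair of a term $\underline{M.lift}_{M'}$ and a predicate-transformer map $M.lift^\star_{M'}$. $S.F.field$ denotes lookup. $S$ always contains, for $\mathsf{Pure}$: $wp\_type=\lambda a{:}\mathsf{Type}_0.(a\to\mathsf{Type}_0)\to\mathsf{Type}_0$, $return^\star=\lambda a.\lambda x{:}a.\lambda p.\,p\,x$, $bind^\star=\lambda a\,b\,w_1\,w_2\,p.\,w_1(\lambda x.(w_2\,x)\,p)$ (no other fields). $S$ is well formed if each entry is well typed (using only earlier entries) according to its WP: $\underline{return}: a{:}\mathsf{Type}_0\to x{:}a\to repr\,a\,(return^\star\,a\,x)$; $\underline{bind}: a\to b\to w_1{:}wp\_type\,a\to repr\,a\,w_1\to w_2{:}(a\to wp\_type\,b)\to(x{:}a\to repr\,b\,(w_2\,x))\to repr\,b\,(bind^\star\,a\,b\,w_1\,w_2)$; $\underline{act}_j:\overline{x_j{:}t_j}\to repr\,t\,wp$ when $c_j=F\,t\,wp$; $\underline{M.lift}_{M'}:a\to w{:}S.M.wp\_type\,a\to S.M.repr\,a\,w\to S.M'.repr\,a\,(M.lift^\star_{M'}\,w)$ (type argument of $lift^\star$ implicit).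 Lifts are between user-defined effects. **Typing $S;\Gamma\vdash e:c$** ($\Gamma$ a list of bindings $x{:}t$). Standard rules for variables, constants, universes ($\mathsf{Type}_i:\mathsf{Type}_{i+1}$), products (with universe the maximum), abstraction ($\lambda x{:}t.e:x{:}t\to c$ if $\Gamma,x{:}t\vdash e:c$), application ($e_1e_2:c[e_2/x]$ if $e_1:x{:}t\to c$ and $e_2:t$), pairs, sums, and dependent case analysis; case analysis whose branches are $M\,t\,wp_1$ and $M\,t\,wp_2$ computations (non-dependent $t$) has type $M\,t\,(\mathsf{case}(e)\,x.wp_1\,x.wp_2)$. Also: - T-Return: $e:\mathsf{Tot}\,t$ gives $M.\mathsf{return}\,t\,e:M\,t\,(S.M.return^\star\,t\,e)$. - T-Bind: $t_2:\mathsf{Type}_0$, $wp_2:x{:}t_1\to S.M.wp\_type\,t_2$, $e_1:M\,t_1\,wp_1$ and $\Gamma,x{:}t_1\vdash e_2:M\,t_2\,(wp_2\,x)$ give $M.\mathsf{bind}\,t_1\,t_2\,wp_1\,e_1\,wp_2\,x.e_2:M\,t_2\,(S.M.bind^\star\,t_1\,t_2\,wp_1\,wp_2)$. - T-Lift: $e:M\,t\,wp$ gives $M.\mathsf{lift}_{M'}\,t\,wp\,e:M'\,t\,(S.M.lift^\star_{M'}\,wp)$. - T-Act: if $S.F.act^\star=\overline{x{:}t}\to c$ and each $e_i:t_i$, then $F.\mathsf{act}\,\bar e:c[\bar e/\bar x]$. - T-Reify: $e:F\,t\,wp$ gives $\mathsf{reify}\,e:\mathsf{Tot}(S.F.repr\,t\,wp)$.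 T-Reflect: the converse, $e:\mathsf{Tot}(S.F.repr\,t\,wp)$ gives $\mathsf{reflect}\,e:F\,t\,wp$. - T-Run: $e:\mathsf{Pure}\,t\,wp$ and $S;\Gamma\models\exists p.\,wp\,p$ give $\mathsf{run}\,e:\mathsf{Tot}\,t$. - T-Refine: $t:\mathsf{Type}_i$ and $\Gamma,x{:}t\vdash\phi:\mathsf{Type}_j$ give $x{:}t\{\phi\}:\mathsf{Type}_i$. - C-Pure: $t:\mathsf{Type}_0$, $wp:(t\to\mathsf{Type}_0)\to\mathsf{Type}_0$ give $\mathsf{Pure}\,t\,wp:\mathsf{Type}_0$. C-F: $S.F.repr\,t\,wp:\mathsf{Type}_0$ gives $F\,t\,wp:\mathsf{Type}_0$. - T-Sub: $e:c'$ and $c'<:c$ give $e:c$. **Subtyping $S;\Gamma\vdash c'<:c$ and $t'<:t$** (a preorder): $\mathsf{Tot}\,t'<:\mathsf{Tot}\,t$ if $t'<:t$; $\mathsf{Pure}\,t'\,wp'<:\mathsf{Pure}\,t\,wp$ if $t'<:t$ and $S;\Gamma\models\forall p.\,wp\,p\Rightarrow wp'\,p$; $F\,t'\,wp'<:F\,t\,wp$ if $S.F.repr\,t'\,wp'<:S.F.repr\,t\,wp$; $x{:}t'\to c'<:x{:}t\to c$ if $t<:t'$ and $\Gamma,x{:}t\vdash c'<:c$; $x{:}t\{\phi\}<:t$; $t<:x{:}t\{\phi\}$ if $\Gamma,x{:}t\models\phi$; $t'<:t$ if $t'\longrightarrow^*t$ or $t\longrightarrow^*t'$. **Validity $S;\Gamma\models\phi$**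 is entailment of a proof-irrelevant classical higher-order logic, with squashed connectives (e.g. $p\wedge q$ is $x{:}\mathsf{unit}\{p\times q\}$, $p\Rightarrow q$ is $x{:}\mathsf{unit}\{p\to q\}$, in $\mathsf{Type}_0$): usual rules for hypotheses from $\Gamma$, the connectives and quantifiers, equality (reflexive, substitutive, containing reduction, extensional on functions), and case analysis on sums. **Reduction $S\vdash e\longrightarrow e'$** is the closure under evaluation contexts $E::=\bullet\mid\lambda x{:}t.E\mid E\,e\mid e\,E\mid\mathsf{run}\,E\mid\mathsf{reify}\,E\mid\mathsf{reflect}\,E\mid M.\mathsf{bind}\,t_1\,t_2\,wp_1\,E\,wp_2\,x.e_2\mid M.\mathsf{return}\,t\,E\mid M.\mathsf{lift}_{M'}\,t\,wp\,E\mid F.\mathsf{act}\,\bar e\,E\,\bar e'$ and case with $E$ in the scrutinee or either branch, of: $(\lambda x{:}t.e)\,e'\to e[e'/x]$; the usual rules for $\mathsf{fst},\mathsf{snd}$, case; $\mathsf{run}(\mathsf{Pure}.\mathsf{return}\,t\,e)\to e$; $\mathsf{Pure}.\mathsf{bind}\,t_1\,t_2\,wp_1\,(\mathsf{Pure}.\mathsf{return}\,t\,e_1)\,wp_2\,x.e_2\to e_2[e_1/x]$; $\mathsf{reify}(\mathsf{reflect}\,e)\to e$; $\mathsf{reify}(F.\mathsf{return}\,t\,e)\to S.F.\underline{return}\,t\,e$; $\mathsf{reify}(F.\mathsf{bind}\,t_1\,t_2\,wp_1\,e_1\,wp_2\,x.e_2)\to S.F.\underline{bind}\,t_1\,t_2\,wp_1\,(\mathsf{reify}\,e_1)\,wp_2\,(\lambda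 x{:}t_1.\mathsf{reify}\,e_2)$; $\mathsf{reify}(F.\mathsf{act}\,\bar e)\to S.F.\underline{act}\,\bar e$; $\mathsf{reify}(M.\mathsf{lift}_{M'}\,t\,wp\,e)\to S.\underline{M.lift}_{M'}\,t\,wp\,(\mathsf{reify}\,e)$. **Standing assumption.** Strong normalization of $\mathrm{EMF}^\star$ is relative to strong normalization of the Calculus of Inductive Constructions, which is assumed. *)

theory Defs
  imports Main
begin

text \<open>
  The calculus is formalised with de Bruijn indices; the head of a context is the innermost binding
  (index 0).
\<close>

section \<open>Syntax\<close>

type_synonym ename = nat

datatype eff = Pure | User ename

text \<open>
  \<open>CFalse\<close>, \<open>CEq\<close> and \<open>CEx\<close> are the logical constants; the other connectives and the universal
  quantifier are squashed types, defined below.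
\<close>

datatype const =
    CUnitT | CUnit
  | CProd | CPair | CFst | CSnd
  | CSum | CInl | CInr
  | CFalse | CEq | CEx

text \<open>
  Scopes: the second argument of \<open>Refine\<close>, \<open>Lam\<close> and \<open>Pi\<close>, the first (return type, binding the
  scrutinee), third and fourth arguments of \<open>Case\<close>, and the last argument of \<open>Bind\<close> each bind one
  variable. Argument orders: \<open>Case t e e1 e2\<close>, \<open>Lift F F' t wp e\<close> (from \<open>F\<close> to \<open>F'\<close>),
  \<open>Act F j es\<close> (the \<open>j\<close>-th action of \<open>F\<close>), \<open>Ret M t e\<close>, \<open>Bind M t1 t2 wp1 e1 wp2 e2\<close>.
\<close>

datatype tm =
    Var nat
  | Universe nat
  | Const const
  | Refine tm tm
  | Lam tm tm
  | Pi tm comp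
  | App tm tm
  | Case tm tm tm tm
  | Run tm
  | Reify tm
  | Reflect tm
  | Lift ename ename tm tm tm
  | Act ename nat "tm list"
  | Ret eff tm tm
  | Bind eff tm tm tm tm tm tm
and comp =
    Tot tm
  | Cmp eff tm tm

section \<open>Renaming and substitution\<close>

definition upr :: "(nat \<Rightarrow> nat) \<Rightarrow> nat \<Rightarrow> nat" where
  "upr r = case_nat 0 (\<lambda>k. Suc (r k))"

primrec ren :: "(nat \<Rightarrow> nat) \<Rightarrow> tm \<Rightarrow> tm"
  and cren :: "(nat \<Rightarrow> nat) \<Rightarrow> comp \<Rightarrow> comp" where
  "ren r (Var k) = Var (r k)"
| "ren r (Universe i) = Universe i"
| "ren r (Const c) = Const c"
| "ren r (Refine t phi) = Refine (ren r t) (ren (upr r) phi)"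
| "ren r (Lam t e) = Lam (ren r t) (ren (upr r) e)"
| "ren r (Pi t c) = Pi (ren r t) (cren (upr r) c)"
| "ren r (App e1 e2) = App (ren r e1) (ren r e2)"
| "ren r (Case t e e1 e2) = Case (ren (upr r) t) (ren r e) (ren (upr r) e1) (ren (upr r) e2)"
| "ren r (Run e) = Run (ren r e)"
| "ren r (Reify e) = Reify (ren r e)"
| "ren r (Reflect e) = Reflect (ren r e)"
| "ren r (Lift F F' t wp e) = Lift F F' (ren r t) (ren r wp) (ren r e)"
| "ren r (Act F j es) = Act F j (map (ren r) es)"
| "ren r (Ret M t e) = Ret M (ren r t) (ren r e)"
| "ren r (Bind M t1 t2 wp1 e1 wp2 e2) =
     Bind M (ren r t1) (ren r t2) (ren r wp1) (ren r e1) (ren r wp2) (ren (upr r) e2)"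
| "cren r (Tot t) = Tot (ren r t)"
| "cren r (Cmp M t wp) = Cmp M (ren r t) (ren r wp)"

abbreviation shift :: "tm \<Rightarrow> tm" where
  "shift \<equiv> ren Suc"

definition ups :: "(nat \<Rightarrow> tm) \<Rightarrow> nat \<Rightarrow> tm" where
  "ups s = case_nat (Var 0) (\<lambda>k. shift (s k))"

primrec sub :: "(nat \<Rightarrow> tm) \<Rightarrow> tm \<Rightarrow> tm"
  and csub :: "(nat \<Rightarrow> tm) \<Rightarrow> comp \<Rightarrow> comp" where
  "sub s (Var k) = s k"
| "sub s (Universe i) = Universe i"
| "sub s (Const c) = Const c"
| "sub s (Refine t phi) = Refine (sub s t) (sub (ups s) phi)"
| "sub s (Lam t e) = Lam (sub s t) (sub (ups s) e)"
| "sub s (Pi t c) = Pi (sub s t) (csub (ups s) c)"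
| "sub s (App e1 e2) = App (sub s e1) (sub s e2)"
| "sub s (Case t e e1 e2) = Case (sub (ups s) t) (sub s e) (sub (ups s) e1) (sub (ups s) e2)"
| "sub s (Run e) = Run (sub s e)"
| "sub s (Reify e) = Reify (sub s e)"
| "sub s (Reflect e) = Reflect (sub s e)"
| "sub s (Lift F F' t wp e) = Lift F F' (sub s t) (sub s wp) (sub s e)"
| "sub s (Act F j es) = Act F j (map (sub s) es)"
| "sub s (Ret M t e) = Ret M (sub s t) (sub s e)"
| "sub s (Bind M t1 t2 wp1 e1 wp2 e2) =
     Bind M (sub s t1) (sub s t2) (sub s wp1) (sub s e1) (sub s wp2) (sub (ups s) e2)"
| "csub s (Tot t) = Tot (sub s t)"
| "csub s (Cmp M t wp) = Cmp M (sub s t) (sub s wp)"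

text \<open>
  \<open>inst es\<close> replaces the \<open>length es\<close> innermost variables; the \<^emph>\<open>last\<close> element of \<open>es\<close> is for index 0,
  so that \<open>es\<close> is listed in the order in which the variables were bound.
\<close>

definition inst :: "tm list \<Rightarrow> nat \<Rightarrow> tm" where
  "inst es k = (if k < length es then rev es ! k else Var (k - length es))"

abbreviation sub1 :: "tm \<Rightarrow> tm \<Rightarrow> tm" where
  "sub1 e t \<equiv> sub (inst [e]) t"

abbreviation csub1 :: "tm \<Rightarrow> comp \<Rightarrow> comp" where
  "csub1 e c \<equiv> csub (inst [e]) c"

text \<open>
  Change of variable from a variable of sum type to a variable of one of the summands:
  \<open>sub (via CInl) t\<close> is \<open>t[inl x/y]\<close>, with \<open>x\<close> taking the place of \<open>y\<close>.
\<close>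

definition via :: "const \<Rightarrow> nat \<Rightarrow> tm" where
  "via c = case_nat (App (Const c) (Var 0)) (\<lambda>k. Var (Suc k))"

section \<open>Derived syntax\<close>

abbreviation arr :: "tm \<Rightarrow> tm \<Rightarrow> tm" where
  "arr t t' \<equiv> Pi t (Tot (shift t'))"

abbreviation app2 :: "tm \<Rightarrow> tm \<Rightarrow> tm \<Rightarrow> tm" where
  "app2 f a b \<equiv> App (App f a) b"

abbreviation apps :: "tm \<Rightarrow> tm list \<Rightarrow> tm" where
  "apps f es \<equiv> foldl App f es"

abbreviation unitT :: tm where
  "unitT \<equiv> Const CUnitT"

abbreviation prodT :: "tm \<Rightarrow> tm \<Rightarrow> tm" where
  "prodT t1 t2 \<equiv> app2 (Const CProd) t1 t2"

abbreviation sumT :: "tm \<Rightarrow> tm \<Rightarrow> tm" where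
  "sumT t1 t2 \<equiv> app2 (Const CSum) t1 t2"

abbreviation squash :: "tm \<Rightarrow> tm" where
  "squash phi \<equiv> Refine unitT (shift phi)"

abbreviation Conj :: "tm \<Rightarrow> tm \<Rightarrow> tm" where
  "Conj p q \<equiv> squash (prodT p q)"

abbreviation Disj :: "tm \<Rightarrow> tm \<Rightarrow> tm" where
  "Disj p q \<equiv> squash (sumT p q)"

abbreviation Imp :: "tm \<Rightarrow> tm \<Rightarrow> tm" where
  "Imp p q \<equiv> squash (arr p q)"

abbreviation Falsum :: tm where
  "Falsum \<equiv> Const CFalse"

abbreviation Neg :: "tm \<Rightarrow> tm" where
  "Neg p \<equiv> Imp p Falsum"

abbreviation All :: "tm \<Rightarrow> tm \<Rightarrow> tm" where
  "All t phi \<equiv> squash (Pi t (Tot phi))"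

abbreviation Exi :: "tm \<Rightarrow> tm \<Rightarrow> tm" where
  "Exi t phi \<equiv> app2 (Const CEx) t (Lam t phi)"

abbreviation Eq :: "tm \<Rightarrow> tm \<Rightarrow> tm \<Rightarrow> tm" where
  "Eq t a b \<equiv> apps (Const CEq) [t, a, b]"

section \<open>Signatures\<close>

text \<open>
  An action \<open>\<lparr>act_args = [t1, ..., tn], act_res = t, act_wp = wp, act_impl = e\<rparr>\<close> of an effect \<open>F\<close> has
  type \<open>x1:t1 \<rightarrow> ... \<rightarrow> xn:tn \<rightarrow> F t wp\<close>; each \<open>ti\<close> is in the scope of the preceding variables, and
  \<open>t\<close> and \<open>wp\<close> in the scope of all of them.
\<close>

record action =
  act_args :: "tm list"
  act_res :: tm
  act_wp :: tm
  act_impl :: tm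

record effect =
  repr :: tm
  wp_type :: tm
  ret_impl :: tm
  ret_star :: tm
  bind_impl :: tm
  bind_star :: tm
  actions :: "action list"

datatype entry =
    EffDef ename effect
  | LiftDef ename ename (lift_impl: tm) (lift_star: tm)

text \<open>The most recent entry comes first.\<close>

type_synonym signature = "entry list"

primrec lookup_eff :: "signature \<Rightarrow> ename \<Rightarrow> effect option" where
  "lookup_eff [] F = None"
| "lookup_eff (d # S) F =
     (case d of
        EffDef G D \<Rightarrow> if G = F then Some D else lookup_eff S F
      | LiftDef G G' l w \<Rightarrow> lookup_eff S F)"

primrec lookup_lift :: "signature \<Rightarrow> ename \<Rightarrow> ename \<Rightarrow> (tm \<times> tm) option" where
  "lookup_lift [] F F' = None"
| "lookup_lift (d # S) F F' =
     (case d of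
        EffDef G D \<Rightarrow> lookup_lift S F F'
      | LiftDef G G' l w \<Rightarrow> if G = F \<and> G' = F' then Some (l, w) else lookup_lift S F F')"

definition pure_wp_type :: tm where
  "pure_wp_type = Lam (Universe 0) (arr (arr (Var 0) (Universe 0)) (Universe 0))"

definition pure_ret_star :: tm where
  "pure_ret_star =
     Lam (Universe 0) (Lam (Var 0) (Lam (arr (Var 1) (Universe 0)) (App (Var 0) (Var 1))))"

text \<open>\<open>\<lambda>a b w1 w2 p. w1 (\<lambda>x. (w2 x) p)\<close>, with the evident type annotations\<close>

definition pure_bind_star :: tm where
  "pure_bind_star =
     Lam (Universe 0) (Lam (Universe 0)
       (Lam (App pure_wp_type (Var 1))
         (Lam (arr (Var 2) (App pure_wp_type (Var 1)))
           (Lam (arr (Var 2) (Universe 0))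
             (App (Var 2) (Lam (Var 4) (app2 (Var 2) (Var 0) (Var 1))))))))"

fun wp_type_of :: "signature \<Rightarrow> eff \<Rightarrow> tm option" where
  "wp_type_of S Pure = Some pure_wp_type"
| "wp_type_of S (User F) = map_option wp_type (lookup_eff S F)"

fun ret_star_of :: "signature \<Rightarrow> eff \<Rightarrow> tm option" where
  "ret_star_of S Pure = Some pure_ret_star"
| "ret_star_of S (User F) = map_option ret_star (lookup_eff S F)"

fun bind_star_of :: "signature \<Rightarrow> eff \<Rightarrow> tm option" where
  "bind_star_of S Pure = Some pure_bind_star"
| "bind_star_of S (User F) = map_option bind_star (lookup_eff S F)"

section \<open>Reduction\<close>

inductive red :: "signature \<Rightarrow> tm \<Rightarrow> tm \<Rightarrow> bool" for S where
  R_Beta: "red S (App (Lam t e) e') (sub1 e' e)"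
| R_Fst: "red S (App (Const CFst) (app2 (Const CPair) e1 e2)) e1"
| R_Snd: "red S (App (Const CSnd) (app2 (Const CPair) e1 e2)) e2"
| R_CaseInl: "red S (Case t (App (Const CInl) e) e1 e2) (sub1 e e1)"
| R_CaseInr: "red S (Case t (App (Const CInr) e) e1 e2) (sub1 e e2)"
| R_RunRet: "red S (Run (Ret Pure t e)) e"
| R_PureBind: "red S (Bind Pure t1 t2 wp1 (Ret Pure t e1) wp2 e2) (sub1 e1 e2)"
| R_ReifyReflect: "red S (Reify (Reflect e)) e"
| R_ReifyRet: "lookup_eff S F = Some D \<Longrightarrow>
    red S (Reify (Ret (User F) t e)) (apps (ret_impl D) [t, e])"
| R_ReifyBind: "lookup_eff S F = Some D \<Longrightarrow>
    red S (Reify (Bind (User F) t1 t2 wp1 e1 wp2 e2))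
          (apps (bind_impl D) [t1, t2, wp1, Reify e1, wp2, Lam t1 (Reify e2)])"
| R_ReifyAct: "lookup_eff S F = Some D \<Longrightarrow> j < length (actions D) \<Longrightarrow>
    red S (Reify (Act F j es)) (apps (act_impl (actions D ! j)) es)"
| R_ReifyLift: "lookup_lift S F F' = Some (l, w) \<Longrightarrow>
    red S (Reify (Lift F F' t wp e)) (apps l [t, wp, Reify e])"
| E_Lam: "red S e e' \<Longrightarrow> red S (Lam t e) (Lam t e')"
| E_App1: "red S e1 e1' \<Longrightarrow> red S (App e1 e2) (App e1' e2)"
| E_App2: "red S e2 e2' \<Longrightarrow> red S (App e1 e2) (App e1 e2')"
| E_Run: "red S e e' \<Longrightarrow> red S (Run e) (Run e')"
| E_Reify: "red S e e' \<Longrightarrow> red S (Reify e) (Reify e')"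
| E_Reflect: "red S e e' \<Longrightarrow> red S (Reflect e) (Reflect e')"
| E_Bind: "red S e1 e1' \<Longrightarrow>
    red S (Bind M t1 t2 wp1 e1 wp2 e2) (Bind M t1 t2 wp1 e1' wp2 e2)"
| E_Ret: "red S e e' \<Longrightarrow> red S (Ret M t e) (Ret M t e')"
| E_Lift: "red S e e' \<Longrightarrow> red S (Lift F F' t wp e) (Lift F F' t wp e')"
| E_Act: "red S e e' \<Longrightarrow> red S (Act F j (es @ e # es')) (Act F j (es @ e' # es'))"
| E_Case: "red S e e' \<Longrightarrow> red S (Case t e e1 e2) (Case t e' e1 e2)"
| E_CaseL: "red S e1 e1' \<Longrightarrow> red S (Case t e e1 e2) (Case t e e1' e2)"
| E_CaseR: "red S e2 e2' \<Longrightarrow> red S (Case t e e1 e2) (Case t e e1 e2')"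

abbreviation reds :: "signature \<Rightarrow> tm \<Rightarrow> tm \<Rightarrow> bool" where
  "reds S \<equiv> (red S)\<^sup>*\<^sup>*"

definition is_value :: "signature \<Rightarrow> tm \<Rightarrow> bool" where
  "is_value S v \<longleftrightarrow> (\<nexists>v'. red S v v')"

section \<open>Typing, subtyping and validity\<close>

type_synonym ctx = "tm list"

text \<open>
  Constants are schematic in their type parameters; \<open>const_type S \<Gamma> c t\<close> below gives the instances.
  The judgements are
  \<^item> \<open>wf_ctx S \<Gamma>\<close>: \<open>\<Gamma>\<close> is a well-formed context;
  \<^item> \<open>const_type S \<Gamma> k t\<close>: the constant \<open>k\<close> has type \<open>t\<close>;
  \<^item> \<open>has_type S \<Gamma> e c\<close>: the typing judgement;
  \<^item> \<open>wf_comp S \<Gamma> c i\<close>: the computation type \<open>c\<close> is well formed and lives in universe \<open>i\<close>;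
  \<^item> \<open>sub_type S \<Gamma> t' t\<close> and \<open>sub_comp S \<Gamma> c' c\<close>: subtyping, of value and of computation types;
  \<^item> \<open>valid S \<Gamma> \<phi>\<close>: validity.

  As usual, rules carry the premises that make the types they mention well formed: \<open>T_Lam\<close>
  (domain), \<open>T_Case\<close> and \<open>T_CaseM\<close> (return type), \<open>T_Ret\<close> (result type), \<open>T_Reflect\<close> and \<open>T_Sub\<close>
  (resulting computation type), and \<open>C_User\<close> (arguments of \<open>repr\<close>, at the domains of its declared
  type). This matters because subtyping contains conversion of raw types: without such premises
  in \<open>T_Lam\<close> and \<open>T_Sub\<close>, all untyped lambda terms would be typeable.
\<close>

inductive
  wf_ctx :: "signature \<Rightarrow> ctx \<Rightarrow> bool" and
  const_type :: "signature \<Rightarrow> ctx \<Rightarrow> const \<Rightarrow> tm \<Rightarrow> bool" and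
  has_type :: "signature \<Rightarrow> ctx \<Rightarrow> tm \<Rightarrow> comp \<Rightarrow> bool" and
  wf_comp :: "signature \<Rightarrow> ctx \<Rightarrow> comp \<Rightarrow> nat \<Rightarrow> bool" and
  sub_type :: "signature \<Rightarrow> ctx \<Rightarrow> tm \<Rightarrow> tm \<Rightarrow> bool" and
  sub_comp :: "signature \<Rightarrow> ctx \<Rightarrow> comp \<Rightarrow> comp \<Rightarrow> bool" and
  valid :: "signature \<Rightarrow> ctx \<Rightarrow> tm \<Rightarrow> bool"
  for S :: signature
where
  W_Nil: "wf_ctx S []"
| W_Cons: "wf_ctx S \<Gamma> \<Longrightarrow> has_type S \<Gamma> t (Tot (Universe i)) \<Longrightarrow> wf_ctx S (t # \<Gamma>)"

| K_UnitT: "wf_ctx S \<Gamma> \<Longrightarrow> const_type S \<Gamma> CUnitT (Universe 0)"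
| K_Unit: "wf_ctx S \<Gamma> \<Longrightarrow> const_type S \<Gamma> CUnit unitT"
| K_Prod: "wf_ctx S \<Gamma> \<Longrightarrow>
    const_type S \<Gamma> CProd (arr (Universe i) (arr (Universe j) (Universe (max i j))))"
| K_Pair: "has_type S \<Gamma> t1 (Tot (Universe i)) \<Longrightarrow> has_type S \<Gamma> t2 (Tot (Universe j)) \<Longrightarrow>
    const_type S \<Gamma> CPair (arr t1 (arr t2 (prodT t1 t2)))"
| K_Fst: "has_type S \<Gamma> t1 (Tot (Universe i)) \<Longrightarrow> has_type S \<Gamma> t2 (Tot (Universe j)) \<Longrightarrow>
    const_type S \<Gamma> CFst (arr (prodT t1 t2) t1)"
| K_Snd: "has_type S \<Gamma> t1 (Tot (Universe i)) \<Longrightarrow> has_type S \<Gamma> t2 (Tot (Universe j)) \<Longrightarrow>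
    const_type S \<Gamma> CSnd (arr (prodT t1 t2) t2)"
| K_Sum: "wf_ctx S \<Gamma> \<Longrightarrow>
    const_type S \<Gamma> CSum (arr (Universe i) (arr (Universe j) (Universe (max i j))))"
| K_Inl: "has_type S \<Gamma> t1 (Tot (Universe i)) \<Longrightarrow> has_type S \<Gamma> t2 (Tot (Universe j)) \<Longrightarrow>
    const_type S \<Gamma> CInl (arr t1 (sumT t1 t2))"
| K_Inr: "has_type S \<Gamma> t1 (Tot (Universe i)) \<Longrightarrow> has_type S \<Gamma> t2 (Tot (Universe j)) \<Longrightarrow>
    const_type S \<Gamma> CInr (arr t2 (sumT t1 t2))"
| K_False: "wf_ctx S \<Gamma> \<Longrightarrow> const_type S \<Gamma> CFalse (Universe 0)"
| K_Eq: "wf_ctx S \<Gamma> \<Longrightarrow>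
    const_type S \<Gamma> CEq (Pi (Universe i) (Tot (arr (Var 0) (arr (Var 0) (Universe 0)))))"
| K_Ex: "wf_ctx S \<Gamma> \<Longrightarrow>
    const_type S \<Gamma> CEx (Pi (Universe i) (Tot (arr (arr (Var 0) (Universe j)) (Universe 0))))"

| T_Var: "wf_ctx S \<Gamma> \<Longrightarrow> k < length \<Gamma> \<Longrightarrow>
    has_type S \<Gamma> (Var k) (Tot (ren (\<lambda>n. n + Suc k) (\<Gamma> ! k)))"
| T_Const: "const_type S \<Gamma> k t \<Longrightarrow> has_type S \<Gamma> (Const k) (Tot t)"
| T_Universe: "wf_ctx S \<Gamma> \<Longrightarrow> has_type S \<Gamma> (Universe i) (Tot (Universe (Suc i)))"
| T_Refine: "has_type S \<Gamma> t (Tot (Universe i)) \<Longrightarrow>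
    has_type S (t # \<Gamma>) phi (Tot (Universe j)) \<Longrightarrow>
    has_type S \<Gamma> (Refine t phi) (Tot (Universe i))"
| T_Pi: "has_type S \<Gamma> t (Tot (Universe i)) \<Longrightarrow> wf_comp S (t # \<Gamma>) c j \<Longrightarrow>
    has_type S \<Gamma> (Pi t c) (Tot (Universe (max i j)))"
| T_Lam: "has_type S \<Gamma> t (Tot (Universe i)) \<Longrightarrow> has_type S (t # \<Gamma>) e c \<Longrightarrow>
    has_type S \<Gamma> (Lam t e) (Tot (Pi t c))"
| T_App: "has_type S \<Gamma> e1 (Tot (Pi t c)) \<Longrightarrow> has_type S \<Gamma> e2 (Tot t) \<Longrightarrow>
    has_type S \<Gamma> (App e1 e2) (csub1 e2 c)"
| T_Case: "has_type S \<Gamma> e (Tot (sumT t1 t2)) \<Longrightarrow>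
    has_type S (sumT t1 t2 # \<Gamma>) t (Tot (Universe i)) \<Longrightarrow>
    has_type S (t1 # \<Gamma>) e1 (Tot (sub (via CInl) t)) \<Longrightarrow>
    has_type S (t2 # \<Gamma>) e2 (Tot (sub (via CInr) t)) \<Longrightarrow>
    has_type S \<Gamma> (Case t e e1 e2) (Tot (sub1 e t))"
| T_CaseM: "has_type S \<Gamma> e (Tot (sumT t1 t2)) \<Longrightarrow>
    has_type S \<Gamma> t (Tot (Universe i)) \<Longrightarrow>
    has_type S (t1 # \<Gamma>) e1 (Cmp M (shift t) wp1) \<Longrightarrow>
    has_type S (t2 # \<Gamma>) e2 (Cmp M (shift t) wp2) \<Longrightarrow>
    wp_type_of S M = Some W \<Longrightarrow>
    has_type S \<Gamma> (Case (shift t) e e1 e2) (Cmp M t (Case (shift (App W t)) e wp1 wp2))"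
| T_Ret: "has_type S \<Gamma> t (Tot (Universe 0)) \<Longrightarrow> has_type S \<Gamma> e (Tot t) \<Longrightarrow>
    ret_star_of S M = Some R \<Longrightarrow>
    has_type S \<Gamma> (Ret M t e) (Cmp M t (apps R [t, e]))"
| T_Bind: "has_type S \<Gamma> t2 (Tot (Universe 0)) \<Longrightarrow>
    wp_type_of S M = Some W \<Longrightarrow> bind_star_of S M = Some B \<Longrightarrow>
    has_type S \<Gamma> wp2 (Tot (arr t1 (App W t2))) \<Longrightarrow>
    has_type S \<Gamma> e1 (Cmp M t1 wp1) \<Longrightarrow>
    has_type S (t1 # \<Gamma>) e2 (Cmp M (shift t2) (App (shift wp2) (Var 0))) \<Longrightarrow>
    has_type S \<Gamma> (Bind M t1 t2 wp1 e1 wp2 e2) (Cmp M t2 (apps B [t1, t2, wp1, wp2]))"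
| T_Lift: "has_type S \<Gamma> e (Cmp (User F) t wp) \<Longrightarrow> lookup_lift S F F' = Some (l, w) \<Longrightarrow>
    has_type S \<Gamma> (Lift F F' t wp e) (Cmp (User F') t (apps w [t, wp]))"
| T_Act: "wf_ctx S \<Gamma> \<Longrightarrow>
    lookup_eff S F = Some D \<Longrightarrow> j < length (actions D) \<Longrightarrow> A = actions D ! j \<Longrightarrow>
    length es = length (act_args A) \<Longrightarrow>
    (\<forall>i < length es. has_type S \<Gamma> (es ! i) (Tot (sub (inst (take i es)) (act_args A ! i)))) \<Longrightarrow>
    has_type S \<Gamma> (Act F j es) (csub (inst es) (Cmp (User F) (act_res A) (act_wp A)))"
| T_Reify: "has_type S \<Gamma> e (Cmp (User F) t wp) \<Longrightarrow> lookup_eff S F = Some D \<Longrightarrow>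
    has_type S \<Gamma> (Reify e) (Tot (apps (repr D) [t, wp]))"
| T_Reflect: "has_type S \<Gamma> e (Tot (apps (repr D) [t, wp])) \<Longrightarrow> lookup_eff S F = Some D \<Longrightarrow>
    wf_comp S \<Gamma> (Cmp (User F) t wp) i \<Longrightarrow>
    has_type S \<Gamma> (Reflect e) (Cmp (User F) t wp)"
| T_Run: "has_type S \<Gamma> e (Cmp Pure t wp) \<Longrightarrow>
    valid S \<Gamma> (Exi (arr t (Universe 0)) (App (shift wp) (Var 0))) \<Longrightarrow>
    has_type S \<Gamma> (Run e) (Tot t)"
| T_Sub: "has_type S \<Gamma> e c' \<Longrightarrow> sub_comp S \<Gamma> c' c \<Longrightarrow> wf_comp S \<Gamma> c i \<Longrightarrow> has_type S \<Gamma> e c"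

| C_Tot: "has_type S \<Gamma> t (Tot (Universe i)) \<Longrightarrow> wf_comp S \<Gamma> (Tot t) i"
| C_Pure: "has_type S \<Gamma> t (Tot (Universe 0)) \<Longrightarrow>
    has_type S \<Gamma> wp (Tot (arr (arr t (Universe 0)) (Universe 0))) \<Longrightarrow>
    wf_comp S \<Gamma> (Cmp Pure t wp) 0"
| C_User: "lookup_eff S F = Some D \<Longrightarrow>
    has_type S \<Gamma> t (Tot (Universe 0)) \<Longrightarrow> has_type S \<Gamma> wp (Tot (App (wp_type D) t)) \<Longrightarrow>
    has_type S \<Gamma> (apps (repr D) [t, wp]) (Tot (Universe 0)) \<Longrightarrow>
    wf_comp S \<Gamma> (Cmp (User F) t wp) 0"

| S_Refl: "sub_type S \<Gamma> t t"
| S_Trans: "sub_type S \<Gamma> t1 t2 \<Longrightarrow> sub_type S \<Gamma> t2 t3 \<Longrightarrow> sub_type S \<Gamma> t1 t3"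
| S_Pi: "sub_type S \<Gamma> t t' \<Longrightarrow> sub_comp S (t # \<Gamma>) c' c \<Longrightarrow> sub_type S \<Gamma> (Pi t' c') (Pi t c)"
| S_RefineL: "sub_type S \<Gamma> (Refine t phi) t"
| S_RefineR: "valid S (t # \<Gamma>) phi \<Longrightarrow> sub_type S \<Gamma> t (Refine t phi)"
| S_Red: "reds S t' t \<Longrightarrow> sub_type S \<Gamma> t' t"
| S_Exp: "reds S t t' \<Longrightarrow> sub_type S \<Gamma> t' t"

| SC_Refl: "sub_comp S \<Gamma> c c"
| SC_Trans: "sub_comp S \<Gamma> c1 c2 \<Longrightarrow> sub_comp S \<Gamma> c2 c3 \<Longrightarrow> sub_comp S \<Gamma> c1 c3"
| SC_Tot: "sub_type S \<Gamma> t' t \<Longrightarrow> sub_comp S \<Gamma> (Tot t') (Tot t)"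
| SC_Pure: "sub_type S \<Gamma> t' t \<Longrightarrow>
    valid S \<Gamma> (All (arr t (Universe 0))
      (Imp (App (shift wp) (Var 0)) (App (shift wp') (Var 0)))) \<Longrightarrow>
    sub_comp S \<Gamma> (Cmp Pure t' wp') (Cmp Pure t wp)"
| SC_User: "lookup_eff S F = Some D \<Longrightarrow>
    sub_type S \<Gamma> (apps (repr D) [t', wp']) (apps (repr D) [t, wp]) \<Longrightarrow>
    sub_comp S \<Gamma> (Cmp (User F) t' wp') (Cmp (User F) t wp)"

\<comment> \<open>With \<open>T_Var\<close>, \<open>V_Hyp\<close> and \<open>V_Refine\<close> give the hypotheses of the context.\<close>
| V_Hyp: "has_type S \<Gamma> e (Tot phi) \<Longrightarrow> valid S \<Gamma> phi"
| V_Refine: "has_type S \<Gamma> e (Tot (Refine t phi)) \<Longrightarrow> valid S \<Gamma> (sub1 e phi)"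
| V_ConjI: "valid S \<Gamma> p \<Longrightarrow> valid S \<Gamma> q \<Longrightarrow> valid S \<Gamma> (Conj p q)"
| V_ConjE1: "valid S \<Gamma> (Conj p q) \<Longrightarrow> valid S \<Gamma> p"
| V_ConjE2: "valid S \<Gamma> (Conj p q) \<Longrightarrow> valid S \<Gamma> q"
| V_DisjI1: "valid S \<Gamma> p \<Longrightarrow> has_type S \<Gamma> q (Tot (Universe i)) \<Longrightarrow> valid S \<Gamma> (Disj p q)"
| V_DisjI2: "valid S \<Gamma> q \<Longrightarrow> has_type S \<Gamma> p (Tot (Universe i)) \<Longrightarrow> valid S \<Gamma> (Disj p q)"
| V_DisjE: "valid S \<Gamma> (Disj p q) \<Longrightarrow> valid S (p # \<Gamma>) (shift r) \<Longrightarrow>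
    valid S (q # \<Gamma>) (shift r) \<Longrightarrow> has_type S \<Gamma> r (Tot (Universe i)) \<Longrightarrow> valid S \<Gamma> r"
| V_ImpI: "has_type S \<Gamma> p (Tot (Universe i)) \<Longrightarrow> has_type S \<Gamma> q (Tot (Universe j)) \<Longrightarrow>
    valid S (p # \<Gamma>) (shift q) \<Longrightarrow> valid S \<Gamma> (Imp p q)"
| V_ImpE: "valid S \<Gamma> (Imp p q) \<Longrightarrow> valid S \<Gamma> p \<Longrightarrow> valid S \<Gamma> q"
| V_FalseE: "valid S \<Gamma> Falsum \<Longrightarrow> has_type S \<Gamma> phi (Tot (Universe i)) \<Longrightarrow> valid S \<Gamma> phi"
| V_Classical: "has_type S \<Gamma> phi (Tot (Universe i)) \<Longrightarrow> valid S (Neg phi # \<Gamma>) Falsum \<Longrightarrow>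
    valid S \<Gamma> phi"
| V_AllI: "has_type S \<Gamma> t (Tot (Universe i)) \<Longrightarrow> valid S (t # \<Gamma>) phi \<Longrightarrow> valid S \<Gamma> (All t phi)"
| V_AllE: "valid S \<Gamma> (All t phi) \<Longrightarrow> has_type S \<Gamma> e (Tot t) \<Longrightarrow> valid S \<Gamma> (sub1 e phi)"
| V_ExI: "has_type S (t # \<Gamma>) phi (Tot (Universe i)) \<Longrightarrow> has_type S \<Gamma> e (Tot t) \<Longrightarrow>
    valid S \<Gamma> (sub1 e phi) \<Longrightarrow> valid S \<Gamma> (Exi t phi)"
| V_ExE: "valid S \<Gamma> (Exi t phi) \<Longrightarrow> valid S (phi # t # \<Gamma>) (shift (shift r)) \<Longrightarrow>
    has_type S \<Gamma> r (Tot (Universe i)) \<Longrightarrow> valid S \<Gamma> r"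
| V_EqRefl: "has_type S \<Gamma> e (Tot t) \<Longrightarrow> valid S \<Gamma> (Eq t e e)"
| V_EqSubst: "has_type S (t # \<Gamma>) phi (Tot (Universe i)) \<Longrightarrow> valid S \<Gamma> (Eq t a b) \<Longrightarrow>
    valid S \<Gamma> (sub1 a phi) \<Longrightarrow> valid S \<Gamma> (sub1 b phi)"
\<comment> \<open>Reduction of an arbitrary subterm that is not in the scope of a binder of \<open>e\<close>; the subterm \<open>a\<close>
    need not be a total term, so that this is not an instance of \<open>V_EqSubst\<close>.\<close>
| V_EqRed: "red S a b \<Longrightarrow> has_type S \<Gamma> (sub1 a e) (Tot t) \<Longrightarrow> has_type S \<Gamma> (sub1 b e) (Tot t) \<Longrightarrow>
    valid S \<Gamma> (Eq t (sub1 a e) (sub1 b e))"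
| V_EqExt: "has_type S \<Gamma> f (Tot (Pi t (Tot u))) \<Longrightarrow> has_type S \<Gamma> g (Tot (Pi t (Tot u))) \<Longrightarrow>
    valid S \<Gamma> (All t (Eq u (App (shift f) (Var 0)) (App (shift g) (Var 0)))) \<Longrightarrow>
    valid S \<Gamma> (Eq (Pi t (Tot u)) f g)"
| V_SumCase: "has_type S \<Gamma> e (Tot (sumT t1 t2)) \<Longrightarrow>
    has_type S (sumT t1 t2 # \<Gamma>) phi (Tot (Universe i)) \<Longrightarrow>
    valid S (t1 # \<Gamma>) (sub (via CInl) phi) \<Longrightarrow>
    valid S (t2 # \<Gamma>) (sub (via CInr) phi) \<Longrightarrow>
    valid S \<Gamma> (sub1 e phi)"

section \<open>Well-formed signatures\<close>

text \<open>
  The terms of a definition or lift are closed, so they need no shifting under the binders of the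
  types below.
\<close>

definition pis :: "tm list \<Rightarrow> tm \<Rightarrow> tm" where
  "pis ts u = foldr (\<lambda>t v. Pi t (Tot v)) ts u"

text \<open>\<open>a:Type0 \<rightarrow> wp_type a \<rightarrow> Type0\<close>\<close>

definition repr_ty :: "effect \<Rightarrow> tm" where
  "repr_ty D = pis [Universe 0, App (wp_type D) (Var 0)] (Universe 0)"

text \<open>\<open>a:Type0 \<rightarrow> a \<rightarrow> wp_type a\<close>\<close>

definition ret_star_ty :: "effect \<Rightarrow> tm" where
  "ret_star_ty D = pis [Universe 0, Var 0] (App (wp_type D) (Var 1))"

text \<open>\<open>a:Type0 \<rightarrow> b:Type0 \<rightarrow> wp_type a \<rightarrow> (a \<rightarrow> wp_type b) \<rightarrow> wp_type b\<close>\<close>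

definition bind_star_ty :: "effect \<Rightarrow> tm" where
  "bind_star_ty D =
     pis [Universe 0, Universe 0, App (wp_type D) (Var 1),
          Pi (Var 2) (Tot (App (wp_type D) (Var 2)))]
         (App (wp_type D) (Var 2))"

text \<open>\<open>a:Type0 \<rightarrow> x:a \<rightarrow> repr a (ret_star a x)\<close>\<close>

definition ret_impl_ty :: "effect \<Rightarrow> tm" where
  "ret_impl_ty D =
     pis [Universe 0, Var 0] (apps (repr D) [Var 1, apps (ret_star D) [Var 1, Var 0]])"

text \<open>
  \<open>a:Type0 \<rightarrow> b:Type0 \<rightarrow> w1:wp_type a \<rightarrow> repr a w1 \<rightarrow> w2:(a \<rightarrow> wp_type b) \<rightarrow>
   (x:a \<rightarrow> repr b (w2 x)) \<rightarrow> repr b (bind_star a b w1 w2)\<close>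
\<close>

definition bind_impl_ty :: "effect \<Rightarrow> tm" where
  "bind_impl_ty D =
     pis [Universe 0, Universe 0, App (wp_type D) (Var 1),
          apps (repr D) [Var 2, Var 0],
          Pi (Var 3) (Tot (App (wp_type D) (Var 3))),
          Pi (Var 4) (Tot (apps (repr D) [Var 4, App (Var 1) (Var 0)]))]
         (apps (repr D) [Var 4, apps (bind_star D) [Var 5, Var 4, Var 3, Var 1]])"

definition act_impl_ty :: "effect \<Rightarrow> action \<Rightarrow> tm" where
  "act_impl_ty D A = pis (act_args A) (apps (repr D) [act_res A, act_wp A])"

text \<open>\<open>a:Type0 \<rightarrow> M.wp_type a \<rightarrow> M'.wp_type a\<close>\<close>

definition lift_star_ty :: "effect \<Rightarrow> effect \<Rightarrow> tm" where
  "lift_star_ty D D' = pis [Universe 0, App (wp_type D) (Var 0)] (App (wp_type D') (Var 1))"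

text \<open>\<open>a:Type0 \<rightarrow> w:M.wp_type a \<rightarrow> M.repr a w \<rightarrow> M'.repr a (lift_star a w)\<close>\<close>

definition lift_impl_ty :: "effect \<Rightarrow> effect \<Rightarrow> tm \<Rightarrow> tm" where
  "lift_impl_ty D D' w =
     pis [Universe 0, App (wp_type D) (Var 0), apps (repr D) [Var 1, Var 0]]
         (apps (repr D') [Var 2, apps w [Var 2, Var 1]])"

definition wf_effect :: "signature \<Rightarrow> effect \<Rightarrow> bool" where
  "wf_effect S D \<longleftrightarrow>
     (\<exists>i. has_type S [] (wp_type D) (Tot (arr (Universe 0) (Universe i)))) \<and>
     has_type S [] (repr D) (Tot (repr_ty D)) \<and>
     has_type S [] (ret_star D) (Tot (ret_star_ty D)) \<and>
     has_type S [] (bind_star D) (Tot (bind_star_ty D)) \<and>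
     has_type S [] (ret_impl D) (Tot (ret_impl_ty D)) \<and>
     has_type S [] (bind_impl D) (Tot (bind_impl_ty D)) \<and>
     (\<forall>A \<in> set (actions D).
        has_type S (rev (act_args A)) (act_res A) (Tot (Universe 0)) \<and>
        has_type S (rev (act_args A)) (act_wp A) (Tot (App (wp_type D) (act_res A))) \<and>
        has_type S [] (act_impl A) (Tot (act_impl_ty D A)))"

inductive wf_sig :: "signature \<Rightarrow> bool" where
  WS_Nil: "wf_sig []"
| WS_Eff: "wf_sig S \<Longrightarrow> lookup_eff S F = None \<Longrightarrow> wf_effect S D \<Longrightarrow> wf_sig (EffDef F D # S)"
| WS_Lift: "wf_sig S \<Longrightarrow> lookup_lift S F F' = None \<Longrightarrow>
    lookup_eff S F = Some D \<Longrightarrow> lookup_eff S F' = Some D' \<Longrightarrow>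
    has_type S [] w (Tot (lift_star_ty D D')) \<Longrightarrow>
    has_type S [] l (Tot (lift_impl_ty D D' w)) \<Longrightarrow>
    wf_sig (LiftDef F F' l w # S)"

section \<open>Strong normalization\<close>

text \<open>
  Strong normalization of the calculus over \<open>S\<close>: every term typeable in some context, with any
  computation type, admits no infinite reduction. It is known only relative to strong
  normalization of the Calculus of Inductive Constructions, and is used as an assumption.
\<close>

definition strongly_normalizing :: "signature \<Rightarrow> bool" where
  "strongly_normalizing S \<longleftrightarrow> (\<forall>\<Gamma> e c. has_type S \<Gamma> e c \<longrightarrow> termip (red S) e)"

end

theory Submission
  imports Defs
begin

text \<open>
  By strong normalization \<open>e\<close> has a normal form, which by subject reduction and progress is
  \<open>Pure.return t' v\<close> at the type \<open>Pure t wp\<close>. Inverting subtyping gives \<open>t' <: t\<close> and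
  \<open>wp p \<Longrightarrow> return\<^sup>\<star> t' v p\<close>; the right-hand side reduces to \<open>p v\<close>, and \<open>run e\<close> reduces to \<open>v\<close>.

  Inversion of subtyping rests on a confluent parallel reduction, since reduction itself is not
  confluent once raw types are compared up to conversion. Subtyping passes through ill-typed
  intermediate types, and validity through ill-typed formulas, so both are first brought into a form
  whose ends alone are typed. Finally, case analysis on computations does not record that its return
  type lies in \<open>Type\<^sub>0\<close>; this is recovered from the uniqueness of the universe of a type.
\<close>

section \<open>Substitution and free variables\<close>

text \<open>Subject reduction and progress depend on the shapes of types, and shapes are compared
  through \<open>qstep\<close>, which erases refinements at the root. Whether a refinement formula
  is valid therefore never influences the shape of a type, and neither a model nor a consistency
  proof of the logic is required. Derivations of validity are analysed closely only where
  \<open>Pure\<close> subtyping compares predicate transformers.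

  There is a circle to break. Regularity needs \<open>Type0\<close> in the case rule for
  computations; that fact comes from uniqueness of universes; uniqueness rests on subject reduction;
  and subject reduction rests on regularity. Hence the metatheory is developed for a second system
  that demands \<open>Type0\<close>, and every original derivation is recognised as a derivation of
  that system afterwards, by an induction in which uniqueness is already available.\<close>

definition unb :: "nat set \<Rightarrow> nat set" where
  "unb A = {k. Suc k \<in> A}"

primrec fv :: "tm \<Rightarrow> nat set" and cfv :: "comp \<Rightarrow> nat set" where
  "fv (Var k) = {k}"
| "fv (Universe i) = {}"
| "fv (Const c) = {}"
| "fv (Refine t phi) = fv t \<union> unb (fv phi)"
| "fv (Lam t e) = fv t \<union> unb (fv e)"
| "fv (Pi t c) = fv t \<union> unb (cfv c)"
| "fv (App e1 e2) = fv e1 \<union> fv e2"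
| "fv (Case t e e1 e2) = unb (fv t) \<union> fv e \<union> unb (fv e1) \<union> unb (fv e2)"
| "fv (Run e) = fv e"
| "fv (Reify e) = fv e"
| "fv (Reflect e) = fv e"
| "fv (Lift F F' t wp e) = fv t \<union> fv wp \<union> fv e"
| "fv (Act F j es) = \<Union> (set (map fv es))"
| "fv (Ret M t e) = fv t \<union> fv e"
| "fv (Bind M t1 t2 wp1 e1 wp2 e2) =
     fv t1 \<union> fv t2 \<union> fv wp1 \<union> fv e1 \<union> fv wp2 \<union> unb (fv e2)"
| "cfv (Tot t) = fv t"
| "cfv (Cmp M t wp) = fv t \<union> fv wp"

section \<open>Composition laws of renaming and substitution\<close>

lemma upr_simps [simp]: "upr r 0 = 0" "upr r (Suc k) = Suc (r k)"
  by (simp_all add: upr_def)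

lemma ups_simps [simp]: "ups s 0 = Var 0" "ups s (Suc k) = shift (s k)"
  by (simp_all add: ups_def)

lemma via_simps [simp]: "via c 0 = App (Const c) (Var 0)" "via c (Suc k) = Var (Suc k)"
  by (simp_all add: via_def)

lemma inst1_simps [simp]: "inst [a] 0 = a" "inst [a] (Suc k) = Var k"
  by (simp_all add: inst_def)

lemma ups_Var_comp: "ups (\<lambda>k. Var (r k)) = (\<lambda>k. Var (upr r k))"
  by (auto simp: fun_eq_iff ups_def upr_def split: nat.split)

lemma ren_eq_sub: "ren r t = sub (\<lambda>k. Var (r k)) t" "cren r c = csub (\<lambda>k. Var (r k)) c"
  by (induction t and c arbitrary: r and r) (simp_all add: ups_Var_comp)

lemma ups_comp_upr: "(\<lambda>k. ups s (upr r k)) = ups (\<lambda>k. s (r k))"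
  by (auto simp: fun_eq_iff ups_def upr_def split: nat.split)

lemma sub_ren: "sub s (ren r t) = sub (\<lambda>k. s (r k)) t"
  "csub s (cren r c) = csub (\<lambda>k. s (r k)) c"
  by (induction t and c arbitrary: r s and r s) (simp_all add: ups_comp_upr)

lemma ren_ren: "ren s (ren r t) = ren (\<lambda>k. s (r k)) t"
  by (simp add: ren_eq_sub(1)[of s] ren_eq_sub(1)[of "\<lambda>k. s (r k)"] sub_ren)

lemma upr_comp_ups: "(\<lambda>k. ren (upr r) (ups s k)) = ups (\<lambda>k. ren r (s k))"
  by (auto simp: fun_eq_iff ups_def upr_def ren_ren split: nat.split)

lemma ren_sub: "ren r (sub s t) = sub (\<lambda>k. ren r (s k)) t"
  "cren r (csub s c) = csub (\<lambda>k. ren r (s k)) c"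
  by (induction t and c arbitrary: r s and r s) (simp_all add: upr_comp_ups)

lemma ups_comp_ups: "(\<lambda>k. sub (ups r) (ups s k)) = ups (\<lambda>k. sub r (s k))"
  by (auto simp: fun_eq_iff ups_def ren_sub sub_ren split: nat.split)

lemma sub_sub: "sub r (sub s t) = sub (\<lambda>k. sub r (s k)) t"
  "csub r (csub s c) = csub (\<lambda>k. sub r (s k)) c"
  by (induction t and c arbitrary: r s and r s) (simp_all add: ups_comp_ups)

lemma ups_Var: "ups Var = Var"
  by (auto simp: fun_eq_iff ups_def split: nat.split)

lemma sub_Var [simp]: "sub Var t = t" "csub Var c = c"
  by (induction t and c) (simp_all add: ups_Var map_idI)

lemma shift_inj [simp]: "shift a = shift b \<longleftrightarrow> a = b"
proof -
  have "sub (\<lambda>k. Var (k - 1)) (shift a) = a" for a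
    by (simp add: sub_ren)
  then show ?thesis by metis
qed

lemma ups_cong: "(\<forall>k\<in>A. ups r k = ups s k) \<longleftrightarrow> (\<forall>k\<in>unb A. r k = s k)"
  by (auto simp: unb_def ups_def split: nat.splits)

text \<open>Agreement on a union of variable sets splits by \<open>ball_Un\<close> and passes a
  binder by \<open>ups_cong\<close>. The object-level quantifiers let every case of the induction
  close by rewriting alone.\<close>

lemma sub_cong_ball:
  "\<forall>r s. (\<forall>k\<in>fv t. r k = s k) \<longrightarrow> sub r t = sub s t"
  "\<forall>r s. (\<forall>k\<in>cfv c. r k = s k) \<longrightarrow> csub r c = csub s c"
  by (induction t and c) (simp_all add: ball_Un ups_cong)

lemma sub_cong_fv:
  "(\<And>k. k \<in> fv t \<Longrightarrow> r k = s k) \<Longrightarrow> sub r t = sub s t"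
  "(\<And>k. k \<in> cfv c \<Longrightarrow> r k = s k) \<Longrightarrow> csub r c = csub s c"
  using sub_cong_ball by blast+

lemma fv_ren: "fv (ren r t) = r ` fv t" "cfv (cren r c) = r ` cfv c"
proof -
  have unb_upr: "unb (upr r ` A) = r ` unb A" for r A
  proof (intro set_eqI iffI)
    fix x assume "x \<in> unb (upr r ` A)"
    then obtain y where "y \<in> A" "Suc x = upr r y" by (auto simp: unb_def)
    then show "x \<in> r ` unb A" by (cases y) (auto simp: unb_def)
  next
    fix x assume "x \<in> r ` unb A"
    then obtain y where "Suc y \<in> A" "x = r y" by (auto simp: unb_def)
    then show "x \<in> unb (upr r ` A)"
      unfolding unb_def by (metis (no_types) imageI mem_Collect_eq upr_simps(2))
  qed
  show "fv (ren r t) = r ` fv t" "cfv (cren r c) = r ` cfv c"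
    by (induction t and c arbitrary: r and r) (simp_all add: unb_upr image_Un image_UN)
qed

lemma unb_UN_ups: "unb (\<Union>k\<in>A. fv (ups s k)) = (\<Union>k\<in>unb A. fv (s k))"
  by (auto simp: unb_def ups_def fv_ren split: nat.splits dest!: gr0_implies_Suc)

lemma fv_sub: "fv (sub s t) = (\<Union>k\<in>fv t. fv (s k))" "cfv (csub s c) = (\<Union>k\<in>cfv c. fv (s k))"
  by (induction t and c arbitrary: s and s) (simp_all add: unb_UN_ups)

lemma sub_closed: "fv t = {} \<Longrightarrow> sub s t = t"
  using sub_cong_fv(1)[of t s Var] by simp

lemma ren_closed: "fv t = {} \<Longrightarrow> ren r t = t"
  by (simp add: ren_eq_sub sub_closed)

lemma sub_ups_shift [simp]: "sub (ups s) (shift t) = shift (sub s t)" "csub (ups s) (cren Suc c) = cren Suc (csub s c)"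
  by (simp_all add: sub_ren ren_sub)

lemma ren_upr_shift [simp]: "ren (upr r) (shift t) = shift (ren r t)"
  by (simp add: ren_ren)

lemma sub1_shift [simp]: "sub1 a (shift t) = t" "csub1 a (cren Suc c) = c"
  by (simp_all add: sub_ren)

lemma sub_inst_ups: "(\<lambda>k. sub s (inst [a] k)) = (\<lambda>k. sub (inst [sub s a]) (ups s k))"
  by (auto simp: fun_eq_iff ups_def sub_ren split: nat.split)

lemma sub_sub1: "sub s (sub1 a t) = sub1 (sub s a) (sub (ups s) t)"
  "csub s (csub1 a c) = csub1 (sub s a) (csub (ups s) c)"
  by (simp_all add: sub_sub sub_inst_ups)

lemma sub_ups_via: "sub (ups s) (sub (via c) t) = sub (via c) (sub (ups s) t)"
proof -
  have "sub (ups s) (via c k) = sub (via c) (ups s k)" for k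
    by (cases k) (simp_all add: sub_ren, simp add: ren_eq_sub)
  then show ?thesis by (simp add: sub_sub)
qed

lemma sub1_via: "sub1 a (sub (via c) t) = sub1 (App (Const c) a) t"
proof -
  have "sub1 a (via c k) = inst [App (Const c) a] k" for k
    by (cases k) simp_all
  then show ?thesis by (simp add: sub_sub)
qed

lemma sub_inst: "fv t \<subseteq> {..<length es} \<Longrightarrow> sub s (sub (inst es) t) = sub (inst (map (sub s) es)) t"
  by (auto simp: sub_sub inst_def rev_map intro!: sub_cong_fv)

section \<open>Parallel reduction\<close>

text \<open>Reduction inserts signature terms without shifting, even below binders, so it commutes
  with substitution only when these terms are closed. The arguments of an action form a telescope:
  each argument type may mention only the arguments before it.\<close>

definition closed_sig :: "signature \<Rightarrow> bool" where
  "closed_sig S \<longleftrightarrow>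
     (\<forall>F D. lookup_eff S F = Some D \<longrightarrow>
        fv (repr D) = {} \<and> fv (wp_type D) = {} \<and> fv (ret_star D) = {} \<and> fv (bind_star D) = {} \<and>
        fv (ret_impl D) = {} \<and> fv (bind_impl D) = {} \<and>
        (\<forall>A \<in> set (actions D).
           (\<forall>i < length (act_args A). fv (act_args A ! i) \<subseteq> {..<i}) \<and>
           fv (act_res A) \<subseteq> {..<length (act_args A)} \<and> fv (act_wp A) \<subseteq> {..<length (act_args A)} \<and>
           fv (act_impl A) = {})) \<and>
     (\<forall>F F' l w. lookup_lift S F F' = Some (l, w) \<longrightarrow> fv l = {} \<and> fv w = {})"

text \<open>The root contractions of \<open>red\<close>, separated from its evaluation contexts:
  parallel reduction brings contexts of its own, which reach further than those of
  \<open>red\<close>.\<close>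

inductive ctr :: "signature \<Rightarrow> tm \<Rightarrow> tm \<Rightarrow> bool" for S where
  ctr_Beta: "ctr S (App (Lam t e) e') (sub1 e' e)"
| ctr_Fst: "ctr S (App (Const CFst) (app2 (Const CPair) e1 e2)) e1"
| ctr_Snd: "ctr S (App (Const CSnd) (app2 (Const CPair) e1 e2)) e2"
| ctr_Inl: "ctr S (Case t (App (Const CInl) e) e1 e2) (sub1 e e1)"
| ctr_Inr: "ctr S (Case t (App (Const CInr) e) e1 e2) (sub1 e e2)"
| ctr_Run: "ctr S (Run (Ret Pure t e)) e"
| ctr_Bind: "ctr S (Bind Pure t1 t2 wp1 (Ret Pure t e1) wp2 e2) (sub1 e1 e2)"
| ctr_Reflect: "ctr S (Reify (Reflect e)) e"
| ctr_ReifyRet: "lookup_eff S F = Some D \<Longrightarrow>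
    ctr S (Reify (Ret (User F) t e)) (apps (ret_impl D) [t, e])"
| ctr_ReifyBind: "lookup_eff S F = Some D \<Longrightarrow>
    ctr S (Reify (Bind (User F) t1 t2 wp1 e1 wp2 e2))
          (apps (bind_impl D) [t1, t2, wp1, Reify e1, wp2, Lam t1 (Reify e2)])"
| ctr_ReifyAct: "lookup_eff S F = Some D \<Longrightarrow> j < length (actions D) \<Longrightarrow>
    ctr S (Reify (Act F j es)) (apps (act_impl (actions D ! j)) es)"
| ctr_ReifyLift: "lookup_lift S F F' = Some (l, w) \<Longrightarrow>
    ctr S (Reify (Lift F F' t wp e)) (apps l [t, wp, Reify e])"

text \<open>
  Conversion reaches below every binder: \<open>(\<lambda>x. C) a\<close> and \<open>(\<lambda>x. C) b\<close> are related by reduction of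
  \<open>a\<close>, so \<open>C[a/x]\<close> and \<open>C[b/x]\<close> are convertible. Plain reduction is therefore not confluent, and a
  redex must also be contracted below \<open>Pi\<close>, \<open>Refine\<close>, the return type of \<open>Case\<close> and the last argument of
  \<open>Bind\<close>, provided it mentions no variable bound there. The set \<open>X\<close> collects these frozen variables.
  Reduction does go below \<open>Lam\<close> and the branches of \<open>Case\<close>, so their binder is frozen only when the whole
  term is already pinned down by a frozen variable.
\<close>

definition fz :: "nat set \<Rightarrow> nat set" where "fz X = insert 0 (Suc ` X)"

definition bX :: "nat set \<Rightarrow> tm \<Rightarrow> nat set" where
  "bX X t = (if fv t \<inter> X = {} then Suc ` X else fz X)"

text \<open>Two layers: \<open>prn\<close> works inside the immediate subterms and keeps the root
  constructor, \<open>pr\<close> may then contract the root once. Because the contraction applies to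
  the result \<open>m\<close> of the inner steps, a redex that these steps have just created can be
  contracted as well, as in Aczel's superdevelopments. The freezing test looks at the source
  \<open>t\<close>, whose free variables include those of \<open>m\<close>.\<close>

inductive pr :: "signature \<Rightarrow> nat set \<Rightarrow> tm \<Rightarrow> tm \<Rightarrow> bool"
  and prn :: "signature \<Rightarrow> nat set \<Rightarrow> tm \<Rightarrow> tm \<Rightarrow> bool"
  and prc :: "signature \<Rightarrow> nat set \<Rightarrow> comp \<Rightarrow> comp \<Rightarrow> bool" for S where
  pr_cong: "prn S X t t' \<Longrightarrow> pr S X t t'"
| pr_ctr: "prn S X t m \<Longrightarrow> fv t \<inter> X = {} \<Longrightarrow> ctr S m t' \<Longrightarrow> pr S X t t'"
| prn_Var: "prn S X (Var k) (Var k)"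
| prn_Universe: "prn S X (Universe i) (Universe i)"
| prn_Const: "prn S X (Const c) (Const c)"
| prn_Refine: "pr S X t t' \<Longrightarrow> pr S (fz X) phi phi' \<Longrightarrow> prn S X (Refine t phi) (Refine t' phi')"
| prn_Lam: "pr S X t t' \<Longrightarrow> pr S (bX X (Lam t e)) e e' \<Longrightarrow> prn S X (Lam t e) (Lam t' e')"
| prn_Pi: "pr S X t t' \<Longrightarrow> prc S (fz X) c c' \<Longrightarrow> prn S X (Pi t c) (Pi t' c')"
| prn_App: "pr S X e1 e1' \<Longrightarrow> pr S X e2 e2' \<Longrightarrow> prn S X (App e1 e2) (App e1' e2')"
| prn_Case: "pr S (fz X) t t' \<Longrightarrow> pr S X e e' \<Longrightarrow> pr S (bX X (Case t e e1 e2)) e1 e1' \<Longrightarrow>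
    pr S (bX X (Case t e e1 e2)) e2 e2' \<Longrightarrow> prn S X (Case t e e1 e2) (Case t' e' e1' e2')"
| prn_Run: "pr S X e e' \<Longrightarrow> prn S X (Run e) (Run e')"
| prn_Reify: "pr S X e e' \<Longrightarrow> prn S X (Reify e) (Reify e')"
| prn_Reflect: "pr S X e e' \<Longrightarrow> prn S X (Reflect e) (Reflect e')"
| prn_Lift: "pr S X t t' \<Longrightarrow> pr S X wp wp' \<Longrightarrow> pr S X e e' \<Longrightarrow>
    prn S X (Lift F F' t wp e) (Lift F F' t' wp' e')"
| prn_Act: "list_all2 (pr S X) es es' \<Longrightarrow> prn S X (Act F j es) (Act F j es')"
| prn_Ret: "pr S X t t' \<Longrightarrow> pr S X e e' \<Longrightarrow> prn S X (Ret M t e) (Ret M t' e')"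
| prn_Bind: "pr S X t1 t1' \<Longrightarrow> pr S X t2 t2' \<Longrightarrow> pr S X wp1 wp1' \<Longrightarrow> pr S X e1 e1' \<Longrightarrow>
    pr S X wp2 wp2' \<Longrightarrow> pr S (fz X) e2 e2' \<Longrightarrow>
    prn S X (Bind M t1 t2 wp1 e1 wp2 e2) (Bind M t1' t2' wp1' e1' wp2' e2')"
| prc_Tot: "pr S X t t' \<Longrightarrow> prc S X (Tot t) (Tot t')"
| prc_Cmp: "pr S X t t' \<Longrightarrow> pr S X wp wp' \<Longrightarrow> prc S X (Cmp M t wp) (Cmp M t' wp')"
monos list_all2_mono

inductive_cases prn_cases:
  "prn S X (Var k) u" "prn S X (Universe i) u" "prn S X (Const c) u" "prn S X (Refine t phi) u"
  "prn S X (Lam t e) u" "prn S X (Pi t c) u" "prn S X (App e1 e2) u" "prn S X (Case t e e1 e2) u"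
  "prn S X (Run e) u" "prn S X (Reify e) u" "prn S X (Reflect e) u" "prn S X (Lift F F' t wp e) u"
  "prn S X (Act F j es) u" "prn S X (Ret M t e) u" "prn S X (Bind M t1 t2 wp1 e1 wp2 e2) u"
  "prc S X (Tot t) d" "prc S X (Cmp M t wp) d"

inductive_cases ctr_cases:
  "ctr S (Var k) u" "ctr S (Universe i) u" "ctr S (Const c) u" "ctr S (Refine t phi) u"
  "ctr S (Lam t e) u" "ctr S (Pi t c) u" "ctr S (App e1 e2) u" "ctr S (Case t e e1 e2) u"
  "ctr S (Run e) u" "ctr S (Reify e) u" "ctr S (Reflect e) u" "ctr S (Lift F F' t wp e) u"
  "ctr S (Act F j es) u" "ctr S (Ret M t e) u" "ctr S (Bind M t1 t2 wp1 e1 wp2 e2) u"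

section \<open>Stability of parallel reduction under renaming and substitution\<close>

lemma pr_refl: "pr S X t t" "prc S X c c"
  by (induction t and c arbitrary: X and X)
    (simp_all add: pr_cong pr_prn_prc.intros(3-) list_all2_conv_all_nth)

lemma fz_mono: "X \<subseteq> Y \<Longrightarrow> fz X \<subseteq> fz Y"
  by (auto simp: fz_def)

lemma bX_mono: "X \<subseteq> Y \<Longrightarrow> bX X t \<subseteq> bX Y t"
  by (auto simp: fz_def bX_def)

lemma bX_mono_fv: "fv t \<subseteq> fv u \<Longrightarrow> bX X t \<subseteq> bX X u"
  by (auto simp: fz_def bX_def)

lemma bX_fz: "bX X t \<subseteq> fz X"
  by (auto simp: fz_def bX_def)

lemma pr_mono:
  "pr S Y t t' \<Longrightarrow> X \<subseteq> Y \<Longrightarrow> pr S X t t'"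
  "prn S Y t t' \<Longrightarrow> X \<subseteq> Y \<Longrightarrow> prn S X t t'"
  "prc S Y c c' \<Longrightarrow> X \<subseteq> Y \<Longrightarrow> prc S X c c'"
proof (induction arbitrary: X and X and X rule: pr_prn_prc.inducts)
  case (pr_ctr X t m t' Xa)
  then have "fv t \<inter> Xa = {}" by blast
  then show ?case by (rule pr_prn_prc.pr_ctr[OF pr_ctr.IH(2)[OF pr_ctr.prems] _ \<open>ctr S m t'\<close>])
next
  case (prn_Act X es es' F j)
  then show ?case by (intro pr_prn_prc.prn_Act) (erule list_all2_mono, simp)
next
  case (pr_cong X t t')
  then show ?case by (simp add: pr_prn_prc.pr_cong)
qed (intro pr_prn_prc.intros(3-); simp add: fz_mono bX_mono)+

lemma fv_apps: "fv (apps f es) = fv f \<union> \<Union> (fv ` set es)"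
  by (induction es arbitrary: f) auto

lemma fv_sub1: "fv (sub1 a t) \<subseteq> unb (fv t) \<union> fv a"
proof -
  have "fv (inst [a] k) \<subseteq> unb (fv t) \<union> fv a" if "k \<in> fv t" for k
    using that by (cases k) (auto simp: unb_def)
  then show ?thesis by (auto simp: fv_sub)
qed

lemma closed_sigD:
  assumes "closed_sig S"
  shows "lookup_eff S F = Some D \<Longrightarrow> fv (repr D) = {}"
    "lookup_eff S F = Some D \<Longrightarrow> fv (wp_type D) = {}"
    "lookup_eff S F = Some D \<Longrightarrow> fv (ret_star D) = {}"
    "lookup_eff S F = Some D \<Longrightarrow> fv (bind_star D) = {}"
    "lookup_eff S F = Some D \<Longrightarrow> fv (ret_impl D) = {}"
    "lookup_eff S F = Some D \<Longrightarrow> fv (bind_impl D) = {}"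
    "lookup_eff S F = Some D \<Longrightarrow> j < length (actions D) \<Longrightarrow> fv (act_impl (actions D ! j)) = {}"
    "lookup_eff S F = Some D \<Longrightarrow> j < length (actions D) \<Longrightarrow> i < length (act_args (actions D ! j)) \<Longrightarrow>
       fv (act_args (actions D ! j) ! i) \<subseteq> {..<i}"
    "lookup_eff S F = Some D \<Longrightarrow> j < length (actions D) \<Longrightarrow>
       fv (act_res (actions D ! j)) \<subseteq> {..<length (act_args (actions D ! j))}"
    "lookup_eff S F = Some D \<Longrightarrow> j < length (actions D) \<Longrightarrow>
       fv (act_wp (actions D ! j)) \<subseteq> {..<length (act_args (actions D ! j))}"
    "lookup_lift S F F' = Some (l, w) \<Longrightarrow> fv l = {}"
    "lookup_lift S F F' = Some (l, w) \<Longrightarrow> fv w = {}"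
  using assms unfolding closed_sig_def by (meson nth_mem)+

lemma fv_ctr:
  assumes "ctr S t u" "closed_sig S"
  shows "fv u \<subseteq> fv t"
  using assms(1)
proof cases
  case (ctr_Beta t e e')
  then show ?thesis using fv_sub1[of e' e] by auto
next
  case (ctr_Inl t e e1 e2)
  then show ?thesis using fv_sub1[of e e1] by auto
next
  case (ctr_Inr t e e1 e2)
  then show ?thesis using fv_sub1[of e e2] by auto
next
  case (ctr_Bind t1 t2 wp1 t e1 wp2 e2)
  then show ?thesis using fv_sub1[of e1 e2] by auto
qed (simp_all add: fv_apps closed_sigD[OF assms(2)] unb_def, blast?)

lemma fv_pr:
  assumes "closed_sig S"
  shows "pr S X t t' \<Longrightarrow> fv t' \<subseteq> fv t" "prn S X t t' \<Longrightarrow> fv t' \<subseteq> fv t"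
    "prc S X c c' \<Longrightarrow> cfv c' \<subseteq> cfv c"
proof (induction rule: pr_prn_prc.inducts)
  case (pr_ctr X t m t')
  then show ?case using fv_ctr assms by blast
next
  case (prn_Act X es es' F j)
  then show ?case by (fastforce simp: list_all2_conv_all_nth in_set_conv_nth)
qed (auto simp: unb_def)

lemma fv_shift_fz: "fv t \<inter> X = {} \<Longrightarrow> fv (shift t) \<inter> fz X = {}"
  by (auto simp: fv_ren fz_def)

lemma ctr_sub:
  assumes "ctr S t u" "closed_sig S"
  shows "ctr S (sub s t) (sub s u)"
  using assms(1)
proof cases
  case (ctr_ReifyAct F D j es)
  have "sub s (apps f es) = apps (sub s f) (map (sub s) es)" for f
    by (induction es arbitrary: f) simp_all
  with ctr_ReifyAct show ?thesis
    by (simp add: sub_closed closed_sigD[OF assms(2)] ctr.ctr_ReifyAct)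
qed (use ctr.intros in \<open>simp_all add: sub_sub1 sub_closed closed_sigD[OF assms(2)]\<close>)

lemma ctr_ren: "ctr S t u \<Longrightarrow> closed_sig S \<Longrightarrow> ctr S (ren r t) (ren r u)"
  by (simp add: ren_eq_sub ctr_sub)

text \<open>For \<open>bX\<close> the test concerns the whole enclosing term: if that term avoids
  \<open>Y\<close>, its image avoids \<open>X\<close>, so a binder is frozen after the renaming only
  if it was frozen before.\<close>

lemma frozen_upr:
  assumes "\<And>k. k \<notin> Y \<Longrightarrow> r k \<notin> X"
  shows "k \<notin> fz Y \<Longrightarrow> upr r k \<notin> fz X" "k \<notin> bX Y t \<Longrightarrow> upr r k \<notin> bX X (ren r t)"
  using assms by (cases k; fastforce simp: fz_def bX_def fv_ren split: if_splits)+

lemma pr_ren: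
  assumes "closed_sig S"
  shows "pr S Y t t' \<Longrightarrow> (\<And>k. k \<notin> Y \<Longrightarrow> r k \<notin> X) \<Longrightarrow> pr S X (ren r t) (ren r t')"
    "prn S Y t t' \<Longrightarrow> (\<And>k. k \<notin> Y \<Longrightarrow> r k \<notin> X) \<Longrightarrow> prn S X (ren r t) (ren r t')"
    "prc S Y c c' \<Longrightarrow> (\<And>k. k \<notin> Y \<Longrightarrow> r k \<notin> X) \<Longrightarrow> prc S X (cren r c) (cren r c')"
proof (induction arbitrary: X r and X r and X r rule: pr_prn_prc.inducts)
  case (pr_cong X t t')
  then show ?case by (simp add: pr_prn_prc.pr_cong)
next
  case (pr_ctr Y t m t')
  have "fv (ren r t) \<inter> X = {}" using pr_ctr by (auto simp: fv_ren)
  moreover have "prn S X (ren r t) (ren r m)" using pr_ctr by blast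
  ultimately show ?case using ctr_ren[OF \<open>ctr S m t'\<close> assms] pr_prn_prc.pr_ctr by blast
next
  case (prn_Act Y es es' F j)
  then show ?case
    by (auto intro!: pr_prn_prc.prn_Act simp: list_all2_conv_all_nth)
next
  case (prn_Lam Y t t' e e')
  have "pr S (bX X (ren r (Lam t e))) (ren (upr r) e) (ren (upr r) e')"
    by (rule prn_Lam.IH, erule frozen_upr(2)[rotated]) (rule prn_Lam.prems)
  with prn_Lam show ?case by (simp add: pr_prn_prc.prn_Lam)
next
  case (prn_Case Y t t' e e' e1 e2 e1' e2')
  have "pr S (bX X (ren r (Case t e e1 e2))) (ren (upr r) e1) (ren (upr r) e1')"
    by (rule prn_Case.IH, erule frozen_upr(2)[rotated]) (rule prn_Case.prems)
  moreover have "pr S (bX X (ren r (Case t e e1 e2))) (ren (upr r) e2) (ren (upr r) e2')"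
    by (rule prn_Case.IH, erule frozen_upr(2)[rotated]) (rule prn_Case.prems)
  moreover have "pr S (fz X) (ren (upr r) t) (ren (upr r) t')"
    by (rule prn_Case.IH, erule frozen_upr(1)[rotated]) (rule prn_Case.prems)
  ultimately show ?case using prn_Case by (simp add: pr_prn_prc.prn_Case)
next
  case (prn_Refine Y t t' e e')
  have "pr S (fz X) (ren (upr r) e) (ren (upr r) e')"
    by (rule prn_Refine.IH, erule frozen_upr(1)[rotated]) (rule prn_Refine.prems)
  with prn_Refine show ?case by (simp add: pr_prn_prc.prn_Refine)
next
  case (prn_Pi Y t t' e e')
  have "prc S (fz X) (cren (upr r) e) (cren (upr r) e')"
    by (rule prn_Pi.IH, erule frozen_upr(1)[rotated]) (rule prn_Pi.prems)
  with prn_Pi show ?case by (simp add: pr_prn_prc.prn_Pi)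
next
  case (prn_Bind Y t1 t1' t2 t2' wp1 wp1' e1 e1' wp2 wp2' e2 e2' M)
  have "pr S (fz X) (ren (upr r) e2) (ren (upr r) e2')"
    by (rule prn_Bind.IH, erule frozen_upr(1)[rotated]) (rule prn_Bind.prems)
  with prn_Bind show ?case by (simp add: pr_prn_prc.prn_Bind)
qed (simp_all add: pr_prn_prc.intros(3-))

lemma frozen_ups:
  assumes "\<And>k. k \<notin> Y \<Longrightarrow> fv (s k) \<inter> X = {}"
  shows "k \<notin> fz Y \<Longrightarrow> fv (ups s k) \<inter> fz X = {}" "k \<notin> bX Y t \<Longrightarrow> fv (ups s k) \<inter> bX X (sub s t) = {}"
proof -
  show *: "k \<notin> fz Y \<Longrightarrow> fv (ups s k) \<inter> fz X = {}"
  proof (cases k)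
    case (Suc m)
    assume "k \<notin> fz Y"
    with Suc have "m \<notin> Y" by (auto simp: fz_def)
    with Suc show ?thesis using fv_shift_fz[OF assms] by simp
  qed (simp add: fz_def)
  show "k \<notin> bX Y t \<Longrightarrow> fv (ups s k) \<inter> bX X (sub s t) = {}"
  proof (cases "fv t \<inter> Y = {}")
    case True
    then have "fv (sub s t) \<inter> X = {}" using assms by (fastforce simp: fv_sub)
    with True assms show "k \<notin> bX Y t \<Longrightarrow> ?thesis"
      by (cases k) (fastforce simp: bX_def fv_ren)+
  next
    case False
    assume "k \<notin> bX Y t"
    with False have "k \<notin> fz Y" by (simp add: bX_def)
    then show ?thesis using * bX_fz by fastforce
  qed
qed

lemma pr_ups:
  assumes "closed_sig S" "\<And>k. pr S X (s k) (s' k)"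
  shows "pr S (fz X) (ups s k) (ups s' k)" "pr S (bX X t) (ups s k) (ups s' k)"
proof -
  show "pr S (fz X) (ups s k) (ups s' k)"
    by (cases k) (auto simp: pr_refl fz_def intro!: pr_ren(1)[OF assms(1) assms(2)])
  then show "pr S (bX X t) (ups s k) (ups s' k)"
    by (rule pr_mono) (rule bX_fz)
qed

text \<open>A redex contracted in \<open>t\<close> mentions no variable of \<open>Y\<close>, and all
  other variables receive terms that avoid \<open>X\<close>; so the contraction remains permitted
  after the substitution. Only at a variable can a substitution change the root constructor, hence
  \<open>prn\<close> is preserved on every other term, and the case \<open>pr_ctr\<close> relies on
  this.\<close>

lemma pr_sub:
  assumes "closed_sig S"
  shows "pr S Y t t' \<Longrightarrow> (\<And>k. k \<notin> Y \<Longrightarrow> fv (s k) \<inter> X = {}) \<Longrightarrow> (\<And>k. pr S X (s k) (s' k)) \<Longrightarrow>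
      pr S X (sub s t) (sub s' t')"
    "prn S Y t t' \<Longrightarrow> (\<And>k. k \<notin> Y \<Longrightarrow> fv (s k) \<inter> X = {}) \<Longrightarrow> (\<And>k. pr S X (s k) (s' k)) \<Longrightarrow>
      pr S X (sub s t) (sub s' t') \<and> ((\<forall>k. t \<noteq> Var k) \<longrightarrow> prn S X (sub s t) (sub s' t'))"
    "prc S Y c c' \<Longrightarrow> (\<And>k. k \<notin> Y \<Longrightarrow> fv (s k) \<inter> X = {}) \<Longrightarrow> (\<And>k. pr S X (s k) (s' k)) \<Longrightarrow>
      prc S X (csub s c) (csub s' c')"
proof (induction arbitrary: X s s' and X s s' and X s s' rule: pr_prn_prc.inducts)
  case (pr_cong X t t')
  then show ?case by blast
next
  case (pr_ctr Y t m t')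
  have "fv (sub s t) \<inter> X = {}" using pr_ctr.hyps pr_ctr.prems by (fastforce simp: fv_sub)
  moreover have "t \<noteq> Var k" for k
    using pr_ctr.IH(1) \<open>ctr S m t'\<close> by (auto elim!: prn_cases ctr_cases)
  then have "prn S X (sub s t) (sub s' m)" using pr_ctr.IH(2)[of s X s'] pr_ctr.prems by blast
  ultimately show ?case using ctr_sub[OF \<open>ctr S m t'\<close> assms] pr_prn_prc.pr_ctr by blast
next
  case (prn_Act Y es es' F j)
  then have "prn S X (sub s (Act F j es)) (sub s' (Act F j es'))"
    by (auto intro!: pr_prn_prc.prn_Act simp: list_all2_conv_all_nth)
  then show ?case by (simp add: pr_prn_prc.pr_cong)
next
  case (prn_Var Y k)
  then show ?case by simp
next
  case (prn_Lam Y t t' e e')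
  have "pr S (bX X (sub s (Lam t e))) (sub (ups s) e) (sub (ups s') e')"
    using frozen_ups(2)[OF prn_Lam.prems(1)] pr_ups(2)[OF assms prn_Lam.prems(2)] by (intro prn_Lam.IH)
  then have "prn S X (sub s (Lam t e)) (sub s' (Lam t' e'))"
    using prn_Lam by (simp add: pr_prn_prc.prn_Lam)
  then show ?case by (simp add: pr_prn_prc.pr_cong)
next
  case (prn_Case Y t t' e e' e1 e2 e1' e2')
  have fr: "k \<notin> bX Y (Case t e e1 e2) \<Longrightarrow> fv (ups s k) \<inter> bX X (sub s (Case t e e1 e2)) = {}" for k
    by (rule frozen_ups(2)) (rule prn_Case.prems)
  have st: "pr S (bX X (sub s (Case t e e1 e2))) (ups s k) (ups s' k)" for k
    by (rule pr_ups(2)[OF assms prn_Case.prems(2)])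
  have "pr S (bX X (sub s (Case t e e1 e2))) (sub (ups s) e1) (sub (ups s') e1')"
    "pr S (bX X (sub s (Case t e e1 e2))) (sub (ups s) e2) (sub (ups s') e2')"
    by (rule prn_Case.IH, erule fr, rule st)+
  moreover have "pr S (fz X) (sub (ups s) t) (sub (ups s') t')"
    using frozen_ups(1)[OF prn_Case.prems(1)] pr_ups(1)[OF assms prn_Case.prems(2)]
    by (intro prn_Case.IH)
  ultimately have "prn S X (sub s (Case t e e1 e2)) (sub s' (Case t' e' e1' e2'))"
    using prn_Case by (simp add: pr_prn_prc.prn_Case)
  then show ?case by (simp add: pr_prn_prc.pr_cong)
next
  case (prn_Refine Y t t' e e')
  have "pr S (fz X) (sub (ups s) e) (sub (ups s') e')"
    using frozen_ups(1)[OF prn_Refine.prems(1)] pr_ups(1)[OF assms prn_Refine.prems(2)] by (intro prn_Refine.IH)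
  then have "prn S X (sub s (Refine t e)) (sub s' (Refine t' e'))"
    using prn_Refine by (simp add: pr_prn_prc.prn_Refine)
  then show ?case by (simp add: pr_prn_prc.pr_cong)
next
  case (prn_Pi Y t t' e e')
  have "prc S (fz X) (csub (ups s) e) (csub (ups s') e')"
    using frozen_ups(1)[OF prn_Pi.prems(1)] pr_ups(1)[OF assms prn_Pi.prems(2)] by (intro prn_Pi.IH)
  then have "prn S X (sub s (Pi t e)) (sub s' (Pi t' e'))"
    using prn_Pi by (simp add: pr_prn_prc.prn_Pi)
  then show ?case by (simp add: pr_prn_prc.pr_cong)
next
  case (prn_Bind Y t1 t1' t2 t2' wp1 wp1' e1 e1' wp2 wp2' e2 e2' M)
  have "pr S (fz X) (sub (ups s) e2) (sub (ups s') e2')"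
    using frozen_ups(1)[OF prn_Bind.prems(1)] pr_ups(1)[OF assms prn_Bind.prems(2)] by (intro prn_Bind.IH)
  then have "prn S X (sub s (Bind M t1 t2 wp1 e1 wp2 e2)) (sub s' (Bind M t1' t2' wp1' e1' wp2' e2'))"
    using prn_Bind by (simp add: pr_prn_prc.prn_Bind)
  then show ?case by (simp add: pr_prn_prc.pr_cong)
qed (simp_all add: pr_prn_prc.intros(1,3-))

text \<open>Index 0 was frozen while \<open>t\<close> was reduced, so no contracted redex mentions
  it, and \<open>a\<close> is free to contain frozen variables.\<close>

lemma pr_sub1:
  assumes "closed_sig S" "pr S (fz X) t t'" "pr S X a a'"
  shows "pr S X (sub1 a t) (sub1 a' t')"
proof (rule pr_sub(1)[OF assms(1,2)])
  show "k \<notin> fz X \<Longrightarrow> fv (inst [a] k) \<inter> X = {}" for k by (cases k) (auto simp: fz_def)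
  show "pr S X (inst [a] k) (inst [a'] k)" for k using assms(3) by (cases k) (simp_all add: pr_refl)
qed

lemma pr_sub1_free:
  assumes "closed_sig S" "pr S (Suc ` X) t t'" "pr S X a a'" "fv a \<inter> X = {}"
  shows "pr S X (sub1 a t) (sub1 a' t')"
proof (rule pr_sub(1)[OF assms(1,2)])
  show "k \<notin> Suc ` X \<Longrightarrow> fv (inst [a] k) \<inter> X = {}" for k using assms(4) by (cases k) auto
  show "pr S X (inst [a] k) (inst [a'] k)" for k using assms(3) by (cases k) (simp_all add: pr_refl)
qed

section \<open>Triangle property of parallel reduction\<close>

lemma ctr_det: "ctr S t u \<Longrightarrow> ctr S t v \<Longrightarrow> u = v"
  by (induction rule: ctr.induct) (auto elim: ctr_cases)

inductive_cases pr_E: "pr S X t u"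

text \<open>None of these heads can be the root of a redex, so a step acts on the components
  only.\<close>

lemma pr_headE:
  "pr S X (Lam t e) u \<Longrightarrow> \<exists>t' e'. u = Lam t' e' \<and> pr S X t t' \<and> pr S (bX X (Lam t e)) e e'"
  "pr S X (Const k) u \<Longrightarrow> u = Const k"
  "pr S X (Ret M t e) u \<Longrightarrow> \<exists>t' e'. u = Ret M t' e' \<and> pr S X t t' \<and> pr S X e e'"
  "pr S X (Reflect e) u \<Longrightarrow> \<exists>e'. u = Reflect e' \<and> pr S X e e'"
  "pr S X (Act F j es) u \<Longrightarrow> \<exists>es'. u = Act F j es' \<and> list_all2 (pr S X) es es'"
  "pr S X (Lift F F' t wp e) u \<Longrightarrow> \<exists>t' wp' e'. u = Lift F F' t' wp' e' \<and> pr S X t t' \<and> pr S X wp wp' \<and> pr S X e e'"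
  "pr S X (Bind (User F) t1 t2 wp1 e1 wp2 e2) u \<Longrightarrow> \<exists>t1' t2' wp1' e1' wp2' e2'.
     u = Bind (User F) t1' t2' wp1' e1' wp2' e2' \<and> pr S X t1 t1' \<and> pr S X t2 t2' \<and> pr S X wp1 wp1' \<and>
     pr S X e1 e1' \<and> pr S X wp2 wp2' \<and> pr S (fz X) e2 e2'"
  "pr S X (Universe i) u \<Longrightarrow> u = Universe i"
  "pr S X (Var n) u \<Longrightarrow> u = Var n"
  "pr S X (Pi t c) u \<Longrightarrow> \<exists>t' c'. u = Pi t' c' \<and> pr S X t t' \<and> prc S (fz X) c c'"
  "pr S X (Refine t e) u \<Longrightarrow> \<exists>t' e'. u = Refine t' e' \<and> pr S X t t' \<and> pr S (fz X) e e'"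
  by - (erule pr_E; erule prn_cases; auto elim: ctr_cases)+

lemma pr_const_App:
  assumes "pr S X (App (Const k) e) u" "k \<noteq> CFst" "k \<noteq> CSnd"
  shows "\<exists>e'. u = App (Const k) e' \<and> pr S X e e'"
  using assms by - (erule pr_E; erule prn_cases; auto dest!: pr_headE(2) elim!: ctr_cases)

lemma pr_const_App2:
  assumes "pr S X (app2 (Const k) e1 e2) u" "k \<noteq> CFst" "k \<noteq> CSnd"
  shows "\<exists>e1' e2'. u = app2 (Const k) e1' e2' \<and> pr S X e1 e1' \<and> pr S X e2 e2'"
  using assms by - (erule pr_E; erule prn_cases; auto dest!: pr_const_App elim!: ctr_cases)

lemma pr_cong_simps:
  "pr S X e1 e1' \<Longrightarrow> pr S X e2 e2' \<Longrightarrow> pr S X (App e1 e2) (App e1' e2')"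
  "pr S X e e' \<Longrightarrow> pr S X (Reify e) (Reify e')"
  "pr S X e e' \<Longrightarrow> pr S X (Run e) (Run e')"
  by (simp_all add: pr_prn_prc.intros(1,3-))

lemma pr_apps: "list_all2 (pr S X) es es' \<Longrightarrow> pr S X f f' \<Longrightarrow> pr S X (apps f es) (apps f' es')"
  by (induction es es' arbitrary: f f' rule: list_all2_induct) (auto intro: pr_cong_simps)

text \<open>Inner steps do not destroy a root redex, because the constructors that form it are
  rigid. Since the whole redex avoids \<open>X\<close>, \<open>bX\<close> leaves the binders of
  \<open>Lam\<close> and \<open>Case\<close> unfrozen, and the argument avoids \<open>X\<close> as
  \<open>pr_sub1_free\<close> asks. The binder of \<open>Bind\<close> is always frozen, so
  \<open>pr_sub1\<close> suffices there.\<close>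

lemma ctr_pr:
  assumes "ctr S t u" "closed_sig S" "prn S X t t'" "fv t \<inter> X = {}"
  shows "\<exists>u'. ctr S t' u' \<and> pr S X u u'"
  using assms(1)
proof cases
  case (ctr_Beta t b e)
  then obtain t2 b2 e2 where *: "t' = App (Lam t2 b2) e2" "pr S (bX X (Lam t b)) b b2" "pr S X e e2"
    using assms(3) by (auto elim!: prn_cases dest!: pr_headE(1))
  have "fv (Lam t b) \<inter> X = {}" "fv e \<inter> X = {}" using ctr_Beta assms(4) by auto
  then have "pr S X (sub1 e b) (sub1 e2 b2)"
    using * by (intro pr_sub1_free[OF assms(2)]) (simp_all add: bX_def)
  with * ctr_Beta show ?thesis by (auto intro: ctr.intros)
next
  case (ctr_Fst e2)
  then show ?thesis using assms
    by (auto elim!: prn_cases dest!: pr_headE(2) pr_const_App2 intro!: ctr.intros)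
next
  case (ctr_Snd e1)
  then show ?thesis using assms
    by (auto elim!: prn_cases dest!: pr_headE(2) pr_const_App2 intro!: ctr.intros)
next
  case (ctr_Inl r e e1 e2)
  then obtain r' e' e1' e2' where *: "t' = Case r' (App (Const CInl) e') e1' e2'"
    "pr S (bX X t) e1 e1'" "pr S (bX X t) e2 e2'" "pr S X e e'"
    using assms(3) by (auto elim!: prn_cases dest!: pr_const_App)
  have "fv e \<inter> X = {}" using ctr_Inl assms(4) by auto
  then have "pr S X (sub1 e e1) (sub1 e' e1')"
    using * assms(4) by (intro pr_sub1_free[OF assms(2)]) (simp_all add: bX_def)
  with * ctr_Inl show ?thesis by (auto intro: ctr.intros)
next
  case (ctr_Inr r e e1 e2)
  then obtain r' e' e1' e2' where *: "t' = Case r' (App (Const CInr) e') e1' e2'"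
    "pr S (bX X t) e1 e1'" "pr S (bX X t) e2 e2'" "pr S X e e'"
    using assms(3) by (auto elim!: prn_cases dest!: pr_const_App)
  have "fv e \<inter> X = {}" using ctr_Inr assms(4) by auto
  then have "pr S X (sub1 e e2) (sub1 e' e2')"
    using * assms(4) by (intro pr_sub1_free[OF assms(2)]) (simp_all add: bX_def)
  with * ctr_Inr show ?thesis by (auto intro: ctr.intros)
next
  case (ctr_Run t)
  then show ?thesis using assms
    by (auto elim!: prn_cases dest!: pr_headE intro!: ctr.intros)
next
  case (ctr_Bind t1 t2 wp1 t e1 wp2 e2)
  then obtain t1' t2' wp1' r' e1' wp2' e2' where *: "t' = Bind Pure t1' t2' wp1' (Ret Pure r' e1') wp2' e2'"
    "pr S (fz X) e2 e2'" "pr S X e1 e1'"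
    using assms(3) by (auto elim!: prn_cases dest!: pr_headE(3))
  then have "pr S X (sub1 e1 e2) (sub1 e1' e2')"
    by (intro pr_sub1[OF assms(2)])
  with * ctr_Bind show ?thesis by (auto intro: ctr.intros)
next
  case ctr_Reflect
  then show ?thesis using assms
    by (auto elim!: prn_cases dest!: pr_headE intro!: ctr.intros)
next
  case (ctr_ReifyRet F D t e)
  then show ?thesis using assms
    by (fastforce elim!: prn_cases dest!: pr_headE intro!: ctr.intros pr_apps pr_cong_simps pr_refl)
next
  case (ctr_ReifyBind F D t1 t2 wp1 e1 wp2 e2)
  then obtain t1' t2' wp1' e1' wp2' e2' where *: "t' = Reify (Bind (User F) t1' t2' wp1' e1' wp2' e2')"
    "pr S X t1 t1'" "pr S X t2 t2'" "pr S X wp1 wp1'" "pr S X e1 e1'" "pr S X wp2 wp2'" "pr S (fz X) e2 e2'"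
    using assms(3) by (auto elim!: prn_cases dest!: pr_headE(7))
  \<comment> \<open>The continuation leaves a \<open>Bind\<close>, whose binder is always frozen,
    and enters a \<open>Lam\<close>, whose binder is frozen at most as much.\<close>
  have "pr S (bX X (Lam t1 (Reify e2))) (Reify e2) (Reify e2')"
    using pr_mono(1)[OF *(7) bX_fz] by (rule pr_cong_simps)
  then have "pr S X (Lam t1 (Reify e2)) (Lam t1' (Reify e2'))"
    using * by (simp add: pr_prn_prc.intros(1,3-))
  with * ctr_ReifyBind show ?thesis
    by (intro exI[of _ "apps (bind_impl D) [t1', t2', wp1', Reify e1', wp2', Lam t1' (Reify e2')]"])
      (simp add: ctr.ctr_ReifyBind[simplified] pr_refl pr_cong_simps)
next
  case (ctr_ReifyAct F D j es)
  then show ?thesis using assms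
    by (fastforce elim!: prn_cases dest!: pr_headE intro!: ctr.intros pr_apps pr_refl)
next
  case (ctr_ReifyLift F F' l w t wp e)
  then show ?thesis using assms
    by (fastforce elim!: prn_cases dest!: pr_headE intro!: ctr.intros pr_apps pr_cong_simps pr_refl)
qed

text \<open>The target collects the maximal reducts of the components; contracting the root is left
  to \<open>pr_triangle\<close>.\<close>

lemma prn_triangle:
  assumes cs: "closed_sig S"
    and IH: "\<And>s X. size s < size t \<Longrightarrow> \<exists>d. \<forall>s'. pr S X s s' \<longrightarrow> pr S X s' d"
  shows "\<exists>d. prn S X t d \<and> (\<forall>m. prn S X t m \<longrightarrow> prn S X m d)"
proof -
  have bm: "pr S (bX X t) e d \<Longrightarrow> fv m \<subseteq> fv t \<Longrightarrow> pr S (bX X m) e d" for e d m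
    by (erule pr_mono) (rule bX_mono_fv)
  \<comment> \<open>Since \<open>pr\<close> is reflexive, the common target of all reducts is itself
    a reduct of the source.\<close>
  have refl: "(\<And>s'. pr S Y s s' \<Longrightarrow> pr S Y s' d) \<Longrightarrow> pr S Y s d" for Y s d
    using pr_refl(1) by blast
  show ?thesis
  proof (cases t)
    case (Refine a b)
    obtain d1 d2 where "\<And>s'. pr S X a s' \<Longrightarrow> pr S X s' d1" "\<And>s'. pr S (fz X) b s' \<Longrightarrow> pr S (fz X) s' d2"
      using IH[of a X] IH[of b "fz X"] Refine by auto
    with refl Refine show ?thesis
      by (intro exI[of _ "Refine d1 d2"]) (auto elim!: prn_cases intro!: pr_prn_prc.intros(3-))
  next
    case (Lam a b)
    obtain d1 d2 where d: "\<And>s'. pr S X a s' \<Longrightarrow> pr S X s' d1" "\<And>s'. pr S (bX X t) b s' \<Longrightarrow> pr S (bX X t) s' d2"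
      using IH[of a X] IH[of b "bX X t"] Lam by auto
    with refl have "prn S X t (Lam d1 d2)"
      unfolding Lam by (intro pr_prn_prc.intros(3-)) blast+
    moreover have "prn S X m (Lam d1 d2)" if "prn S X t m" for m
    proof -
      from that Lam obtain a' b' where "m = Lam a' b'" "pr S X a a'" "pr S (bX X t) b b'"
        by (auto elim!: prn_cases)
      then show ?thesis using d bm[OF _ fv_pr(2)[OF cs that]]
        by (auto intro!: pr_prn_prc.intros(3-))
    qed
    ultimately show ?thesis by blast
  next
    case (Pi a c)
    obtain d1 where d1: "\<And>s'. pr S X a s' \<Longrightarrow> pr S X s' d1" using IH[of a X] Pi by auto
    show ?thesis
    proof (cases c)
      case (Tot b)
      obtain d2 where "\<And>s'. pr S (fz X) b s' \<Longrightarrow> pr S (fz X) s' d2"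
        using IH[of b "fz X"] Pi Tot by auto
      with d1 refl Pi Tot show ?thesis
        by (intro exI[of _ "Pi d1 (Tot d2)"]) (auto elim!: prn_cases intro!: pr_prn_prc.intros(3-))
    next
      case (Cmp M u w)
      obtain d2 d3 where "\<And>s'. pr S (fz X) u s' \<Longrightarrow> pr S (fz X) s' d2"
        "\<And>s'. pr S (fz X) w s' \<Longrightarrow> pr S (fz X) s' d3"
        using IH[of u "fz X"] IH[of w "fz X"] Pi Cmp by auto
      with d1 refl Pi Cmp show ?thesis
        by (intro exI[of _ "Pi d1 (Cmp M d2 d3)"]) (auto elim!: prn_cases intro!: pr_prn_prc.intros(3-))
    qed
  next
    case (App a b)
    obtain d1 d2 where "\<And>s'. pr S X a s' \<Longrightarrow> pr S X s' d1" "\<And>s'. pr S X b s' \<Longrightarrow> pr S X s' d2"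
      using IH[of a X] IH[of b X] App by auto
    with refl App show ?thesis
      by (intro exI[of _ "App d1 d2"]) (auto elim!: prn_cases intro!: pr_prn_prc.intros(3-))
  next
    case (Case a b e1 e2)
    obtain d1 d2 d3 d4 where d: "\<And>s'. pr S (fz X) a s' \<Longrightarrow> pr S (fz X) s' d1" "\<And>s'. pr S X b s' \<Longrightarrow> pr S X s' d2"
      "\<And>s'. pr S (bX X t) e1 s' \<Longrightarrow> pr S (bX X t) s' d3" "\<And>s'. pr S (bX X t) e2 s' \<Longrightarrow> pr S (bX X t) s' d4"
      using IH[of a "fz X"] IH[of b X] IH[of e1 "bX X t"] IH[of e2 "bX X t"] Case by auto
    with refl have "prn S X t (Case d1 d2 d3 d4)"
      unfolding Case by (intro pr_prn_prc.intros(3-)) blast+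
    moreover have "prn S X m (Case d1 d2 d3 d4)" if "prn S X t m" for m
    proof -
      from that Case obtain a' b' e1' e2' where "m = Case a' b' e1' e2'" "pr S (fz X) a a'" "pr S X b b'"
        "pr S (bX X t) e1 e1'" "pr S (bX X t) e2 e2'"
        by (auto elim!: prn_cases)
      then show ?thesis using d bm[OF _ fv_pr(2)[OF cs that]]
        by (auto intro!: pr_prn_prc.intros(3-))
    qed
    ultimately show ?thesis by blast
  next
    case (Run a)
    obtain d1 where "\<And>s'. pr S X a s' \<Longrightarrow> pr S X s' d1" using IH[of a X] Run by auto
    with refl Run show ?thesis
      by (intro exI[of _ "Run d1"]) (auto elim!: prn_cases intro!: pr_prn_prc.intros(3-))
  next
    case (Reify a)
    obtain d1 where "\<And>s'. pr S X a s' \<Longrightarrow> pr S X s' d1" using IH[of a X] Reify by auto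
    with refl Reify show ?thesis
      by (intro exI[of _ "Reify d1"]) (auto elim!: prn_cases intro!: pr_prn_prc.intros(3-))
  next
    case (Reflect a)
    obtain d1 where "\<And>s'. pr S X a s' \<Longrightarrow> pr S X s' d1" using IH[of a X] Reflect by auto
    with refl Reflect show ?thesis
      by (intro exI[of _ "Reflect d1"]) (auto elim!: prn_cases intro!: pr_prn_prc.intros(3-))
  next
    case (Lift F F' a b c)
    obtain d1 d2 d3 where "\<And>s'. pr S X a s' \<Longrightarrow> pr S X s' d1" "\<And>s'. pr S X b s' \<Longrightarrow> pr S X s' d2"
      "\<And>s'. pr S X c s' \<Longrightarrow> pr S X s' d3"
      using IH[of a X] IH[of b X] IH[of c X] Lift by auto
    with refl Lift show ?thesis
      by (intro exI[of _ "Lift F F' d1 d2 d3"]) (auto elim!: prn_cases intro!: pr_prn_prc.intros(3-))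
  next
    case (Act F j es)
    have "\<forall>e\<in>set es. \<exists>d. \<forall>s'. pr S X e s' \<longrightarrow> pr S X s' d"
      using IH[of _ X] Act size_list_estimation'[of _ es _ size] by (auto simp: less_Suc_eq_le)
    then obtain d where d: "\<And>e s'. e \<in> set es \<Longrightarrow> pr S X e s' \<Longrightarrow> pr S X s' (d e)"
      by metis
    with refl Act show ?thesis
      by (intro exI[of _ "Act F j (map d es)"])
        (auto elim!: prn_cases intro!: pr_prn_prc.intros(3-) simp: list_all2_conv_all_nth)
  next
    case (Ret M a b)
    obtain d1 d2 where "\<And>s'. pr S X a s' \<Longrightarrow> pr S X s' d1" "\<And>s'. pr S X b s' \<Longrightarrow> pr S X s' d2"
      using IH[of a X] IH[of b X] Ret by auto
    with refl Ret show ?thesis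
      by (intro exI[of _ "Ret M d1 d2"]) (auto elim!: prn_cases intro!: pr_prn_prc.intros(3-))
  next
    case (Bind M t1 t2 wp1 e1 wp2 e2)
    obtain d1 d2 d3 where d123: "\<And>s'. pr S X t1 s' \<Longrightarrow> pr S X s' d1" "\<And>s'. pr S X t2 s' \<Longrightarrow> pr S X s' d2"
      "\<And>s'. pr S X wp1 s' \<Longrightarrow> pr S X s' d3"
      using IH[of t1 X] IH[of t2 X] IH[of wp1 X] Bind by auto
    obtain d4 d5 d6 where "\<And>s'. pr S X e1 s' \<Longrightarrow> pr S X s' d4"
      "\<And>s'. pr S X wp2 s' \<Longrightarrow> pr S X s' d5" "\<And>s'. pr S (fz X) e2 s' \<Longrightarrow> pr S (fz X) s' d6"
      using IH[of e1 X] IH[of wp2 X] IH[of e2 "fz X"] Bind by auto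
    with d123 refl Bind show ?thesis
      by (intro exI[of _ "Bind M d1 d2 d3 d4 d5 d6"]) (auto elim!: prn_cases intro!: pr_prn_prc.intros(3-))
  qed (auto intro: pr_prn_prc.intros(3-) elim!: prn_cases)
qed

text \<open>The maximal reduct develops all components and afterwards contracts the root, if a redex
  is there and freezing permits it. A redex survives the remaining inner steps by
  \<open>ctr_pr\<close> and has a single contractum by \<open>ctr_det\<close>; this covers both a
  \<open>t'\<close> that has contracted its root and one that has not.\<close>

lemma pr_triangle:
  assumes cs: "closed_sig S"
  shows "\<exists>d. \<forall>t'. pr S X t t' \<longrightarrow> pr S X t' d"
proof (induction t arbitrary: X rule: measure_induct_rule[of size])
  case (less t)
  obtain d where d: "prn S X t d" "\<And>m. prn S X t m \<Longrightarrow> prn S X m d"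
    using prn_triangle[OF cs less.IH] by blast
  show ?case
  proof (cases "fv t \<inter> X = {} \<and> (\<exists>u. ctr S d u)")
    case True
    then obtain u where u: "ctr S d u" and X: "fv t \<inter> X = {}" by blast
    have "pr S X t' u" if "pr S X t t'" for t'
      using that
    proof cases
      case pr_cong
      then have "fv t' \<inter> X = {}" using X fv_pr(2)[OF cs] by blast
      then show ?thesis using d(2) u pr_cong by (blast intro: pr_prn_prc.pr_ctr)
    next
      case (pr_ctr m)
      then have "fv m \<inter> X = {}" using X fv_pr(2)[OF cs] by blast
      then obtain u' where "ctr S d u'" "pr S X t' u'"
        using ctr_pr[OF pr_ctr(3) cs d(2)[OF pr_ctr(1)]] by blast
      then show ?thesis using ctr_det u by blast
    qed
    then show ?thesis by blast
  next
    case False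
    have "pr S X t' d" if "pr S X t t'" for t'
      using that
    proof cases
      case pr_cong
      then show ?thesis using d(2) by (blast intro: pr_prn_prc.pr_cong)
    next
      case (pr_ctr m)
      then have "fv m \<inter> X = {}" using fv_pr(2)[OF cs] by blast
      then obtain u' where "ctr S d u'" "pr S X t' u'"
        using ctr_pr[OF pr_ctr(3) cs d(2)[OF pr_ctr(1)]] by blast
      then show ?thesis using False pr_ctr(2) by blast
    qed
    then show ?thesis by blast
  qed
qed

section \<open>Conversion\<close>

lemma prn_refl: "(\<forall>k. t \<noteq> Var k) \<Longrightarrow> prn S X t t"
  by (cases t) (auto intro!: pr_prn_prc.intros(3-) simp: pr_refl list_all2_conv_all_nth)

lemma ctr_red: "ctr S t u \<Longrightarrow> red S t u"
  by (induction rule: ctr.induct) (rule red.intros; assumption)+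

text \<open>With nothing frozen, \<open>bX\<close> is empty, so a body of \<open>Lam\<close> or a
  branch of \<open>Case\<close> may contract redexes that mention its own bound variable, as the
  evaluation contexts do.\<close>

lemma red_pr:
  assumes "red S t u"
  shows "pr S {} t u"
  using assms
proof induction
  case (E_Act e e' F j es es')
  then have "list_all2 (pr S {}) (es @ e # es') (es @ e' # es')"
    by (intro list_all2_appendI) (simp_all add: list_all2_same pr_refl)
  then show ?case by (simp add: pr_prn_prc.intros(1,3-))
next
  case (E_Lam e e' t)
  then show ?case by (simp add: pr_prn_prc.intros(1,3-) pr_refl bX_def)
next
  case (E_CaseL e1 e1' t e e2)
  then show ?case by (simp add: pr_prn_prc.intros(1,3-) pr_refl bX_def)
next
  case (E_CaseR e2 e2' t e e1)
  then show ?case by (simp add: pr_prn_prc.intros(1,3-) pr_refl bX_def)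
qed (rule pr_ctr[OF prn_refl _ ctr.intros(1)] pr_ctr[OF prn_refl _ ctr.intros(2)]
    pr_ctr[OF prn_refl _ ctr.intros(3)] pr_ctr[OF prn_refl _ ctr.intros(4)] pr_ctr[OF prn_refl _ ctr.intros(5)]
    pr_ctr[OF prn_refl _ ctr.intros(6)] pr_ctr[OF prn_refl _ ctr.intros(7)] pr_ctr[OF prn_refl _ ctr.intros(8)]
    pr_ctr[OF prn_refl _ ctr.intros(9)] pr_ctr[OF prn_refl _ ctr.intros(10)] pr_ctr[OF prn_refl _ ctr.intros(11)]
    pr_ctr[OF prn_refl _ ctr.intros(12)]; simp |
   simp add: pr_prn_prc.intros(1,3-) pr_refl)+

section \<open>Untyped conversion and its closure under contexts\<close>

inductive conv :: "signature \<Rightarrow> tm \<Rightarrow> tm \<Rightarrow> bool" for S where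
  conv_red: "red S t u \<Longrightarrow> conv S t u"
| conv_refl [simp]: "conv S t t"
| conv_sym: "conv S t u \<Longrightarrow> conv S u t"
| conv_trans: "conv S t u \<Longrightarrow> conv S u v \<Longrightarrow> conv S t v"

lemma red_sub:
  assumes "closed_sig S" "red S t u"
  shows "red S (sub s t) (sub s u)"
  using assms(2)
proof (induction arbitrary: s)
  case (R_ReifyAct F D j es)
  then show ?case using ctr_sub[OF ctr_ReifyAct assms(1)] ctr_red by blast
qed (auto simp: sub_sub1 sub_closed closed_sigD[OF assms(1)] intro: red.intros[simplified])

lemma conv_sub:
  assumes "closed_sig S" "conv S t u"
  shows "conv S (sub s t) (sub s u)"
  using assms(2) by induction (auto intro: conv.intros red_sub[OF assms(1)])

text \<open>Both sides are beta contracta of one abstraction applied to \<open>a\<close> and to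
  \<open>b\<close>, and reduction may work in an argument. Conversion is untyped, so any domain
  serves in place of \<open>unitT\<close>. The hole may lie below any binder of \<open>C\<close>,
  provided the binder captures nothing of \<open>a\<close> and \<open>b\<close>.\<close>

lemma conv_hole: "conv S a b \<Longrightarrow> conv S (sub1 a C) (sub1 b C)"
proof (induction rule: conv.induct)
  case (conv_red a b)
  have "conv S (App (Lam unitT C) a) (sub1 a C)" "conv S (App (Lam unitT C) b) (sub1 b C)"
    "conv S (App (Lam unitT C) a) (App (Lam unitT C) b)"
    using conv_red by (auto intro: conv.conv_red red.intros)
  then show ?case by (meson conv.conv_sym conv.conv_trans)
qed (auto intro: conv.intros)

text \<open>These are the positions at which \<open>red\<close> itself goes below a binder. Here the
  converted terms may mention the bound variable, which \<open>conv_hole\<close> does not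
  allow.\<close>

lemma conv_binder:
  "conv S e e' \<Longrightarrow> conv S (Lam t e) (Lam t e')"
  "conv S e e' \<Longrightarrow> conv S (Case t a e e2) (Case t a e' e2)"
  "conv S e e' \<Longrightarrow> conv S (Case t a e1 e) (Case t a e1 e')"
  by (induction rule: conv.induct; blast intro: conv.intros red.intros)+

text \<open>Plain conversion is not closed under all binders, so the inclusion of \<open>pr\<close>
  in \<open>conv\<close> does not go through by a direct induction. This is the invariant that does:
  only subterms without frozen variables are exchanged, and such a subterm can be moved out of the
  scope of any frozen binder.\<close>

definition hstep :: "signature \<Rightarrow> nat set \<Rightarrow> tm \<Rightarrow> tm \<Rightarrow> bool" where
  "hstep S X t t' \<longleftrightarrow>
     (\<exists>C a b. t = sub1 a C \<and> t' = sub1 b C \<and> conv S a b \<and> fv a \<inter> X = {} \<and> fv b \<inter> X = {})"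

abbreviation hsteps :: "signature \<Rightarrow> nat set \<Rightarrow> tm \<Rightarrow> tm \<Rightarrow> bool" where
  "hsteps S X \<equiv> (hstep S X)\<^sup>*\<^sup>*"

lemma hsteps_conv: "hsteps S X t t' \<Longrightarrow> conv S t t'"
  by (induction rule: rtranclp_induct) (auto simp: hstep_def intro: conv_trans conv_hole)

lemma conv_hsteps: "conv S t t' \<Longrightarrow> fv t \<inter> X = {} \<Longrightarrow> fv t' \<inter> X = {} \<Longrightarrow> hsteps S X t t'"
  by (intro r_into_rtranclp, unfold hstep_def, intro exI[of _ "Var 0"] exI[of _ t] exI[of _ t']) simp

lemma hsteps_ctx:
  assumes "\<And>C a. K (sub1 a C) = sub1 a (K' C)" "hsteps S X t t'"
  shows "hsteps S X (K t) (K t')"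
  using assms(2)
proof (induction rule: rtranclp_induct)
  case (step u v)
  then obtain C a b where *: "u = sub1 a C" "v = sub1 b C" "conv S a b" "fv a \<inter> X = {}" "fv b \<inter> X = {}"
    by (auto simp: hstep_def)
  then have "hstep S X (K u) (K v)"
    unfolding hstep_def by (intro exI[of _ "K' C"] exI[of _ a] exI[of _ b]) (simp add: assms(1))
  with step show ?case by simp
qed simp

text \<open>The permutation swaps the hole with the bound variable: below the binder the hole is
  innermost, whereas after the binder has been absorbed into the context the bound variable
  is.\<close>

lemma sub_ups_inst: "sub1 (shift a) C = sub (ups (inst [a])) (ren (\<lambda>k. if k = 0 then 1 else if k = 1 then 0 else k) C)"
proof -
  have "inst [shift a] k = ups (inst [a]) (if k = 0 then 1 else if k = 1 then 0 else k)" for k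
    by (cases k; cases "k - 1") simp_all
  then show ?thesis unfolding sub_ren by (intro sub_cong_fv)
qed

text \<open>\<open>Universe 0\<close> is a placeholder for a variable that does not occur.\<close>

lemma unshift: "0 \<notin> fv t \<Longrightarrow> t = shift (sub1 (Universe 0) t)"
proof -
  assume *: "0 \<notin> fv t"
  have "shift (sub1 (Universe 0) t) = sub (\<lambda>k. shift (inst [Universe 0] k)) t"
    by (simp add: ren_sub)
  also have "\<dots> = sub Var t"
  proof (rule sub_cong_fv)
    show "k \<in> fv t \<Longrightarrow> shift (inst [Universe 0] k) = Var k" for k
      using * by (cases k) auto
  qed
  finally show ?thesis by simp
qed

lemma fv_unshift: "fv t \<inter> fz X = {} \<Longrightarrow> fv (sub1 (Universe 0) t) \<inter> X = {}"
proof -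
  assume *: "fv t \<inter> fz X = {}"
  then have "t = shift (sub1 (Universe 0) t)" by (intro unshift) (auto simp: fz_def)
  then have "fv t = Suc ` fv (sub1 (Universe 0) t)" by (metis fv_ren(1))
  with * show ?thesis by (auto simp: fz_def)
qed

text \<open>The exchanged subterms avoid the new binder, hence are shifts of terms that live outside
  it. The conversion between them is brought outside by substituting for the absent index, and the
  hole crosses the binder by \<open>sub_ups_inst\<close>.\<close>

lemma hsteps_bctx:
  assumes cs: "closed_sig S" and K: "\<And>C a. K (sub (ups (inst [a])) C) = sub1 a (K' C)" and "hsteps S (fz X) t t'"
  shows "hsteps S X (K t) (K t')"
  using assms(3)
proof (induction rule: rtranclp_induct)
  case (step u v)
  then obtain C a b where *: "u = sub1 a C" "v = sub1 b C" "conv S a b" "fv a \<inter> fz X = {}" "fv b \<inter> fz X = {}"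
    by (auto simp: hstep_def)
  define a0 b0 where "a0 = sub1 (Universe 0) a" "b0 = sub1 (Universe 0) b"
  have "a = shift a0" "b = shift b0"
    using *(4,5) unfolding a0_b0_def by (auto intro!: unshift simp: fz_def)
  moreover have "conv S a0 b0" using conv_sub[OF cs *(3)] by (simp add: a0_b0_def)
  moreover have "fv a0 \<inter> X = {}" "fv b0 \<inter> X = {}"
    using fv_unshift *(4,5) by (auto simp: a0_b0_def)
  moreover define C' where "C' = ren (\<lambda>k. if k = 0 then 1 else if k = 1 then 0 else k) C"
  moreover have "K u = sub1 a0 (K' C')" "K v = sub1 b0 (K' C')"
    using calculation(1,2) *(1,2) K sub_ups_inst C'_def by simp_all
  ultimately have "hstep S X (K u) (K v)"
    unfolding hstep_def by blast
  with step show ?case by simp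
qed simp

lemma hsteps_cong:
  shows "hsteps S X a a' \<Longrightarrow> hsteps S X b b' \<Longrightarrow> hsteps S X (App a b) (App a' b')"
    and "hsteps S X a a' \<Longrightarrow> hsteps S X (Run a) (Run a')"
    and "hsteps S X a a' \<Longrightarrow> hsteps S X (Reify a) (Reify a')"
    and "hsteps S X a a' \<Longrightarrow> hsteps S X (Reflect a) (Reflect a')"
    and "hsteps S X a a' \<Longrightarrow> hsteps S X b b' \<Longrightarrow> hsteps S X (Ret M a b) (Ret M a' b')"
    and "hsteps S X a a' \<Longrightarrow> hsteps S X b b' \<Longrightarrow> hsteps S X d d' \<Longrightarrow> hsteps S X (Lift F F' a b d) (Lift F F' a' b' d')"
proof -
  have 1: "hsteps S X a a' \<Longrightarrow> hsteps S X (App a b) (App a' b)" for a a' b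
    by (rule hsteps_ctx[where K="\<lambda>x. App x b" and K'="\<lambda>x. App x (shift b)"]) simp_all
  have 2: "hsteps S X b b' \<Longrightarrow> hsteps S X (App a b) (App a b')" for a b b'
    by (rule hsteps_ctx[where K="\<lambda>x. App a x" and K'="\<lambda>x. App (shift a) x"]) simp_all
  show "hsteps S X a a' \<Longrightarrow> hsteps S X b b' \<Longrightarrow> hsteps S X (App a b) (App a' b')"
    using rtranclp_trans[OF 1 2] .
  show "hsteps S X a a' \<Longrightarrow> hsteps S X (Run a) (Run a')"
    by (rule hsteps_ctx[where K=Run and K'=Run]) simp_all
  show "hsteps S X a a' \<Longrightarrow> hsteps S X (Reify a) (Reify a')"
    by (rule hsteps_ctx[where K=Reify and K'=Reify]) simp_all
  show "hsteps S X a a' \<Longrightarrow> hsteps S X (Reflect a) (Reflect a')"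
    by (rule hsteps_ctx[where K=Reflect and K'=Reflect]) simp_all
  have 1: "hsteps S X a a' \<Longrightarrow> hsteps S X (Ret M a b) (Ret M a' b)" for a a' b
    by (rule hsteps_ctx[where K="\<lambda>x. Ret M x b" and K'="\<lambda>x. Ret M x (shift b)"]) simp_all
  have 2: "hsteps S X b b' \<Longrightarrow> hsteps S X (Ret M a b) (Ret M a b')" for a b b'
    by (rule hsteps_ctx[where K="\<lambda>x. Ret M a x" and K'="\<lambda>x. Ret M (shift a) x"]) simp_all
  show "hsteps S X a a' \<Longrightarrow> hsteps S X b b' \<Longrightarrow> hsteps S X (Ret M a b) (Ret M a' b')"
    using rtranclp_trans[OF 1 2] .
  have 1: "hsteps S X a a' \<Longrightarrow> hsteps S X (Lift F F' a b d) (Lift F F' a' b d)" for a a' b d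
    by (rule hsteps_ctx[where K="\<lambda>x. Lift F F' x b d" and K'="\<lambda>x. Lift F F' x (shift b) (shift d)"]) simp_all
  have 2: "hsteps S X b b' \<Longrightarrow> hsteps S X (Lift F F' a b d) (Lift F F' a b' d)" for a b b' d
    by (rule hsteps_ctx[where K="\<lambda>x. Lift F F' a x d" and K'="\<lambda>x. Lift F F' (shift a) x (shift d)"]) simp_all
  have 3: "hsteps S X d d' \<Longrightarrow> hsteps S X (Lift F F' a b d) (Lift F F' a b d')" for a b d d'
    by (rule hsteps_ctx[where K="\<lambda>x. Lift F F' a b x" and K'="\<lambda>x. Lift F F' (shift a) (shift b) x"]) simp_all
  show "hsteps S X a a' \<Longrightarrow> hsteps S X b b' \<Longrightarrow> hsteps S X d d' \<Longrightarrow> hsteps S X (Lift F F' a b d) (Lift F F' a' b' d')"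
    using rtranclp_trans[OF rtranclp_trans[OF 1 2] 3] .
qed

lemma hsteps_Act:
  assumes "list_all2 (hsteps S X) es es'"
  shows "hsteps S X (Act F j es) (Act F j es')"
proof -
  have "hsteps S X (Act F j (pre @ es)) (Act F j (pre @ es'))" for pre
    using assms
  proof (induction arbitrary: pre rule: list_all2_induct)
    case (Cons e es e' es')
    have "hsteps S X (Act F j (pre @ e # es)) (Act F j (pre @ e' # es))"
      by (rule hsteps_ctx[where K="\<lambda>x. Act F j (pre @ x # es)" and K'="\<lambda>x. Act F j (map shift pre @ x # map shift es)"])
        (simp_all add: Cons map_idI)
    with Cons(3)[of "pre @ [e']"] show ?case by simp
  qed simp
  from this[of "[]"] show ?thesis by simp
qed

lemma hsteps_cong_binder:
  assumes cs: "closed_sig S"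
  shows "hsteps S X a a' \<Longrightarrow> hsteps S (fz X) b b' \<Longrightarrow> hsteps S X (Refine a b) (Refine a' b')"
    and "hsteps S X a a' \<Longrightarrow> hsteps S (fz X) b b' \<Longrightarrow> hsteps S X (Lam a b) (Lam a' b')"
    and "hsteps S (fz X) t t' \<Longrightarrow> hsteps S X e e' \<Longrightarrow> hsteps S (fz X) e1 e1' \<Longrightarrow> hsteps S (fz X) e2 e2' \<Longrightarrow>
      hsteps S X (Case t e e1 e2) (Case t' e' e1' e2')"
    and "hsteps S X t1 t1' \<Longrightarrow> hsteps S X t2 t2' \<Longrightarrow> hsteps S X wp1 wp1' \<Longrightarrow> hsteps S X a1 a1' \<Longrightarrow>
      hsteps S X wp2 wp2' \<Longrightarrow> hsteps S (fz X) a2 a2' \<Longrightarrow>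
      hsteps S X (Bind M t1 t2 wp1 a1 wp2 a2) (Bind M t1' t2' wp1' a1' wp2' a2')"
    and "hsteps S X a a' \<Longrightarrow> hsteps S (fz X) b b' \<Longrightarrow> hsteps S X (Pi a (Tot b)) (Pi a' (Tot b'))"
    and "hsteps S X a a' \<Longrightarrow> hsteps S (fz X) b b' \<Longrightarrow> hsteps S (fz X) d d' \<Longrightarrow>
      hsteps S X (Pi a (Cmp M b d)) (Pi a' (Cmp M b' d'))"
proof -
  \<comment> \<open>\<open>?u\<close> makes room for the hole below a binder, where the hole has
    index 1.\<close>
  let ?u = "ren (upr Suc)"
  have u: "sub (ups (inst [a])) (?u b) = b" for a b
    by (simp add: sub_ren ups_comp_upr) (simp add: ups_Var flip: inst1_simps(2))
  show "hsteps S X a a' \<Longrightarrow> hsteps S (fz X) b b' \<Longrightarrow> hsteps S X (Refine a b) (Refine a' b')"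
    by (rule rtranclp_trans)
      (rule hsteps_ctx[where K="\<lambda>x. Refine x b" and K'="\<lambda>x. Refine x (?u b)"]
        hsteps_bctx[OF cs, where K="\<lambda>x. Refine a' x" and K'="\<lambda>x. Refine (shift a') x"]; simp add: u)+
  show "hsteps S X a a' \<Longrightarrow> hsteps S (fz X) b b' \<Longrightarrow> hsteps S X (Lam a b) (Lam a' b')"
    by (rule rtranclp_trans)
      (rule hsteps_ctx[where K="\<lambda>x. Lam x b" and K'="\<lambda>x. Lam x (?u b)"]
        hsteps_bctx[OF cs, where K="\<lambda>x. Lam a' x" and K'="\<lambda>x. Lam (shift a') x"]; simp add: u)+
  show "hsteps S X a a' \<Longrightarrow> hsteps S (fz X) b b' \<Longrightarrow> hsteps S X (Pi a (Tot b)) (Pi a' (Tot b'))"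
    by (rule rtranclp_trans)
      (rule hsteps_ctx[where K="\<lambda>x. Pi x (Tot b)" and K'="\<lambda>x. Pi x (Tot (?u b))"]
        hsteps_bctx[OF cs, where K="\<lambda>x. Pi a' (Tot x)" and K'="\<lambda>x. Pi (shift a') (Tot x)"]; simp add: u)+
  show "hsteps S X a a' \<Longrightarrow> hsteps S (fz X) b b' \<Longrightarrow> hsteps S (fz X) d d' \<Longrightarrow>
      hsteps S X (Pi a (Cmp M b d)) (Pi a' (Cmp M b' d'))"
    by (rule rtranclp_trans, rule rtranclp_trans)
      (rule hsteps_ctx[where K="\<lambda>x. Pi x (Cmp M b d)" and K'="\<lambda>x. Pi x (Cmp M (?u b) (?u d))"]
        hsteps_bctx[OF cs, where K="\<lambda>x. Pi a' (Cmp M x d)" and K'="\<lambda>x. Pi (shift a') (Cmp M x (?u d))"]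
        hsteps_bctx[OF cs, where K="\<lambda>x. Pi a' (Cmp M b' x)" and K'="\<lambda>x. Pi (shift a') (Cmp M (?u b') x)"]; simp add: u)+
  show "hsteps S (fz X) t t' \<Longrightarrow> hsteps S X e e' \<Longrightarrow> hsteps S (fz X) e1 e1' \<Longrightarrow> hsteps S (fz X) e2 e2' \<Longrightarrow>
      hsteps S X (Case t e e1 e2) (Case t' e' e1' e2')"
    by (rule rtranclp_trans, rule rtranclp_trans, rule rtranclp_trans)
      (rule hsteps_bctx[OF cs, where K="\<lambda>x. Case x e e1 e2" and K'="\<lambda>x. Case x (shift e) (?u e1) (?u e2)"]
        hsteps_ctx[where K="\<lambda>x. Case t' x e1 e2" and K'="\<lambda>x. Case (?u t') x (?u e1) (?u e2)"]
        hsteps_bctx[OF cs, where K="\<lambda>x. Case t' e' x e2" and K'="\<lambda>x. Case (?u t') (shift e') x (?u e2)"]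
        hsteps_bctx[OF cs, where K="\<lambda>x. Case t' e' e1' x" and K'="\<lambda>x. Case (?u t') (shift e') (?u e1') x"]; simp add: u)+
  show "hsteps S X t1 t1' \<Longrightarrow> hsteps S X t2 t2' \<Longrightarrow> hsteps S X wp1 wp1' \<Longrightarrow> hsteps S X a1 a1' \<Longrightarrow>
      hsteps S X wp2 wp2' \<Longrightarrow> hsteps S (fz X) a2 a2' \<Longrightarrow>
      hsteps S X (Bind M t1 t2 wp1 a1 wp2 a2) (Bind M t1' t2' wp1' a1' wp2' a2')"
    by (rule rtranclp_trans, rule rtranclp_trans, rule rtranclp_trans, rule rtranclp_trans, rule rtranclp_trans)
      (rule
        hsteps_ctx[where K="\<lambda>x. Bind M x t2 wp1 a1 wp2 a2" and K'="\<lambda>x. Bind M x (shift t2) (shift wp1) (shift a1) (shift wp2) (?u a2)"]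
        hsteps_ctx[where K="\<lambda>x. Bind M t1' x wp1 a1 wp2 a2" and K'="\<lambda>x. Bind M (shift t1') x (shift wp1) (shift a1) (shift wp2) (?u a2)"]
        hsteps_ctx[where K="\<lambda>x. Bind M t1' t2' x a1 wp2 a2" and K'="\<lambda>x. Bind M (shift t1') (shift t2') x (shift a1) (shift wp2) (?u a2)"]
        hsteps_ctx[where K="\<lambda>x. Bind M t1' t2' wp1' x wp2 a2" and K'="\<lambda>x. Bind M (shift t1') (shift t2') (shift wp1') x (shift wp2) (?u a2)"]
        hsteps_ctx[where K="\<lambda>x. Bind M t1' t2' wp1' a1' x a2" and K'="\<lambda>x. Bind M (shift t1') (shift t2') (shift wp1') (shift a1') x (?u a2)"]
        hsteps_bctx[OF cs, where K="\<lambda>x. Bind M t1' t2' wp1' a1' wp2' x" and K'="\<lambda>x. Bind M (shift t1') (shift t2') (shift wp1') (shift a1') (shift wp2') x"]; simp add: u)+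
qed

lemma hsteps_mono: "hsteps S Y t t' \<Longrightarrow> X \<subseteq> Y \<Longrightarrow> hsteps S X t t'"
  by (erule rtranclp_mono[THEN predicate2D, rotated]) (fastforce simp: hstep_def)

text \<open>Parallel reduction reaches positions closed to \<open>red\<close>, yet yields nothing
  beyond \<open>conv\<close>. A term contracted at its root avoids \<open>X\<close> and counts as a
  single hole. A \<open>Lam\<close> or \<open>Case\<close> with unfrozen binder avoids
  \<open>X\<close> as a whole, so it too is one hole and \<open>conv_binder\<close> applies inside;
  if the binder is frozen it behaves like any other binder.\<close>

lemma pr_hsteps:
  assumes cs: "closed_sig S"
  shows "pr S X t t' \<Longrightarrow> hsteps S X t t'" "prn S X t t' \<Longrightarrow> hsteps S X t t'"
    "prc S X c c' \<Longrightarrow> (\<exists>b b'. c = Tot b \<and> c' = Tot b' \<and> hsteps S X b b') \<or>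
      (\<exists>M b d b' d'. c = Cmp M b d \<and> c' = Cmp M b' d' \<and> hsteps S X b b' \<and> hsteps S X d d')"
proof (induction rule: pr_prn_prc.inducts)
  case (pr_ctr X t m t')
  then have "fv t' \<inter> X = {}" using fv_pr(2)[OF cs, of X t m] fv_ctr[OF _ cs, of m t'] by blast
  moreover have "conv S t t'"
    using pr_ctr hsteps_conv ctr_red by (blast intro: conv_trans conv_red)
  ultimately show ?case using pr_ctr by (blast intro: conv_hsteps)
next
  case (prn_Lam X t t' e e')
  show ?case
  proof (cases "fv (Lam t e) \<inter> X = {}")
    case True
    have "hsteps S {} t t'" using prn_Lam.IH hsteps_mono by blast
    then have "conv S (Lam t e') (Lam t' e')"
      by (intro hsteps_conv[of S "{}"] hsteps_cong_binder(2)[OF cs]) simp_all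
    moreover have "conv S (Lam t e) (Lam t e')"
      using prn_Lam.IH by (intro conv_binder) (auto intro: hsteps_conv)
    moreover have "fv (Lam t' e') \<inter> X = {}"
      using True fv_pr(2)[OF cs, of X "Lam t e" "Lam t' e'"] prn_Lam pr_prn_prc.prn_Lam by blast
    ultimately show ?thesis using True by (blast intro: conv_hsteps conv_trans)
  next
    case False
    then show ?thesis using prn_Lam hsteps_cong_binder(2)[OF cs] by (simp add: bX_def)
  qed
next
  case (prn_Case X t t' e e' e1 e2 e1' e2')
  show ?case
  proof (cases "fv (Case t e e1 e2) \<inter> X = {}")
    case True
    have "hsteps S {} e e'" "hsteps S (fz {}) t t'"
      using prn_Case.IH hsteps_mono by (blast, meson fz_mono empty_subsetI hsteps_mono)
    then have "conv S (Case t e e1' e2') (Case t' e' e1' e2')"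
      by (intro hsteps_conv[of S "{}"] hsteps_cong_binder(3)[OF cs]) simp_all
    moreover have "conv S (Case t e e1 e2) (Case t e e1' e2)" "conv S (Case t e e1' e2) (Case t e e1' e2')"
      using prn_Case.IH by (auto intro: hsteps_conv conv_binder)
    moreover have "fv (Case t' e' e1' e2') \<inter> X = {}"
      using True fv_pr(2)[OF cs, of X "Case t e e1 e2" "Case t' e' e1' e2'"] prn_Case pr_prn_prc.prn_Case by blast
    ultimately show ?thesis using True by (blast intro: conv_hsteps conv_trans)
  next
    case False
    then show ?thesis using prn_Case hsteps_cong_binder(3)[OF cs] by (simp add: bX_def)
  qed
next
  case (prn_Pi X t t' c c')
  then show ?case using hsteps_cong_binder(5,6)[OF cs] by auto
next
  case (prn_Act X es es' F j)
  then show ?case by (auto intro!: hsteps_Act elim: list_all2_mono)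
next
  case (prn_Refine X t t' e e')
  then show ?case by (intro hsteps_cong_binder[OF cs])
next
  case (prn_Bind X t1 t1' t2 t2' wp1 wp1' e1 e1' wp2 wp2' e2 e2' M)
  then show ?case by (intro hsteps_cong_binder[OF cs])
qed (simp_all add: hsteps_cong)

lemma pr_conv: "closed_sig S \<Longrightarrow> pr S X t t' \<Longrightarrow> conv S t t'"
  using hsteps_conv pr_hsteps(1) by blast

section \<open>An equivalent type system\<close>

text \<open>
  Stripping refinements at the root makes the two refinement rules of subtyping invisible, so that
  subtyping between types other than products becomes joinability.
\<close>

inductive qstep :: "signature \<Rightarrow> tm \<Rightarrow> tm \<Rightarrow> bool" for S where
  qs_pr: "pr S {} t u \<Longrightarrow> qstep S t u"
| qs_strip: "qstep S (Refine t phi) t"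

abbreviation qs :: "signature \<Rightarrow> tm \<Rightarrow> tm \<Rightarrow> bool" where
  "qs S \<equiv> (qstep S)\<^sup>*\<^sup>*"

section \<open>Confluence of reduction with stripping of refinements\<close>

lemma diamond_confluent:
  assumes dia: "\<And>a b c. R a b \<Longrightarrow> R a c \<Longrightarrow> \<exists>d. R b d \<and> R c d" and "R\<^sup>*\<^sup>* a b" "R\<^sup>*\<^sup>* a c"
  shows "\<exists>d. R\<^sup>*\<^sup>* b d \<and> R\<^sup>*\<^sup>* c d"
proof -
  have strip: "\<exists>d. R\<^sup>*\<^sup>* b d \<and> R c d" if "R a b" "R\<^sup>*\<^sup>* a c" for a b c
    using that(2,1)
  proof (induction arbitrary: b rule: converse_rtranclp_induct)
    case base
    then show ?case by blast
  next
    case (step a a')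
    then obtain d where "R a' d" "R b d" using dia by blast
    with step.IH show ?case by (meson converse_rtranclp_into_rtranclp)
  qed
  show ?thesis
    using assms(2,3)
  proof (induction arbitrary: c rule: converse_rtranclp_induct)
    case base
    then show ?case by blast
  next
    case (step a a')
    then obtain d where "R\<^sup>*\<^sup>* a' d" "R c d" using strip by blast
    with step.IH show ?case by (meson converse_rtranclp_into_rtranclp)
  qed
qed

text \<open>Stripping commutes with a parallel step because a refinement is never contracted at its
  root, so its base reduces on its own. Two parallel steps are closed by the triangle
  property.\<close>

lemma qs_confluent:
  assumes "closed_sig S" "qs S a b" "qs S a c"
  shows "\<exists>d. qs S b d \<and> qs S c d"
proof (rule diamond_confluent[OF _ assms(2,3)])
  fix a b c
  assume "qstep S a b" "qstep S a c"
  then consider "pr S {} a b" "pr S {} a c"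
    | t phi where "a = Refine t phi" "b = t" "pr S {} a c"
    | t phi where "a = Refine t phi" "c = t" "pr S {} a b"
    | "b = c"
    by (auto elim!: qstep.cases)
  then show "\<exists>d. qstep S b d \<and> qstep S c d"
  proof cases
    case 1
    then show ?thesis using pr_triangle[OF assms(1), of "{}" a] qs_pr by blast
  next
    case 2
    then show ?thesis by (auto dest!: pr_headE(11) intro: qstep.intros)
  next
    case 3
    then show ?thesis by (auto dest!: pr_headE(11) intro: qstep.intros)
  next
    case 4
    then show ?thesis using qs_pr pr_refl by blast
  qed
qed

inductive convc :: "signature \<Rightarrow> comp \<Rightarrow> comp \<Rightarrow> bool" for S where
  "conv S t t' \<Longrightarrow> convc S (Tot t) (Tot t')"
| "conv S t t' \<Longrightarrow> conv S w w' \<Longrightarrow> convc S (Cmp M t w) (Cmp M t' w')"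

lemma convc_simps [simp]:
  "convc S (Tot t) c \<longleftrightarrow> (\<exists>t'. c = Tot t' \<and> conv S t t')"
  "convc S c (Tot t) \<longleftrightarrow> (\<exists>t'. c = Tot t' \<and> conv S t' t)"
  "convc S (Cmp M t w) c \<longleftrightarrow> (\<exists>t' w'. c = Cmp M t' w' \<and> conv S t t' \<and> conv S w w')"
  "convc S c (Cmp M t w) \<longleftrightarrow> (\<exists>t' w'. c = Cmp M t' w' \<and> conv S t' t \<and> conv S w' w)"
  by (auto simp: convc.simps)

lemma convc_refl [simp]: "convc S c c"
  by (cases c) auto

lemma convc_sym: "convc S c d \<Longrightarrow> convc S d c"
  by (induction rule: convc.induct) (auto intro: conv_sym)

lemma convc_trans: "convc S c d \<Longrightarrow> convc S d e \<Longrightarrow> convc S c e"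
  by (induction rule: convc.induct) (auto intro: conv_trans)

lemma prc_convc: "closed_sig S \<Longrightarrow> prc S X c d \<Longrightarrow> convc S c d"
  by (erule prc.cases) (auto intro: pr_conv)

text \<open>A product is neither stripped nor contracted at the root, so its shape is permanent.
  Together with the analogous facts for universes and type constants this keeps the type formers
  apart.\<close>

lemma qs_Pi:
  assumes "closed_sig S" "qs S (Pi t c) u"
  shows "\<exists>t' c'. u = Pi t' c' \<and> conv S t t' \<and> convc S c c'"
  using assms(2)
proof (induction rule: rtranclp_induct)
  case (step u v)
  then obtain t' c' where *: "u = Pi t' c'" "conv S t t'" "convc S c c'" by blast
  with step(2) obtain t'' c'' where "v = Pi t'' c''" "pr S {} t' t''" "prc S (fz {}) c' c''"
    by (auto elim!: qstep.cases dest!: pr_headE(10))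
  with * show ?case
    using pr_conv[OF assms(1)] prc_convc[OF assms(1)] conv_trans convc_trans by metis
qed simp

lemma qs_Universe: "qs S (Universe i) u \<Longrightarrow> u = Universe i"
  by (induction rule: rtranclp_induct) (auto elim!: qstep.cases dest!: pr_headE(8))

lemma qs_Const: "qs S (Const k) u \<Longrightarrow> u = Const k"
  by (induction rule: rtranclp_induct) (auto elim!: qstep.cases dest!: pr_headE(2))

lemma qs_const_App2:
  assumes "closed_sig S" "qs S (app2 (Const k) a b) u" "k \<noteq> CFst" "k \<noteq> CSnd"
  shows "\<exists>a' b'. u = app2 (Const k) a' b' \<and> conv S a a' \<and> conv S b b'"
  using assms(2)
proof (induction rule: rtranclp_induct)
  case (step u v)
  then obtain a' b' where *: "u = app2 (Const k) a' b'" "conv S a a'" "conv S b b'" by blast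
  with step(2) obtain a'' b'' where "v = app2 (Const k) a'' b''" "pr S {} a' a''" "pr S {} b' b''"
    using assms(3,4) by (auto elim!: qstep.cases dest!: pr_const_App2)
  with * show ?case using pr_conv[OF assms(1)] conv_trans by metis
qed simp

text \<open>
  Subtyping of codomains may be derived in a context extended by an ill-formed domain. No validity
  judgement is derivable there, so such a derivation uses only these context-free rules.
\<close>

inductive rs :: "signature \<Rightarrow> tm \<Rightarrow> tm \<Rightarrow> bool" and rsc :: "signature \<Rightarrow> comp \<Rightarrow> comp \<Rightarrow> bool" for S where
  rs_Refl: "rs S t t"
| rs_Trans: "rs S t1 t2 \<Longrightarrow> rs S t2 t3 \<Longrightarrow> rs S t1 t3"
| rs_Pi: "rs S t t' \<Longrightarrow> rsc S c' c \<Longrightarrow> rs S (Pi t' c') (Pi t c)"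
| rs_RefineL: "rs S (Refine t phi) t"
| rs_Conv: "conv S t t' \<Longrightarrow> rs S t t'"
| rsc_Refl: "rsc S c c"
| rsc_Trans: "rsc S c1 c2 \<Longrightarrow> rsc S c2 c3 \<Longrightarrow> rsc S c1 c3"
| rsc_Tot: "rs S t' t \<Longrightarrow> rsc S (Tot t') (Tot t)"
| rsc_User: "lookup_eff S F = Some D \<Longrightarrow>
    rs S (apps (repr D) [t', wp']) (apps (repr D) [t, wp]) \<Longrightarrow>
    rsc S (Cmp (User F) t' wp') (Cmp (User F) t wp)"

text \<open>
  A system equivalent to the one of the definitions: extended contexts are premises,
  the product rule of subtyping is split according to whether its extended context is well formed,
  \<open>S_Red\<close> and \<open>S_Exp\<close> become conversion, and \<open>t_CaseM\<close> requires its return type in \<open>Type0\<close>, which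
  regularity needs. That the last requirement loses nothing is the uniqueness of universes.
\<close>

inductive
  wctx :: "signature \<Rightarrow> ctx \<Rightarrow> bool" and
  ktyp :: "signature \<Rightarrow> ctx \<Rightarrow> const \<Rightarrow> tm \<Rightarrow> bool" and
  ty :: "signature \<Rightarrow> ctx \<Rightarrow> tm \<Rightarrow> comp \<Rightarrow> bool" and
  wcmp :: "signature \<Rightarrow> ctx \<Rightarrow> comp \<Rightarrow> nat \<Rightarrow> bool" and
  sbt :: "signature \<Rightarrow> ctx \<Rightarrow> tm \<Rightarrow> tm \<Rightarrow> bool" and
  sbc :: "signature \<Rightarrow> ctx \<Rightarrow> comp \<Rightarrow> comp \<Rightarrow> bool" and
  val :: "signature \<Rightarrow> ctx \<Rightarrow> tm \<Rightarrow> bool"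
  for S :: signature
where
  w_Nil: "wctx S []"
| w_Cons: "wctx S \<Gamma> \<Longrightarrow> ty S \<Gamma> t (Tot (Universe i)) \<Longrightarrow> wctx S (t # \<Gamma>)"

| k_UnitT: "wctx S \<Gamma> \<Longrightarrow> ktyp S \<Gamma> CUnitT (Universe 0)"
| k_Unit: "wctx S \<Gamma> \<Longrightarrow> ktyp S \<Gamma> CUnit unitT"
| k_Prod: "wctx S \<Gamma> \<Longrightarrow>
    ktyp S \<Gamma> CProd (arr (Universe i) (arr (Universe j) (Universe (max i j))))"
| k_Pair: "ty S \<Gamma> t1 (Tot (Universe i)) \<Longrightarrow> ty S \<Gamma> t2 (Tot (Universe j)) \<Longrightarrow>
    ktyp S \<Gamma> CPair (arr t1 (arr t2 (prodT t1 t2)))"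
| k_Fst: "ty S \<Gamma> t1 (Tot (Universe i)) \<Longrightarrow> ty S \<Gamma> t2 (Tot (Universe j)) \<Longrightarrow>
    ktyp S \<Gamma> CFst (arr (prodT t1 t2) t1)"
| k_Snd: "ty S \<Gamma> t1 (Tot (Universe i)) \<Longrightarrow> ty S \<Gamma> t2 (Tot (Universe j)) \<Longrightarrow>
    ktyp S \<Gamma> CSnd (arr (prodT t1 t2) t2)"
| k_Sum: "wctx S \<Gamma> \<Longrightarrow>
    ktyp S \<Gamma> CSum (arr (Universe i) (arr (Universe j) (Universe (max i j))))"
| k_Inl: "ty S \<Gamma> t1 (Tot (Universe i)) \<Longrightarrow> ty S \<Gamma> t2 (Tot (Universe j)) \<Longrightarrow>
    ktyp S \<Gamma> CInl (arr t1 (sumT t1 t2))"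
| k_Inr: "ty S \<Gamma> t1 (Tot (Universe i)) \<Longrightarrow> ty S \<Gamma> t2 (Tot (Universe j)) \<Longrightarrow>
    ktyp S \<Gamma> CInr (arr t2 (sumT t1 t2))"
| k_False: "wctx S \<Gamma> \<Longrightarrow> ktyp S \<Gamma> CFalse (Universe 0)"
| k_Eq: "wctx S \<Gamma> \<Longrightarrow>
    ktyp S \<Gamma> CEq (Pi (Universe i) (Tot (arr (Var 0) (arr (Var 0) (Universe 0)))))"
| k_Ex: "wctx S \<Gamma> \<Longrightarrow>
    ktyp S \<Gamma> CEx (Pi (Universe i) (Tot (arr (arr (Var 0) (Universe j)) (Universe 0))))"

| t_Var: "wctx S \<Gamma> \<Longrightarrow> k < length \<Gamma> \<Longrightarrow>
    ty S \<Gamma> (Var k) (Tot (ren (\<lambda>n. n + Suc k) (\<Gamma> ! k)))"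
| t_Const: "ktyp S \<Gamma> k t \<Longrightarrow> ty S \<Gamma> (Const k) (Tot t)"
| t_Universe: "wctx S \<Gamma> \<Longrightarrow> ty S \<Gamma> (Universe i) (Tot (Universe (Suc i)))"
| t_Refine: "ty S \<Gamma> t (Tot (Universe i)) \<Longrightarrow>
    ty S (t # \<Gamma>) phi (Tot (Universe j)) \<Longrightarrow>
    ty S \<Gamma> (Refine t phi) (Tot (Universe i))"
| t_Pi: "ty S \<Gamma> t (Tot (Universe i)) \<Longrightarrow> wcmp S (t # \<Gamma>) c j \<Longrightarrow>
    ty S \<Gamma> (Pi t c) (Tot (Universe (max i j)))"
| t_Lam: "ty S \<Gamma> t (Tot (Universe i)) \<Longrightarrow> ty S (t # \<Gamma>) e c \<Longrightarrow>
    ty S \<Gamma> (Lam t e) (Tot (Pi t c))"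
| t_App: "ty S \<Gamma> e1 (Tot (Pi t c)) \<Longrightarrow> ty S \<Gamma> e2 (Tot t) \<Longrightarrow>
    ty S \<Gamma> (App e1 e2) (csub1 e2 c)"
| t_Case: "ty S \<Gamma> e (Tot (sumT t1 t2)) \<Longrightarrow>
    wctx S (sumT t1 t2 # \<Gamma>) \<Longrightarrow> wctx S (t1 # \<Gamma>) \<Longrightarrow> wctx S (t2 # \<Gamma>) \<Longrightarrow>
    ty S (sumT t1 t2 # \<Gamma>) t (Tot (Universe i)) \<Longrightarrow>
    ty S (t1 # \<Gamma>) e1 (Tot (sub (via CInl) t)) \<Longrightarrow>
    ty S (t2 # \<Gamma>) e2 (Tot (sub (via CInr) t)) \<Longrightarrow>
    ty S \<Gamma> (Case t e e1 e2) (Tot (sub1 e t))"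
| t_CaseM: "ty S \<Gamma> e (Tot (sumT t1 t2)) \<Longrightarrow>
    wctx S (t1 # \<Gamma>) \<Longrightarrow> wctx S (t2 # \<Gamma>) \<Longrightarrow>
    ty S \<Gamma> t (Tot (Universe 0)) \<Longrightarrow>
    ty S (t1 # \<Gamma>) e1 (Cmp M (shift t) wp1) \<Longrightarrow>
    ty S (t2 # \<Gamma>) e2 (Cmp M (shift t) wp2) \<Longrightarrow>
    wp_type_of S M = Some W \<Longrightarrow>
    ty S \<Gamma> (Case (shift t) e e1 e2) (Cmp M t (Case (shift (App W t)) e wp1 wp2))"
| t_Ret: "ty S \<Gamma> t (Tot (Universe 0)) \<Longrightarrow> ty S \<Gamma> e (Tot t) \<Longrightarrow>
    ret_star_of S M = Some R \<Longrightarrow>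
    ty S \<Gamma> (Ret M t e) (Cmp M t (apps R [t, e]))"
| t_Bind: "ty S \<Gamma> t2 (Tot (Universe 0)) \<Longrightarrow>
    wp_type_of S M = Some W \<Longrightarrow> bind_star_of S M = Some B \<Longrightarrow>
    ty S \<Gamma> wp2 (Tot (arr t1 (App W t2))) \<Longrightarrow>
    ty S \<Gamma> e1 (Cmp M t1 wp1) \<Longrightarrow>
    wctx S (t1 # \<Gamma>) \<Longrightarrow>
    ty S (t1 # \<Gamma>) e2 (Cmp M (shift t2) (App (shift wp2) (Var 0))) \<Longrightarrow>
    ty S \<Gamma> (Bind M t1 t2 wp1 e1 wp2 e2) (Cmp M t2 (apps B [t1, t2, wp1, wp2]))"
| t_Lift: "ty S \<Gamma> e (Cmp (User F) t wp) \<Longrightarrow> lookup_lift S F F' = Some (l, w) \<Longrightarrow>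
    ty S \<Gamma> (Lift F F' t wp e) (Cmp (User F') t (apps w [t, wp]))"
| t_Act: "wctx S \<Gamma> \<Longrightarrow>
    lookup_eff S F = Some D \<Longrightarrow> j < length (actions D) \<Longrightarrow> A = actions D ! j \<Longrightarrow>
    length es = length (act_args A) \<Longrightarrow>
    (\<forall>i < length es. ty S \<Gamma> (es ! i) (Tot (sub (inst (take i es)) (act_args A ! i)))) \<Longrightarrow>
    ty S \<Gamma> (Act F j es) (csub (inst es) (Cmp (User F) (act_res A) (act_wp A)))"
| t_Reify: "ty S \<Gamma> e (Cmp (User F) t wp) \<Longrightarrow> lookup_eff S F = Some D \<Longrightarrow>
    ty S \<Gamma> (Reify e) (Tot (apps (repr D) [t, wp]))"
| t_Reflect: "ty S \<Gamma> e (Tot (apps (repr D) [t, wp])) \<Longrightarrow> lookup_eff S F = Some D \<Longrightarrow>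
    wcmp S \<Gamma> (Cmp (User F) t wp) i \<Longrightarrow>
    ty S \<Gamma> (Reflect e) (Cmp (User F) t wp)"
| t_Run: "ty S \<Gamma> e (Cmp Pure t wp) \<Longrightarrow>
    val S \<Gamma> (Exi (arr t (Universe 0)) (App (shift wp) (Var 0))) \<Longrightarrow>
    ty S \<Gamma> (Run e) (Tot t)"
| t_Sub: "ty S \<Gamma> e c' \<Longrightarrow> sbc S \<Gamma> c' c \<Longrightarrow> wcmp S \<Gamma> c i \<Longrightarrow> ty S \<Gamma> e c"

| c_Tot: "ty S \<Gamma> t (Tot (Universe i)) \<Longrightarrow> wcmp S \<Gamma> (Tot t) i"
| c_Pure: "ty S \<Gamma> t (Tot (Universe 0)) \<Longrightarrow>
    ty S \<Gamma> wp (Tot (arr (arr t (Universe 0)) (Universe 0))) \<Longrightarrow>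
    wcmp S \<Gamma> (Cmp Pure t wp) 0"
| c_User: "lookup_eff S F = Some D \<Longrightarrow>
    ty S \<Gamma> t (Tot (Universe 0)) \<Longrightarrow> ty S \<Gamma> wp (Tot (App (wp_type D) t)) \<Longrightarrow>
    ty S \<Gamma> (apps (repr D) [t, wp]) (Tot (Universe 0)) \<Longrightarrow>
    wcmp S \<Gamma> (Cmp (User F) t wp) 0"

| s_Refl: "sbt S \<Gamma> t t"
| s_Trans: "sbt S \<Gamma> t1 t2 \<Longrightarrow> sbt S \<Gamma> t2 t3 \<Longrightarrow> sbt S \<Gamma> t1 t3"
| s_Pi: "sbt S \<Gamma> t t' \<Longrightarrow> wctx S (t # \<Gamma>) \<Longrightarrow> sbc S (t # \<Gamma>) c' c \<Longrightarrow>
    sbt S \<Gamma> (Pi t' c') (Pi t c)"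
| s_PiRaw: "sbt S \<Gamma> t t' \<Longrightarrow> rsc S c' c \<Longrightarrow> sbt S \<Gamma> (Pi t' c') (Pi t c)"
| s_RefineL: "sbt S \<Gamma> (Refine t phi) t"
| s_RefineR: "wctx S (t # \<Gamma>) \<Longrightarrow> val S (t # \<Gamma>) phi \<Longrightarrow> sbt S \<Gamma> t (Refine t phi)"
| s_Conv: "conv S t t' \<Longrightarrow> sbt S \<Gamma> t t'"

| sc_Refl: "sbc S \<Gamma> c c"
| sc_Trans: "sbc S \<Gamma> c1 c2 \<Longrightarrow> sbc S \<Gamma> c2 c3 \<Longrightarrow> sbc S \<Gamma> c1 c3"
| sc_Tot: "sbt S \<Gamma> t' t \<Longrightarrow> sbc S \<Gamma> (Tot t') (Tot t)"
| sc_Pure: "sbt S \<Gamma> t' t \<Longrightarrow>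
    val S \<Gamma> (All (arr t (Universe 0))
      (Imp (App (shift wp) (Var 0)) (App (shift wp') (Var 0)))) \<Longrightarrow>
    sbc S \<Gamma> (Cmp Pure t' wp') (Cmp Pure t wp)"
| sc_User: "lookup_eff S F = Some D \<Longrightarrow>
    sbt S \<Gamma> (apps (repr D) [t', wp']) (apps (repr D) [t, wp]) \<Longrightarrow>
    sbc S \<Gamma> (Cmp (User F) t' wp') (Cmp (User F) t wp)"

| v_Hyp: "ty S \<Gamma> e (Tot phi) \<Longrightarrow> val S \<Gamma> phi"
| v_Refine: "ty S \<Gamma> e (Tot (Refine t phi)) \<Longrightarrow> val S \<Gamma> (sub1 e phi)"
| v_ConjI: "val S \<Gamma> p \<Longrightarrow> val S \<Gamma> q \<Longrightarrow> val S \<Gamma> (Conj p q)"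
| v_ConjE1: "val S \<Gamma> (Conj p q) \<Longrightarrow> val S \<Gamma> p"
| v_ConjE2: "val S \<Gamma> (Conj p q) \<Longrightarrow> val S \<Gamma> q"
| v_DisjI1: "val S \<Gamma> p \<Longrightarrow> ty S \<Gamma> q (Tot (Universe i)) \<Longrightarrow> val S \<Gamma> (Disj p q)"
| v_DisjI2: "val S \<Gamma> q \<Longrightarrow> ty S \<Gamma> p (Tot (Universe i)) \<Longrightarrow> val S \<Gamma> (Disj p q)"
| v_DisjE: "val S \<Gamma> (Disj p q) \<Longrightarrow> wctx S (p # \<Gamma>) \<Longrightarrow> wctx S (q # \<Gamma>) \<Longrightarrow>
    val S (p # \<Gamma>) (shift r) \<Longrightarrow>
    val S (q # \<Gamma>) (shift r) \<Longrightarrow> ty S \<Gamma> r (Tot (Universe i)) \<Longrightarrow> val S \<Gamma> r"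
| v_ImpI: "ty S \<Gamma> p (Tot (Universe i)) \<Longrightarrow> ty S \<Gamma> q (Tot (Universe j)) \<Longrightarrow>
    val S (p # \<Gamma>) (shift q) \<Longrightarrow> val S \<Gamma> (Imp p q)"
| v_ImpE: "val S \<Gamma> (Imp p q) \<Longrightarrow> val S \<Gamma> p \<Longrightarrow> val S \<Gamma> q"
| v_FalseE: "val S \<Gamma> Falsum \<Longrightarrow> ty S \<Gamma> phi (Tot (Universe i)) \<Longrightarrow> val S \<Gamma> phi"
| v_Classical: "wctx S (Neg phi # \<Gamma>) \<Longrightarrow> ty S \<Gamma> phi (Tot (Universe i)) \<Longrightarrow> val S (Neg phi # \<Gamma>) Falsum \<Longrightarrow>
    val S \<Gamma> phi"
| v_AllI: "ty S \<Gamma> t (Tot (Universe i)) \<Longrightarrow> val S (t # \<Gamma>) phi \<Longrightarrow> val S \<Gamma> (All t phi)"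
| v_AllE: "val S \<Gamma> (All t phi) \<Longrightarrow> ty S \<Gamma> e (Tot t) \<Longrightarrow> val S \<Gamma> (sub1 e phi)"
| v_ExI: "wctx S (t # \<Gamma>) \<Longrightarrow> ty S (t # \<Gamma>) phi (Tot (Universe i)) \<Longrightarrow> ty S \<Gamma> e (Tot t) \<Longrightarrow>
    val S \<Gamma> (sub1 e phi) \<Longrightarrow> val S \<Gamma> (Exi t phi)"
| v_ExE: "val S \<Gamma> (Exi t phi) \<Longrightarrow> wctx S (t # \<Gamma>) \<Longrightarrow> wctx S (phi # t # \<Gamma>) \<Longrightarrow>
    val S (phi # t # \<Gamma>) (shift (shift r)) \<Longrightarrow>
    ty S \<Gamma> r (Tot (Universe i)) \<Longrightarrow> val S \<Gamma> r"
| v_EqRefl: "ty S \<Gamma> e (Tot t) \<Longrightarrow> val S \<Gamma> (Eq t e e)"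
| v_EqSubst: "wctx S (t # \<Gamma>) \<Longrightarrow> ty S (t # \<Gamma>) phi (Tot (Universe i)) \<Longrightarrow> val S \<Gamma> (Eq t a b) \<Longrightarrow>
    val S \<Gamma> (sub1 a phi) \<Longrightarrow> val S \<Gamma> (sub1 b phi)"
| v_EqRed: "red S a b \<Longrightarrow> ty S \<Gamma> (sub1 a e) (Tot t) \<Longrightarrow> ty S \<Gamma> (sub1 b e) (Tot t) \<Longrightarrow>
    val S \<Gamma> (Eq t (sub1 a e) (sub1 b e))"
| v_EqExt: "ty S \<Gamma> f (Tot (Pi t (Tot u))) \<Longrightarrow> ty S \<Gamma> g (Tot (Pi t (Tot u))) \<Longrightarrow>
    val S \<Gamma> (All t (Eq u (App (shift f) (Var 0)) (App (shift g) (Var 0)))) \<Longrightarrow>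
    val S \<Gamma> (Eq (Pi t (Tot u)) f g)"
| v_SumCase: "ty S \<Gamma> e (Tot (sumT t1 t2)) \<Longrightarrow>
    wctx S (sumT t1 t2 # \<Gamma>) \<Longrightarrow> wctx S (t1 # \<Gamma>) \<Longrightarrow> wctx S (t2 # \<Gamma>) \<Longrightarrow>
    ty S (sumT t1 t2 # \<Gamma>) phi (Tot (Universe i)) \<Longrightarrow>
    val S (t1 # \<Gamma>) (sub (via CInl) phi) \<Longrightarrow>
    val S (t2 # \<Gamma>) (sub (via CInr) phi) \<Longrightarrow>
    val S \<Gamma> (sub1 e phi)"

lemma rs_sbt: "rs S t t' \<Longrightarrow> sbt S \<Gamma> t t'" "rsc S c c' \<Longrightarrow> sbc S \<Gamma> c c'"
  by (induction arbitrary: \<Gamma> and \<Gamma> rule: rs_rsc.inducts) (auto intro: s_Refl s_Trans s_PiRaw s_RefineL s_Conv sc_Refl sc_Trans sc_Tot sc_User)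

text \<open>Subtyping has rules without premises and so says nothing about its context; every other
  judgement guarantees a well-formed one.\<close>

lemma ty_wctx:
  "wctx S \<Gamma> \<Longrightarrow> True"
  "ktyp S \<Gamma> k t \<Longrightarrow> wctx S \<Gamma>"
  "ty S \<Gamma> e c \<Longrightarrow> wctx S \<Gamma>"
  "wcmp S \<Gamma> c i \<Longrightarrow> wctx S \<Gamma>"
  "sbt S \<Gamma> t t' \<Longrightarrow> True"
  "sbc S \<Gamma> c c' \<Longrightarrow> True"
  "val S \<Gamma> phi \<Longrightarrow> wctx S \<Gamma>"
  by (induction rule: wctx_ktyp_ty_wcmp_sbt_sbc_val.inducts) simp_all

section \<open>Substitution in derivations\<close>

lemma sub_ups_ups_shift [simp]:
  "sub (ups (ups s)) (ren (upr Suc) t) = ren (upr Suc) (sub (ups s) t)"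
  "csub (ups (ups s)) (cren (upr Suc) c) = cren (upr Suc) (csub (ups s) c)"
proof -
  have "ups (ups s) (upr Suc k) = ren (upr Suc) (ups s k)" for k
    by (cases k) simp_all
  then show "sub (ups (ups s)) (ren (upr Suc) t) = ren (upr Suc) (sub (ups s) t)"
    "csub (ups (ups s)) (cren (upr Suc) c) = cren (upr Suc) (csub (ups s) c)"
    by (simp_all add: sub_ren ren_sub)
qed

lemma unb_lessThan [simp]: "unb A \<subseteq> {..<n} \<longleftrightarrow> A \<subseteq> {..<Suc n}"
  by (auto simp: unb_def subset_iff less_Suc_eq_0_disj gr0_conv_Suc)
    (metis not0_implies_Suc)

lemma fv_pure_stars [simp]: "fv pure_wp_type = {}" "fv pure_ret_star = {}" "fv pure_bind_star = {}"
  by (auto simp: pure_wp_type_def pure_ret_star_def pure_bind_star_def unb_def numeral_eq_Suc)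

lemma fv_stars:
  assumes "closed_sig S"
  shows "wp_type_of S M = Some W \<Longrightarrow> fv W = {}" "ret_star_of S M = Some R \<Longrightarrow> fv R = {}"
    "bind_star_of S M = Some B \<Longrightarrow> fv B = {}"
  by (cases M; auto simp: closed_sigD[OF assms])+

lemma fv_sub1_bound: "fv t \<subseteq> {..<Suc n} \<Longrightarrow> fv a \<subseteq> {..<n} \<Longrightarrow> fv (sub1 a t) \<subseteq> {..<n}"
  using fv_sub1[of a t] by (simp add: subset_iff unb_def) blast

lemma cfv_sub1_bound: "cfv c \<subseteq> {..<Suc n} \<Longrightarrow> fv a \<subseteq> {..<n} \<Longrightarrow> cfv (csub1 a c) \<subseteq> {..<n}"
  by (cases c) (simp_all add: fv_sub1_bound)

lemma fv_inst_bound: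
  "fv t \<subseteq> {..<length es} \<Longrightarrow> (\<And>e. e \<in> set es \<Longrightarrow> fv e \<subseteq> A) \<Longrightarrow> fv (sub (inst es) t) \<subseteq> A"
  by (auto simp: fv_sub inst_def subset_iff) (metis length_rev nth_mem set_rev)

lemma fv_shift_bound [simp]: "fv (shift t) \<subseteq> {..<Suc n} \<longleftrightarrow> fv t \<subseteq> {..<n}"
  by (auto simp: fv_ren)

text \<open>The clause for contexts bounds each entry after shifting it to the whole context, which
  is the type that \<open>t_Var\<close> assigns.\<close>

lemma ty_closed:
  assumes cs: "closed_sig S"
  shows "wctx S \<Gamma> \<Longrightarrow> \<forall>k<length \<Gamma>. fv (ren (\<lambda>n. n + Suc k) (\<Gamma> ! k)) \<subseteq> {..<length \<Gamma>}"
    "ktyp S \<Gamma> k t \<Longrightarrow> fv t \<subseteq> {..<length \<Gamma>}"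
    "ty S \<Gamma> e c \<Longrightarrow> fv e \<subseteq> {..<length \<Gamma>} \<and> cfv c \<subseteq> {..<length \<Gamma>}"
    "wcmp S \<Gamma> c i \<Longrightarrow> cfv c \<subseteq> {..<length \<Gamma>}"
    "sbt S \<Gamma> t1 t2 \<Longrightarrow> True"
    "sbc S \<Gamma> c1 c2 \<Longrightarrow> True"
    "val S \<Gamma> phi \<Longrightarrow> True"
proof (induction rule: wctx_ktyp_ty_wcmp_sbt_sbc_val.inducts)
  case (w_Cons \<Gamma> t i)
  show ?case
  proof (intro allI impI)
    fix k assume k: "k < length (t # \<Gamma>)"
    show "fv (ren (\<lambda>n. n + Suc k) ((t # \<Gamma>) ! k)) \<subseteq> {..<length (t # \<Gamma>)}"
    proof (cases k)
      case 0
      then show ?thesis using w_Cons by (auto simp: fv_ren)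
    next
      case (Suc m)
      then have "fv (ren (\<lambda>n. n + Suc m) (\<Gamma> ! m)) \<subseteq> {..<length \<Gamma>}" using w_Cons k by simp
      with Suc show ?thesis by (force simp: fv_ren)
    qed
  qed
next
  case (t_App \<Gamma> e1 t c e2)
  then show ?case by (simp add: cfv_sub1_bound)
next
  case (t_Case \<Gamma> e t1 t2 t i e1 e2)
  then show ?case by (simp add: fv_sub1_bound)
next
  case (t_CaseM \<Gamma> e t1 t2 t M wp1 wp2 W e1 e2)
  then show ?case by (auto simp: fv_stars[OF cs] fv_ren)
next
  case (t_Act \<Gamma> F D j A es)
  then have es: "\<And>e. e \<in> set es \<Longrightarrow> fv e \<subseteq> {..<length \<Gamma>}"
    by (metis in_set_conv_nth)
  then have "fv (sub (inst es) (act_res A)) \<subseteq> {..<length \<Gamma>}"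
    "fv (sub (inst es) (act_wp A)) \<subseteq> {..<length \<Gamma>}"
    using t_Act closed_sigD(9,10)[OF cs, of F D j] by - (rule fv_inst_bound; simp)+
  with es show ?case by auto
next
  case (t_Bind \<Gamma> t2 M W B wp2 t1 e1 wp1 e2)
  then show ?case by (simp add: fv_stars[OF cs])
next
  case (t_Ret \<Gamma> t e M R)
  then show ?case by (simp add: fv_stars[OF cs])
qed (simp_all add: closed_sigD[OF cs])

lemma rs_sub:
  assumes cs: "closed_sig S"
  shows "rs S t t' \<Longrightarrow> rs S (sub s t) (sub s t')" "rsc S c c' \<Longrightarrow> rsc S (csub s c) (csub s c')"
proof (induction arbitrary: s and s rule: rs_rsc.inducts)
  case (rsc_User F D t' wp' t wp)
  then show ?case by (auto intro!: rs_rsc.rsc_User simp: sub_closed closed_sigD[OF cs])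
qed (auto intro: rs_rsc.intros conv_sub[OF cs])

text \<open>
  Extending a substitution under a binder renames its values, so the lemma is proved for an abstract
  class \<open>SS\<close>, to be instantiated by renamings first and by well-typed substitutions afterwards.
\<close>

lemma ty_subst_generic:
  assumes cs: "closed_sig S"
    and SSw: "\<And>\<Delta> s \<Gamma>. SS \<Delta> s \<Gamma> \<Longrightarrow> wctx S \<Delta>"
    and SSv: "\<And>\<Delta> s \<Gamma> k. SS \<Delta> s \<Gamma> \<Longrightarrow> k < length \<Gamma> \<Longrightarrow> ty S \<Delta> (s k) (Tot (sub s (ren (\<lambda>n. n + Suc k) (\<Gamma> ! k))))"
    and SSu: "\<And>\<Delta> s \<Gamma> t i. SS \<Delta> s \<Gamma> \<Longrightarrow> ty S \<Delta> (sub s t) (Tot (Universe i)) \<Longrightarrow> SS (sub s t # \<Delta>) (ups s) (t # \<Gamma>)"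
  shows "wctx S \<Gamma> \<Longrightarrow> \<Gamma> = t # \<Gamma>' \<Longrightarrow> SS \<Delta> s \<Gamma>' \<Longrightarrow>
      SS (sub s t # \<Delta>) (ups s) (t # \<Gamma>') \<and> wctx S (sub s t # \<Delta>)"
    "ktyp S \<Gamma> k t \<Longrightarrow> SS \<Delta> s \<Gamma> \<Longrightarrow> ktyp S \<Delta> k (sub s t)"
    "ty S \<Gamma> e c \<Longrightarrow> SS \<Delta> s \<Gamma> \<Longrightarrow> ty S \<Delta> (sub s e) (csub s c)"
    "wcmp S \<Gamma> c i \<Longrightarrow> SS \<Delta> s \<Gamma> \<Longrightarrow> wcmp S \<Delta> (csub s c) i"
    "sbt S \<Gamma> t1 t2 \<Longrightarrow> SS \<Delta> s \<Gamma> \<Longrightarrow> sbt S \<Delta> (sub s t1) (sub s t2)"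
    "sbc S \<Gamma> c1 c2 \<Longrightarrow> SS \<Delta> s \<Gamma> \<Longrightarrow> sbc S \<Delta> (csub s c1) (csub s c2)"
    "val S \<Gamma> phi \<Longrightarrow> SS \<Delta> s \<Gamma> \<Longrightarrow> val S \<Delta> (sub s phi)"
proof (induction arbitrary: t \<Gamma>' \<Delta> s and \<Delta> s and \<Delta> s and \<Delta> s and \<Delta> s and \<Delta> s and \<Delta> s rule: wctx_ktyp_ty_wcmp_sbt_sbc_val.inducts)
  case w_Nil
  then show ?case by simp
next
  \<comment> \<open>The clause for contexts serves the rules with a premise
    \<open>wctx S (t # \<Gamma>)\<close> but no premise typing \<open>t\<close>: the substitution is
    extended below the binder by induction on the derivation of that context. This is why the
    extended contexts were made premises.\<close>
  case w_Cons
  then show ?case using SSu SSw w_Cons by (metis list.inject wctx_ktyp_ty_wcmp_sbt_sbc_val.w_Cons sub.simps(2) csub.simps(1))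
next
  case (k_UnitT \<Gamma>)
  then show ?case using SSw by (simp) (rule wctx_ktyp_ty_wcmp_sbt_sbc_val.k_UnitT[simplified]; blast?)
next
  case (k_Unit \<Gamma>)
  then show ?case using SSw by (simp) (rule wctx_ktyp_ty_wcmp_sbt_sbc_val.k_Unit[simplified]; blast?)
next
  case (k_Prod \<Gamma>)
  then show ?case using SSw by (auto intro: wctx_ktyp_ty_wcmp_sbt_sbc_val.k_Prod[simplified])
next
  case k_Pair
  then show ?case by (simp add: sub_sub1 sub_closed closed_sigD[OF cs] fv_stars[OF cs]) (rule wctx_ktyp_ty_wcmp_sbt_sbc_val.k_Pair[simplified]; blast?)
next
  case k_Fst
  then show ?case by (simp add: sub_sub1 sub_closed closed_sigD[OF cs] fv_stars[OF cs]) (rule wctx_ktyp_ty_wcmp_sbt_sbc_val.k_Fst[simplified]; blast?)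
next
  case k_Snd
  then show ?case by (simp add: sub_sub1 sub_closed closed_sigD[OF cs] fv_stars[OF cs]) (rule wctx_ktyp_ty_wcmp_sbt_sbc_val.k_Snd[simplified]; blast?)
next
  case (k_Sum \<Gamma>)
  then show ?case using SSw by (auto intro: wctx_ktyp_ty_wcmp_sbt_sbc_val.k_Sum[simplified])
next
  case k_Inl
  then show ?case by (simp add: sub_sub1 sub_closed closed_sigD[OF cs] fv_stars[OF cs]) (rule wctx_ktyp_ty_wcmp_sbt_sbc_val.k_Inl[simplified]; blast?)
next
  case k_Inr
  then show ?case by (simp add: sub_sub1 sub_closed closed_sigD[OF cs] fv_stars[OF cs]) (rule wctx_ktyp_ty_wcmp_sbt_sbc_val.k_Inr[simplified]; blast?)
next
  case (k_False \<Gamma>)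
  then show ?case using SSw by (simp) (rule wctx_ktyp_ty_wcmp_sbt_sbc_val.k_False[simplified]; blast?)
next
  case (k_Eq \<Gamma>)
  then show ?case using SSw by (auto intro: wctx_ktyp_ty_wcmp_sbt_sbc_val.k_Eq[simplified])
next
  case (k_Ex \<Gamma>)
  then show ?case using SSw by (auto intro: wctx_ktyp_ty_wcmp_sbt_sbc_val.k_Ex[simplified])
next
  case t_Var
  then show ?case using SSv by simp
next
  case t_Const
  then show ?case by (simp add: sub_sub1 sub_closed closed_sigD[OF cs] fv_stars[OF cs]) (rule wctx_ktyp_ty_wcmp_sbt_sbc_val.t_Const[simplified]; blast?)
next
  case (t_Universe \<Gamma>)
  then show ?case using SSw by (simp) (rule wctx_ktyp_ty_wcmp_sbt_sbc_val.t_Universe[simplified]; blast?)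
next
  case (t_Refine \<Gamma> t i phi j)
  have "ty S \<Delta> (sub s t) (csub s (Tot (Universe i)))" using t_Refine by blast
  then have "SS (sub s t # \<Delta>) (ups s) (t # \<Gamma>)" using SSu[OF t_Refine.prems] by simp
  with t_Refine show ?case by (simp) (rule wctx_ktyp_ty_wcmp_sbt_sbc_val.t_Refine[simplified]; blast?)
next
  case (t_Pi \<Gamma> t i c j)
  have "ty S \<Delta> (sub s t) (csub s (Tot (Universe i)))" using t_Pi by blast
  then have "SS (sub s t # \<Delta>) (ups s) (t # \<Gamma>)" using SSu[OF t_Pi.prems] by simp
  with t_Pi show ?case by (simp) (rule wctx_ktyp_ty_wcmp_sbt_sbc_val.t_Pi[simplified]; blast?)
next
  case (t_Lam \<Gamma> t i e c)
  have "ty S \<Delta> (sub s t) (csub s (Tot (Universe i)))" using t_Lam by blast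
  then have "SS (sub s t # \<Delta>) (ups s) (t # \<Gamma>)" using SSu[OF t_Lam.prems] by simp
  with t_Lam show ?case by (simp) (rule wctx_ktyp_ty_wcmp_sbt_sbc_val.t_Lam[simplified]; blast?)
next
  case t_App
  then show ?case by (simp add: sub_sub1 sub_closed closed_sigD[OF cs] fv_stars[OF cs]) (rule wctx_ktyp_ty_wcmp_sbt_sbc_val.t_App[simplified]; blast?)
next
  case (t_Case \<Gamma> e t1 t2 t i e1 e2)
  have ss: "SS (sub s (sumT t1 t2) # \<Delta>) (ups s) (sumT t1 t2 # \<Gamma>)" "wctx S (sub s (sumT t1 t2) # \<Delta>)"
    "SS (sub s t1 # \<Delta>) (ups s) (t1 # \<Gamma>)" "wctx S (sub s t1 # \<Delta>)"
    "SS (sub s t2 # \<Delta>) (ups s) (t2 # \<Gamma>)" "wctx S (sub s t2 # \<Delta>)"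
    using t_Case.IH(4,6,8)[OF refl t_Case.prems] by auto
  show ?case
    using wctx_ktyp_ty_wcmp_sbt_sbc_val.t_Case[of S \<Delta> "sub s e" "sub s t1" "sub s t2" "sub (ups s) t" i "sub (ups s) e1" "sub (ups s) e2"]
      t_Case.IH(2)[OF t_Case.prems] t_Case.IH(10)[OF ss(1)] t_Case.IH(12)[OF ss(3)] t_Case.IH(14)[OF ss(5)] ss
    by (simp add: sub_sub1 sub_ups_via)
next
  case (t_CaseM \<Gamma> e t1 t2 t e1 M wp1 e2 wp2 W)
  have ss0: "SS (sub s (t1) # \<Delta>) (ups s) ((t1) # \<Gamma>)" "wctx S (sub s (t1) # \<Delta>)"
    using t_CaseM.IH(4)[OF refl t_CaseM.prems] by blast+
  have ss1: "SS (sub s (t2) # \<Delta>) (ups s) ((t2) # \<Gamma>)" "wctx S (sub s (t2) # \<Delta>)"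
    using t_CaseM.IH(6)[OF refl t_CaseM.prems] by blast+
  show ?case
    using wctx_ktyp_ty_wcmp_sbt_sbc_val.t_CaseM[of S \<Delta> "sub s e" "sub s t1" "sub s t2" "sub s t" "sub (ups s) e1" M "sub (ups s) wp1" "sub (ups s) e2" "sub (ups s) wp2" W]
      t_CaseM.IH(2)[OF t_CaseM.prems] t_CaseM.IH(8)[OF t_CaseM.prems] t_CaseM.IH(10)[OF ss0(1)] t_CaseM.IH(12)[OF ss1(1)] ss0(2) ss1(2) \<open>wp_type_of S M = Some W\<close>
    by (simp add: sub_sub1 sub_closed closed_sigD[OF cs] fv_stars[OF cs])
next
  case t_Ret
  then show ?case by (simp add: sub_sub1 sub_closed closed_sigD[OF cs] fv_stars[OF cs]) (metis wctx_ktyp_ty_wcmp_sbt_sbc_val.t_Ret[simplified])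
next
  case (t_Bind \<Gamma> t2 M W B wp2 t1 e1 wp1 e2)
  have ss0: "SS (sub s (t1) # \<Delta>) (ups s) ((t1) # \<Gamma>)" "wctx S (sub s (t1) # \<Delta>)"
    using t_Bind.IH(10)[OF refl t_Bind.prems] by blast+
  show ?case
    using wctx_ktyp_ty_wcmp_sbt_sbc_val.t_Bind[of S \<Delta> "sub s t2" M W B "sub s wp2" "sub s t1" "sub s e1" "sub s wp1" "sub (ups s) e2"]
      t_Bind.IH(2)[OF t_Bind.prems] t_Bind.IH(6)[OF t_Bind.prems] t_Bind.IH(8)[OF t_Bind.prems] t_Bind.IH(12)[OF ss0(1)] ss0(2) \<open>wp_type_of S M = Some W\<close> \<open>bind_star_of S M = Some B\<close>
    by (simp add: sub_sub1 sub_closed closed_sigD[OF cs] fv_stars[OF cs])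
next
  case t_Lift
  then show ?case by (simp add: sub_sub1 sub_closed closed_sigD[OF cs] fv_stars[OF cs]) (metis wctx_ktyp_ty_wcmp_sbt_sbc_val.t_Lift[simplified])
next
  case (t_Act \<Gamma> F D j A es)
  have "ty S \<Delta> (map (sub s) es ! i) (Tot (sub (inst (take i (map (sub s) es))) (act_args A ! i)))"
    if "i < length es" for i
  proof -
    \<comment> \<open>The type of an argument mentions only earlier arguments, all of which are
      instantiated; hence substituting into the instantiated type amounts to instantiating with the
      substituted arguments.\<close>
    have "fv (act_args A ! i) \<subseteq> {..<length (take i es)}"
      using closed_sigD(8)[OF cs, of F D j i] t_Act that by simp
    then have "sub s (sub (inst (take i es)) (act_args A ! i)) = sub (inst (take i (map (sub s) es))) (act_args A ! i)"
      by (simp add: sub_inst take_map)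
    moreover have "ty S \<Delta> (sub s (es ! i)) (csub s (Tot (sub (inst (take i es)) (act_args A ! i))))"
      using t_Act that by blast
    ultimately show ?thesis using that by simp
  qed
  moreover have "csub s (csub (inst es) (Cmp (User F) (act_res A) (act_wp A))) =
      csub (inst (map (sub s) es)) (Cmp (User F) (act_res A) (act_wp A))"
    using closed_sigD(9,10)[OF cs, of F D j] t_Act by (simp add: sub_inst)
  ultimately show ?case
    using SSw[OF t_Act.prems] \<open>lookup_eff S F = Some D\<close> \<open>j < length (actions D)\<close> \<open>A = actions D ! j\<close>
      \<open>length es = length (act_args A)\<close> wctx_ktyp_ty_wcmp_sbt_sbc_val.t_Act[of S \<Delta> F D j A "map (sub s) es"] by simp
next
  case t_Reify
  then show ?case by (simp add: sub_sub1 sub_closed closed_sigD[OF cs] fv_stars[OF cs]) (rule wctx_ktyp_ty_wcmp_sbt_sbc_val.t_Reify[simplified]; blast?)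
next
  case t_Reflect
  then show ?case by (simp add: sub_sub1 sub_closed closed_sigD[OF cs] fv_stars[OF cs]) (metis wctx_ktyp_ty_wcmp_sbt_sbc_val.t_Reflect[simplified])
next
  case t_Run
  then show ?case by (simp add: sub_sub1 sub_closed closed_sigD[OF cs] fv_stars[OF cs]) (rule wctx_ktyp_ty_wcmp_sbt_sbc_val.t_Run[simplified]; blast?)
next
  case t_Sub
  then show ?case by (blast intro: wctx_ktyp_ty_wcmp_sbt_sbc_val.t_Sub)
next
  case c_Tot
  then show ?case by (simp add: sub_sub1 sub_closed closed_sigD[OF cs] fv_stars[OF cs]) (rule wctx_ktyp_ty_wcmp_sbt_sbc_val.c_Tot[simplified]; blast?)
next
  case c_Pure
  then show ?case by (simp add: sub_sub1 sub_closed closed_sigD[OF cs] fv_stars[OF cs]) (rule wctx_ktyp_ty_wcmp_sbt_sbc_val.c_Pure[simplified]; blast?)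
next
  case c_User
  then show ?case by (simp add: sub_sub1 sub_closed closed_sigD[OF cs] fv_stars[OF cs]) (metis wctx_ktyp_ty_wcmp_sbt_sbc_val.c_User[simplified])
next
  case s_Refl
  show ?case by (rule wctx_ktyp_ty_wcmp_sbt_sbc_val.s_Refl)
next
  case s_Trans
  then show ?case by (blast intro: wctx_ktyp_ty_wcmp_sbt_sbc_val.s_Trans)
next
  case (s_Pi \<Gamma> t t' c' c)
  have ss0: "SS (sub s (t) # \<Delta>) (ups s) ((t) # \<Gamma>)" "wctx S (sub s (t) # \<Delta>)"
    using s_Pi.IH(4)[OF refl s_Pi.prems] by blast+
  show ?case
    using wctx_ktyp_ty_wcmp_sbt_sbc_val.s_Pi[of S \<Delta> "sub s t" "sub s t'" "csub (ups s) c'" "csub (ups s) c"]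
      s_Pi.IH(2)[OF s_Pi.prems] s_Pi.IH(6)[OF ss0(1)] ss0(2)
    by (simp add: sub_sub1 sub_closed closed_sigD[OF cs] fv_stars[OF cs])
next
  case s_PiRaw
  then show ?case using rs_sub[OF cs] by (simp) (rule wctx_ktyp_ty_wcmp_sbt_sbc_val.s_PiRaw[simplified]; blast?)
next
  case s_RefineL
  then show ?case by (simp add: sub_sub1 sub_closed closed_sigD[OF cs] fv_stars[OF cs]) (rule wctx_ktyp_ty_wcmp_sbt_sbc_val.s_RefineL[simplified]; blast?)
next
  case (s_RefineR t \<Gamma> phi)
  have ss0: "SS (sub s (t) # \<Delta>) (ups s) ((t) # \<Gamma>)" "wctx S (sub s (t) # \<Delta>)"
    using s_RefineR.IH(2)[OF refl s_RefineR.prems] by blast+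
  show ?case
    using wctx_ktyp_ty_wcmp_sbt_sbc_val.s_RefineR[of S "sub s t" \<Delta> "sub (ups s) phi"]
      s_RefineR.IH(4)[OF ss0(1)] ss0(2)
    by (simp add: sub_sub1 sub_closed closed_sigD[OF cs] fv_stars[OF cs])
next
  case s_Conv
  then show ?case by (blast intro: wctx_ktyp_ty_wcmp_sbt_sbc_val.s_Conv conv_sub[OF cs])
next
  case sc_Refl
  show ?case by (rule wctx_ktyp_ty_wcmp_sbt_sbc_val.sc_Refl)
next
  case sc_Trans
  then show ?case by (blast intro: wctx_ktyp_ty_wcmp_sbt_sbc_val.sc_Trans)
next
  case sc_Tot
  then show ?case by (simp add: sub_sub1 sub_closed closed_sigD[OF cs] fv_stars[OF cs]) (rule wctx_ktyp_ty_wcmp_sbt_sbc_val.sc_Tot[simplified]; blast?)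
next
  case sc_Pure
  then show ?case by (simp add: sub_sub1 sub_closed closed_sigD[OF cs] fv_stars[OF cs]) (rule wctx_ktyp_ty_wcmp_sbt_sbc_val.sc_Pure[simplified]; blast?)
next
  case sc_User
  then show ?case by (simp add: sub_sub1 sub_closed closed_sigD[OF cs] fv_stars[OF cs]) (metis wctx_ktyp_ty_wcmp_sbt_sbc_val.sc_User[simplified])
next
  case v_Hyp
  then show ?case by (simp add: sub_sub1 sub_closed closed_sigD[OF cs] fv_stars[OF cs]) (rule wctx_ktyp_ty_wcmp_sbt_sbc_val.v_Hyp[simplified]; blast?)
next
  case (v_Refine \<Gamma> e t phi)
  then show ?case using wctx_ktyp_ty_wcmp_sbt_sbc_val.v_Refine[of S \<Delta> "sub s e" "sub s t" "sub (ups s) phi"] by (simp add: sub_sub1)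
next
  case v_ConjI
  then show ?case by (simp add: sub_sub1 sub_closed closed_sigD[OF cs] fv_stars[OF cs]) (rule wctx_ktyp_ty_wcmp_sbt_sbc_val.v_ConjI[simplified]; blast?)
next
  case v_ConjE1
  then show ?case by (simp add: sub_sub1 sub_closed closed_sigD[OF cs] fv_stars[OF cs]) (rule wctx_ktyp_ty_wcmp_sbt_sbc_val.v_ConjE1[simplified]; blast?)
next
  case v_ConjE2
  then show ?case by (simp add: sub_sub1 sub_closed closed_sigD[OF cs] fv_stars[OF cs]) (rule wctx_ktyp_ty_wcmp_sbt_sbc_val.v_ConjE2[simplified]; blast?)
next
  case v_DisjI1
  then show ?case by (simp add: sub_sub1 sub_closed closed_sigD[OF cs] fv_stars[OF cs]) (rule wctx_ktyp_ty_wcmp_sbt_sbc_val.v_DisjI1[simplified]; blast?)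
next
  case v_DisjI2
  then show ?case by (simp add: sub_sub1 sub_closed closed_sigD[OF cs] fv_stars[OF cs]) (rule wctx_ktyp_ty_wcmp_sbt_sbc_val.v_DisjI2[simplified]; blast?)
next
  case (v_DisjE \<Gamma> p q r i)
  have ss0: "SS (sub s (p) # \<Delta>) (ups s) ((p) # \<Gamma>)" "wctx S (sub s (p) # \<Delta>)"
    using v_DisjE.IH(4)[OF refl v_DisjE.prems] by blast+
  have ss1: "SS (sub s (q) # \<Delta>) (ups s) ((q) # \<Gamma>)" "wctx S (sub s (q) # \<Delta>)"
    using v_DisjE.IH(6)[OF refl v_DisjE.prems] by blast+
  show ?case
    using wctx_ktyp_ty_wcmp_sbt_sbc_val.v_DisjE[of S \<Delta> "sub s p" "sub s q" "sub s r" i]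
      v_DisjE.IH(2)[OF v_DisjE.prems] v_DisjE.IH(8)[OF ss0(1)] v_DisjE.IH(10)[OF ss1(1)] v_DisjE.IH(12)[OF v_DisjE.prems] ss0(2) ss1(2)
    by (simp add: sub_sub1 sub_closed closed_sigD[OF cs] fv_stars[OF cs])
next
  case (v_ImpI \<Gamma> p i q j)
  have "SS (sub s p # \<Delta>) (ups s) (p # \<Gamma>)"
    using SSu[OF v_ImpI.prems] v_ImpI.IH(2)[OF v_ImpI.prems] by simp
  then show ?case
    using wctx_ktyp_ty_wcmp_sbt_sbc_val.v_ImpI[of S \<Delta> "sub s p" i "sub s q" j]
      v_ImpI.IH(2,4)[OF v_ImpI.prems] v_ImpI.IH(6) by fastforce
next
  case v_ImpE
  then show ?case by (simp add: sub_sub1 sub_closed closed_sigD[OF cs] fv_stars[OF cs]) (rule wctx_ktyp_ty_wcmp_sbt_sbc_val.v_ImpE[simplified]; blast?)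
next
  case v_FalseE
  then show ?case by (simp add: sub_sub1 sub_closed closed_sigD[OF cs] fv_stars[OF cs]) (rule wctx_ktyp_ty_wcmp_sbt_sbc_val.v_FalseE[simplified]; blast?)
next
  case (v_Classical phi \<Gamma> i)
  have ss0: "SS (sub s (Neg phi) # \<Delta>) (ups s) ((Neg phi) # \<Gamma>)" "wctx S (sub s (Neg phi) # \<Delta>)"
    using v_Classical.IH(2)[OF refl v_Classical.prems] by blast+
  show ?case
    using wctx_ktyp_ty_wcmp_sbt_sbc_val.v_Classical[of S "sub s phi" \<Delta> i]
      v_Classical.IH(4)[OF v_Classical.prems] v_Classical.IH(6)[OF ss0(1)] ss0(2)
    by (simp add: sub_sub1 sub_closed closed_sigD[OF cs] fv_stars[OF cs])
next
  case (v_AllI \<Gamma> t i phi)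
  have "ty S \<Delta> (sub s t) (csub s (Tot (Universe i)))" using v_AllI by blast
  then have "SS (sub s t # \<Delta>) (ups s) (t # \<Gamma>)" using SSu[OF v_AllI.prems] by simp
  with v_AllI show ?case by (simp) (rule wctx_ktyp_ty_wcmp_sbt_sbc_val.v_AllI[simplified]; blast?)
next
  case (v_AllE \<Gamma> t phi e)
  then show ?case using wctx_ktyp_ty_wcmp_sbt_sbc_val.v_AllE[of S \<Delta> "sub s t" "sub (ups s) phi" "sub s e"] by (simp add: sub_sub1)
next
  case (v_ExI t \<Gamma> phi i e)
  have ss0: "SS (sub s (t) # \<Delta>) (ups s) ((t) # \<Gamma>)" "wctx S (sub s (t) # \<Delta>)"
    using v_ExI.IH(2)[OF refl v_ExI.prems] by blast+
  show ?case
    using wctx_ktyp_ty_wcmp_sbt_sbc_val.v_ExI[of S "sub s t" \<Delta> "sub (ups s) phi" i "sub s e"]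
      v_ExI.IH(4)[OF ss0(1)] v_ExI.IH(6)[OF v_ExI.prems] v_ExI.IH(8)[OF v_ExI.prems] ss0(2)
    by (simp add: sub_sub1 sub_closed closed_sigD[OF cs] fv_stars[OF cs])
next
  case (v_ExE \<Gamma> t phi r i)
  have ss0: "SS (sub s t # \<Delta>) (ups s) (t # \<Gamma>)" "wctx S (sub s t # \<Delta>)"
    using v_ExE.IH(4)[OF refl v_ExE.prems] by blast+
  have ss1: "SS (sub (ups s) phi # sub s t # \<Delta>) (ups (ups s)) (phi # t # \<Gamma>)"
    "wctx S (sub (ups s) phi # sub s t # \<Delta>)" using v_ExE.IH(6)[OF refl ss0(1)] by blast+
  show ?case
    using wctx_ktyp_ty_wcmp_sbt_sbc_val.v_ExE[of S \<Delta> "sub s t" "sub (ups s) phi" "sub s r" i]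
      v_ExE.IH(2,10)[OF v_ExE.prems] v_ExE.IH(8)[OF ss1(1)] ss0(2) ss1(2)
    by simp
next
  case v_EqRefl
  then show ?case by (simp add: sub_sub1 sub_closed closed_sigD[OF cs] fv_stars[OF cs]) (rule wctx_ktyp_ty_wcmp_sbt_sbc_val.v_EqRefl[simplified]; blast?)
next
  case (v_EqSubst t \<Gamma> phi i a b)
  have ss0: "SS (sub s (t) # \<Delta>) (ups s) ((t) # \<Gamma>)" "wctx S (sub s (t) # \<Delta>)"
    using v_EqSubst.IH(2)[OF refl v_EqSubst.prems] by blast+
  show ?case
    using wctx_ktyp_ty_wcmp_sbt_sbc_val.v_EqSubst[of S "sub s t" \<Delta> "sub (ups s) phi" i "sub s a" "sub s b"]
      v_EqSubst.IH(4)[OF ss0(1)] v_EqSubst.IH(6)[OF v_EqSubst.prems] v_EqSubst.IH(8)[OF v_EqSubst.prems] ss0(2)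
    by (simp add: sub_sub1 sub_closed closed_sigD[OF cs] fv_stars[OF cs])
next
  case (v_EqRed a b \<Gamma> e t)
  then show ?case
    using wctx_ktyp_ty_wcmp_sbt_sbc_val.v_EqRed[of S "sub s a" "sub s b" \<Delta> "sub (ups s) e" "sub s t"] red_sub[OF cs \<open>red S a b\<close>, of s]
    by (simp add: sub_sub1)
next
  case (v_EqExt \<Gamma> f t u g)
  then show ?case by simp (rule wctx_ktyp_ty_wcmp_sbt_sbc_val.v_EqExt[simplified]; blast?)
next
  case (v_SumCase \<Gamma> e t1 t2 phi i)
  have ss0: "SS (sub s (sumT t1 t2) # \<Delta>) (ups s) ((sumT t1 t2) # \<Gamma>)" "wctx S (sub s (sumT t1 t2) # \<Delta>)"
    using v_SumCase.IH(4)[OF refl v_SumCase.prems] by blast+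
  have ss1: "SS (sub s (t1) # \<Delta>) (ups s) ((t1) # \<Gamma>)" "wctx S (sub s (t1) # \<Delta>)"
    using v_SumCase.IH(6)[OF refl v_SumCase.prems] by blast+
  have ss2: "SS (sub s (t2) # \<Delta>) (ups s) ((t2) # \<Gamma>)" "wctx S (sub s (t2) # \<Delta>)"
    using v_SumCase.IH(8)[OF refl v_SumCase.prems] by blast+
  show ?case
    using wctx_ktyp_ty_wcmp_sbt_sbc_val.v_SumCase[of S \<Delta> "sub s e" "sub s t1" "sub s t2" "sub (ups s) phi" i]
      v_SumCase.IH(2)[OF v_SumCase.prems] v_SumCase.IH(10)[OF ss0(1)] v_SumCase.IH(12)[OF ss1(1)] v_SumCase.IH(14)[OF ss2(1)] ss0(2) ss1(2) ss2(2)
    by (simp add: sub_sub1 sub_ups_via)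
qed

section \<open>Well-typed renamings and substitutions, weakening and narrowing\<close>

abbreviation at :: "ctx \<Rightarrow> nat \<Rightarrow> tm" where
  "at \<Gamma> k \<equiv> ren (\<lambda>n. n + Suc k) (\<Gamma> ! k)"

definition rtyp :: "signature \<Rightarrow> ctx \<Rightarrow> (nat \<Rightarrow> nat) \<Rightarrow> ctx \<Rightarrow> bool" where
  "rtyp S \<Delta> r \<Gamma> \<longleftrightarrow> wctx S \<Delta> \<and> (\<forall>k < length \<Gamma>. r k < length \<Delta> \<and> at \<Delta> (r k) = ren r (at \<Gamma> k))"

definition styp :: "signature \<Rightarrow> ctx \<Rightarrow> (nat \<Rightarrow> tm) \<Rightarrow> ctx \<Rightarrow> bool" where
  "styp S \<Delta> s \<Gamma> \<longleftrightarrow> wctx S \<Delta> \<and> (\<forall>k < length \<Gamma>. ty S \<Delta> (s k) (Tot (sub s (at \<Gamma> k))))"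

lemma at_simps [simp]: "at (t # \<Gamma>) 0 = shift t" "at (t # \<Gamma>) (Suc k) = shift (at \<Gamma> k)"
  by (simp_all add: ren_ren)

lemma rtyp_upr:
  assumes "rtyp S \<Delta> r \<Gamma>" "ty S \<Delta> (ren r t) (Tot (Universe i))"
  shows "rtyp S (ren r t # \<Delta>) (upr r) (t # \<Gamma>)"
  unfolding rtyp_def
proof (intro conjI allI impI)
  show "wctx S (ren r t # \<Delta>)" using assms by (auto intro: w_Cons simp: rtyp_def)
  fix k assume k: "k < length (t # \<Gamma>)"
  show "upr r k < length (ren r t # \<Delta>)" using assms(1) k by (cases k) (auto simp: rtyp_def)
  show "at (ren r t # \<Delta>) (upr r k) = ren (upr r) (at (t # \<Gamma>) k)"
  proof (cases k)
    case 0
    then show ?thesis by (simp only: upr_simps at_simps ren_upr_shift)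
  next
    case (Suc m)
    then have "at \<Delta> (r m) = ren r (at \<Gamma> m)" using assms(1) k by (simp add: rtyp_def)
    with Suc show ?thesis by (simp only: upr_simps at_simps ren_upr_shift)
  qed
qed

lemma ty_ren:
  assumes cs: "closed_sig S"
  shows "ty S \<Gamma> e c \<Longrightarrow> rtyp S \<Delta> r \<Gamma> \<Longrightarrow> ty S \<Delta> (ren r e) (cren r c)"
    "wcmp S \<Gamma> c i \<Longrightarrow> rtyp S \<Delta> r \<Gamma> \<Longrightarrow> wcmp S \<Delta> (cren r c) i"
    "sbt S \<Gamma> t1 t2 \<Longrightarrow> rtyp S \<Delta> r \<Gamma> \<Longrightarrow> sbt S \<Delta> (ren r t1) (ren r t2)"
    "sbc S \<Gamma> c1 c2 \<Longrightarrow> rtyp S \<Delta> r \<Gamma> \<Longrightarrow> sbc S \<Delta> (cren r c1) (cren r c2)"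
    "val S \<Gamma> phi \<Longrightarrow> rtyp S \<Delta> r \<Gamma> \<Longrightarrow> val S \<Delta> (ren r phi)"
proof -
  define SS where "SS = (\<lambda>\<Delta> s \<Gamma>. \<exists>r. s = (\<lambda>k. Var (r k)) \<and> rtyp S \<Delta> r \<Gamma>)"
  have w: "SS \<Delta> s \<Gamma> \<Longrightarrow> wctx S \<Delta>" for \<Delta> s \<Gamma> by (auto simp: SS_def rtyp_def)
  have v: "ty S \<Delta> (s k) (Tot (sub s (at \<Gamma> k)))" if "SS \<Delta> s \<Gamma>" "k < length \<Gamma>" for \<Delta> s \<Gamma> k
  proof -
    from that obtain r where r: "s = (\<lambda>k. Var (r k))" "rtyp S \<Delta> r \<Gamma>" by (auto simp: SS_def)
    then have "sub s (at \<Gamma> k) = at \<Delta> (r k)"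
      using that(2) unfolding rtyp_def by (simp only: ren_eq_sub(1)[of r, symmetric])
    moreover have "ty S \<Delta> (Var (r k)) (Tot (at \<Delta> (r k)))"
      using r(2) that(2) unfolding rtyp_def by (intro t_Var) blast+
    ultimately show ?thesis using r(1) by (simp only:)
  qed
  have u: "SS (sub s t # \<Delta>) (ups s) (t # \<Gamma>)" if "SS \<Delta> s \<Gamma>" "ty S \<Delta> (sub s t) (Tot (Universe i))" for \<Delta> s \<Gamma> t i
  proof -
    from that(1) obtain r where r: "s = (\<lambda>k. Var (r k))" "rtyp S \<Delta> r \<Gamma>" by (auto simp: SS_def)
    then have "rtyp S (ren r t # \<Delta>) (upr r) (t # \<Gamma>)"
      using that(2) rtyp_upr[OF r(2)] unfolding r(1) ren_eq_sub(1)[symmetric] by blast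
    then show ?thesis unfolding SS_def r(1)
      by (auto simp: ups_Var_comp ren_eq_sub(1)[of r])
  qed
  have SS: "rtyp S \<Delta> r \<Gamma> \<Longrightarrow> SS \<Delta> (\<lambda>k. Var (r k)) \<Gamma>" by (auto simp: SS_def)
  show "ty S \<Gamma> e c \<Longrightarrow> rtyp S \<Delta> r \<Gamma> \<Longrightarrow> ty S \<Delta> (ren r e) (cren r c)"
    "wcmp S \<Gamma> c i \<Longrightarrow> rtyp S \<Delta> r \<Gamma> \<Longrightarrow> wcmp S \<Delta> (cren r c) i"
    "sbt S \<Gamma> t1 t2 \<Longrightarrow> rtyp S \<Delta> r \<Gamma> \<Longrightarrow> sbt S \<Delta> (ren r t1) (ren r t2)"
    "sbc S \<Gamma> c1 c2 \<Longrightarrow> rtyp S \<Delta> r \<Gamma> \<Longrightarrow> sbc S \<Delta> (cren r c1) (cren r c2)"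
    "val S \<Gamma> phi \<Longrightarrow> rtyp S \<Delta> r \<Gamma> \<Longrightarrow> val S \<Delta> (ren r phi)"
    unfolding ren_eq_sub
    by (rule ty_subst_generic(3)[where SS=SS] ty_subst_generic(4)[where SS=SS] ty_subst_generic(5)[where SS=SS]
        ty_subst_generic(6)[where SS=SS] ty_subst_generic(7)[where SS=SS],
        rule cs, erule w, erule (1) v, erule (1) u, assumption, erule SS)+
qed

lemma rtyp_Suc: "wctx S (t # \<Gamma>) \<Longrightarrow> rtyp S (t # \<Gamma>) Suc \<Gamma>"
  unfolding rtyp_def by (auto simp del: at_simps) (simp add: ren_ren)

lemma ty_shift:
  assumes "closed_sig S" "wctx S (t # \<Gamma>)"
  shows "ty S \<Gamma> e c \<Longrightarrow> ty S (t # \<Gamma>) (shift e) (cren Suc c)"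
    "wcmp S \<Gamma> c i \<Longrightarrow> wcmp S (t # \<Gamma>) (cren Suc c) i"
    "sbt S \<Gamma> t1 t2 \<Longrightarrow> sbt S (t # \<Gamma>) (shift t1) (shift t2)"
    "sbc S \<Gamma> c1 c2 \<Longrightarrow> sbc S (t # \<Gamma>) (cren Suc c1) (cren Suc c2)"
    "val S \<Gamma> phi \<Longrightarrow> val S (t # \<Gamma>) (shift phi)"
  using ty_ren[OF assms(1) _ rtyp_Suc[OF assms(2)]] by blast+

lemma styp_ups:
  assumes cs: "closed_sig S" and "styp S \<Delta> s \<Gamma>" "ty S \<Delta> (sub s t) (Tot (Universe i))"
  shows "styp S (sub s t # \<Delta>) (ups s) (t # \<Gamma>)"
  unfolding styp_def
proof (intro conjI allI impI)
  show w: "wctx S (sub s t # \<Delta>)" using assms by (auto intro: w_Cons simp: styp_def)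
  fix k assume k: "k < length (t # \<Gamma>)"
  show "ty S (sub s t # \<Delta>) (ups s k) (Tot (sub (ups s) (at (t # \<Gamma>) k)))"
  proof (cases k)
    case 0
    have "ty S (sub s t # \<Delta>) (Var 0) (Tot (at (sub s t # \<Delta>) 0))" using w by (intro t_Var) simp_all
    with 0 show ?thesis by (simp only: ups_simps at_simps sub_ups_shift)
  next
    case (Suc m)
    then have "ty S \<Delta> (s m) (Tot (sub s (at \<Gamma> m)))" using assms(2) k by (simp add: styp_def)
    from ty_shift(1)[OF cs w this] Suc show ?thesis by (simp only: ups_simps at_simps sub_ups_shift cren.simps)
  qed
qed

lemma ty_sub:
  assumes cs: "closed_sig S" and s: "styp S \<Delta> s \<Gamma>"
  shows "ty S \<Gamma> e c \<Longrightarrow> ty S \<Delta> (sub s e) (csub s c)"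
    "wcmp S \<Gamma> c i \<Longrightarrow> wcmp S \<Delta> (csub s c) i"
    "sbt S \<Gamma> t1 t2 \<Longrightarrow> sbt S \<Delta> (sub s t1) (sub s t2)"
    "sbc S \<Gamma> c1 c2 \<Longrightarrow> sbc S \<Delta> (csub s c1) (csub s c2)"
    "val S \<Gamma> phi \<Longrightarrow> val S \<Delta> (sub s phi)"
proof -
  have w: "styp S \<Delta> s \<Gamma> \<Longrightarrow> wctx S \<Delta>" for \<Delta> s \<Gamma> by (auto simp: styp_def)
  have v: "styp S \<Delta> s \<Gamma> \<Longrightarrow> k < length \<Gamma> \<Longrightarrow> ty S \<Delta> (s k) (Tot (sub s (at \<Gamma> k)))" for \<Delta> s \<Gamma> k
    by (auto simp: styp_def)
  show "ty S \<Gamma> e c \<Longrightarrow> ty S \<Delta> (sub s e) (csub s c)"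
    "wcmp S \<Gamma> c i \<Longrightarrow> wcmp S \<Delta> (csub s c) i"
    "sbt S \<Gamma> t1 t2 \<Longrightarrow> sbt S \<Delta> (sub s t1) (sub s t2)"
    "sbc S \<Gamma> c1 c2 \<Longrightarrow> sbc S \<Delta> (csub s c1) (csub s c2)"
    "val S \<Gamma> phi \<Longrightarrow> val S \<Delta> (sub s phi)"
    by (rule ty_subst_generic(3)[where SS="styp S"] ty_subst_generic(4)[where SS="styp S"]
        ty_subst_generic(5)[where SS="styp S"] ty_subst_generic(6)[where SS="styp S"]
        ty_subst_generic(7)[where SS="styp S"],
        rule cs, erule w, erule (1) v, erule (1) styp_ups[OF cs], assumption, rule s)+
qed

lemma wctx_ConsD: "wctx S (t # \<Gamma>) \<Longrightarrow> wctx S \<Gamma> \<and> (\<exists>i. ty S \<Gamma> t (Tot (Universe i)))"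
  by (erule wctx.cases) auto

lemma ty_Var_at: "wctx S \<Gamma> \<Longrightarrow> k < length \<Gamma> \<Longrightarrow> ty S \<Gamma> (Var k) (Tot (at \<Gamma> k))"
  by (rule t_Var)

lemma styp_inst1:
  assumes "ty S \<Gamma> a (Tot t)"
  shows "styp S \<Gamma> (inst [a]) (t # \<Gamma>)"
  unfolding styp_def
proof (intro conjI allI impI)
  show "wctx S \<Gamma>" using assms by (rule ty_wctx)
  fix k assume "k < length (t # \<Gamma>)"
  then show "ty S \<Gamma> (inst [a] k) (Tot (sub (inst [a]) (at (t # \<Gamma>) k)))"
    using assms ty_Var_at[OF ty_wctx(3)[OF assms]] by (cases k) (simp_all only: inst1_simps at_simps sub1_shift, simp)
qed

lemma ty_sub1:
  assumes "closed_sig S" "ty S \<Gamma> a (Tot t)"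
  shows "ty S (t # \<Gamma>) e c \<Longrightarrow> ty S \<Gamma> (sub1 a e) (csub1 a c)"
    "wcmp S (t # \<Gamma>) c i \<Longrightarrow> wcmp S \<Gamma> (csub1 a c) i"
    "sbt S (t # \<Gamma>) t1 t2 \<Longrightarrow> sbt S \<Gamma> (sub1 a t1) (sub1 a t2)"
    "sbc S (t # \<Gamma>) c1 c2 \<Longrightarrow> sbc S \<Gamma> (csub1 a c1) (csub1 a c2)"
    "val S (t # \<Gamma>) phi \<Longrightarrow> val S \<Gamma> (sub1 a phi)"
  using ty_sub[OF assms(1) styp_inst1[OF assms(2)]] by blast+

text \<open>Narrowing is the identity substitution, read as a substitution between the two contexts:
  index 0 obtains its former type by subsumption, all other variables keep theirs.\<close>

lemma styp_narrow:
  assumes cs: "closed_sig S" and "wctx S (t # \<Gamma>)" "wctx S (u # \<Gamma>)" "sbt S \<Gamma> u t"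
  shows "styp S (u # \<Gamma>) Var (t # \<Gamma>)"
  unfolding styp_def
proof (intro conjI allI impI)
  show "wctx S (u # \<Gamma>)" by fact
  obtain i where t: "ty S \<Gamma> t (Tot (Universe i))" using wctx_ConsD assms(2) by blast
  fix k assume k: "k < length (t # \<Gamma>)"
  have "ty S (u # \<Gamma>) (Var k) (Tot (at (u # \<Gamma>) k))" using k assms(3) by (intro t_Var) simp_all
  moreover have "ty S (u # \<Gamma>) (shift t) (Tot (Universe i))" using ty_shift(1)[OF cs assms(3) t] by simp
  ultimately show "ty S (u # \<Gamma>) (Var k) (Tot (sub Var (at (t # \<Gamma>) k)))"
    using ty_shift(3)[OF cs assms(3,4)]
    by (cases k) (auto simp only: at_simps sub_Var intro: t_Sub sc_Tot c_Tot)
qed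

lemma ty_narrow:
  assumes "closed_sig S" "wctx S (t # \<Gamma>)" "wctx S (u # \<Gamma>)" "sbt S \<Gamma> u t"
  shows "ty S (t # \<Gamma>) e c \<Longrightarrow> ty S (u # \<Gamma>) e c"
    "wcmp S (t # \<Gamma>) c i \<Longrightarrow> wcmp S (u # \<Gamma>) c i"
    "sbt S (t # \<Gamma>) t1 t2 \<Longrightarrow> sbt S (u # \<Gamma>) t1 t2"
    "sbc S (t # \<Gamma>) c1 c2 \<Longrightarrow> sbc S (u # \<Gamma>) c1 c2"
    "val S (t # \<Gamma>) phi \<Longrightarrow> val S (u # \<Gamma>) phi"
  using ty_sub[OF assms(1) styp_narrow[OF assms]] by simp_all

section \<open>Inversion of typing and subtyping\<close>

text \<open>The types that the rule of the head constructor assigns before any use of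
  \<open>t_Sub\<close>. With \<open>ty_gen\<close> it replaces rule inversion on \<open>ty\<close>,
  where \<open>t_Sub\<close> would match every term again.\<close>

fun gen :: "signature \<Rightarrow> ctx \<Rightarrow> tm \<Rightarrow> comp \<Rightarrow> bool" where
  "gen S \<Gamma> (Var k) c \<longleftrightarrow> k < length \<Gamma> \<and> c = Tot (at \<Gamma> k)"
| "gen S \<Gamma> (Universe i) c \<longleftrightarrow> c = Tot (Universe (Suc i))"
| "gen S \<Gamma> (Const k) c \<longleftrightarrow> (\<exists>t. ktyp S \<Gamma> k t \<and> c = Tot t)"
| "gen S \<Gamma> (Refine t phi) c \<longleftrightarrow>
    (\<exists>i j. ty S \<Gamma> t (Tot (Universe i)) \<and> ty S (t # \<Gamma>) phi (Tot (Universe j)) \<and> c = Tot (Universe i))"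
| "gen S \<Gamma> (Lam t e) c \<longleftrightarrow> (\<exists>i d. ty S \<Gamma> t (Tot (Universe i)) \<and> ty S (t # \<Gamma>) e d \<and> c = Tot (Pi t d))"
| "gen S \<Gamma> (Pi t d) c \<longleftrightarrow>
    (\<exists>i j. ty S \<Gamma> t (Tot (Universe i)) \<and> wcmp S (t # \<Gamma>) d j \<and> c = Tot (Universe (max i j)))"
| "gen S \<Gamma> (App f a) c \<longleftrightarrow> (\<exists>t d. ty S \<Gamma> f (Tot (Pi t d)) \<and> ty S \<Gamma> a (Tot t) \<and> c = csub1 a d)"
| "gen S \<Gamma> (Case t e e1 e2) c \<longleftrightarrow> (\<exists>t1 t2. ty S \<Gamma> e (Tot (sumT t1 t2)) \<and> wctx S (t1 # \<Gamma>) \<and> wctx S (t2 # \<Gamma>) \<and>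
    (wctx S (sumT t1 t2 # \<Gamma>) \<and> (\<exists>i. ty S (sumT t1 t2 # \<Gamma>) t (Tot (Universe i)) \<and>
        ty S (t1 # \<Gamma>) e1 (Tot (sub (via CInl) t)) \<and> ty S (t2 # \<Gamma>) e2 (Tot (sub (via CInr) t)) \<and>
        c = Tot (sub1 e t)) \<or>
     (\<exists>t0 M wp1 wp2 W. t = shift t0 \<and> ty S \<Gamma> t0 (Tot (Universe 0)) \<and>
        ty S (t1 # \<Gamma>) e1 (Cmp M t wp1) \<and> ty S (t2 # \<Gamma>) e2 (Cmp M t wp2) \<and>
        wp_type_of S M = Some W \<and> c = Cmp M t0 (Case (shift (App W t0)) e wp1 wp2))))"
| "gen S \<Gamma> (Run e) c \<longleftrightarrow> (\<exists>t wp. ty S \<Gamma> e (Cmp Pure t wp) \<and>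
    val S \<Gamma> (Exi (arr t (Universe 0)) (App (shift wp) (Var 0))) \<and> c = Tot t)"
| "gen S \<Gamma> (Reify e) c \<longleftrightarrow> (\<exists>F t wp D. ty S \<Gamma> e (Cmp (User F) t wp) \<and> lookup_eff S F = Some D \<and>
    c = Tot (apps (repr D) [t, wp]))"
| "gen S \<Gamma> (Reflect e) c \<longleftrightarrow> (\<exists>F t wp D i. ty S \<Gamma> e (Tot (apps (repr D) [t, wp])) \<and> lookup_eff S F = Some D \<and>
    wcmp S \<Gamma> (Cmp (User F) t wp) i \<and> c = Cmp (User F) t wp)"
| "gen S \<Gamma> (Lift F F' t wp e) c \<longleftrightarrow> (\<exists>l w. ty S \<Gamma> e (Cmp (User F) t wp) \<and> lookup_lift S F F' = Some (l, w) \<and>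
    c = Cmp (User F') t (apps w [t, wp]))"
| "gen S \<Gamma> (Act F j es) c \<longleftrightarrow> (\<exists>D A. lookup_eff S F = Some D \<and> j < length (actions D) \<and> A = actions D ! j \<and>
    length es = length (act_args A) \<and>
    (\<forall>i < length es. ty S \<Gamma> (es ! i) (Tot (sub (inst (take i es)) (act_args A ! i)))) \<and>
    c = csub (inst es) (Cmp (User F) (act_res A) (act_wp A)))"
| "gen S \<Gamma> (Ret M t e) c \<longleftrightarrow> (\<exists>R. ty S \<Gamma> t (Tot (Universe 0)) \<and> ty S \<Gamma> e (Tot t) \<and>
    ret_star_of S M = Some R \<and> c = Cmp M t (apps R [t, e]))"
| "gen S \<Gamma> (Bind M t1 t2 wp1 e1 wp2 e2) c \<longleftrightarrow> (\<exists>W B. ty S \<Gamma> t2 (Tot (Universe 0)) \<and>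
    wp_type_of S M = Some W \<and> bind_star_of S M = Some B \<and>
    ty S \<Gamma> wp2 (Tot (arr t1 (App W t2))) \<and> ty S \<Gamma> e1 (Cmp M t1 wp1) \<and> wctx S (t1 # \<Gamma>) \<and>
    ty S (t1 # \<Gamma>) e2 (Cmp M (shift t2) (App (shift wp2) (Var 0))) \<and>
    c = Cmp M t2 (apps B [t1, t2, wp1, wp2]))"

lemma ty_gen_all:
  "wctx S \<Gamma> \<Longrightarrow> True"
  "ktyp S \<Gamma> k t \<Longrightarrow> True"
  "ty S \<Gamma> e c \<Longrightarrow> \<exists>c0. gen S \<Gamma> e c0 \<and> sbc S \<Gamma> c0 c"
  "wcmp S \<Gamma> c i \<Longrightarrow> True"
  "sbt S \<Gamma> t1 t2 \<Longrightarrow> True"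
  "sbc S \<Gamma> c1 c2 \<Longrightarrow> True"
  "val S \<Gamma> phi \<Longrightarrow> True"
proof (induction rule: wctx_ktyp_ty_wcmp_sbt_sbc_val.inducts)
  case t_Sub
  then show ?case by (blast intro: sc_Trans)
next
  case (t_Case \<Gamma> e t1 t2 t i e1 e2)
  then show ?case by (intro exI[of _ "Tot (sub1 e t)"]) (auto intro: sc_Refl)
next
  case (t_CaseM \<Gamma> e t1 t2 t e1 M wp1 e2 wp2 W)
  then show ?case by (intro exI[of _ "Cmp M t (Case (shift (App W t)) e wp1 wp2)"]) (auto intro: sc_Refl)
next
  case (t_Act \<Gamma> F D j A es)
  then show ?case
    by (intro exI[of _ "csub (inst es) (Cmp (User F) (act_res A) (act_wp A))"]) (auto intro: sc_Refl)
qed (auto intro!: exI sc_Refl)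

lemma ty_gen: "ty S \<Gamma> e c \<Longrightarrow> \<exists>c0. gen S \<Gamma> e c0 \<and> sbc S \<Gamma> c0 c"
  by (rule ty_gen_all)

text \<open>
  The intermediate types in a chain of subtypings may be ill typed, so that for codomains conversion
  cannot be absorbed into \<open>sbc\<close>, which demands validity for \<open>Cmp\<close>; it is kept as separate steps.
\<close>

inductive csx :: "signature \<Rightarrow> ctx \<Rightarrow> comp \<Rightarrow> comp \<Rightarrow> bool" for S \<Gamma> where
  csx_sub: "sbc S \<Gamma> c c' \<Longrightarrow> csx S \<Gamma> c c'"
| csx_conv: "convc S c c' \<Longrightarrow> csx S \<Gamma> c c'"
| csx_trans: "csx S \<Gamma> c c' \<Longrightarrow> csx S \<Gamma> c' c'' \<Longrightarrow> csx S \<Gamma> c c''"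

section \<open>Subtyping as joinability or as a relation between products\<close>

definition joinable :: "signature \<Rightarrow> tm \<Rightarrow> tm \<Rightarrow> bool" where
  "joinable S A B \<longleftrightarrow> (\<exists>H. qs S A H \<and> qs S B H)"

text \<open>A Kripke form of the product rule. Codomains are compared over every well-formed domain
  \<open>T\<close> below the target domain, rather than over the domains of the chain, which may be
  ill formed. Such a \<open>T\<close> lies below every domain that precedes the target in the chain,
  so the relation composes without narrowing in an ill-formed context.\<close>

definition pirel :: "signature \<Rightarrow> ctx \<Rightarrow> tm \<Rightarrow> comp \<Rightarrow> tm \<Rightarrow> comp \<Rightarrow> bool" where
  "pirel S \<Gamma> t c t' c' \<longleftrightarrow> sbt S \<Gamma> t' t \<and> (\<forall>T. wctx S (T # \<Gamma>) \<longrightarrow> sbt S \<Gamma> T t' \<longrightarrow> csx S (T # \<Gamma>) c c')"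

text \<open>Products are the only types whose components vary by genuine subtyping; elsewhere
  subtyping leaves a common reduct up to stripping. The reductions in the second alternative are
  there because a product may be hidden below redexes and refinements.\<close>

definition inv :: "signature \<Rightarrow> ctx \<Rightarrow> tm \<Rightarrow> tm \<Rightarrow> bool" where
  "inv S \<Gamma> A B \<longleftrightarrow> joinable S A B \<or>
     (\<exists>t c t' c'. qs S A (Pi t c) \<and> qs S B (Pi t' c') \<and> pirel S \<Gamma> t c t' c')"

lemma conv_joinable:
  assumes cs: "closed_sig S" and "conv S t u"
  shows "joinable S t u"
  using assms(2)
proof induction
  case (conv_red t u)
  then show ?case using red_pr qs_pr unfolding joinable_def by blast
next
  case (conv_trans t u v)
  then show ?case using qs_confluent[OF cs, of u] unfolding joinable_def by (meson rtranclp_trans)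
qed (auto simp: joinable_def)

lemma pirel_conv:
  assumes "pirel S \<Gamma> t c t' c'" "conv S t t1" "convc S c c1" "conv S t' t1'" "convc S c' c1'"
  shows "pirel S \<Gamma> t1 c1 t1' c1'"
  using assms unfolding pirel_def
  by (meson conv_sym convc_sym csx_conv csx_trans s_Conv s_Trans)

lemma pirel_trans:
  assumes "pirel S \<Gamma> t c t' c'" "pirel S \<Gamma> t' c' t'' c''"
  shows "pirel S \<Gamma> t c t'' c''"
  using assms unfolding pirel_def by (meson csx_trans s_Trans)

text \<open>By confluence the two reductions of the middle type \<open>M\<close> meet. If either of
  them leads to a product, so does their meeting point, with convertible components, and
  \<open>pirel\<close> is insensitive to conversion.\<close>

lemma inv_trans:
  assumes cs: "closed_sig S" and "inv S \<Gamma> A M" "inv S \<Gamma> M B"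
  shows "inv S \<Gamma> A B"
  using assms(2) unfolding inv_def
proof (elim disjE exE conjE)
  assume "joinable S A M"
  then obtain H where H: "qs S A H" "qs S M H" by (auto simp: joinable_def)
  from assms(3) show "joinable S A B \<or>
     (\<exists>t c t' c'. qs S A (Pi t c) \<and> qs S B (Pi t' c') \<and> pirel S \<Gamma> t c t' c')"
    unfolding inv_def
  proof (elim disjE exE conjE)
    assume "joinable S M B"
    then show ?thesis using H qs_confluent[OF cs, of M] unfolding joinable_def by (meson rtranclp_trans)
  next
    fix t c t' c' assume *: "qs S M (Pi t c)" "qs S B (Pi t' c')" "pirel S \<Gamma> t c t' c'"
    obtain K where "qs S H K" "qs S (Pi t c) K" using qs_confluent[OF cs H(2) *(1)] by blast
    moreover from qs_Pi[OF cs this(2)] obtain t1 c1 where "K = Pi t1 c1" "conv S t t1" "convc S c c1" by blast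
    ultimately show ?thesis using H *
      by (meson conv_refl convc_refl pirel_conv rtranclp_trans)
  qed
next
  fix t c t' c' assume *: "qs S A (Pi t c)" "qs S M (Pi t' c')" "pirel S \<Gamma> t c t' c'"
  from assms(3) show "joinable S A B \<or>
     (\<exists>t c t' c'. qs S A (Pi t c) \<and> qs S B (Pi t' c') \<and> pirel S \<Gamma> t c t' c')"
    unfolding inv_def
  proof (elim disjE exE conjE)
    assume "joinable S M B"
    then obtain H where H: "qs S M H" "qs S B H" by (auto simp: joinable_def)
    obtain K where "qs S H K" "qs S (Pi t' c') K" using qs_confluent[OF cs H(1) *(2)] by blast
    moreover from qs_Pi[OF cs this(2)] obtain t1 c1 where "K = Pi t1 c1" "conv S t' t1" "convc S c' c1" by blast
    ultimately show ?thesis using H *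
      by (meson conv_refl convc_refl pirel_conv rtranclp_trans)
  next
    fix u d u' d' assume **: "qs S M (Pi u d)" "qs S B (Pi u' d')" "pirel S \<Gamma> u d u' d'"
    obtain K where K: "qs S (Pi u d) K" "qs S (Pi t' c') K" using qs_confluent[OF cs **(1) *(2)] by blast
    obtain t1 c1 where t1: "K = Pi t1 c1" "conv S t' t1" "convc S c' c1" using qs_Pi[OF cs K(2)] by blast
    obtain "conv S u t1" "convc S d c1" using qs_Pi[OF cs K(1)] t1(1) by blast
    then have "pirel S \<Gamma> t1 c1 u' d'" using pirel_conv[OF **(3)] by simp
    moreover have "pirel S \<Gamma> t c t1 c1" using pirel_conv[OF *(3)] t1 by simp
    ultimately show ?thesis using * ** pirel_trans by blast
  qed
qed

lemma sbt_inv_all: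
  assumes cs: "closed_sig S"
  shows
  "wctx S \<Gamma> \<Longrightarrow> True"
  "ktyp S \<Gamma> k t \<Longrightarrow> True"
  "ty S \<Gamma> e c \<Longrightarrow> True"
  "wcmp S \<Gamma> c i \<Longrightarrow> True"
  "sbt S \<Gamma> t1 t2 \<Longrightarrow> inv S \<Gamma> t1 t2"
  "sbc S \<Gamma> c1 c2 \<Longrightarrow> True"
  "val S \<Gamma> phi \<Longrightarrow> True"
proof (induction rule: wctx_ktyp_ty_wcmp_sbt_sbc_val.inducts)
  case (s_Trans \<Gamma> t1 t2 t3)
  then show ?case using inv_trans[OF cs] by blast
next
  case (s_Pi \<Gamma> t t' c' c)
  \<comment> \<open>Narrowing transports the comparison of codomains from \<open>t\<close> to every
    domain below it, which is what the quantifier in \<open>pirel\<close> asks for.\<close>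
  then have "pirel S \<Gamma> t' c' t c"
    unfolding pirel_def using ty_narrow(4)[OF cs] csx_sub by blast
  then show ?case unfolding inv_def by blast
next
  case (s_PiRaw \<Gamma> t t' c' c)
  then have "pirel S \<Gamma> t' c' t c"
    unfolding pirel_def using rs_sbt(2) csx_sub by blast
  then show ?case unfolding inv_def by blast
next
  case (s_RefineL \<Gamma> t phi)
  have "joinable S (Refine t phi) t" unfolding joinable_def using qs_strip by blast
  then show ?case by (simp add: inv_def)
next
  case (s_RefineR t \<Gamma> phi)
  have "joinable S t (Refine t phi)" unfolding joinable_def using qs_strip by blast
  then show ?case by (simp add: inv_def)
next
  case (s_Conv t t' \<Gamma>)
  then show ?case using conv_joinable[OF cs] by (simp add: inv_def)
qed (auto simp: inv_def joinable_def)

lemma sbt_inv: "closed_sig S \<Longrightarrow> sbt S \<Gamma> A B \<Longrightarrow> inv S \<Gamma> A B"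
  by (rule sbt_inv_all)

lemma sbt_PiE:
  assumes cs: "closed_sig S" and "sbt S \<Gamma> A (Pi t' c')"
  obtains t c where "qs S A (Pi t c)" "pirel S \<Gamma> t c t' c'"
proof -
  from sbt_inv[OF assms] consider H where "qs S A H" "qs S (Pi t' c') H"
    | t c t1 c1 where "qs S A (Pi t c)" "qs S (Pi t' c') (Pi t1 c1)" "pirel S \<Gamma> t c t1 c1"
    by (auto simp: inv_def joinable_def)
  then show ?thesis
  proof cases
    case 1
    then obtain t1 c1 where *: "H = Pi t1 c1" "conv S t' t1" "convc S c' c1" using qs_Pi[OF cs] by blast
    have "pirel S \<Gamma> t1 c1 t' c'" unfolding pirel_def
      using * by (auto intro: s_Conv csx_conv convc_sym)
    with * 1 that show ?thesis by blast
  next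
    case 2
    then have *: "conv S t' t1" "convc S c' c1" using qs_Pi[OF cs] by auto
    then have "pirel S \<Gamma> t c t' c'" using pirel_conv[OF 2(3)] by (simp add: conv_sym convc_sym)
    with 2 that show ?thesis by blast
  qed
qed

lemma sbt_Pi_Pi:
  assumes cs: "closed_sig S" and "sbt S \<Gamma> (Pi t c) (Pi t' c')"
  shows "pirel S \<Gamma> t c t' c'"
proof -
  from assms obtain t1 c1 where *: "qs S (Pi t c) (Pi t1 c1)" "pirel S \<Gamma> t1 c1 t' c'" by (rule sbt_PiE)
  then have "conv S t t1" "convc S c c1" using qs_Pi[OF cs] by auto
  then show ?thesis using pirel_conv[OF *(2)] by (simp add: conv_sym convc_sym)
qed

lemma sbt_Universe:
  assumes cs: "closed_sig S"
  shows "sbt S \<Gamma> A (Universe i) \<Longrightarrow> qs S A (Universe i)" "sbt S \<Gamma> (Universe i) A \<Longrightarrow> qs S A (Universe i)"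
  using sbt_inv[OF cs] qs_Universe unfolding inv_def joinable_def by fastforce+

text \<open>A saturated binary constant never reduces to a product, so the product alternative of
  \<open>inv\<close> is excluded and only joinability is left.\<close>

lemma sbt_const2:
  assumes cs: "closed_sig S" and "sbt S \<Gamma> A (app2 (Const k) a b) \<or> sbt S \<Gamma> (app2 (Const k) a b) A" "k \<noteq> CFst" "k \<noteq> CSnd"
  shows "\<exists>a' b'. qs S A (app2 (Const k) a' b') \<and> conv S a a' \<and> conv S b b'"
proof -
  have "\<not> qs S (app2 (Const k) a b) (Pi t c)" for t c
    using qs_const_App2[OF cs _ assms(3,4)] by blast
  then have "joinable S A (app2 (Const k) a b)"
    using assms(2) sbt_inv[OF cs] unfolding inv_def joinable_def by blast
  then show ?thesis unfolding joinable_def using qs_const_App2[OF cs _ assms(3,4)] by blast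
qed

section \<open>Regularity\<close>

definition ok_eff :: "signature \<Rightarrow> effect \<Rightarrow> bool" where
  "ok_eff S D \<longleftrightarrow>
     (\<exists>i. ty S [] (wp_type D) (Tot (arr (Universe 0) (Universe i)))) \<and>
     ty S [] (repr D) (Tot (repr_ty D)) \<and>
     ty S [] (ret_star D) (Tot (ret_star_ty D)) \<and>
     ty S [] (bind_star D) (Tot (bind_star_ty D)) \<and>
     ty S [] (ret_impl D) (Tot (ret_impl_ty D)) \<and>
     ty S [] (bind_impl D) (Tot (bind_impl_ty D)) \<and>
     (\<forall>A \<in> set (actions D).
        ty S (rev (act_args A)) (act_res A) (Tot (Universe 0)) \<and>
        ty S (rev (act_args A)) (act_wp A) (Tot (App (wp_type D) (act_res A))) \<and>
        ty S [] (act_impl A) (Tot (act_impl_ty D A)))"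

text \<open>Well-formedness in flattened form: all entries are typed in the auxiliary system and
  over the whole of \<open>S\<close>, not over the earlier entries alone. \<open>wf_sig_ok\<close>
  derives it from \<open>wf_sig\<close>.\<close>

definition ok_sig :: "signature \<Rightarrow> bool" where
  "ok_sig S \<longleftrightarrow> closed_sig S \<and> (\<forall>F D. lookup_eff S F = Some D \<longrightarrow> ok_eff S D) \<and>
     (\<forall>F F' l w. lookup_lift S F F' = Some (l, w) \<longrightarrow>
        (\<exists>D D'. lookup_eff S F = Some D \<and> lookup_eff S F' = Some D' \<and>
           ty S [] w (Tot (lift_star_ty D D')) \<and> ty S [] l (Tot (lift_impl_ty D D' w))))"

lemma ok_closed [simp]: "ok_sig S \<Longrightarrow> closed_sig S"
  by (simp add: ok_sig_def)

lemma inst_Nil [simp]: "inst [] = Var"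
  by (auto simp: inst_def)

lemma sub1_inst: "sub1 e (sub (ups (inst es)) t) = sub (inst (es @ [e])) t"
proof -
  have "sub1 e (ups (inst es) k) = inst (es @ [e]) k" for k
    by (cases k) (simp_all add: inst_def sub_ren)
  then show ?thesis by (simp add: sub_sub)
qed

text \<open>The accumulator \<open>es0\<close> holds the arguments already consumed, so that
  iterated single substitutions become one simultaneous instantiation of the telescope.\<close>

lemma ty_apps:
  assumes "ty S \<Gamma> f (Tot (sub (inst es0) (pis ts u)))" "length es = length ts"
    and "\<And>i. i < length es \<Longrightarrow> ty S \<Gamma> (es ! i) (Tot (sub (inst (es0 @ take i es)) (ts ! i)))"
  shows "ty S \<Gamma> (apps f es) (Tot (sub (inst (es0 @ es)) u))"
  using assms
proof (induction es arbitrary: f es0 ts)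
  case Nil
  then show ?case by (simp add: pis_def)
next
  case (Cons e es)
  then obtain t ts' where ts: "ts = t # ts'" by (cases ts) auto
  have "ty S \<Gamma> e (Tot (sub (inst es0) t))" using Cons.prems(3)[of 0] ts by simp
  with Cons.prems(1) have "ty S \<Gamma> (App f e) (csub1 e (csub (ups (inst es0)) (Tot (pis ts' u))))"
    unfolding ts pis_def by (intro t_App) simp_all
  then have "ty S \<Gamma> (App f e) (Tot (sub (inst (es0 @ [e])) (pis ts' u)))"
    by (simp add: sub1_inst)
  moreover have "ty S \<Gamma> (es ! i) (Tot (sub (inst ((es0 @ [e]) @ take i es)) (ts' ! i)))" if "i < length es" for i
    using Cons.prems(3)[of "Suc i"] ts that by simp
  ultimately show ?case using Cons.IH[of "App f e" "es0 @ [e]" ts'] Cons.prems(2) ts by simp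
qed

lemma ty_weaken_closed:
  assumes cs: "closed_sig S" and "ty S [] e (Tot t)" "wctx S \<Gamma>"
  shows "ty S \<Gamma> e (Tot t)"
proof -
  have "rtyp S \<Gamma> id []" using assms(3) by (simp add: rtyp_def)
  then have "ty S \<Gamma> (ren id e) (cren id (Tot t))" using ty_ren(1)[OF cs assms(2)] by blast
  moreover have "fv e = {}" "fv t = {}" using ty_closed(3)[OF cs assms(2)] by auto
  ultimately show ?thesis by (simp add: ren_closed)
qed

lemma ty_conv:
  "ty S \<Gamma> e (Tot t) \<Longrightarrow> conv S t t' \<Longrightarrow> ty S \<Gamma> t' (Tot (Universe i)) \<Longrightarrow> ty S \<Gamma> e (Tot t')"
  by (rule t_Sub) (auto intro: sc_Tot s_Conv c_Tot)

lemma conv_beta: "conv S (App (Lam t e) a) (sub1 a e)"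
  by (rule conv_red) (rule R_Beta)

lemma conv_app: "conv S f g \<Longrightarrow> conv S a b \<Longrightarrow> conv S (App f a) (App g b)"
proof -
  have "conv S f g \<Longrightarrow> conv S (App f a) (App g a)"
    by (induction rule: conv.induct) (auto intro: conv.intros red.intros)
  moreover have "conv S a b \<Longrightarrow> conv S (App g a) (App g b)"
    by (induction rule: conv.induct) (auto intro: conv.intros red.intros)
  ultimately show "conv S f g \<Longrightarrow> conv S a b \<Longrightarrow> conv S (App f a) (App g b)"
    using conv_trans by blast
qed

section \<open>Derived typing rules and the transformers of \<open>Pure\<close>\<close>

context
  fixes S assumes cs: "closed_sig S"
begin

lemma ty_arr:
  assumes "ty S \<Gamma> a (Tot (Universe i))" "ty S \<Gamma> b (Tot (Universe j))"
  shows "ty S \<Gamma> (arr a b) (Tot (Universe (max i j)))"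
proof -
  have "wctx S (a # \<Gamma>)" using assms ty_wctx(3) by (blast intro: w_Cons)
  then have "ty S (a # \<Gamma>) (shift b) (Tot (Universe j))" using ty_shift(1)[OF cs _ assms(2)] by simp
  with assms show ?thesis by (auto intro: t_Pi c_Tot)
qed

lemma ty_app_arr: "ty S \<Gamma> f (Tot (arr a b)) \<Longrightarrow> ty S \<Gamma> e (Tot a) \<Longrightarrow> ty S \<Gamma> (App f e) (Tot b)"
  using t_App[of S \<Gamma> f a "Tot (shift b)" e] by simp

lemma ty_const2:
  assumes "ty S \<Gamma> a (Tot (Universe i))" "ty S \<Gamma> b (Tot (Universe j))"
  shows "ty S \<Gamma> (prodT a b) (Tot (Universe (max i j)))" "ty S \<Gamma> (sumT a b) (Tot (Universe (max i j)))"
  using ty_app_arr[OF ty_app_arr[OF t_Const[OF k_Prod[OF ty_wctx(3)[OF assms(1)]]] assms(1)] assms(2)]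
    ty_app_arr[OF ty_app_arr[OF t_Const[OF k_Sum[OF ty_wctx(3)[OF assms(1)]]] assms(1)] assms(2)] .

lemma ty_Var_n:
  "wctx S (a0 # \<Gamma>) \<Longrightarrow> ty S (a0 # \<Gamma>) (Var 0) (Tot (shift a0))"
  "wctx S (a1 # a0 # \<Gamma>) \<Longrightarrow> ty S (a1 # a0 # \<Gamma>) (Var 1) (Tot (shift (shift a0)))"
  "wctx S (a2 # a1 # a0 # \<Gamma>) \<Longrightarrow> ty S (a2 # a1 # a0 # \<Gamma>) (Var 2) (Tot (shift (shift (shift a0))))"
  "wctx S (a3 # a2 # a1 # a0 # \<Gamma>) \<Longrightarrow> ty S (a3 # a2 # a1 # a0 # \<Gamma>) (Var 3) (Tot (shift (shift (shift (shift a0)))))"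
  "wctx S (a4 # a3 # a2 # a1 # a0 # \<Gamma>) \<Longrightarrow>
     ty S (a4 # a3 # a2 # a1 # a0 # \<Gamma>) (Var 4) (Tot (shift (shift (shift (shift (shift a0))))))"
  using t_Var[of S "a0 # \<Gamma>" 0] t_Var[of S "a1 # a0 # \<Gamma>" "Suc 0"] t_Var[of S "a2 # a1 # a0 # \<Gamma>" "Suc (Suc 0)"]
    t_Var[of S "a3 # a2 # a1 # a0 # \<Gamma>" "Suc (Suc (Suc 0))"]
    t_Var[of S "a4 # a3 # a2 # a1 # a0 # \<Gamma>" "Suc (Suc (Suc (Suc 0)))"]
  by (simp_all only: at_simps list.size) (simp_all add: numeral_eq_Suc)

lemma ty_pure_wp_type: "wctx S \<Gamma> \<Longrightarrow> ty S \<Gamma> pure_wp_type (Tot (arr (Universe 0) (Universe 1)))"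
proof -
  assume w: "wctx S \<Gamma>"
  have U: "ty S \<Gamma> (Universe 0) (Tot (Universe 1))" using t_Universe[OF w, of 0] by simp
  then have w1: "wctx S (Universe 0 # \<Gamma>)" using w by (blast intro: w_Cons)
  have U1: "ty S (Universe 0 # \<Gamma>) (Universe 0) (Tot (Universe 1))" using t_Universe[OF w1, of 0] by simp
  have "ty S (Universe 0 # \<Gamma>) (Var 0) (Tot (Universe 0))" using ty_Var_n(1)[OF w1] by simp
  then have "ty S (Universe 0 # \<Gamma>) (arr (arr (Var 0) (Universe 0)) (Universe 0)) (Tot (Universe (max (max 0 1) 1)))"
    by (intro ty_arr U1)
  then show ?thesis unfolding pure_wp_type_def using U by (auto intro: t_Lam)
qed

lemma conv_pure_wp: "conv S (App pure_wp_type t) (arr (arr t (Universe 0)) (Universe 0))"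
  unfolding pure_wp_type_def by (rule conv_trans[OF conv_beta]) simp

lemma ty_pure_wp:
  assumes "ty S \<Gamma> t (Tot (Universe 0))"
  shows "ty S \<Gamma> (App pure_wp_type t) (Tot (Universe 1))"
    "ty S \<Gamma> (arr (arr t (Universe 0)) (Universe 0)) (Tot (Universe 1))"
proof -
  have w: "wctx S \<Gamma>" using assms by (rule ty_wctx)
  show "ty S \<Gamma> (App pure_wp_type t) (Tot (Universe 1))"
    using ty_app_arr[OF ty_pure_wp_type[OF w] assms] by simp
  have U: "ty S \<Gamma> (Universe 0) (Tot (Universe 1))" using t_Universe[OF w, of 0] by simp
  show "ty S \<Gamma> (arr (arr t (Universe 0)) (Universe 0)) (Tot (Universe 1))"
    using ty_arr[OF ty_arr[OF assms U] U] by simp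
qed

text \<open>\<open>c_Pure\<close> states the transformer type in contracted form, the rules with
  \<open>wp_type_of\<close> as an application. Passing between the two lets \<open>Pure\<close> and
  user effects be treated alike.\<close>

lemma ty_pure_wp_conv:
  assumes "ty S \<Gamma> t (Tot (Universe 0))"
  shows "ty S \<Gamma> w (Tot (App pure_wp_type t)) \<longleftrightarrow> ty S \<Gamma> w (Tot (arr (arr t (Universe 0)) (Universe 0)))"
  using ty_conv[OF _ conv_pure_wp ty_pure_wp(2)[OF assms]]
    ty_conv[OF _ conv_sym[OF conv_pure_wp] ty_pure_wp(1)[OF assms]] by blast

lemma wctx_ConsI: "ty S \<Gamma> t (Tot (Universe i)) \<Longrightarrow> wctx S (t # \<Gamma>)"
  using ty_wctx(3) w_Cons by blast

text \<open>\<open>Pure\<close> is built in and has no signature entry, so its transformers are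
  typed by hand, at the types that \<open>ret_star_ty\<close> and \<open>bind_star_ty\<close>
  prescribe for user effects.\<close>

lemma ty_pure_ret_star:
  "ty S [] pure_ret_star (Tot (pis [Universe 0, Var 0] (App pure_wp_type (Var 1))))"
proof -
  have U: "wctx S \<Gamma> \<Longrightarrow> ty S \<Gamma> (Universe 0) (Tot (Universe 1))" for \<Gamma>
    using t_Universe[of S \<Gamma> 0] by simp
  let ?G1 = "[Universe 0]" let ?G2 = "[Var 0, Universe 0]"
  have w1: "wctx S ?G1" using U[OF w_Nil] by (rule wctx_ConsI)
  have v1: "ty S ?G1 (Var 0) (Tot (Universe 0))" using ty_Var_n(1)[OF w1] by simp
  have w2: "wctx S ?G2" using v1 by (rule wctx_ConsI)
  have v2: "ty S ?G2 (Var 1) (Tot (Universe 0))" using ty_Var_n(2)[OF w2] by simp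
  let ?p = "arr (Var 1) (Universe 0)"
  have p: "ty S ?G2 ?p (Tot (Universe 1))" using ty_arr[OF v2 U[OF w2]] by simp
  have w3: "wctx S (?p # ?G2)" using p by (rule wctx_ConsI)
  have "ty S (?p # ?G2) (Var 0) (Tot (arr (Var 2) (Universe 0)))"
    using ty_Var_n(1)[OF w3] by (simp add: numeral_2_eq_2)
  moreover have "ty S (?p # ?G2) (Var 1) (Tot (Var 2))"
    using ty_Var_n(2)[OF w3] by (simp add: numeral_2_eq_2)
  ultimately have "ty S (?p # ?G2) (App (Var 0) (Var 1)) (Tot (Universe 0))"
    by (rule ty_app_arr)
  then have "ty S ?G2 (Lam ?p (App (Var 0) (Var 1))) (Tot (arr ?p (Universe 0)))"
    using t_Lam[OF p] by simp
  then have "ty S ?G2 (Lam ?p (App (Var 0) (Var 1))) (Tot (App pure_wp_type (Var 1)))"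
    using ty_pure_wp_conv[OF v2] by blast
  then show ?thesis unfolding pure_ret_star_def pis_def
    using U[OF w_Nil] v1 by (auto intro!: t_Lam)
qed

lemma ty_pure_bind_star:
  "ty S [] pure_bind_star (Tot (pis [Universe 0, Universe 0, App pure_wp_type (Var 1),
      Pi (Var 2) (Tot (App pure_wp_type (Var 2)))] (App pure_wp_type (Var 2))))"
proof -
  have U: "wctx S \<Gamma> \<Longrightarrow> ty S \<Gamma> (Universe 0) (Tot (Universe 1))" for \<Gamma>
    using t_Universe[of S \<Gamma> 0] by simp
  have pwt: "fv pure_wp_type = {}" by simp
  note n = numeral_eq_Suc ren_closed[OF pwt]
  \<comment> \<open>The bound variables are \<open>a\<close>, \<open>b\<close>, \<open>w1\<close>,
    \<open>w2\<close>, \<open>p\<close>, \<open>x\<close> from the outside in; in the last context,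
    \<open>?G6\<close>, they have the indices 5 down to 0.\<close>
  let ?G2 = "[Universe 0, Universe 0]"
  have w1: "wctx S [Universe 0]" using U[OF w_Nil] by (rule wctx_ConsI)
  have w2: "wctx S ?G2" using U[OF w1] by (rule wctx_ConsI)
  have a2: "ty S ?G2 (Var 1) (Tot (Universe 0))" using ty_Var_n(2)[OF w2] by simp
  let ?w1 = "App pure_wp_type (Var 1)"
  let ?G3 = "?w1 # ?G2"
  have tw1: "ty S ?G2 ?w1 (Tot (Universe 1))" using ty_pure_wp(1)[OF a2] .
  have w3: "wctx S ?G3" using tw1 by (rule wctx_ConsI)
  have a3: "ty S ?G3 (Var 2) (Tot (Universe 0))" using ty_Var_n(3)[OF w3] by simp
  have b3: "ty S ?G3 (Var 1) (Tot (Universe 0))" using ty_Var_n(2)[OF w3] by simp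
  let ?w2 = "arr (Var 2) (App pure_wp_type (Var 1))"
  let ?G4 = "?w2 # ?G3"
  have tw2: "ty S ?G3 ?w2 (Tot (Universe 1))" using ty_arr[OF a3 ty_pure_wp(1)[OF b3]] by simp
  have w4: "wctx S ?G4" using tw2 by (rule wctx_ConsI)
  have b4: "ty S ?G4 (Var 2) (Tot (Universe 0))" using ty_Var_n(3)[OF w4] by simp
  let ?p = "arr (Var 2) (Universe 0)"
  let ?G5 = "?p # ?G4"
  have tp: "ty S ?G4 ?p (Tot (Universe 1))" using ty_arr[OF b4 U[OF w4]] by simp
  have w5: "wctx S ?G5" using tp by (rule wctx_ConsI)
  have a5: "ty S ?G5 (Var 4) (Tot (Universe 0))" using ty_Var_n(5)[OF w5] by simp
  let ?G6 = "Var 4 # ?G5"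
  have w6: "wctx S ?G6" using a5 by (rule wctx_ConsI)
  have b6: "ty S ?G6 (Var 4) (Tot (Universe 0))" using ty_Var_n(5)[OF w6] by simp
  have "ty S ?G6 (Var 2) (Tot (arr (Var 5) (App pure_wp_type (Var 4))))"
    using ty_Var_n(3)[OF w6] by (simp add: n)
  moreover have "ty S ?G6 (Var 0) (Tot (Var 5))"
    using ty_Var_n(1)[OF w6] by (simp add: n)
  ultimately have "ty S ?G6 (App (Var 2) (Var 0)) (Tot (App pure_wp_type (Var 4)))"
    by (rule ty_app_arr)
  then have "ty S ?G6 (App (Var 2) (Var 0)) (Tot (arr (arr (Var 4) (Universe 0)) (Universe 0)))"
    using ty_pure_wp_conv[OF b6] by blast
  moreover have "ty S ?G6 (Var 1) (Tot (arr (Var 4) (Universe 0)))"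
    using ty_Var_n(2)[OF w6] by (simp add: n)
  ultimately have "ty S ?G6 (app2 (Var 2) (Var 0) (Var 1)) (Tot (Universe 0))"
    by (rule ty_app_arr)
  then have q: "ty S ?G5 (Lam (Var 4) (app2 (Var 2) (Var 0) (Var 1))) (Tot (arr (Var 4) (Universe 0)))"
    using t_Lam[OF a5] by simp
  have "ty S ?G5 (Var 2) (Tot (App pure_wp_type (Var 4)))"
    using ty_Var_n(3)[OF w5] by (simp add: n)
  then have "ty S ?G5 (Var 2) (Tot (arr (arr (Var 4) (Universe 0)) (Universe 0)))"
    using ty_pure_wp_conv[OF a5] by blast
  then have "ty S ?G5 (App (Var 2) (Lam (Var 4) (app2 (Var 2) (Var 0) (Var 1)))) (Tot (Universe 0))"
    using q by (rule ty_app_arr)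
  then have "ty S ?G4 (Lam ?p (App (Var 2) (Lam (Var 4) (app2 (Var 2) (Var 0) (Var 1))))) (Tot (arr ?p (Universe 0)))"
    using t_Lam[OF tp] by simp
  then have "ty S ?G4 (Lam ?p (App (Var 2) (Lam (Var 4) (app2 (Var 2) (Var 0) (Var 1))))) (Tot (App pure_wp_type (Var 2)))"
    using ty_pure_wp_conv[OF b4] by blast
  then have "ty S [] pure_bind_star (Tot (Pi (Universe 0) (Tot (Pi (Universe 0) (Tot (Pi ?w1 (Tot (Pi ?w2 (Tot (App pure_wp_type (Var 2)))))))))))"
    unfolding pure_bind_star_def
    by (intro t_Lam[OF U[OF w_Nil]] t_Lam[OF U[OF w1]] t_Lam[OF tw1] t_Lam[OF tw2])
  then show ?thesis by (simp add: pis_def n)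
qed

end

lemma ok_sigD:
  assumes "ok_sig S" "lookup_eff S F = Some D"
  shows "\<exists>i. ty S [] (wp_type D) (Tot (arr (Universe 0) (Universe i)))"
    "ty S [] (repr D) (Tot (repr_ty D))"
    "ty S [] (ret_star D) (Tot (ret_star_ty D))"
    "ty S [] (bind_star D) (Tot (bind_star_ty D))"
    "ty S [] (ret_impl D) (Tot (ret_impl_ty D))"
    "ty S [] (bind_impl D) (Tot (bind_impl_ty D))"
    "j < length (actions D) \<Longrightarrow> A = actions D ! j \<Longrightarrow> ty S (rev (act_args A)) (act_res A) (Tot (Universe 0))"
    "j < length (actions D) \<Longrightarrow> A = actions D ! j \<Longrightarrow>
       ty S (rev (act_args A)) (act_wp A) (Tot (App (wp_type D) (act_res A)))"
    "j < length (actions D) \<Longrightarrow> A = actions D ! j \<Longrightarrow> ty S [] (act_impl A) (Tot (act_impl_ty D A))"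
  using assms unfolding ok_sig_def ok_eff_def by (meson nth_mem)+

lemma ok_liftD:
  assumes "ok_sig S" "lookup_lift S F F' = Some (l, w)"
  obtains D D' where "lookup_eff S F = Some D" "lookup_eff S F' = Some D'"
    "ty S [] w (Tot (lift_star_ty D D'))" "ty S [] l (Tot (lift_impl_ty D D' w))"
  using assms unfolding ok_sig_def by meson

lemma inst_simps:
  "inst [a, b] 0 = b" "inst [a, b] (Suc 0) = a" "inst [a, b] (Suc (Suc k)) = Var k"
  "inst [a, b, c] 0 = c" "inst [a, b, c] (Suc 0) = b" "inst [a, b, c] (Suc (Suc 0)) = a"
  "inst [a, b, c] (Suc (Suc (Suc k))) = Var k"
  by (simp_all add: inst_def)

section \<open>Well-formedness of the types assigned by the rules\<close>

context
  fixes S assumes ok: "ok_sig S"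
begin

lemma sig_closed: "closed_sig S"
  using ok by simp

lemma W_ty:
  assumes "wp_type_of S M = Some W" "wctx S \<Gamma>"
  shows "\<exists>k. ty S \<Gamma> W (Tot (arr (Universe 0) (Universe k)))"
proof (cases M)
  case Pure
  then show ?thesis using ty_pure_wp_type[OF sig_closed assms(2)] assms(1) by auto
next
  case (User F)
  then obtain D where "lookup_eff S F = Some D" "W = wp_type D" using assms by auto
  then show ?thesis using ok_sigD(1)[OF ok] ty_weaken_closed[OF sig_closed _ assms(2)] by blast
qed

lemma AppW_ty:
  assumes "wp_type_of S M = Some W" "ty S \<Gamma> t (Tot (Universe 0))"
  shows "\<exists>k. ty S \<Gamma> (App W t) (Tot (Universe k))"
  using W_ty[OF assms(1) ty_wctx(3)[OF assms(2)]] ty_app_arr[OF sig_closed _ assms(2)] by blast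

lemma wcmp_CmpD:
  assumes "wcmp S \<Gamma> (Cmp M t wp) i"
  shows "i = 0" "ty S \<Gamma> t (Tot (Universe 0))" "\<exists>W. wp_type_of S M = Some W \<and> ty S \<Gamma> wp (Tot (App W t))"
  using assms by (cases; auto simp: ty_pure_wp_conv[OF sig_closed])+

lemma repr_app:
  assumes "lookup_eff S F = Some D" "ty S \<Gamma> t (Tot (Universe 0))" "ty S \<Gamma> wp (Tot (App (wp_type D) t))"
  shows "ty S \<Gamma> (apps (repr D) [t, wp]) (Tot (Universe 0))"
proof -
  have "ty S \<Gamma> (apps (repr D) [t, wp]) (Tot (sub (inst ([] @ [t, wp])) (Universe 0)))"
  proof (rule ty_apps)
    show "ty S \<Gamma> (repr D) (Tot (sub (inst []) (pis [Universe 0, App (wp_type D) (Var 0)] (Universe 0))))"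
      using ty_weaken_closed[OF sig_closed ok_sigD(2)[OF ok assms(1)] ty_wctx(3)[OF assms(2)]] by (simp add: repr_ty_def)
    fix i assume "i < length [t, wp]"
    then show "ty S \<Gamma> ([t, wp] ! i) (Tot (sub (inst ([] @ take i [t, wp])) ([Universe 0, App (wp_type D) (Var 0)] ! i)))"
      using assms by (auto simp: less_Suc_eq sub_closed closed_sigD[OF sig_closed])
  qed simp
  then show ?thesis by simp
qed

lemma wcmp_CmpI:
  assumes "wp_type_of S M = Some W" "ty S \<Gamma> t (Tot (Universe 0))" "ty S \<Gamma> wp (Tot (App W t))"
  shows "wcmp S \<Gamma> (Cmp M t wp) 0"
proof (cases M)
  case Pure
  then show ?thesis using assms ty_pure_wp_conv[OF sig_closed assms(2)] by (auto intro: c_Pure)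
next
  case (User F)
  then show ?thesis using assms repr_app by (auto intro!: c_User)
qed

lemma ret_star_app:
  assumes "wp_type_of S M = Some W" "ret_star_of S M = Some R" "ty S \<Gamma> t (Tot (Universe 0))" "ty S \<Gamma> e (Tot t)"
  shows "ty S \<Gamma> (apps R [t, e]) (Tot (App W t))"
proof -
  have "ty S [] R (Tot (pis [Universe 0, Var 0] (App W (Var 1))))"
  proof (cases M)
    case Pure
    then show ?thesis using ty_pure_ret_star[OF sig_closed] assms(1,2) by simp
  next
    case (User F)
    then show ?thesis using ok_sigD(3)[OF ok] assms(1,2) by (auto simp: ret_star_ty_def)
  qed
  then have R: "ty S \<Gamma> R (Tot (pis [Universe 0, Var 0] (App W (Var 1))))"
    using ty_weaken_closed[OF sig_closed] ty_wctx(3)[OF assms(3)] by blast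
  have "ty S \<Gamma> (apps R [t, e]) (Tot (sub (inst ([] @ [t, e])) (App W (Var 1))))"
  proof (rule ty_apps)
    fix i assume "i < length [t, e]"
    then show "ty S \<Gamma> ([t, e] ! i) (Tot (sub (inst ([] @ take i [t, e])) ([Universe 0, Var 0] ! i)))"
      using assms by (auto simp: less_Suc_eq)
  qed (use R in simp_all)
  then show ?thesis by (simp add: sub_closed fv_stars(1)[OF sig_closed assms(1)] inst_simps)
qed

lemma bind_star_app:
  assumes "wp_type_of S M = Some W" "bind_star_of S M = Some B" "ty S \<Gamma> t1 (Tot (Universe 0))"
    "ty S \<Gamma> t2 (Tot (Universe 0))" "ty S \<Gamma> wp1 (Tot (App W t1))" "ty S \<Gamma> wp2 (Tot (arr t1 (App W t2)))"
  shows "ty S \<Gamma> (apps B [t1, t2, wp1, wp2]) (Tot (App W t2))"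
proof -
  let ?ts = "[Universe 0, Universe 0, App W (Var 1), Pi (Var 2) (Tot (App W (Var 2)))]"
  have "ty S [] B (Tot (pis ?ts (App W (Var 2))))"
  proof (cases M)
    case Pure
    then show ?thesis using ty_pure_bind_star[OF sig_closed] assms(1,2) by simp
  next
    case (User F)
    then show ?thesis using ok_sigD(4)[OF ok] assms(1,2) by (auto simp: bind_star_ty_def)
  qed
  then have B: "ty S \<Gamma> B (Tot (pis ?ts (App W (Var 2))))"
    using ty_weaken_closed[OF sig_closed] ty_wctx(3)[OF assms(3)] by blast
  note W = fv_stars(1)[OF sig_closed assms(1)]
  have "ty S \<Gamma> (apps B [t1, t2, wp1, wp2]) (Tot (sub (inst ([] @ [t1, t2, wp1, wp2])) (App W (Var 2))))"
  proof (rule ty_apps)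
    fix i assume "i < length [t1, t2, wp1, wp2]"
    then show "ty S \<Gamma> ([t1, t2, wp1, wp2] ! i) (Tot (sub (inst ([] @ take i [t1, t2, wp1, wp2])) (?ts ! i)))"
      using assms(3-6) by (auto simp: less_Suc_eq sub_closed[OF W] ren_closed[OF W] inst_simps numeral_2_eq_2)
  qed (use B in simp_all)
  then show ?thesis by (simp add: sub_closed[OF W] inst_def numeral_2_eq_2)
qed

lemma lift_star_app:
  assumes "lookup_lift S F F' = Some (l, w)" "wcmp S \<Gamma> (Cmp (User F) t wp) i"
  shows "wcmp S \<Gamma> (Cmp (User F') t (apps w [t, wp])) 0"
proof -
  obtain D D' where D: "lookup_eff S F = Some D" "lookup_eff S F' = Some D'"
    "ty S [] w (Tot (lift_star_ty D D'))"
    using ok_liftD[OF ok assms(1)] by blast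
  have t: "ty S \<Gamma> t (Tot (Universe 0))" and wp: "ty S \<Gamma> wp (Tot (App (wp_type D) t))"
    using wcmp_CmpD[OF assms(2)] D by auto
  have "ty S \<Gamma> (apps w [t, wp]) (Tot (sub (inst ([] @ [t, wp])) (App (wp_type D') (Var 1))))"
  proof (rule ty_apps)
    show "ty S \<Gamma> w (Tot (sub (inst []) (pis [Universe 0, App (wp_type D) (Var 0)] (App (wp_type D') (Var 1)))))"
      using ty_weaken_closed[OF sig_closed D(3) ty_wctx(3)[OF t]] by (simp add: lift_star_ty_def)
    fix i assume "i < length [t, wp]"
    then show "ty S \<Gamma> ([t, wp] ! i) (Tot (sub (inst ([] @ take i [t, wp])) ([Universe 0, App (wp_type D) (Var 0)] ! i)))"
      using t wp by (auto simp: less_Suc_eq sub_closed closed_sigD(2)[OF sig_closed D(1)])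
  qed simp
  then have "ty S \<Gamma> (apps w [t, wp]) (Tot (App (wp_type D') t))"
    by (simp add: sub_closed closed_sigD(2)[OF sig_closed D(2)] inst_simps)
  then show ?thesis using D t by (intro wcmp_CmpI) auto
qed

lemma wctx_rev_nth:
  assumes "wctx S (rev ts)" "i < length ts"
  shows "wctx S (rev (take i ts)) \<and> (\<exists>k. ty S (rev (take i ts)) (ts ! i) (Tot (Universe k)))"
  using assms
proof (induction ts rule: rev_induct)
  case (snoc t ts)
  then have "wctx S (t # rev ts)" by simp
  from wctx_ConsD[OF this] snoc show ?case by (cases "i = length ts") (auto simp: nth_append)
qed simp

text \<open>Arguments that fit a telescope form a well-typed simultaneous substitution. Variables
  are counted from the innermost binding and arguments from the outermost, hence the index
  \<open>length es - Suc k\<close>. The type of that argument mentions only earlier ones, on which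
  the full and the truncated instantiation agree.\<close>

lemma styp_inst:
  assumes "wctx S (rev ts)" "wctx S \<Gamma>" "length es = length ts"
    and "\<And>i. i < length es \<Longrightarrow> ty S \<Gamma> (es ! i) (Tot (sub (inst (take i es)) (ts ! i)))"
  shows "styp S \<Gamma> (inst es) (rev ts)"
  unfolding styp_def
proof (intro conjI allI impI)
  fix k assume k: "k < length (rev ts)"
  let ?i = "length es - Suc k"
  have i: "?i < length es" using k assms(3) by simp
  have ek: "inst es k = es ! ?i" using k assms(3) by (simp add: inst_def rev_nth)
  have tk: "rev ts ! k = ts ! ?i" using k assms(3) by (simp add: rev_nth)
  have "sub (inst es) (at (rev ts) k) = sub (\<lambda>n. inst es (n + Suc k)) (ts ! ?i)"
    by (simp only: tk sub_ren)
  also have "\<dots> = sub (inst (take ?i es)) (ts ! ?i)"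
  proof (rule sub_cong_fv)
    fix n assume n: "n \<in> fv (ts ! ?i)"
    obtain q where "ty S (rev (take ?i ts)) (ts ! ?i) (Tot (Universe q))"
      using wctx_rev_nth[OF assms(1), of ?i] i assms(3) by auto
    from ty_closed(3)[OF sig_closed this] n i assms(3) have "n < ?i" by auto
    moreover have "rev es ! (n + Suc k) = rev (take ?i es) ! n" if "n < ?i"
      using that i by (simp add: rev_nth add.commute)
    moreover from \<open>n < ?i\<close> have "n + Suc k < length es" by arith
    ultimately show "inst es (n + Suc k) = inst (take ?i es) n"
      using i by (simp add: inst_def)
  qed
  finally show "ty S \<Gamma> (inst es k) (Tot (sub (inst es) (at (rev ts) k)))"
    using assms(4)[OF i] ek by simp
qed (rule assms(2))

lemma act_wcmp:
  assumes "lookup_eff S F = Some D" "j < length (actions D)" "A = actions D ! j" "wctx S \<Gamma>"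
    "length es = length (act_args A)"
    "\<And>i. i < length es \<Longrightarrow> ty S \<Gamma> (es ! i) (Tot (sub (inst (take i es)) (act_args A ! i)))"
  shows "wcmp S \<Gamma> (csub (inst es) (Cmp (User F) (act_res A) (act_wp A))) 0"
proof -
  note r = ok_sigD(7,8)[OF ok assms(1,2,3)]
  have "wcmp S (rev (act_args A)) (Cmp (User F) (act_res A) (act_wp A)) 0"
    using r assms(1) by (intro wcmp_CmpI) auto
  moreover have "styp S \<Gamma> (inst es) (rev (act_args A))"
    using styp_inst[OF ty_wctx(3)[OF r(1)] assms(4,5,6)] .
  ultimately show ?thesis using ty_sub(2)[OF sig_closed] by blast
qed

lemma ktyp_regular:
  assumes "ktyp S \<Gamma> k t"
  shows "\<exists>i. ty S \<Gamma> t (Tot (Universe i))"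
proof -
  have w: "wctx S \<Gamma>" using assms by (rule ty_wctx)
  have U: "wctx S \<Delta> \<Longrightarrow> ty S \<Delta> (Universe i) (Tot (Universe (Suc i)))" for \<Delta> i by (rule t_Universe)
  have v: "wctx S (Universe i # \<Gamma>)" "ty S (Universe i # \<Gamma>) (Var 0) (Tot (Universe i))" for i
    using wctx_ConsI[OF sig_closed U[OF w]] ty_Var_n(1)[OF sig_closed, of "Universe i" \<Gamma>] by auto
  from assms show ?thesis
  proof cases
    case k_Unit
    then show ?thesis using t_Const[OF k_UnitT[OF w]] by blast
  next
    case (k_Eq i)
    have "ty S (Universe i # \<Gamma>) (arr (Var 0) (arr (Var 0) (Universe 0))) (Tot (Universe (max i (max i (Suc 0)))))"
      by (intro ty_arr[OF sig_closed] v U)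
    from t_Pi[OF U[OF w] c_Tot[OF this]] k_Eq show ?thesis by blast
  next
    case (k_Ex i j)
    have "ty S (Universe i # \<Gamma>) (arr (arr (Var 0) (Universe j)) (Universe 0)) (Tot (Universe (max (max i (Suc j)) (Suc 0))))"
      by (intro ty_arr[OF sig_closed] v U)
    from t_Pi[OF U[OF w] c_Tot[OF this]] k_Ex show ?thesis by blast
  qed (use U[OF w] ty_arr[OF sig_closed] ty_const2[OF sig_closed] in \<open>metis+\<close>)
qed

lemma ty_TotD: "wcmp S \<Gamma> (Tot t) i \<Longrightarrow> ty S \<Gamma> t (Tot (Universe i))"
  by (erule wcmp.cases) auto

lemma ty_PiD:
  assumes "ty S \<Gamma> (Pi t c) d"
  shows "\<exists>i j. ty S \<Gamma> t (Tot (Universe i)) \<and> wcmp S (t # \<Gamma>) c j"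
  using ty_gen[OF assms] by auto

lemma ty_RefineD:
  assumes "ty S \<Gamma> (Refine t phi) d"
  shows "\<exists>i j. ty S \<Gamma> t (Tot (Universe i)) \<and> ty S (t # \<Gamma>) phi (Tot (Universe j))"
  using ty_gen[OF assms] by auto

text \<open>The transformer of a case on computations is itself a case whose return type does not
  depend on the scrutinee. The ordinary rule \<open>t_Case\<close> types it, because
  \<open>via\<close> has no effect on a shifted type other than shifting it over the
  summand.\<close>

lemma case_wcmp:
  assumes e: "ty S \<Gamma> e (Tot (sumT t1 t2))" "wctx S (sumT t1 t2 # \<Gamma>)" "wctx S (t1 # \<Gamma>)" "wctx S (t2 # \<Gamma>)"
    and t: "ty S \<Gamma> t (Tot (Universe 0))" and W: "wp_type_of S M = Some W"
    and "wcmp S (t1 # \<Gamma>) (Cmp M (shift t) wp1) i" "wcmp S (t2 # \<Gamma>) (Cmp M (shift t) wp2) j"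
  shows "wcmp S \<Gamma> (Cmp M t (Case (shift (App W t)) e wp1 wp2)) 0"
proof (rule wcmp_CmpI[OF W t])
  obtain k where k: "ty S \<Gamma> (App W t) (Tot (Universe k))" using AppW_ty[OF W t] by blast
  have "ty S (t1 # \<Gamma>) wp1 (Tot (shift (App W t)))" "ty S (t2 # \<Gamma>) wp2 (Tot (shift (App W t)))"
    using wcmp_CmpD(3)[OF assms(7)] wcmp_CmpD(3)[OF assms(8)] W
    by (auto simp: ren_closed fv_stars[OF sig_closed])
  moreover have "sub (via c) (shift u) = shift u" for c u
  proof -
    have "sub (via c) (shift u) = sub (\<lambda>k. Var (Suc k)) u" by (simp add: sub_ren)
    then show ?thesis by (simp only: ren_eq_sub)
  qed
  ultimately have "ty S \<Gamma> (Case (shift (App W t)) e wp1 wp2) (Tot (sub1 e (shift (App W t))))"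
    using ty_shift(1)[OF sig_closed e(2) k] e by (intro t_Case) auto
  then show "ty S \<Gamma> (Case (shift (App W t)) e wp1 wp2) (Tot (App W t))"
    by (simp only: sub1_shift)
qed

lemma at_regular: "wctx S \<Gamma> \<Longrightarrow> k < length \<Gamma> \<Longrightarrow> \<exists>i. ty S \<Gamma> (at \<Gamma> k) (Tot (Universe i))"
proof (induction \<Gamma> arbitrary: k rule: list.induct)
  case (Cons t \<Gamma>)
  have "\<exists>A i. at (t # \<Gamma>) k = shift A \<and> ty S \<Gamma> A (Tot (Universe i))"
  proof (cases k)
    case 0
    then show ?thesis using wctx_ConsD[OF Cons.prems(1)] by (metis at_simps(1))
  next
    case (Suc m)
    then have "m < length \<Gamma>" using Cons.prems(2) by simp
    then obtain i where "ty S \<Gamma> (at \<Gamma> m) (Tot (Universe i))"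
      using Cons.IH wctx_ConsD[OF Cons.prems(1)] by blast
    then show ?thesis unfolding Suc at_simps by blast
  qed
  then obtain A i where A: "at (t # \<Gamma>) k = shift A" "ty S \<Gamma> A (Tot (Universe i))" by blast
  from ty_shift(1)[OF sig_closed Cons.prems(1) A(2)] show ?case unfolding A(1) by auto
qed simp

lemma regular_all:
  "wctx S \<Gamma> \<Longrightarrow> True"
  "ktyp S \<Gamma> k t \<Longrightarrow> True"
  "ty S \<Gamma> e c \<Longrightarrow> \<exists>i. wcmp S \<Gamma> c i"
  "wcmp S \<Gamma> c i \<Longrightarrow> True"
  "sbt S \<Gamma> t1 t2 \<Longrightarrow> True"
  "sbc S \<Gamma> c1 c2 \<Longrightarrow> True"
  "val S \<Gamma> phi \<Longrightarrow> True"
proof (induction rule: wctx_ktyp_ty_wcmp_sbt_sbc_val.inducts)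
  case (t_Var \<Gamma> k)
  then show ?case using at_regular c_Tot by blast
next
  case (t_Const \<Gamma> k t)
  then show ?case using ktyp_regular c_Tot by blast
next
  case (t_Universe \<Gamma> i)
  then show ?case using c_Tot wctx_ktyp_ty_wcmp_sbt_sbc_val.t_Universe by blast
next
  case (t_Refine \<Gamma> t i phi j)
  then show ?case by blast
next
  case (t_Pi \<Gamma> t i c j)
  then show ?case using c_Tot wctx_ktyp_ty_wcmp_sbt_sbc_val.t_Universe ty_wctx(3) by blast
next
  case (t_Lam \<Gamma> t i e c)
  then show ?case using c_Tot wctx_ktyp_ty_wcmp_sbt_sbc_val.t_Pi by blast
next
  case (t_App \<Gamma> e1 t c e2)
  then obtain i where "wcmp S \<Gamma> (Tot (Pi t c)) i" by blast
  then obtain j where "wcmp S (t # \<Gamma>) c j" using ty_TotD ty_PiD by blast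
  then show ?case using ty_sub1(2)[OF sig_closed t_App.IH(3)] by blast
next
  case (t_Case \<Gamma> e t1 t2 t i e1 e2)
  then have "ty S \<Gamma> (sub1 e t) (csub1 e (Tot (Universe i)))"
    by (intro ty_sub1(1)[OF sig_closed])
  then have "ty S \<Gamma> (sub1 e t) (Tot (Universe i))" by simp
  then show ?case using c_Tot by blast
next
  case (t_CaseM \<Gamma> e t1 t2 t e1 M wp1 e2 wp2 W)
  then have "wctx S (sumT t1 t2 # \<Gamma>)" using ty_TotD wctx_ConsI[OF sig_closed] by blast
  with t_CaseM show ?case using case_wcmp by blast
next
  case (t_Ret \<Gamma> t e M R)
  then obtain W where W: "wp_type_of S M = Some W" by (cases M) auto
  then show ?case using t_Ret ret_star_app wcmp_CmpI by blast
next
  case (t_Bind \<Gamma> t2 M W B wp2 t1 e1 wp1 e2)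
  then obtain i where "wcmp S \<Gamma> (Cmp M t1 wp1) i" by blast
  then have "ty S \<Gamma> t1 (Tot (Universe 0))" "ty S \<Gamma> wp1 (Tot (App W t1))"
    using wcmp_CmpD[of \<Gamma> M t1 wp1] t_Bind by auto
  then show ?case using t_Bind bind_star_app wcmp_CmpI by blast
next
  case (t_Lift \<Gamma> e F t wp F' l w)
  then show ?case using lift_star_app by blast
next
  case (t_Act \<Gamma> F D j A es)
  then show ?case using act_wcmp by blast
next
  case (t_Reify \<Gamma> e F t wp D)
  then obtain i where "wcmp S \<Gamma> (Cmp (User F) t wp) i" by blast
  then have "ty S \<Gamma> (apps (repr D) [t, wp]) (Tot (Universe 0))"
    using wcmp_CmpD t_Reify repr_app by fastforce
  then show ?case using c_Tot by blast
next
  case (t_Run \<Gamma> e t wp)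
  then show ?case using wcmp_CmpD(2) c_Tot by blast
next
  case (t_Sub \<Gamma> e c' c i)
  then show ?case by blast
next
  case (t_Reflect \<Gamma> e D t wp F i)
  then show ?case by blast
qed simp_all

lemma regular: "ty S \<Gamma> e c \<Longrightarrow> \<exists>i. wcmp S \<Gamma> c i"
  by (rule regular_all)

lemma regular_Tot: "ty S \<Gamma> e (Tot t) \<Longrightarrow> \<exists>i. ty S \<Gamma> t (Tot (Universe i))"
  using regular ty_TotD by blast

end

section \<open>Validity and ill-typed formulas\<close>

lemma sub_Suc: "sub (\<lambda>k. Var (Suc k)) t = shift t"
  by (simp add: ren_eq_sub)

lemma sub_shift_comp: "sub (\<lambda>k. shift (s k)) t = shift (sub s t)"
  by (simp add: ren_sub)

text \<open>Subtyping never changes the kind of a computation. For user effects the comparison of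
  representations is a single \<open>sbt\<close> and composes along a chain. For \<open>Pure\<close>
  only the kind is recorded, since implications between possibly ill-typed transformers do not
  compose at once; \<open>fimp\<close> deals with them.\<close>

lemma sbc_Tot_all:
  "wctx S \<Gamma> \<Longrightarrow> True"
  "ktyp S \<Gamma> k t \<Longrightarrow> True"
  "ty S \<Gamma> e c \<Longrightarrow> True"
  "wcmp S \<Gamma> c i \<Longrightarrow> True"
  "sbt S \<Gamma> t1 t2 \<Longrightarrow> True"
  "sbc S \<Gamma> c1 c2 \<Longrightarrow> case c1 of Tot a \<Rightarrow> \<exists>b. c2 = Tot b \<and> sbt S \<Gamma> a b
      | Cmp M a w \<Rightarrow> \<exists>a' w'. c2 = Cmp M a' w' \<and>
         (\<forall>F D. M = User F \<longrightarrow> lookup_eff S F = Some D \<longrightarrow> sbt S \<Gamma> (apps (repr D) [a, w]) (apps (repr D) [a', w']))"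
  "val S \<Gamma> phi \<Longrightarrow> True"
proof (induction rule: wctx_ktyp_ty_wcmp_sbt_sbc_val.inducts)
  case (sc_Refl \<Gamma> c)
  then show ?case by (cases c) (auto intro: s_Refl)
next
  case (sc_Trans \<Gamma> c1 c2 c3)
  then show ?case by (cases c1; cases c2; auto) (blast intro: s_Trans)+
qed auto

lemma sbc_TotE: "sbc S \<Gamma> (Tot a) c \<Longrightarrow> \<exists>b. c = Tot b \<and> sbt S \<Gamma> a b"
  using sbc_Tot_all(6)[of S \<Gamma> "Tot a" c] by simp

lemma sbc_Tot_Tot [simp]: "sbc S \<Gamma> (Tot a) (Tot b) \<longleftrightarrow> sbt S \<Gamma> a b"
  using sbc_TotE sc_Tot by fastforce

lemma sbc_to_Tot: "sbc S \<Gamma> c (Tot b) \<Longrightarrow> \<exists>a. c = Tot a \<and> sbt S \<Gamma> a b"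
  using sbc_Tot_all(6)[of S \<Gamma> c "Tot b"] by (cases c) auto

lemma csx_TotE: "csx S \<Gamma> c c' \<Longrightarrow> c = Tot a \<Longrightarrow> \<exists>b. c' = Tot b \<and> sbt S \<Gamma> a b"
  by (induction arbitrary: a rule: csx.induct) (auto dest: sbc_TotE intro: s_Conv, blast intro: s_Trans)

section \<open>Inversion for constants, squashed formulas and cut\<close>

context
  fixes S assumes ok: "ok_sig S"
begin

text \<open>Inverts applications of constants one argument at a time: the function has a known
  product type \<open>Pi t0 (Tot u0)\<close> but was used at a supertype \<open>Pi t d\<close>. The
  argument is brought back to \<open>t0\<close> and the result type is compared with the known
  codomain.\<close>

lemma pi_app:
  assumes "sbt S \<Gamma> (Pi t0 (Tot u0)) (Pi t d)" "ty S \<Gamma> a (Tot t)" "ty S \<Gamma> t0 (Tot (Universe i))"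
  shows "ty S \<Gamma> a (Tot t0) \<and> (\<exists>u. csub1 a d = Tot u \<and> sbt S \<Gamma> (sub1 a u0) u)"
proof -
  have p: "pirel S \<Gamma> t0 (Tot u0) t d" using sbt_Pi_Pi[OF ok_closed[OF ok] assms(1)] .
  have "wctx S (t # \<Gamma>)" using regular_Tot[OF ok assms(2)] wctx_ConsI[OF ok_closed[OF ok]] by blast
  with p have "csx S (t # \<Gamma>) (Tot u0) d" by (simp add: pirel_def s_Refl)
  then obtain u where u: "d = Tot u" "sbt S (t # \<Gamma>) u0 u" using csx_TotE by blast
  have "sbt S \<Gamma> (sub1 a u0) (sub1 a u)" using ty_sub1(3)[OF ok_closed[OF ok] assms(2) u(2)] .
  moreover have "ty S \<Gamma> a (Tot t0)"
    using p assms(2,3) by (auto simp: pirel_def intro: t_Sub sc_Tot c_Tot)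
  ultimately show ?thesis using u by simp
qed

lemma Const_inv: "ty S \<Gamma> (Const k) (Tot A) \<Longrightarrow> \<exists>t. ktyp S \<Gamma> k t \<and> sbt S \<Gamma> t A"
  using ty_gen[of S \<Gamma> "Const k" "Tot A"] by auto

lemma App_obtain:
  assumes "ty S \<Gamma> (App f a) (Tot B)"
  obtains t d where "ty S \<Gamma> f (Tot (Pi t d))" "ty S \<Gamma> a (Tot t)" "sbc S \<Gamma> (csub1 a d) (Tot B)"
  using ty_gen[OF assms] by auto

lemma ty_Universe_in: "ty S \<Gamma> e c \<Longrightarrow> ty S \<Gamma> (Universe i) (Tot (Universe (Suc i)))"
  using ty_wctx(3) t_Universe by blast

lemma formation_inv:
  assumes "ty S \<Gamma> (app2 (Const k) a b) (Tot B)" "k = CProd \<or> k = CSum"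
  shows "\<exists>i j. ty S \<Gamma> a (Tot (Universe i)) \<and> ty S \<Gamma> b (Tot (Universe j)) \<and> sbt S \<Gamma> (Universe (max i j)) B"
proof -
  obtain t d where 1: "ty S \<Gamma> (App (Const k) a) (Tot (Pi t d))" "ty S \<Gamma> b (Tot t)" "sbc S \<Gamma> (csub1 b d) (Tot B)"
    using App_obtain[OF assms(1)] .
  obtain t' d' where 2: "ty S \<Gamma> (Const k) (Tot (Pi t' d'))" "ty S \<Gamma> a (Tot t')" "sbc S \<Gamma> (csub1 a d') (Tot (Pi t d))"
    using App_obtain[OF 1(1)] .
  obtain i j where "sbt S \<Gamma> (arr (Universe i) (arr (Universe j) (Universe (max i j)))) (Pi t' d')"
    using Const_inv[OF 2(1)] assms(2) by (auto elim: ktyp.cases)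
  from pi_app[OF this 2(2) ty_Universe_in[OF 2(1)]]
  have a: "ty S \<Gamma> a (Tot (Universe i))" "sbt S \<Gamma> (arr (Universe j) (Universe (max i j))) (Pi t d)"
    using 2(3) by (auto intro: s_Trans)
  from pi_app[OF this(2) 1(2) ty_Universe_in[OF 2(1)]]
  have "ty S \<Gamma> b (Tot (Universe j))" "sbt S \<Gamma> (Universe (max i j)) B"
    using 1(3) by (auto intro: s_Trans)
  with a show ?thesis by blast
qed

text \<open>Supplies the typing of \<open>b\<close> for the substitution rule of equality, whose
  premises do not state it.\<close>

lemma Eq_inv:
  assumes "ty S \<Gamma> (Eq t a b) (Tot B)"
  shows "ty S \<Gamma> a (Tot t)" "ty S \<Gamma> b (Tot t)"
proof -
  obtain t3 d3 where 3: "ty S \<Gamma> (app2 (Const CEq) t a) (Tot (Pi t3 d3))" "ty S \<Gamma> b (Tot t3)"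
    using App_obtain[OF assms[simplified]] .
  obtain t2 d2 where 2: "ty S \<Gamma> (App (Const CEq) t) (Tot (Pi t2 d2))" "ty S \<Gamma> a (Tot t2)"
    "sbc S \<Gamma> (csub1 a d2) (Tot (Pi t3 d3))"
    using App_obtain[OF 3(1)] .
  obtain t1 d1 where 1: "ty S \<Gamma> (Const CEq) (Tot (Pi t1 d1))" "ty S \<Gamma> t (Tot t1)"
    "sbc S \<Gamma> (csub1 t d1) (Tot (Pi t2 d2))"
    using App_obtain[OF 2(1)] .
  obtain i where "sbt S \<Gamma> (Pi (Universe i) (Tot (arr (Var 0) (arr (Var 0) (Universe 0))))) (Pi t1 d1)"
    using Const_inv[OF 1(1)] by (auto elim: ktyp.cases)
  from pi_app[OF this 1(2) ty_Universe_in[OF 1(1)]]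
  have t: "ty S \<Gamma> t (Tot (Universe i))" "sbt S \<Gamma> (arr t (arr t (Universe 0))) (Pi t2 d2)"
    using 1(3) by (auto intro: s_Trans)
  from pi_app[OF t(2) 2(2) t(1)]
  have a: "ty S \<Gamma> a (Tot t)" "sbt S \<Gamma> (arr t (Universe 0)) (Pi t3 d3)"
    using 2(3) by (auto intro: s_Trans)
  from pi_app[OF a(2) 3(2) t(1)] a(1) show "ty S \<Gamma> a (Tot t)" "ty S \<Gamma> b (Tot t)" by auto
qed

lemma ty_Eq:
  assumes "ty S \<Gamma> a (Tot t)" "ty S \<Gamma> b (Tot t)"
  shows "ty S \<Gamma> (Eq t a b) (Tot (Universe 0))"
proof -
  obtain i where t: "ty S \<Gamma> t (Tot (Universe i))" using regular_Tot[OF ok assms(1)] by blast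
  have "ty S \<Gamma> (Const CEq) (Tot (Pi (Universe i) (Tot (arr (Var 0) (arr (Var 0) (Universe 0))))))"
    using t_Const[OF k_Eq[OF ty_wctx(3)[OF t]]] .
  from t_App[OF this t] have "ty S \<Gamma> (App (Const CEq) t) (Tot (arr t (arr t (Universe 0))))" by simp
  then have "ty S \<Gamma> (app2 (App (Const CEq) t) a b) (Tot (Universe 0))"
    using assms by (blast intro: ty_app_arr[OF ok_closed[OF ok]])
  then show ?thesis by simp
qed

lemma ty_Exi:
  assumes "ty S (t # \<Gamma>) phi (Tot (Universe j))"
  shows "ty S \<Gamma> (Exi t phi) (Tot (Universe 0))"
proof -
  obtain i where t: "ty S \<Gamma> t (Tot (Universe i))" using wctx_ConsD ty_wctx(3)[OF assms] by blast
  have "ty S \<Gamma> (Const CEx) (Tot (Pi (Universe i) (Tot (arr (arr (Var 0) (Universe j)) (Universe 0)))))"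
    using t_Const[OF k_Ex[OF ty_wctx(3)[OF t]]] .
  from t_App[OF this t] have "ty S \<Gamma> (App (Const CEx) t) (Tot (arr (arr t (Universe j)) (Universe 0)))" by simp
  moreover have "ty S \<Gamma> (Lam t phi) (Tot (arr t (Universe j)))" using t_Lam[OF t assms] by simp
  ultimately show ?thesis by (rule ty_app_arr[OF ok_closed[OF ok]])
qed

lemma ty_unit:
  assumes "wctx S \<Gamma>"
  shows "ty S \<Gamma> unitT (Tot (Universe 0))" "ty S \<Gamma> (Const CUnit) (Tot unitT)" "wctx S (unitT # \<Gamma>)"
    "ty S \<Gamma> Falsum (Tot (Universe 0))"
  using assms t_Const k_UnitT k_Unit k_False wctx_ConsI[OF ok_closed[OF ok]] by blast+

lemma ty_squash:
  assumes "ty S \<Gamma> X (Tot (Universe i))"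
  shows "ty S \<Gamma> (squash X) (Tot (Universe 0))"
  using ty_unit[OF ty_wctx(3)[OF assms]] ty_shift(1)[OF ok_closed[OF ok] _ assms, of unitT] t_Refine by fastforce

text \<open>The unit variable introduced by a squash is instantiated with
  \<open>CUnit\<close>.\<close>

lemma squash_inv:
  assumes "ty S \<Gamma> (squash X) c"
  shows "\<exists>i. ty S \<Gamma> X (Tot (Universe i))"
proof -
  obtain i where "ty S (unitT # \<Gamma>) (shift X) (Tot (Universe i))"
    using ty_RefineD[OF ok assms] by blast
  from ty_sub1(1)[OF ok_closed[OF ok] ty_unit(2)[OF ty_wctx(3)[OF assms]] this] show ?thesis by auto
qed

text \<open>Obtained by eliminating \<open>Disj d Falsum\<close>, whose second branch is
  absurd.\<close>

lemma val_cut: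
  assumes "val S \<Gamma> d" "ty S \<Gamma> d (Tot (Universe j))" "val S (d # \<Gamma>) (shift r)" "ty S \<Gamma> r (Tot (Universe i))"
  shows "val S \<Gamma> r"
proof (rule v_DisjE)
  have w: "wctx S \<Gamma>" using assms(2) by (rule ty_wctx)
  show "val S \<Gamma> (Disj d Falsum)" using assms(1) ty_unit(4)[OF w] by (rule v_DisjI1)
  show "wctx S (d # \<Gamma>)" "val S (d # \<Gamma>) (shift r)" "ty S \<Gamma> r (Tot (Universe i))"
    using assms by (auto intro: ty_wctx)
  show w': "wctx S (Falsum # \<Gamma>)" using ty_unit(4)[OF w] by (rule wctx_ConsI[OF ok_closed[OF ok]])
  have "val S (Falsum # \<Gamma>) Falsum" using ty_Var_n(1)[OF ok_closed[OF ok] w'] v_Hyp by fastforce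
  then show "val S (Falsum # \<Gamma>) (shift r)"
    using ty_shift(1)[OF ok_closed[OF ok] w' assms(4)] v_FalseE by fastforce
qed

lemma conv_shift: "conv S t u \<Longrightarrow> conv S (shift t) (shift u)"
  using conv_sub[OF ok_closed[OF ok]] by (simp add: ren_eq_sub)

text \<open>No rule of validity converts a formula. Instead a variable of type \<open>X\<close> is
  retyped at \<open>Y\<close> by subsumption, which makes \<open>Y\<close> valid under the
  hypothesis \<open>X\<close>, and a cut discharges the hypothesis. Both formulas have to be typed
  for this.\<close>

lemma val_conv:
  assumes "val S \<Gamma> X" "conv S X Y" "ty S \<Gamma> X (Tot (Universe i))" "ty S \<Gamma> Y (Tot (Universe j))"
  shows "val S \<Gamma> Y"
proof (rule val_cut[OF assms(1,3) _ assms(4)])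
  have w: "wctx S (X # \<Gamma>)" using assms(3) by (rule wctx_ConsI[OF ok_closed[OF ok]])
  have "ty S (X # \<Gamma>) (Var 0) (Tot (shift Y))"
    using ty_conv[OF ty_Var_n(1)[OF ok_closed[OF ok] w] conv_shift[OF assms(2)]] ty_shift(1)[OF ok_closed[OF ok] w assms(4)] by simp
  then show "val S (X # \<Gamma>) (shift Y)" by (rule v_Hyp)
qed

text \<open>A variable of squashed type is an element of a refinement of \<open>unitT\<close>, so
  \<open>v_Refine\<close> yields the formula itself.\<close>

lemma unsquash:
  assumes "val S \<Gamma> (squash X)" "ty S \<Gamma> X (Tot (Universe i))"
  shows "val S \<Gamma> X"
proof (rule val_cut[OF assms(1) ty_squash[OF assms(2)] _ assms(2)])
  have w: "wctx S (squash X # \<Gamma>)" using ty_squash[OF assms(2)] by (rule wctx_ConsI[OF ok_closed[OF ok]])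
  have "ty S (squash X # \<Gamma>) (Var 0) (Tot (Refine unitT (shift (shift X))))"
    using ty_Var_n(1)[OF ok_closed[OF ok] w] by simp
  from v_Refine[OF this] show "val S (squash X # \<Gamma>) (shift X)" by simp
qed

lemma styp_Var: "wctx S \<Gamma> \<Longrightarrow> styp S \<Gamma> Var \<Gamma>"
  unfolding styp_def using t_Var by (simp del: at_simps)

lemma styp_Suc: "wctx S (d # \<Gamma>) \<Longrightarrow> styp S (d # \<Gamma>) (\<lambda>k. Var (Suc k)) \<Gamma>"
  unfolding styp_def
proof (intro conjI allI impI)
  fix k assume w: "wctx S (d # \<Gamma>)" and k: "k < length \<Gamma>"
  then have "ty S (d # \<Gamma>) (Var (Suc k)) (Tot (at (d # \<Gamma>) (Suc k)))" by (intro t_Var) auto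
  then show "ty S (d # \<Gamma>) (Var (Suc k)) (Tot (sub (\<lambda>k. Var (Suc k)) (at \<Gamma> k)))"
    by (simp only: sub_Suc at_simps)
qed

lemma styp_comp:
  assumes "styp S \<Delta> s \<Gamma>" "styp S \<Theta> r \<Delta>"
  shows "styp S \<Theta> (\<lambda>k. sub r (s k)) \<Gamma>"
  unfolding styp_def
proof (intro conjI allI impI)
  show "wctx S \<Theta>" using assms(2) by (simp add: styp_def)
  fix k assume "k < length \<Gamma>"
  then have "ty S \<Delta> (s k) (Tot (sub s (at \<Gamma> k)))" using assms(1) unfolding styp_def by blast
  from ty_sub(1)[OF ok_closed[OF ok] assms(2) this] show "ty S \<Theta> (sub r (s k)) (Tot (sub (\<lambda>k. sub r (s k)) (at \<Gamma> k)))"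
    by (simp only: csub.simps sub_sub)
qed

lemma styp_tail:
  assumes "styp S \<Delta> s (d # \<Gamma>)"
  shows "styp S \<Delta> (\<lambda>k. s (Suc k)) \<Gamma>"
  unfolding styp_def
proof (intro conjI allI impI)
  fix k assume "k < length \<Gamma>"
  then have "ty S \<Delta> (s (Suc k)) (Tot (sub s (at (d # \<Gamma>) (Suc k))))" using assms unfolding styp_def by auto
  then show "ty S \<Delta> (s (Suc k)) (Tot (sub (\<lambda>k. s (Suc k)) (at \<Gamma> k)))"
    by (simp only: at_simps sub_ren)
qed (use assms in \<open>simp add: styp_def\<close>)

end

text \<open>
  If \<open>Imp p q\<close> is typed then \<open>q\<close> is typed under the hypothesis \<open>p\<close>, but not without it, even when \<open>p\<close> is
  valid: a valid formula is only typed after adding valid formulas to the context.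
\<close>

inductive qty :: "signature \<Rightarrow> ctx \<Rightarrow> tm \<Rightarrow> bool" for S where
  qty_typed: "ty S \<Gamma> phi (Tot (Universe i)) \<Longrightarrow> qty S \<Gamma> phi"
| qty_ext: "ty S \<Gamma> d (Tot (Universe i)) \<Longrightarrow> val S \<Gamma> d \<Longrightarrow> qty S (d # \<Gamma>) (shift phi) \<Longrightarrow> qty S \<Gamma> phi"

section \<open>Formulas that are typed under valid hypotheses\<close>

context
  fixes S assumes ok: "ok_sig S"
begin

lemma qty_sub:
  assumes "qty S \<Gamma> phi" "styp S \<Delta> s \<Gamma>"
  shows "qty S \<Delta> (sub s phi)"
  using assms
proof (induction arbitrary: \<Delta> s)
  case (qty_typed \<Gamma> phi i)
  then show ?case using ty_sub(1)[OF ok_closed[OF ok] qty_typed(2,1)] qty.qty_typed by simp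
next
  case (qty_ext \<Gamma> d i phi)
  have "ty S \<Delta> (sub s d) (Tot (Universe i))" "val S \<Delta> (sub s d)"
    using ty_sub[OF ok_closed[OF ok] qty_ext.prems] qty_ext.hyps by fastforce+
  moreover from styp_ups[OF ok_closed[OF ok] qty_ext.prems this(1)]
  have "qty S (sub s d # \<Delta>) (shift (sub s phi))" using qty_ext.IH by fastforce
  ultimately show ?case by (rule qty.qty_ext)
qed

text \<open>To transfer \<open>qty\<close> from \<open>phi\<close> to \<open>psi\<close> one may
  pretend that \<open>phi\<close> is typed. The price is an arbitrary substitution instance, since
  the hypotheses that make \<open>phi\<close> typed extend the context.\<close>

lemma qty_lift:
  assumes "qty S \<Gamma> phi" "\<And>\<Delta> s i. styp S \<Delta> s \<Gamma> \<Longrightarrow> ty S \<Delta> (sub s phi) (Tot (Universe i)) \<Longrightarrow> qty S \<Delta> (sub s psi)"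
  shows "qty S \<Gamma> psi"
  using assms
proof (induction arbitrary: psi)
  case (qty_typed \<Gamma> phi i)
  then show ?case using styp_Var[OF ok ty_wctx(3)[OF qty_typed(1)]] by fastforce
next
  case (qty_ext \<Gamma> d i phi)
  have "qty S (d # \<Gamma>) (shift psi)"
  proof (rule qty_ext.IH)
    fix \<Delta> s i assume "styp S \<Delta> s (d # \<Gamma>)" "ty S \<Delta> (sub s (shift phi)) (Tot (Universe i))"
    then show "qty S \<Delta> (sub s (shift psi))"
      using qty_ext.prems[OF styp_tail[OF ok]] by (simp add: sub_ren)
  qed
  with qty_ext show ?case by (blast intro: qty.qty_ext)
qed

text \<open>The same principle for proving a typed formula \<open>r\<close> valid: the added
  hypotheses are valid, so cuts remove them at the end.\<close>

lemma qty_elim: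
  assumes "qty S \<Gamma> phi" "ty S \<Gamma> r (Tot (Universe j))"
    "\<And>\<Delta> s i. styp S \<Delta> s \<Gamma> \<Longrightarrow> ty S \<Delta> (sub s phi) (Tot (Universe i)) \<Longrightarrow> val S \<Delta> (sub s r)"
  shows "val S \<Gamma> r"
  using assms
proof (induction arbitrary: r)
  case (qty_typed \<Gamma> phi i)
  then show ?case using styp_Var[OF ok ty_wctx(3)[OF qty_typed(1)]] by fastforce
next
  case (qty_ext \<Gamma> d i phi)
  have w: "wctx S (d # \<Gamma>)" using qty_ext.hyps(1) by (rule wctx_ConsI[OF ok_closed[OF ok]])
  have "val S (d # \<Gamma>) (shift r)"
  proof (rule qty_ext.IH)
    show "ty S (d # \<Gamma>) (shift r) (Tot (Universe j))"
      using ty_shift(1)[OF ok_closed[OF ok] w qty_ext.prems(1)] by simp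
    fix \<Delta> s i assume "styp S \<Delta> s (d # \<Gamma>)" "ty S \<Delta> (sub s (shift phi)) (Tot (Universe i))"
    then show "val S \<Delta> (sub s (shift r))"
      using qty_ext.prems(2)[OF styp_tail[OF ok]] by (simp add: sub_ren)
  qed
  then show ?case by (rule val_cut[OF ok qty_ext.hyps(2,1) _ qty_ext.prems(1)])
qed

text \<open>A hypothesis \<open>d\<close> that makes the body typed lives below the bound variable.
  Outside the product it is replaced by the hypothesis \<open>Pi t (Tot d)\<close>, valid by
  generalization, and inside it is recovered by applying that hypothesis to the bound variable. The
  substitution \<open>s\<close> is part of the induction because each such step replaces a proof
  variable by an application.\<close>

lemma qty_Pi:
  assumes "qty S \<Gamma>0 phi" "wctx S (t # \<Gamma>)" "styp S (t # \<Gamma>) s \<Gamma>0"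
  shows "qty S \<Gamma> (Pi t (Tot (sub s phi)))"
  using assms
proof (induction arbitrary: \<Gamma> t s)
  case (qty_typed \<Gamma>0 phi i)
  obtain j where t: "ty S \<Gamma> t (Tot (Universe j))" using wctx_ConsD[OF qty_typed(2)] by blast
  have "ty S (t # \<Gamma>) (sub s phi) (Tot (Universe i))"
    using ty_sub(1)[OF ok_closed[OF ok] qty_typed(3,1)] by simp
  from t_Pi[OF t c_Tot[OF this]] show ?case by (rule qty.qty_typed)
next
  case (qty_ext \<Gamma>0 d i phi)
  note cs = ok_closed[OF ok]
  obtain j where t: "ty S \<Gamma> t (Tot (Universe j))" using wctx_ConsD[OF qty_ext.prems(1)] by blast
  let ?d = "sub s d"
  let ?D = "Pi t (Tot ?d)"
  have d: "ty S (t # \<Gamma>) ?d (Tot (Universe i))" "val S (t # \<Gamma>) ?d"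
    using ty_sub(1,5)[OF cs qty_ext.prems(2)] qty_ext.hyps by fastforce+
  have D: "ty S \<Gamma> ?D (Tot (Universe (max j i)))" using t_Pi[OF t c_Tot[OF d(1)]] .
  have vD: "val S \<Gamma> ?D" using unsquash[OF ok v_AllI[OF t d(2)] D] .
  have wD: "wctx S (?D # \<Gamma>)" using D by (rule wctx_ConsI[OF cs])
  let ?t = "shift t"
  let ?G = "?t # ?D # \<Gamma>"
  have t': "ty S (?D # \<Gamma>) ?t (Tot (Universe j))" using ty_shift(1)[OF cs wD t] by simp
  have w': "wctx S ?G" using t' by (rule wctx_ConsI[OF cs])
  \<comment> \<open>In \<open>?G\<close>, index 1 is the proof of the generalized hypothesis and
    index 0 the bound variable, so their application proves \<open>d\<close> at that variable. The
    other values of \<open>s\<close> make room for the new hypothesis below the binder.\<close>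
  define u where "u = case_nat (App (Var 1) (Var 0)) (\<lambda>k. ren (upr Suc) (s k))"
  have ren: "styp S ?G (\<lambda>k. Var (upr Suc k)) (t # \<Gamma>)"
    using styp_ups[OF cs styp_Suc[OF ok wD], of t j] t' unfolding sub_Suc by (simp add: ups_Var_comp)
  have "styp S ?G u (d # \<Gamma>0)"
    unfolding styp_def
  proof (intro conjI allI impI)
    fix k assume k: "k < length (d # \<Gamma>0)"
    show "ty S ?G (u k) (Tot (sub u (at (d # \<Gamma>0) k)))"
    proof (cases k)
      case 0
      have "ty S ?G (Var 1) (Tot (shift (shift ?D)))" using ty_Var_n(2)[OF cs w'] .
      then have "ty S ?G (App (Var 1) (Var 0)) (csub1 (Var 0) (Tot (ren (upr Suc) (ren (upr Suc) ?d))))"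
        using ty_Var_n(1)[OF cs w'] by (intro t_App[where t="shift ?t"]) simp_all
      moreover have "sub1 (Var 0) (ren (upr Suc) (ren (upr Suc) ?d)) = sub u (shift d)"
      proof -
        have "sub1 (Var 0) (ren (upr Suc) (ren (upr Suc) ?d)) = sub (\<lambda>k. Var (upr Suc k)) ?d"
          unfolding sub_ren by (rule sub_cong_fv) (simp add: inst_def upr_def split: nat.split)
        also have "\<dots> = sub u (shift d)" by (simp add: sub_sub sub_ren u_def ren_eq_sub)
        finally show ?thesis .
      qed
      ultimately show ?thesis using 0 by (simp only: at_simps csub.simps) (simp add: u_def)
    next
      case (Suc m)
      then have "ty S (t # \<Gamma>) (s m) (Tot (sub s (at \<Gamma>0 m)))"
        using qty_ext.prems(2) k unfolding styp_def by auto
      from ty_sub(1)[OF cs ren this] Suc show ?thesis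
        by (simp only: at_simps sub_ren csub.simps u_def nat.case) (simp only: ren_eq_sub sub_sub)
    qed
  qed (rule w')
  from qty_ext.IH[OF w' this] have "qty S (?D # \<Gamma>) (Pi ?t (Tot (sub u (shift phi))))" .
  moreover have "sub u (shift phi) = ren (upr Suc) (sub s phi)"
    by (simp add: sub_ren ren_sub u_def)
  ultimately have "qty S (?D # \<Gamma>) (shift (Pi t (Tot (sub s phi))))" by simp
  with D vD show ?case by (rule qty.qty_ext)
qed

end

context
  fixes S assumes ok: "ok_sig S"
begin

lemma qty_squash: "qty S \<Gamma> phi \<Longrightarrow> qty S \<Gamma> (squash phi)"
  by (erule qty_lift[OF ok]) (auto intro!: qty_typed dest: ty_squash[OF ok])

lemma qty_unsquash: "qty S \<Gamma> (squash phi) \<Longrightarrow> qty S \<Gamma> phi"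
proof (erule qty_lift[OF ok])
  fix \<Delta> s i assume "ty S \<Delta> (sub s (squash phi)) (Tot (Universe i))"
  then obtain j where "ty S \<Delta> (sub s phi) (Tot (Universe j))" using squash_inv[OF ok] by fastforce
  then show "qty S \<Delta> (sub s phi)" by (rule qty_typed)
qed

lemma qty_const2:
  assumes "k = CProd \<or> k = CSum"
  shows "qty S \<Gamma> p \<Longrightarrow> qty S \<Gamma> q \<Longrightarrow> qty S \<Gamma> (app2 (Const k) p q)"
    "qty S \<Gamma> (app2 (Const k) p q) \<Longrightarrow> qty S \<Gamma> p" "qty S \<Gamma> (app2 (Const k) p q) \<Longrightarrow> qty S \<Gamma> q"
proof -
  show "qty S \<Gamma> (app2 (Const k) p q)" if p: "qty S \<Gamma> p" and q: "qty S \<Gamma> q"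
  proof (rule qty_lift[OF ok p])
    fix \<Delta> s i assume s: "styp S \<Delta> s \<Gamma>" and pt: "ty S \<Delta> (sub s p) (Tot (Universe i))"
    show "qty S \<Delta> (sub s (app2 (Const k) p q))"
    proof (rule qty_lift[OF ok qty_sub[OF ok q s]])
      fix \<Theta> r j assume r: "styp S \<Theta> r \<Delta>" and "ty S \<Theta> (sub r (sub s q)) (Tot (Universe j))"
      moreover have "ty S \<Theta> (sub r (sub s p)) (Tot (Universe i))"
        using ty_sub(1)[OF ok_closed[OF ok] r pt] by simp
      ultimately show "qty S \<Theta> (sub r (sub s (app2 (Const k) p q)))"
        using ty_const2[OF ok_closed[OF ok]] assms by (intro qty_typed[of _ _ _ "max i j"]) auto
    qed
  qed
  show "qty S \<Gamma> p" if "qty S \<Gamma> (app2 (Const k) p q)"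
    by (rule qty_lift[OF ok that]) (use formation_inv[OF ok _ assms] in \<open>fastforce intro: qty_typed\<close>)
  show "qty S \<Gamma> q" if "qty S \<Gamma> (app2 (Const k) p q)"
    by (rule qty_lift[OF ok that]) (use formation_inv[OF ok _ assms] in \<open>fastforce intro: qty_typed\<close>)
qed

text \<open>Extra hypotheses arise only in \<open>v_ImpE\<close>, where the conclusion is typed
  under the valid premise \<open>p\<close>. They cross a binder only in \<open>v_AllI\<close>, by
  \<open>qty_Pi\<close>; in the remaining cases the formula is typed outright or inherits
  \<open>qty\<close> from a premise.\<close>

lemma val_qty_all:
  "wctx S \<Gamma> \<Longrightarrow> True"
  "ktyp S \<Gamma> k t \<Longrightarrow> True"
  "ty S \<Gamma> e c \<Longrightarrow> True"
  "wcmp S \<Gamma> c i \<Longrightarrow> True"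
  "sbt S \<Gamma> t1 t2 \<Longrightarrow> True"
  "sbc S \<Gamma> c1 c2 \<Longrightarrow> True"
  "val S \<Gamma> phi \<Longrightarrow> qty S \<Gamma> phi"
proof (induction rule: wctx_ktyp_ty_wcmp_sbt_sbc_val.inducts)
  case (v_Hyp \<Gamma> e phi)
  then show ?case using regular_Tot[OF ok] qty_typed by blast
next
  case (v_Refine \<Gamma> e t phi)
  obtain i where "ty S \<Gamma> (Refine t phi) (Tot (Universe i))" using regular_Tot[OF ok v_Refine(1)] by blast
  then obtain i j where t: "ty S \<Gamma> t (Tot (Universe i))" "ty S (t # \<Gamma>) phi (Tot (Universe j))"
    using ty_RefineD[OF ok] by blast
  have "ty S \<Gamma> e (Tot t)" using t_Sub[OF v_Refine(1) _ c_Tot[OF t(1)]] s_RefineL by simp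
  from ty_sub1(1)[OF ok_closed[OF ok] this t(2)] show ?case by (auto intro: qty_typed)
next
  case (v_ConjI \<Gamma> p q)
  then have "qty S \<Gamma> (prodT p q)" by (intro qty_const2(1)) simp_all
  then show ?case by (rule qty_squash)
next
  case (v_ConjE1 \<Gamma> p q)
  then show ?case using qty_unsquash qty_const2(2) by blast
next
  case (v_ConjE2 \<Gamma> p q)
  then show ?case using qty_unsquash qty_const2(3) by blast
next
  case (v_DisjI1 \<Gamma> p q i)
  then have "qty S \<Gamma> (sumT p q)" by (intro qty_const2(1)) (auto intro: qty_typed)
  then show ?case by (rule qty_squash)
next
  case (v_DisjI2 \<Gamma> q p i)
  then have "qty S \<Gamma> (sumT p q)" by (intro qty_const2(1)) (auto intro: qty_typed)
  then show ?case by (rule qty_squash)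
next
  case (v_ImpI \<Gamma> p i q j)
  then show ?case using ty_arr[OF ok_closed[OF ok]] qty_typed qty_squash by blast
next
  case (v_ImpE \<Gamma> p q)
  show ?case
  proof (rule qty_lift[OF ok qty_unsquash[OF v_ImpE.IH(2)]])
    fix \<Delta> s i assume s: "styp S \<Delta> s \<Gamma>" and "ty S \<Delta> (sub s (arr p q)) (Tot (Universe i))"
    then have "ty S \<Delta> (arr (sub s p) (sub s q)) (Tot (Universe i))" by simp
    then obtain i j where *: "ty S \<Delta> (sub s p) (Tot (Universe i))"
      "ty S (sub s p # \<Delta>) (shift (sub s q)) (Tot (Universe j))"
      using ty_PiD[OF ok] ty_TotD[OF ok] by blast
    with ty_sub(5)[OF ok_closed[OF ok] s v_ImpE.IH(3)] show "qty S \<Delta> (sub s q)"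
      by (blast intro: qty_ext qty_typed)
  qed
next
  case (v_AllI \<Gamma> t i phi)
  have w: "wctx S (t # \<Gamma>)" using v_AllI(1) by (rule wctx_ConsI[OF ok_closed[OF ok]])
  have "qty S \<Gamma> (Pi t (Tot phi))" using qty_Pi[OF ok v_AllI.IH(4) w styp_Var[OF ok w]] by simp
  then show ?case by (rule qty_squash)
next
  case (v_AllE \<Gamma> t phi e)
  show ?case
  proof (rule qty_lift[OF ok qty_unsquash[OF v_AllE.IH(2)]])
    fix \<Delta> s i assume s: "styp S \<Delta> s \<Gamma>" and "ty S \<Delta> (sub s (Pi t (Tot phi))) (Tot (Universe i))"
    then have "ty S \<Delta> (Pi (sub s t) (Tot (sub (ups s) phi))) (Tot (Universe i))" by simp
    then obtain j where *: "ty S (sub s t # \<Delta>) (sub (ups s) phi) (Tot (Universe j))"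
      using ty_PiD[OF ok] ty_TotD[OF ok] by blast
    have "ty S \<Delta> (sub s e) (Tot (sub s t))" using ty_sub(1)[OF ok_closed[OF ok] s v_AllE.IH(3)] by simp
    from ty_sub1(1)[OF ok_closed[OF ok] this *] show "qty S \<Delta> (sub s (sub1 e phi))"
      by (auto simp: sub_sub1 intro: qty_typed)
  qed
next
  case (v_ExI t \<Gamma> phi i e)
  then show ?case using ty_Exi[OF ok] qty_typed by blast
next
  case (v_EqRefl \<Gamma> e t)
  then show ?case using ty_Eq[OF ok] qty_typed by blast
next
  case (v_EqSubst t \<Gamma> phi i a b)
  show ?case
  proof (rule qty_lift[OF ok v_EqSubst.IH(6)])
    fix \<Delta> s j assume s: "styp S \<Delta> s \<Gamma>" and "ty S \<Delta> (sub s (Eq t a b)) (Tot (Universe j))"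
    then have b: "ty S \<Delta> (sub s b) (Tot (sub s t))" using Eq_inv(2)[OF ok] by simp
    obtain k where "ty S \<Gamma> t (Tot (Universe k))" using wctx_ConsD[OF v_EqSubst.IH(1)] by blast
    from ty_sub(1)[OF ok_closed[OF ok] s this] have "ty S \<Delta> (sub s t) (Tot (Universe k))" by simp
    from ty_sub(1)[OF ok_closed[OF ok] styp_ups[OF ok_closed[OF ok] s this] v_EqSubst.IH(3)]
    have "ty S (sub s t # \<Delta>) (sub (ups s) phi) (Tot (Universe i))" by simp
    from ty_sub1(1)[OF ok_closed[OF ok] b this] show "qty S \<Delta> (sub s (sub1 b phi))"
      by (auto simp: sub_sub1 intro: qty_typed)
  qed
next
  case (v_EqRed a b \<Gamma> e t)
  then show ?case using ty_Eq[OF ok] qty_typed by blast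
next
  case (v_EqExt \<Gamma> f t u g)
  then show ?case using ty_Eq[OF ok] qty_typed by blast
next
  case (v_SumCase \<Gamma> e t1 t2 phi i)
  from ty_sub1(1)[OF ok_closed[OF ok] v_SumCase.IH(1,9)] show ?case by (auto intro: qty_typed)
qed (simp | blast intro: qty_typed)+

lemma val_qty: "val S \<Gamma> phi \<Longrightarrow> qty S \<Gamma> phi"
  by (rule val_qty_all)

text \<open>
  \<open>qv\<close> is validity up to conversion in continuation form, which makes sense for formulas that are typed
  only under valid hypotheses. \<open>fimp\<close> is the Kripke form of the implication between weakest
  preconditions in \<open>sc_Pure\<close>; it composes although the intermediate ones need not be typed.
\<close>

definition qv :: "ctx \<Rightarrow> tm \<Rightarrow> bool" where
  "qv \<Gamma> phi \<longleftrightarrow> (\<forall>r i. ty S \<Gamma> r (Tot (Universe i)) \<longrightarrow>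
     (\<forall>\<Delta> s X j. styp S \<Delta> s \<Gamma> \<longrightarrow> conv S X (sub s phi) \<longrightarrow> ty S \<Delta> X (Tot (Universe j)) \<longrightarrow> val S \<Delta> X \<longrightarrow>
        val S \<Delta> (sub s r)) \<longrightarrow> val S \<Gamma> r)"

definition fimp :: "ctx \<Rightarrow> tm \<Rightarrow> tm \<Rightarrow> tm \<Rightarrow> bool" where
  "fimp \<Gamma> u' w' w \<longleftrightarrow> (\<forall>\<Delta> s p T i. styp S \<Delta> s \<Gamma> \<longrightarrow> ty S \<Delta> p (Tot (arr T (Universe 0))) \<longrightarrow>
     ty S \<Delta> T (Tot (Universe i)) \<longrightarrow> sbt S \<Delta> (sub s u') T \<longrightarrow>
     qv \<Delta> (App (sub s w') p) \<longrightarrow> qv \<Delta> (App (sub s w) p))"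

section \<open>Implications between predicate transformers\<close>

lemma qv_conv:
  assumes "qv \<Gamma> phi" "conv S phi psi"
  shows "qv \<Gamma> psi"
proof -
  have "conv S (sub s psi) (sub s phi)" for s
    using conv_sub[OF ok_closed[OF ok] assms(2)] conv_sym by blast
  then have "conv S X (sub s phi) \<Longrightarrow> conv S X (sub s psi)" for X s
    using conv_sym conv_trans by blast
  with assms(1) show ?thesis unfolding qv_def by blast
qed

lemma val_qv:
  assumes "val S \<Gamma> X" "ty S \<Gamma> X (Tot (Universe i))"
  shows "qv \<Gamma> X"
  unfolding qv_def
proof (intro allI impI)
  fix r j
  assume "ty S \<Gamma> r (Tot (Universe j))"
    and *: "\<forall>\<Delta> s X' j. styp S \<Delta> s \<Gamma> \<longrightarrow> conv S X' (sub s X) \<longrightarrow> ty S \<Delta> X' (Tot (Universe j)) \<longrightarrow> val S \<Delta> X' \<longrightarrow>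
        val S \<Delta> (sub s r)"
  show "val S \<Gamma> r"
    using *[rule_format, OF styp_Var[OF ok ty_wctx(3)[OF assms(2)]], of X i] assms by simp
qed

text \<open>A typed \<open>phi\<close> may be chosen as its own goal in the continuation;
  \<open>val_conv\<close> then leads back from any typed formula convertible to it.\<close>

lemma qv_val:
  assumes "qv \<Gamma> phi" "ty S \<Gamma> phi (Tot (Universe i))"
  shows "val S \<Gamma> phi"
proof (rule assms(1)[unfolded qv_def, rule_format, OF assms(2)])
  fix \<Delta> s X j
  assume "styp S \<Delta> s \<Gamma>" "conv S X (sub s phi)" "ty S \<Delta> X (Tot (Universe j))" "val S \<Delta> X"
  then show "val S \<Delta> (sub s phi)"
    using val_conv[OF ok] ty_sub(1)[OF ok_closed[OF ok] _ assms(2)] by fastforce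
qed

lemma fimp_trans:
  assumes "fimp \<Gamma> u3 w3 w2" "fimp \<Gamma> u2 w2 w1" "sbt S \<Gamma> u2 u3"
  shows "fimp \<Gamma> u3 w3 w1"
  unfolding fimp_def
proof (intro allI impI)
  fix \<Delta> s p T i
  assume *: "styp S \<Delta> s \<Gamma>" "ty S \<Delta> p (Tot (arr T (Universe 0)))" "ty S \<Delta> T (Tot (Universe i))"
    "sbt S \<Delta> (sub s u3) T" "qv \<Delta> (App (sub s w3) p)"
  have "sbt S \<Delta> (sub s u2) T" using ty_sub(3)[OF ok_closed[OF ok] *(1) assms(3)] *(4) by (rule s_Trans)
  with * assms(1,2) show "qv \<Delta> (App (sub s w1) p)" unfolding fimp_def by blast
qed

lemma fimp_conv:
  assumes "conv S w' w"
  shows "fimp \<Gamma> u w' w"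
  unfolding fimp_def
  using qv_conv conv_app conv_sub[OF ok_closed[OF ok] assms] conv_refl by blast

lemma ty_weaken_pred:
  assumes "ty S \<Gamma> p (Tot (arr T (Universe 0)))" "sbt S \<Gamma> u T" "ty S \<Gamma> u (Tot (Universe i))"
  shows "ty S \<Gamma> p (Tot (arr u (Universe 0)))"
proof (rule t_Sub[OF assms(1)])
  have "wctx S (u # \<Gamma>)" using assms(3) by (rule wctx_ConsI[OF ok_closed[OF ok]])
  then show "sbc S \<Gamma> (Tot (arr T (Universe 0))) (Tot (arr u (Universe 0)))"
    using assms(2) by (simp add: s_Pi sc_Refl)
  show "wcmp S \<Gamma> (Tot (arr u (Universe 0))) (max i (Suc 0))"
    using ty_arr[OF ok_closed[OF ok] assms(3) ty_Universe_in[OF ok assms(3)]] by (rule c_Tot)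
qed

text \<open>The given implication is valid but perhaps ill typed. \<open>val_qty\<close> leads to a
  context in which it is typed; there the quantifier is instantiated with the predicate, restricted
  to \<open>U\<close> by contravariance, and modus ponens applies. The conclusion is handed to the
  continuation of the goal.\<close>

lemma fimp_val:
  assumes H: "val S \<Gamma> (All (arr u' (Universe 0)) (Imp (App (shift w') (Var 0)) (App (shift w) (Var 0))))"
  shows "fimp \<Gamma> u' w' w"
  unfolding fimp_def
proof (intro allI impI)
  note cs = ok_closed[OF ok]
  fix \<Delta> s p T i0
  assume s: "styp S \<Delta> s \<Gamma>" and p: "ty S \<Delta> p (Tot (arr T (Universe 0)))"
    and T: "ty S \<Delta> T (Tot (Universe i0))" "sbt S \<Delta> (sub s u') T"
    and q: "qv \<Delta> (App (sub s w') p)"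
  show "qv \<Delta> (App (sub s w) p)"
    unfolding qv_def
  proof (intro allI impI)
    fix r i
    assume r: "ty S \<Delta> r (Tot (Universe i))"
      and k: "\<forall>\<Theta> t X j. styp S \<Theta> t \<Delta> \<longrightarrow> conv S X (sub t (App (sub s w) p)) \<longrightarrow>
        ty S \<Theta> X (Tot (Universe j)) \<longrightarrow> val S \<Theta> X \<longrightarrow> val S \<Theta> (sub t r)"
    show "val S \<Delta> r"
    proof (rule q[unfolded qv_def, rule_format, OF r])
      fix \<Theta> t X j
      assume t: "styp S \<Theta> t \<Delta>" and X: "conv S X (sub t (App (sub s w') p))"
        "ty S \<Theta> X (Tot (Universe j))" "val S \<Theta> X"
      have rt: "ty S \<Theta> (sub t r) (Tot (Universe i))" using ty_sub(1)[OF cs t r] by simp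
      define H' where "H' = sub t (sub s (All (arr u' (Universe 0)) (Imp (App (shift w') (Var 0)) (App (shift w) (Var 0)))))"
      have H': "val S \<Theta> H'" unfolding H'_def by (intro ty_sub(5)[OF cs t] ty_sub(5)[OF cs s] H)
      show "val S \<Theta> (sub t r)"
      \<comment> \<open>Moves to a context where the quantified implication is typed; its typing is
        then taken apart to type the two sides of the implication.\<close>
      proof (rule qty_elim[OF ok val_qty[OF H'] rt])
        fix \<Omega> v m assume v: "styp S \<Omega> v \<Theta>" and tH: "ty S \<Omega> (sub v H') (Tot (Universe m))"
        define U A B P where "U = sub v (sub t (sub s u'))" and "A = sub v (sub t (sub s w'))"
          and "B = sub v (sub t (sub s w))" and "P = sub v (sub t p)"
        have H'eq: "sub v H' = All (arr U (Universe 0)) (Imp (App (shift A) (Var 0)) (App (shift B) (Var 0)))"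
          by (simp add: H'_def U_def A_def B_def)
        have vH: "val S \<Omega> (All (arr U (Universe 0)) (Imp (App (shift A) (Var 0)) (App (shift B) (Var 0))))"
          using ty_sub(5)[OF cs v H'] unfolding H'eq .
        obtain m1 where "ty S \<Omega> (Pi (arr U (Universe 0)) (Tot (Imp (App (shift A) (Var 0)) (App (shift B) (Var 0))))) (Tot (Universe m1))"
          using squash_inv[OF ok tH[unfolded H'eq]] by blast
        then obtain m2 m3 where tU: "ty S \<Omega> (arr U (Universe 0)) (Tot (Universe m2))"
          and tI: "ty S (arr U (Universe 0) # \<Omega>) (Imp (App (shift A) (Var 0)) (App (shift B) (Var 0))) (Tot (Universe m3))"
          using ty_PiD[OF ok] ty_TotD[OF ok] by blast
        obtain m4 where U: "ty S \<Omega> U (Tot (Universe m4))" using ty_PiD[OF ok tU] by blast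
        have "ty S \<Omega> P (Tot (arr (sub v (sub t T)) (Universe 0)))"
          using ty_sub(1)[OF cs v ty_sub(1)[OF cs t p]] by (simp add: P_def)
        moreover have "sbt S \<Omega> U (sub v (sub t T))"
          unfolding U_def by (intro ty_sub(3)[OF cs v] ty_sub(3)[OF cs t] T)
        ultimately have P: "ty S \<Omega> P (Tot (arr U (Universe 0)))" using U by (rule ty_weaken_pred)
        have vI: "val S \<Omega> (Imp (App A P) (App B P))"
          using v_AllE[OF vH P] by simp
        have "ty S \<Omega> (Imp (App A P) (App B P)) (Tot (Universe m3))"
          using ty_sub1(1)[OF cs P tI] by simp
        then obtain m5 where "ty S \<Omega> (arr (App A P) (App B P)) (Tot (Universe m5))"
          using squash_inv[OF ok] by blast
        then obtain m6 m7 where AP: "ty S \<Omega> (App A P) (Tot (Universe m6))"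
          and BP: "ty S (App A P # \<Omega>) (shift (App B P)) (Tot (Universe m7))"
          using ty_PiD[OF ok] ty_TotD[OF ok] by blast
        have "conv S (sub v X) (App A P)" using conv_sub[OF cs X(1)] by (simp add: A_def P_def)
        moreover have "ty S \<Omega> (sub v X) (Tot (Universe j))" "val S \<Omega> (sub v X)"
          using ty_sub(1,5)[OF cs v] X by fastforce+
        ultimately have vAP: "val S \<Omega> (App A P)" using val_conv[OF ok] AP by blast
        then have vBP: "val S \<Omega> (App B P)" using v_ImpE[OF vI] by blast
        have w: "wctx S (App A P # \<Omega>)" using AP by (rule wctx_ConsI[OF cs])
        have rv: "ty S \<Omega> (sub v (sub t r)) (Tot (Universe i))" using ty_sub(1)[OF cs v rt] by simp
        show "val S \<Omega> (sub v (sub t r))"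
        \<comment> \<open>The conclusion \<open>App B P\<close> is typed only under the hypothesis
          \<open>App A P\<close>, so the continuation is invoked in the context extended by that
          hypothesis, and the cut removes it.\<close>
        proof (rule val_cut[OF ok vAP AP _ rv])
          let ?y = "\<lambda>k. shift (sub v (t k))"
          have y: "sub ?y z = shift (sub v (sub t z))" for z by (simp add: ren_sub sub_sub)
          have "styp S (App A P # \<Omega>) ?y \<Delta>"
            using styp_comp[OF ok styp_comp[OF ok t v] styp_Suc[OF ok w]] by (simp add: sub_Suc)
          moreover have "conv S (shift (App B P)) (sub ?y (App (sub s w) p))"
            unfolding y by (simp add: B_def P_def)
          moreover have "val S (App A P # \<Omega>) (shift (App B P))" using ty_shift(5)[OF cs w vBP] .
          ultimately have "val S (App A P # \<Omega>) (sub ?y r)" using k BP by blast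
          then show "val S (App A P # \<Omega>) (shift (sub v (sub t r)))" unfolding y .
        qed
      qed
    qed
  qed
qed

lemma sbc_fin_all:
  "wctx S \<Gamma> \<Longrightarrow> True"
  "ktyp S \<Gamma> k t \<Longrightarrow> True"
  "ty S \<Gamma> e c \<Longrightarrow> True"
  "wcmp S \<Gamma> c i \<Longrightarrow> True"
  "sbt S \<Gamma> t1 t2 \<Longrightarrow> True"
  "sbc S \<Gamma> c1 c2 \<Longrightarrow> \<forall>u w. c1 = Cmp Pure u w \<longrightarrow> (\<exists>u' w'. c2 = Cmp Pure u' w' \<and> sbt S \<Gamma> u u' \<and> fimp \<Gamma> u' w' w)"
  "val S \<Gamma> phi \<Longrightarrow> True"
proof (induction rule: wctx_ktyp_ty_wcmp_sbt_sbc_val.inducts)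
  case (sc_Refl \<Gamma> c)
  then show ?case by (auto intro: s_Refl fimp_conv)
next
  case (sc_Trans \<Gamma> c1 c2 c3)
  show ?case
  proof (intro allI impI)
    fix u w assume "c1 = Cmp Pure u w"
    then obtain u2 w2 where 2: "c2 = Cmp Pure u2 w2" "sbt S \<Gamma> u u2" "fimp \<Gamma> u2 w2 w"
      using sc_Trans.IH by blast
    then obtain u3 w3 where "c3 = Cmp Pure u3 w3" "sbt S \<Gamma> u2 u3" "fimp \<Gamma> u3 w3 w2"
      using sc_Trans.IH by blast
    with 2 show "\<exists>u' w'. c3 = Cmp Pure u' w' \<and> sbt S \<Gamma> u u' \<and> fimp \<Gamma> u' w' w"
      using s_Trans fimp_trans by blast
  qed
next
  case (sc_Pure \<Gamma> t' t wp wp')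
  then show ?case using fimp_val by simp
qed auto

lemma csx_fin:
  assumes "csx S \<Gamma> c1 c2"
  shows "(\<forall>u w. c1 = Cmp Pure u w \<longrightarrow> (\<exists>u' w'. c2 = Cmp Pure u' w' \<and> sbt S \<Gamma> u u' \<and> fimp \<Gamma> u' w' w)) \<and>
    (\<forall>F u w. c1 = Cmp (User F) u w \<longrightarrow> (\<exists>u' w'. c2 = Cmp (User F) u' w' \<and>
       (\<forall>D. lookup_eff S F = Some D \<longrightarrow> sbt S \<Gamma> (apps (repr D) [u, w]) (apps (repr D) [u', w']))))"
  using assms
proof induction
  case (csx_sub c c')
  then show ?case using sbc_fin_all(6) sbc_Tot_all(6)[of S \<Gamma> c c'] by fastforce
next
  case (csx_conv c c')
  then show ?case using fimp_conv[OF conv_sym] by (auto intro!: s_Conv conv_app)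
next
  case (csx_trans c1 c2 c3)
  show ?case
  proof (intro conjI allI impI)
    fix u w assume "c1 = Cmp Pure u w"
    then obtain u2 w2 where 2: "c2 = Cmp Pure u2 w2" "sbt S \<Gamma> u u2" "fimp \<Gamma> u2 w2 w"
      using csx_trans.IH by auto
    then obtain u3 w3 where "c3 = Cmp Pure u3 w3" "sbt S \<Gamma> u2 u3" "fimp \<Gamma> u3 w3 w2"
      using csx_trans.IH by auto
    with 2 show "\<exists>u' w'. c3 = Cmp Pure u' w' \<and> sbt S \<Gamma> u u' \<and> fimp \<Gamma> u' w' w"
      using s_Trans fimp_trans by blast
  next
    fix F u w assume "c1 = Cmp (User F) u w"
    then obtain u2 w2 where 2: "c2 = Cmp (User F) u2 w2"
      "\<forall>D. lookup_eff S F = Some D \<longrightarrow> sbt S \<Gamma> (apps (repr D) [u, w]) (apps (repr D) [u2, w2])"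
      using csx_trans.IH by auto
    then obtain u3 w3 where "c3 = Cmp (User F) u3 w3"
      "\<forall>D. lookup_eff S F = Some D \<longrightarrow> sbt S \<Gamma> (apps (repr D) [u2, w2]) (apps (repr D) [u3, w3])"
      using csx_trans.IH by auto
    with 2 show "\<exists>u' w'. c3 = Cmp (User F) u' w' \<and>
       (\<forall>D. lookup_eff S F = Some D \<longrightarrow> sbt S \<Gamma> (apps (repr D) [u, w]) (apps (repr D) [u', w']))"
      using s_Trans by blast
  qed
qed

lemma pure_pred_ty:
  assumes "wcmp S \<Gamma> (Cmp Pure u w) i" "ty S \<Gamma> p (Tot (arr u (Universe 0)))"
  shows "ty S \<Gamma> (App w p) (Tot (Universe 0))"
proof -
  have "ty S \<Gamma> w (Tot (arr (arr u (Universe 0)) (Universe 0)))"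
    using assms(1) by cases auto
  then show ?thesis using assms(2) by (rule ty_app_arr[OF ok_closed[OF ok]])
qed

text \<open>With both ends typed the implication can be stated again as a formula: the Kripke form
  is used at a generic predicate, with its precondition as a hypothesis.\<close>

lemma fimp_All:
  assumes "wcmp S \<Gamma> (Cmp Pure u w) i" "wcmp S \<Gamma> (Cmp Pure u' w') j" "sbt S \<Gamma> u u'" "fimp \<Gamma> u' w' w"
  shows "val S \<Gamma> (All (arr u' (Universe 0)) (Imp (App (shift w') (Var 0)) (App (shift w) (Var 0))))"
proof -
  note cs = ok_closed[OF ok]
  have u: "ty S \<Gamma> u (Tot (Universe 0))" "ty S \<Gamma> u' (Tot (Universe 0))"
    using wcmp_CmpD(2)[OF ok] assms(1,2) by blast+
  let ?p = "arr u' (Universe 0)"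
  have p: "ty S \<Gamma> ?p (Tot (Universe 1))"
    using ty_arr[OF cs u(2) ty_Universe_in[OF ok u(2)]] by simp
  have wp: "wctx S (?p # \<Gamma>)" using p by (rule wctx_ConsI[OF cs])
  let ?G = "?p # \<Gamma>"
  have v: "ty S ?G (Var 0) (Tot (arr (shift u') (Universe 0)))" using ty_Var_n(1)[OF cs wp] by simp
  have sh: "ty S ?G (shift u) (Tot (Universe 0))" "ty S ?G (shift u') (Tot (Universe 0))"
    using ty_shift(1)[OF cs wp] u by fastforce+
  have v': "ty S ?G (Var 0) (Tot (arr (shift u) (Universe 0)))"
    using ty_weaken_pred[OF v ty_shift(3)[OF cs wp assms(3)] sh(1)] .
  let ?A = "App (shift w') (Var 0)" and ?B = "App (shift w) (Var 0)"
  have A: "ty S ?G ?A (Tot (Universe 0))"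
    using pure_pred_ty[OF _ v] ty_shift(2)[OF cs wp assms(2)] by simp
  have B: "ty S ?G ?B (Tot (Universe 0))"
    using pure_pred_ty[OF _ v'] ty_shift(2)[OF cs wp assms(1)] by simp
  have wA: "wctx S (?A # ?G)" using A by (rule wctx_ConsI[OF cs])
  let ?s = "\<lambda>k. shift (Var (Suc k))"
  have s: "sub ?s z = shift (shift z)" for z
    by (simp only: sub_shift_comp sub_Suc)
  have st: "styp S (?A # ?G) ?s \<Gamma>"
    using styp_comp[OF ok styp_Suc[OF ok wp] styp_Suc[OF ok wA]] by (simp add: sub_Suc)
  have "qv (?A # ?G) (App (sub ?s w) (Var 1))"
  proof (rule assms(4)[unfolded fimp_def, rule_format, OF st])
    show "ty S (?A # ?G) (Var 1) (Tot (arr (shift (shift u')) (Universe 0)))"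
      using ty_Var_n(2)[OF cs wA] by simp
    show "ty S (?A # ?G) (shift (shift u')) (Tot (Universe 0))"
      using ty_shift(1)[OF cs wA sh(2)] by simp
    show "sbt S (?A # ?G) (sub ?s u') (shift (shift u'))" unfolding s by (rule s_Refl)
    have "val S (?A # ?G) (shift ?A)" using ty_Var_n(1)[OF cs wA] by (rule v_Hyp)
    then have "qv (?A # ?G) (shift ?A)" using ty_shift(1)[OF cs wA A] by (intro val_qv[where i=0]) auto
    then show "qv (?A # ?G) (App (sub ?s w') (Var 1))" unfolding s by simp
  qed
  then have "qv (?A # ?G) (shift ?B)" unfolding s by simp
  then have "val S (?A # ?G) (shift ?B)" using qv_val ty_shift(1)[OF cs wA B] by fastforce
  with A B have "val S ?G (Imp ?A ?B)" by (rule v_ImpI)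
  with p show ?thesis by (rule v_AllI)
qed

text \<open>This is what the study of ill-typed formulas is for: steps of conversion and subtyping
  through arbitrary computation types collapse into one subtyping once the two ends are well formed,
  so that \<open>t_Sub\<close> becomes applicable.\<close>

lemma csx_sbc:
  assumes "csx S \<Gamma> c c'" "wcmp S \<Gamma> c i" "wcmp S \<Gamma> c' j"
  shows "sbc S \<Gamma> c c'"
proof (cases c)
  case (Tot a)
  then show ?thesis using csx_TotE[OF assms(1)] by fastforce
next
  case (Cmp M u w)
  show ?thesis
  proof (cases M)
    case Pure
    then obtain u' w' where *: "c' = Cmp Pure u' w'" "sbt S \<Gamma> u u'" "fimp \<Gamma> u' w' w"
      using csx_fin[OF assms(1)] Cmp by blast
    then show ?thesis using fimp_All[of \<Gamma> u w i u' w' j] assms Cmp Pure by (auto intro!: sc_Pure)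
  next
    case (User F)
    then obtain D where D: "lookup_eff S F = Some D" using assms(2) Cmp by (auto elim: wcmp.cases)
    then obtain u' w' where "c' = Cmp (User F) u' w'" "sbt S \<Gamma> (apps (repr D) [u, w]) (apps (repr D) [u', w'])"
      using csx_fin[OF assms(1)] Cmp User by blast
    with D Cmp User show ?thesis by (auto intro: sc_User)
  qed
qed

lemma ty_convc:
  assumes "ty S \<Gamma> e c" "convc S c c'" "wcmp S \<Gamma> c' i"
  shows "ty S \<Gamma> e c'"
  using regular[OF ok assms(1)] csx_sbc[OF csx_conv[OF assms(2)] _ assms(3)] t_Sub[OF assms(1) _ assms(3)] by blast

lemma sbc_PureE:
  assumes "sbc S \<Gamma> (Cmp Pure u w) (Cmp Pure u' w')" "wcmp S \<Gamma> (Cmp Pure u w) i" "wcmp S \<Gamma> (Cmp Pure u' w') j"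
  shows "sbt S \<Gamma> u u'"
    "val S \<Gamma> (All (arr u' (Universe 0)) (Imp (App (shift w') (Var 0)) (App (shift w) (Var 0))))"
  using sbc_fin_all(6)[OF assms(1)] fimp_All[OF assms(2,3)] by auto

end

section \<open>Subject reduction\<close>

context
  fixes S assumes ok: "ok_sig S"
begin

lemma gen_ty: "gen S \<Gamma> e c \<Longrightarrow> wctx S \<Gamma> \<Longrightarrow> ty S \<Gamma> e c"
proof (cases e)
  case (Case t e' e1 e2)
  assume "gen S \<Gamma> e c" "wctx S \<Gamma>"
  with Case show ?thesis by (auto intro: t_Case t_CaseM[simplified])
next
  case (Act F j es)
  assume "gen S \<Gamma> e c" "wctx S \<Gamma>"
  with Act show ?thesis using t_Act[of S \<Gamma> F _ j _ es] by fastforce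
next
  case (Bind M t1 t2 wp1 e1 wp2 e2)
  assume "gen S \<Gamma> e c" "wctx S \<Gamma>"
  with Bind show ?thesis using t_Bind[of S \<Gamma> t2 M _ _ wp2 t1 e1 wp1 e2] by fastforce
qed (auto intro: wctx_ktyp_ty_wcmp_sbt_sbc_val.intros[simplified])

text \<open>Subsumption can be repeated after a step, so it suffices to preserve the type found by
  generation.\<close>

lemma ty_by_gen:
  assumes "ty S \<Gamma> e c" "\<And>c0. gen S \<Gamma> e c0 \<Longrightarrow> wctx S \<Gamma> \<Longrightarrow> ty S \<Gamma> e c0 \<Longrightarrow> \<exists>i. wcmp S \<Gamma> c0 i \<Longrightarrow> ty S \<Gamma> e' c0"
  shows "ty S \<Gamma> e' c"
proof -
  obtain c0 where *: "gen S \<Gamma> e c0" "sbc S \<Gamma> c0 c" using ty_gen[OF assms(1)] by blast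
  have w: "wctx S \<Gamma>" using assms(1) by (rule ty_wctx)
  have "ty S \<Gamma> e c0" using gen_ty[OF *(1) w] .
  then have "ty S \<Gamma> e' c0" using assms(2)[OF *(1) w] regular[OF ok] by blast
  then show ?thesis using *(2) regular[OF ok assms(1)] t_Sub by blast
qed

lemma ty_sbt: "ty S \<Gamma> e (Tot t) \<Longrightarrow> sbt S \<Gamma> t t' \<Longrightarrow> ty S \<Gamma> t' (Tot (Universe i)) \<Longrightarrow> ty S \<Gamma> e (Tot t')"
  by (auto intro: t_Sub c_Tot)

text \<open>The body is narrowed from the annotation \<open>t\<close> to the domain
  \<open>t'\<close> at which the abstraction is used. Over \<open>t'\<close> the codomains are
  related by \<open>csx\<close>, and regularity of both makes this a subsumption.\<close>

lemma Lam_inv: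
  assumes "ty S \<Gamma> (Lam t e) (Tot (Pi t' c'))" "ty S \<Gamma> a (Tot t')"
  shows "ty S \<Gamma> (sub1 a e) (csub1 a c')"
proof -
  note cs = ok_closed[OF ok]
  obtain i d where *: "ty S \<Gamma> t (Tot (Universe i))" "ty S (t # \<Gamma>) e d" "sbt S \<Gamma> (Pi t d) (Pi t' c')"
    using ty_gen[OF assms(1)] by auto
  have p: "pirel S \<Gamma> t d t' c'" using sbt_Pi_Pi[OF cs *(3)] .
  obtain j k where t': "ty S \<Gamma> t' (Tot (Universe j))" and c': "wcmp S (t' # \<Gamma>) c' k"
    using regular_Tot[OF ok assms(1)] ty_PiD[OF ok] by blast
  have w': "wctx S (t' # \<Gamma>)" using t' by (rule wctx_ConsI[OF cs])
  obtain l where d: "wcmp S (t # \<Gamma>) d l" using regular[OF ok *(2)] by blast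
  have "wcmp S (t' # \<Gamma>) d l" "ty S (t' # \<Gamma>) e d"
    using p ty_narrow(1,2)[OF cs ty_wctx(3)[OF *(2)] w'] d *(2) by (auto simp: pirel_def)
  moreover have "csx S (t' # \<Gamma>) d c'" using p w' by (simp add: pirel_def s_Refl)
  ultimately have "ty S (t' # \<Gamma>) e c'" using csx_sbc[OF ok] c' t_Sub by blast
  then show ?thesis by (rule ty_sub1(1)[OF cs assms(2)])
qed

text \<open>No subtyping rule enters the arguments of such a constant, so they can change by
  conversion only.\<close>

lemma const2_conv:
  assumes "sbt S \<Gamma> (app2 (Const k) a b) (app2 (Const k) a' b')" "k \<noteq> CFst" "k \<noteq> CSnd"
  shows "conv S a a'" "conv S b b'"
proof -
  obtain x y where "qs S (app2 (Const k) a b) (app2 (Const k) x y)" "conv S a' x" "conv S b' y"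
    using sbt_const2[OF ok_closed[OF ok] _ assms(2,3)] assms(1) by blast
  moreover from qs_const_App2[OF ok_closed[OF ok] this(1) assms(2,3)] have "conv S a x" "conv S b y" by auto
  ultimately show "conv S a a'" "conv S b b'" using conv_sym conv_trans by blast+
qed

lemma Pair_inv:
  assumes "ty S \<Gamma> (app2 (Const CPair) a b) (Tot B)"
  shows "\<exists>p q i j. ty S \<Gamma> p (Tot (Universe i)) \<and> ty S \<Gamma> q (Tot (Universe j)) \<and>
    ty S \<Gamma> a (Tot p) \<and> ty S \<Gamma> b (Tot q) \<and> sbt S \<Gamma> (prodT p q) B"
proof -
  obtain t d where 1: "ty S \<Gamma> (App (Const CPair) a) (Tot (Pi t d))" "ty S \<Gamma> b (Tot t)" "sbc S \<Gamma> (csub1 b d) (Tot B)"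
    using App_obtain[OF ok assms] .
  obtain t' d' where 2: "ty S \<Gamma> (Const CPair) (Tot (Pi t' d'))" "ty S \<Gamma> a (Tot t')" "sbc S \<Gamma> (csub1 a d') (Tot (Pi t d))"
    using App_obtain[OF ok 1(1)] .
  obtain p q i j where pq: "ty S \<Gamma> p (Tot (Universe i))" "ty S \<Gamma> q (Tot (Universe j))"
    "sbt S \<Gamma> (arr p (arr q (prodT p q))) (Pi t' d')"
    using Const_inv[OF ok 2(1)] by (auto elim: ktyp.cases)
  from pi_app[OF ok pq(3) 2(2) pq(1)]
  have a: "ty S \<Gamma> a (Tot p)" "sbt S \<Gamma> (arr q (prodT p q)) (Pi t d)"
    using 2(3) by (auto intro: s_Trans)
  from pi_app[OF ok this(2) 1(2) pq(2)]
  have "ty S \<Gamma> b (Tot q)" "sbt S \<Gamma> (prodT p q) B"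
    using 1(3) by (auto intro: s_Trans)
  with a pq show ?thesis by blast
qed

lemma Inj_inv:
  assumes "ty S \<Gamma> (App (Const k) a) (Tot B)" "k = CInl \<or> k = CInr"
  shows "\<exists>p q i j. ty S \<Gamma> p (Tot (Universe i)) \<and> ty S \<Gamma> q (Tot (Universe j)) \<and>
    ty S \<Gamma> a (Tot (if k = CInl then p else q)) \<and> sbt S \<Gamma> (sumT p q) B"
proof -
  obtain t d where 1: "ty S \<Gamma> (Const k) (Tot (Pi t d))" "ty S \<Gamma> a (Tot t)" "sbc S \<Gamma> (csub1 a d) (Tot B)"
    using App_obtain[OF ok assms(1)] .
  obtain p q i j where pq: "ty S \<Gamma> p (Tot (Universe i))" "ty S \<Gamma> q (Tot (Universe j))"
    "sbt S \<Gamma> (arr (if k = CInl then p else q) (sumT p q)) (Pi t d)"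
    using Const_inv[OF ok 1(1)] assms(2) by (auto elim!: ktyp.cases)
  moreover have "ty S \<Gamma> (if k = CInl then p else q) (Tot (Universe (if k = CInl then i else j)))"
    using pq by simp
  from pi_app[OF ok pq(3) 1(2) this]
  have "ty S \<Gamma> a (Tot (if k = CInl then p else q))" "sbt S \<Gamma> (sumT p q) B"
    using 1(3) by (auto intro: s_Trans)
  ultimately show ?thesis by blast
qed

lemma sbc_UserE:
  assumes "sbc S \<Gamma> (Cmp (User F) t wp) (Cmp M t' wp')" "lookup_eff S F = Some D"
  shows "M = User F \<and> sbt S \<Gamma> (apps (repr D) [t, wp]) (apps (repr D) [t', wp'])"
  using sbc_Tot_all(6)[OF assms(1)] assms(2) by auto

text \<open>The assumed implication ranges over all substitution instances; it is used once, at a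
  generic predicate and under its precondition as a hypothesis.\<close>

lemma sbc_PureI:
  assumes "wcmp S \<Gamma> (Cmp Pure u w) i" "wcmp S \<Gamma> (Cmp Pure u w') j"
    and "\<And>\<Delta> s p. styp S \<Delta> s \<Gamma> \<Longrightarrow> ty S \<Delta> p (Tot (arr (sub s u) (Universe 0))) \<Longrightarrow>
      val S \<Delta> (App (sub s w') p) \<Longrightarrow> val S \<Delta> (App (sub s w) p)"
  shows "sbc S \<Gamma> (Cmp Pure u w) (Cmp Pure u w')"
proof (rule sc_Pure[OF s_Refl])
  note cs = ok_closed[OF ok]
  have u: "ty S \<Gamma> u (Tot (Universe 0))" using wcmp_CmpD(2)[OF ok] assms(1) by blast
  let ?p = "arr u (Universe 0)"
  have p: "ty S \<Gamma> ?p (Tot (Universe 1))"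
    using ty_arr[OF cs u ty_Universe_in[OF ok u]] by simp
  have wp: "wctx S (?p # \<Gamma>)" using p by (rule wctx_ConsI[OF cs])
  let ?G = "?p # \<Gamma>"
  have v: "ty S ?G (Var 0) (Tot (arr (shift u) (Universe 0)))" using ty_Var_n(1)[OF cs wp] by simp
  let ?A = "App (shift w') (Var 0)" and ?B = "App (shift w) (Var 0)"
  have A: "ty S ?G ?A (Tot (Universe 0))" "ty S ?G ?B (Tot (Universe 0))"
    using pure_pred_ty[OF ok _ v] ty_shift(2)[OF cs wp assms(1)] ty_shift(2)[OF cs wp assms(2)] by auto
  have wA: "wctx S (?A # ?G)" using A(1) by (rule wctx_ConsI[OF cs])
  let ?s = "\<lambda>k. shift (Var (Suc k))"
  have s: "sub ?s z = shift (shift z)" for z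
    by (simp only: sub_shift_comp sub_Suc)
  have st: "styp S (?A # ?G) ?s \<Gamma>"
    using styp_comp[OF ok styp_Suc[OF ok wp] styp_Suc[OF ok wA]] by (simp add: sub_Suc)
  have "val S (?A # ?G) (App (sub ?s w) (Var 1))"
  proof (rule assms(3)[OF st])
    show "ty S (?A # ?G) (Var 1) (Tot (arr (sub ?s u) (Universe 0)))"
      unfolding s using ty_Var_n(2)[OF cs wA] by simp
    show "val S (?A # ?G) (App (sub ?s w') (Var 1))"
      unfolding s using v_Hyp[OF ty_Var_n(1)[OF cs wA]] by simp
  qed
  then have "val S (?A # ?G) (shift ?B)" unfolding s by simp
  with A have "val S ?G (Imp ?A ?B)" by (rule v_ImpI)
  with p show "val S \<Gamma> (All ?p (Imp ?A ?B))" by (rule v_AllI)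
qed

lemma val_pure_mono:
  assumes "val S \<Gamma> (All (arr u (Universe 0)) (Imp (App (shift w') (Var 0)) (App (shift w) (Var 0))))"
    "ty S \<Gamma> p (Tot (arr u (Universe 0)))" "val S \<Gamma> (App w' p)"
  shows "val S \<Gamma> (App w p)"
proof -
  have "val S \<Gamma> (Imp (App w' p) (App w p))" using v_AllE[OF assms(1,2)] by simp
  then show ?thesis using assms(3) by (rule v_ImpE)
qed

text \<open>As in \<open>ty_apps\<close>, the accumulator \<open>es0\<close> turns successive beta
  steps into one simultaneous instantiation.\<close>

lemma conv_lams:
  assumes "length es = length ts"
  shows "conv S (apps (sub (inst es0) (foldr Lam ts b)) es) (sub (inst (es0 @ es)) b)"
  using assms
proof (induction es arbitrary: es0 ts)
  case (Cons e es)
  then obtain t ts' where ts: "ts = t # ts'" by (cases ts) auto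
  have apps: "conv S f g \<Longrightarrow> conv S (apps f es) (apps g es)" for f g es
    by (induction es arbitrary: f g) (auto intro: conv_app[OF _ conv_refl])
  have "conv S (App (sub (inst es0) (foldr Lam ts b)) e) (sub (inst (es0 @ [e])) (foldr Lam ts' b))"
    using conv_beta[of S "sub (inst es0) t" "sub (ups (inst es0)) (foldr Lam ts' b)" e]
    by (simp add: ts sub1_inst)
  from apps[OF this] Cons.IH[of ts' "es0 @ [e]"] show ?case
    using Cons.prems ts by (auto intro: conv_trans)
qed simp

lemma conv_lams_closed:
  "length es = length ts \<Longrightarrow> conv S (apps (foldr Lam ts b) es) (sub (inst es) b)"
  using conv_lams[of es ts "[]" b] by simp

lemma conv_ret_star: "conv S (App (apps pure_ret_star [t, e]) p) (App p e)"
  using conv_lams_closed[of "[t, e, p]" "[Universe 0, Var 0, arr (Var 1) (Universe 0)]" "App (Var 0) (Var 1)"]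
  by (simp add: pure_ret_star_def inst_simps)

lemma conv_bind_star:
  "conv S (App (apps pure_bind_star [t1, t2, w1, w2]) p) (App w1 (Lam t1 (app2 (shift w2) (Var 0) (shift p))))"
proof -
  have "sub (ups (inst [t1, t2, w1, w2, p])) (app2 (Var 2) (Var 0) (Var 1)) = app2 (shift w2) (Var 0) (shift p)"
    by (simp add: numeral_eq_Suc inst_def)
  moreover have "inst [t1, t2, w1, w2, p] 2 = w1" "inst [t1, t2, w1, w2, p] 4 = t1"
    by (simp_all add: numeral_eq_Suc inst_def)
  ultimately show ?thesis
    using conv_lams_closed[of "[t1, t2, w1, w2, p]" "[Universe 0, Universe 0, App pure_wp_type (Var 1),
        arr (Var 2) (App pure_wp_type (Var 1)), arr (Var 2) (Universe 0)]"
        "App (Var 2) (Lam (Var 4) (app2 (Var 2) (Var 0) (Var 1)))"]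
    by (simp add: pure_bind_star_def)
qed

text \<open>The precondition of the bind converts to \<open>w1 q\<close> with
  \<open>q = \<lambda>x. w2 x p\<close>. By \<open>H\<close> it implies the precondition of the
  return at \<open>q\<close>, which converts to \<open>q e\<close> and on to \<open>w2 e p\<close>.
  Most of the proof types these formulas, because \<open>val_conv\<close> asks for typings at both
  ends.\<close>

lemma pure_bind_sound:
  assumes t: "ty S \<Gamma> t1 (Tot (Universe 0))" "ty S \<Gamma> t2 (Tot (Universe 0))"
    and w1: "ty S \<Gamma> w1 (Tot (App pure_wp_type t1))" and w2: "ty S \<Gamma> w2 (Tot (arr t1 (App pure_wp_type t2)))"
    and e: "ty S \<Gamma> e (Tot t1)"
    and H: "val S \<Gamma> (All (arr t1 (Universe 0)) (Imp (App (shift w1) (Var 0)) (App (shift (apps pure_ret_star [t, e])) (Var 0))))"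
    and tte: "ty S \<Gamma> t (Tot (Universe 0))" "ty S \<Gamma> e (Tot t)" "sbt S \<Gamma> t t1"
    and p: "ty S \<Gamma> p (Tot (arr t2 (Universe 0)))"
    and v: "val S \<Gamma> (App (apps pure_bind_star [t1, t2, w1, w2]) p)"
  shows "val S \<Gamma> (App (App w2 e) p)"
proof -
  note cs = ok_closed[OF ok]
  let ?q = "Lam t1 (app2 (shift w2) (Var 0) (shift p))"
  have w: "wctx S (t1 # \<Gamma>)" using t(1) by (rule wctx_ConsI[OF cs])
  have cl: "ren r pure_wp_type = pure_wp_type" for r by (simp add: ren_closed)
  have t2': "ty S (t1 # \<Gamma>) (shift t2) (Tot (Universe 0))" using ty_shift(1)[OF cs w t(2)] by simp
  have "ty S (t1 # \<Gamma>) (shift w2) (Tot (arr (shift t1) (App pure_wp_type (shift t2))))"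
    using ty_shift(1)[OF cs w w2] by (simp add: cl)
  then have "ty S (t1 # \<Gamma>) (App (shift w2) (Var 0)) (Tot (App pure_wp_type (shift t2)))"
    using ty_Var_n(1)[OF cs w] by (rule ty_app_arr[OF cs])
  then have "ty S (t1 # \<Gamma>) (App (shift w2) (Var 0)) (Tot (arr (arr (shift t2) (Universe 0)) (Universe 0)))"
    using ty_pure_wp_conv[OF cs t2'] by blast
  moreover have "ty S (t1 # \<Gamma>) (shift p) (Tot (arr (shift t2) (Universe 0)))"
    using ty_shift(1)[OF cs w p] by simp
  ultimately have "ty S (t1 # \<Gamma>) (app2 (shift w2) (Var 0) (shift p)) (Tot (Universe 0))"
    by (rule ty_app_arr[OF cs])
  then have q: "ty S \<Gamma> ?q (Tot (arr t1 (Universe 0)))" using t_Lam[OF t(1)] by simp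
  have W: "wp_type_of S Pure = Some pure_wp_type" by simp
  have w1q: "ty S \<Gamma> (App w1 ?q) (Tot (Universe 0))"
    using pure_pred_ty[OF ok wcmp_CmpI[OF ok W t(1) w1] q] .
  have B: "ty S \<Gamma> (apps pure_bind_star [t1, t2, w1, w2]) (Tot (App pure_wp_type t2))"
    by (rule bind_star_app[OF ok W _ t w1 w2]) simp
  have Bp: "ty S \<Gamma> (App (apps pure_bind_star [t1, t2, w1, w2]) p) (Tot (Universe 0))"
    using pure_pred_ty[OF ok wcmp_CmpI[OF ok W t(2) B] p] .
  have "val S \<Gamma> (App w1 ?q)" using val_conv[OF ok v conv_bind_star Bp w1q] .
  from val_pure_mono[OF H q this] have vr: "val S \<Gamma> (App (apps pure_ret_star [t, e]) ?q)" .
  have q': "ty S \<Gamma> ?q (Tot (arr t (Universe 0)))" using ty_weaken_pred[OF ok q tte(3,1)] .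
  have R: "ty S \<Gamma> (apps pure_ret_star [t, e]) (Tot (App pure_wp_type t))"
    by (rule ret_star_app[OF ok W _ tte(1,2)]) simp
  have Rq: "ty S \<Gamma> (App (apps pure_ret_star [t, e]) ?q) (Tot (Universe 0))"
    using pure_pred_ty[OF ok wcmp_CmpI[OF ok W tte(1) R] q'] .
  have "ty S \<Gamma> (App w2 e) (Tot (App pure_wp_type t2))" using ty_app_arr[OF cs w2 e] .
  then have G: "ty S \<Gamma> (App (App w2 e) p) (Tot (Universe 0))"
    using pure_pred_ty[OF ok wcmp_CmpI[OF ok W t(2)] p] by blast
  have "conv S (App ?q e) (App (App w2 e) p)" using conv_beta[of S t1 "app2 (shift w2) (Var 0) (shift p)" e] by simp
  then have "conv S (App (apps pure_ret_star [t, e]) ?q) (App (App w2 e) p)"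
    using conv_ret_star conv_trans by blast
  from val_conv[OF ok vr this Rq G] show ?thesis .
qed

lemma styp_sub_pred:
  assumes "styp S \<Delta> s \<Gamma>" "ty S \<Gamma> e (Tot t)"
  shows "ty S \<Delta> (sub s e) (Tot (sub s t))"
  using ty_sub(1)[OF ok_closed[OF ok] assms] by simp

text \<open>The reduct has the transformer \<open>App wp2 e1\<close>. Since \<open>wp1\<close> may
  stem from subsumption, this is in general not convertible to the transformer of the bind but only
  implied by it, and \<open>pure_bind_sound\<close> provides the implication in every
  instance.\<close>

lemma sr_pure_bind:
  assumes "ty S \<Gamma> (Bind Pure t1 t2 wp1 (Ret Pure t e1) wp2 e2) c"
  shows "ty S \<Gamma> (sub1 e1 e2) c"
proof (rule ty_by_gen[OF assms])
  note cs = ok_closed[OF ok]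
  fix c0
  assume "gen S \<Gamma> (Bind Pure t1 t2 wp1 (Ret Pure t e1) wp2 e2) c0" and "\<exists>i. wcmp S \<Gamma> c0 i"
  then have t2: "ty S \<Gamma> t2 (Tot (Universe 0))" and w2: "ty S \<Gamma> wp2 (Tot (arr t1 (App pure_wp_type t2)))"
    and r: "ty S \<Gamma> (Ret Pure t e1) (Cmp Pure t1 wp1)"
    and e2: "ty S (t1 # \<Gamma>) e2 (Cmp Pure (shift t2) (App (shift wp2) (Var 0)))"
    and c0: "c0 = Cmp Pure t2 (apps pure_bind_star [t1, t2, wp1, wp2])"
    and wc0: "\<exists>i. wcmp S \<Gamma> (Cmp Pure t2 (apps pure_bind_star [t1, t2, wp1, wp2])) i" by auto
  obtain i where wr: "wcmp S \<Gamma> (Cmp Pure t1 wp1) i" using regular[OF ok r] by blast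
  then have t1: "ty S \<Gamma> t1 (Tot (Universe 0))" and w1: "ty S \<Gamma> wp1 (Tot (App pure_wp_type t1))"
    using wcmp_CmpD[OF ok, of \<Gamma> Pure t1 wp1] by auto
  obtain c1 where g: "gen S \<Gamma> (Ret Pure t e1) c1" and c1: "sbc S \<Gamma> c1 (Cmp Pure t1 wp1)" using ty_gen[OF r] by blast
  then have t: "ty S \<Gamma> t (Tot (Universe 0))" "ty S \<Gamma> e1 (Tot t)"
    and c1': "c1 = Cmp Pure t (apps pure_ret_star [t, e1])" by auto
  have "ty S \<Gamma> (Ret Pure t e1) c1" using gen_ty[OF g ty_wctx(3)[OF r]] .
  then obtain j where wc1: "wcmp S \<Gamma> c1 j" using regular[OF ok] by blast
  have st: "sbt S \<Gamma> t t1"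
    and H: "val S \<Gamma> (All (arr t1 (Universe 0)) (Imp (App (shift wp1) (Var 0)) (App (shift (apps pure_ret_star [t, e1])) (Var 0))))"
    using sbc_PureE[OF ok c1[unfolded c1'] wc1[unfolded c1'] wr] by auto
  have e1: "ty S \<Gamma> e1 (Tot t1)" using ty_sbt[OF t(2) st t1] .
  have e: "ty S \<Gamma> (sub1 e1 e2) (Cmp Pure t2 (App wp2 e1))"
    using ty_sub1(1)[OF cs e1 e2] by simp
  obtain k where wk: "wcmp S \<Gamma> (Cmp Pure t2 (App wp2 e1)) k" using regular[OF ok e] by blast
  obtain l where wl: "wcmp S \<Gamma> (Cmp Pure t2 (apps pure_bind_star [t1, t2, wp1, wp2])) l" using wc0 by blast
  have "sbc S \<Gamma> (Cmp Pure t2 (App wp2 e1)) (Cmp Pure t2 (apps pure_bind_star [t1, t2, wp1, wp2]))"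
  proof (rule sbc_PureI[OF wk wl])
    fix \<Delta> s p
    assume s: "styp S \<Delta> s \<Gamma>" and p: "ty S \<Delta> p (Tot (arr (sub s t2) (Universe 0)))"
      and v: "val S \<Delta> (App (sub s (apps pure_bind_star [t1, t2, wp1, wp2])) p)"
    have clw: "sub r pure_wp_type = pure_wp_type" "sub r pure_bind_star = pure_bind_star"
      "sub r pure_ret_star = pure_ret_star" for r
      by (simp_all add: sub_closed)
    have "val S \<Delta> (App (App (sub s wp2) (sub s e1)) p)"
    proof (rule pure_bind_sound)
      show "ty S \<Delta> (sub s t1) (Tot (Universe 0))" "ty S \<Delta> (sub s t2) (Tot (Universe 0))"
        "ty S \<Delta> (sub s t) (Tot (Universe 0))"
        using styp_sub_pred[OF s] t1 t2 t by fastforce+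
      show "ty S \<Delta> (sub s wp1) (Tot (App pure_wp_type (sub s t1)))"
        using styp_sub_pred[OF s w1] by (simp add: clw)
      show "ty S \<Delta> (sub s wp2) (Tot (arr (sub s t1) (App pure_wp_type (sub s t2))))"
        using styp_sub_pred[OF s w2] by (simp add: clw)
      show "ty S \<Delta> (sub s e1) (Tot (sub s t1))" "ty S \<Delta> (sub s e1) (Tot (sub s t))"
        using styp_sub_pred[OF s] e1 t by blast+
      show "sbt S \<Delta> (sub s t) (sub s t1)" using ty_sub(3)[OF cs s st] .
      show "ty S \<Delta> p (Tot (arr (sub s t2) (Universe 0)))" by fact
      show "val S \<Delta> (All (arr (sub s t1) (Universe 0))
          (Imp (App (shift (sub s wp1)) (Var 0)) (App (shift (apps pure_ret_star [sub s t, sub s e1])) (Var 0))))"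
        using ty_sub(5)[OF cs s H] by (simp add: sub_closed ren_closed)
      show "val S \<Delta> (App (apps pure_bind_star [sub s t1, sub s t2, sub s wp1, sub s wp2]) p)"
        using v by (simp add: clw)
    qed
    then show "val S \<Delta> (App (sub s (App wp2 e1)) p)" by simp
  qed
  with e wl show "ty S \<Gamma> (sub1 e1 e2) c0" unfolding c0 using t_Sub by blast
qed

section \<open>Typing of implementations applied to the parts of a computation\<close>

lemma ret_impl_app:
  assumes D: "lookup_eff S F = Some D" and "ty S \<Gamma> t (Tot (Universe 0))" "ty S \<Gamma> e (Tot t)"
  shows "ty S \<Gamma> (apps (ret_impl D) [t, e]) (Tot (apps (repr D) [t, apps (ret_star D) [t, e]]))"
proof -
  note cs = ok_closed[OF ok]
  let ?u = "apps (repr D) [Var 1, apps (ret_star D) [Var 1, Var 0]]"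
  have "ty S \<Gamma> (apps (ret_impl D) [t, e]) (Tot (sub (inst ([] @ [t, e])) ?u))"
  proof (rule ty_apps)
    show "ty S \<Gamma> (ret_impl D) (Tot (sub (inst []) (pis [Universe 0, Var 0] ?u)))"
      using ty_weaken_closed[OF cs ok_sigD(5)[OF ok D] ty_wctx(3)[OF assms(2)]] by (simp add: ret_impl_ty_def)
    fix i assume "i < length [t, e]"
    then show "ty S \<Gamma> ([t, e] ! i) (Tot (sub (inst ([] @ take i [t, e])) ([Universe 0, Var 0] ! i)))"
      using assms by (auto simp: less_Suc_eq)
  qed simp
  then show ?thesis by (simp add: sub_closed closed_sigD(1-6)[OF cs D] inst_simps)
qed

lemma bind_impl_app:
  assumes D: "lookup_eff S F = Some D" and t: "ty S \<Gamma> t1 (Tot (Universe 0))" "ty S \<Gamma> t2 (Tot (Universe 0))"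
    and w: "ty S \<Gamma> w1 (Tot (App (wp_type D) t1))" "ty S \<Gamma> w2 (Tot (arr t1 (App (wp_type D) t2)))"
    and e: "ty S \<Gamma> e1 (Tot (apps (repr D) [t1, w1]))"
    "ty S \<Gamma> e2 (Tot (Pi t1 (Tot (apps (repr D) [shift t2, App (shift w2) (Var 0)]))))"
  shows "ty S \<Gamma> (apps (bind_impl D) [t1, t2, w1, e1, w2, e2])
    (Tot (apps (repr D) [t2, apps (bind_star D) [t1, t2, w1, w2]]))"
proof -
  note cs = ok_closed[OF ok]
  let ?u = "apps (repr D) [Var 4, apps (bind_star D) [Var 5, Var 4, Var 3, Var 1]]"
  let ?ts = "[Universe 0, Universe 0, App (wp_type D) (Var 1),
          apps (repr D) [Var 2, Var 0],
          Pi (Var 3) (Tot (App (wp_type D) (Var 3))),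
          Pi (Var 4) (Tot (apps (repr D) [Var 4, App (Var 1) (Var 0)]))]"
  let ?es = "[t1, t2, w1, e1, w2, e2]"
  note cl = sub_closed closed_sigD(1-6)[OF cs D] ren_closed
  have "ty S \<Gamma> (apps (bind_impl D) ?es) (Tot (sub (inst ([] @ ?es)) ?u))"
  proof (rule ty_apps)
    show "ty S \<Gamma> (bind_impl D) (Tot (sub (inst []) (pis ?ts ?u)))"
      using ty_weaken_closed[OF cs ok_sigD(6)[OF ok D] ty_wctx(3)[OF t(1)]] by (simp add: bind_impl_ty_def)
    fix i assume "i < length ?es"
    then consider "i = 0" | "i = 1" | "i = 2" | "i = 3" | "i = 4" | "i = 5" by fastforce
    then show "ty S \<Gamma> (?es ! i) (Tot (sub (inst ([] @ take i ?es)) (?ts ! i)))"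
      using t w e by cases (simp_all add: cl, simp_all add: numeral_eq_Suc inst_def cl)
  qed simp
  then show ?thesis by (simp add: cl) (simp add: numeral_eq_Suc inst_def)
qed

lemma act_impl_app:
  assumes D: "lookup_eff S F = Some D" "j < length (actions D)" "A = actions D ! j" "wctx S \<Gamma>"
    "length es = length (act_args A)"
    "\<And>i. i < length es \<Longrightarrow> ty S \<Gamma> (es ! i) (Tot (sub (inst (take i es)) (act_args A ! i)))"
  shows "ty S \<Gamma> (apps (act_impl A) es) (Tot (apps (repr D) [sub (inst es) (act_res A), sub (inst es) (act_wp A)]))"
proof -
  note cs = ok_closed[OF ok]
  let ?u = "apps (repr D) [act_res A, act_wp A]"
  have "ty S \<Gamma> (apps (act_impl A) es) (Tot (sub (inst ([] @ es)) ?u))"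
  proof (rule ty_apps)
    show "ty S \<Gamma> (act_impl A) (Tot (sub (inst []) (pis (act_args A) ?u)))"
      using ty_weaken_closed[OF cs ok_sigD(9)[OF ok D(1,2,3)] D(4)] by (simp add: act_impl_ty_def)
  qed (use assms in simp_all)
  then show ?thesis by (simp add: sub_closed closed_sigD(1)[OF cs D(1)])
qed

lemma lift_impl_app:
  assumes L: "lookup_lift S F F' = Some (l, w)" and D: "lookup_eff S F = Some D" "lookup_eff S F' = Some D'"
    and t: "ty S \<Gamma> t (Tot (Universe 0))" "ty S \<Gamma> wp (Tot (App (wp_type D) t))" "ty S \<Gamma> e (Tot (apps (repr D) [t, wp]))"
  shows "ty S \<Gamma> (apps l [t, wp, e]) (Tot (apps (repr D') [t, apps w [t, wp]]))"
proof -
  note cs = ok_closed[OF ok]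
  let ?u = "apps (repr D') [Var 2, apps w [Var 2, Var 1]]"
  let ?ts = "[Universe 0, App (wp_type D) (Var 0), apps (repr D) [Var 1, Var 0]]"
  note cl = sub_closed closed_sigD(1-6)[OF cs D(1)] closed_sigD(1-6)[OF cs D(2)] closed_sigD(12)[OF cs L]
  have "ty S [] l (Tot (lift_impl_ty D D' w))" using ok_liftD[OF ok L] D by auto
  note l = ty_weaken_closed[OF cs this ty_wctx(3)[OF t(1)]]
  have "ty S \<Gamma> (apps l [t, wp, e]) (Tot (sub (inst ([] @ [t, wp, e])) ?u))"
  proof (rule ty_apps)
    show "ty S \<Gamma> l (Tot (sub (inst []) (pis ?ts ?u)))"
      using l by (simp add: lift_impl_ty_def)
    fix i assume "i < length [t, wp, e]"
    then show "ty S \<Gamma> ([t, wp, e] ! i) (Tot (sub (inst ([] @ take i [t, wp, e])) (?ts ! i)))"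
      using t by (auto simp: less_Suc_eq cl inst_simps numeral_2_eq_2)
  qed simp
  then show ?thesis by (simp add: cl inst_simps numeral_2_eq_2)
qed

end

section \<open>Root contractions preserve types\<close>

context
  fixes S assumes ok: "ok_sig S"
begin

lemma Proj_any:
  assumes "ty S \<Gamma> (App (Const k) a) c" "k = CFst \<or> k = CSnd"
  shows "\<exists>p q i j. ty S \<Gamma> p (Tot (Universe i)) \<and> ty S \<Gamma> q (Tot (Universe j)) \<and>
    ty S \<Gamma> a (Tot (prodT p q)) \<and> sbc S \<Gamma> (Tot (if k = CFst then p else q)) c"
proof -
  obtain c0 where "gen S \<Gamma> (App (Const k) a) c0" and c: "sbc S \<Gamma> c0 c" using ty_gen[OF assms(1)] by blast
  then obtain t d where 1: "ty S \<Gamma> (Const k) (Tot (Pi t d))" "ty S \<Gamma> a (Tot t)" "c0 = csub1 a d" by auto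
  obtain p q i j where pq: "ty S \<Gamma> p (Tot (Universe i))" "ty S \<Gamma> q (Tot (Universe j))"
    "sbt S \<Gamma> (arr (prodT p q) (if k = CFst then p else q)) (Pi t d)"
    using Const_inv[OF ok 1(1)] assms(2) by (auto elim!: ktyp.cases)
  from pi_app[OF ok pq(3) 1(2) ty_const2(1)[OF ok_closed[OF ok] pq(1,2)]]
  have "ty S \<Gamma> a (Tot (prodT p q))" "sbc S \<Gamma> (Tot (if k = CFst then p else q)) c0"
    using 1(3) by auto
  with pq c show ?thesis by (blast intro: sc_Trans)
qed

lemma sr_proj:
  assumes "ty S \<Gamma> (App (Const k) (app2 (Const CPair) e1 e2)) c" "k = CFst \<or> k = CSnd"
  shows "ty S \<Gamma> (if k = CFst then e1 else e2) c"
proof -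
  from Proj_any[OF assms] obtain p q i j where
    pq: "ty S \<Gamma> p (Tot (Universe i))" "ty S \<Gamma> q (Tot (Universe j))"
    "ty S \<Gamma> (app2 (Const CPair) e1 e2) (Tot (prodT p q))" "sbc S \<Gamma> (Tot (if k = CFst then p else q)) c"
    by blast
  from Pair_inv[OF ok pq(3)] obtain p' q' where "ty S \<Gamma> e1 (Tot p')" "ty S \<Gamma> e2 (Tot q')"
    "sbt S \<Gamma> (prodT p' q') (prodT p q)" by blast
  with const2_conv[OF ok this(3)] pq have "ty S \<Gamma> e1 (Tot p)" "ty S \<Gamma> e2 (Tot q)"
    using ty_conv by blast+
  then have "ty S \<Gamma> (if k = CFst then e1 else e2) (Tot (if k = CFst then p else q))" by simp
  then show ?thesis using pq(4) regular[OF ok assms(1)] t_Sub by blast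
qed

text \<open>The sum type of the injection and that of the scrutinee agree up to conversion, so the
  injected term fits the branch. For a case on computations the transformer is a case on the same
  injection; it reduces to the transformer of the chosen branch, and conversion returns to the
  original type.\<close>

lemma sr_case_inj:
  assumes "ty S \<Gamma> (Case r (App (Const k) e) e1 e2) c" "k = CInl \<or> k = CInr"
  shows "ty S \<Gamma> (sub1 e (if k = CInl then e1 else e2)) c"
proof (rule ty_by_gen[OF ok assms(1)])
  note cs = ok_closed[OF ok]
  fix c0 assume g: "gen S \<Gamma> (Case r (App (Const k) e) e1 e2) c0" and w: "\<exists>i. wcmp S \<Gamma> c0 i"
  then obtain t1 t2 where e: "ty S \<Gamma> (App (Const k) e) (Tot (sumT t1 t2))"
    and w12: "wctx S (t1 # \<Gamma>)" "wctx S (t2 # \<Gamma>)" and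
    alt: "(\<exists>i. ty S (sumT t1 t2 # \<Gamma>) r (Tot (Universe i)) \<and>
        ty S (t1 # \<Gamma>) e1 (Tot (sub (via CInl) r)) \<and> ty S (t2 # \<Gamma>) e2 (Tot (sub (via CInr) r)) \<and>
        c0 = Tot (sub1 (App (Const k) e) r)) \<or>
     (\<exists>t0 M wp1 wp2 W. r = shift t0 \<and> ty S \<Gamma> t0 (Tot (Universe 0)) \<and>
        ty S (t1 # \<Gamma>) e1 (Cmp M r wp1) \<and> ty S (t2 # \<Gamma>) e2 (Cmp M r wp2) \<and>
        wp_type_of S M = Some W \<and> c0 = Cmp M t0 (Case (shift (App W t0)) (App (Const k) e) wp1 wp2))"
    by (simp only: gen.simps) blast
  let ?t = "if k = CInl then t1 else t2" let ?b = "if k = CInl then e1 else e2"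
  obtain l where t: "ty S \<Gamma> ?t (Tot (Universe l))" using wctx_ConsD w12 by (metis (full_types))
  from Inj_inv[OF ok e assms(2)] obtain p q where pq: "ty S \<Gamma> e (Tot (if k = CInl then p else q))"
    "sbt S \<Gamma> (sumT p q) (sumT t1 t2)" by blast
  have "conv S (if k = CInl then p else q) ?t" using const2_conv[OF ok pq(2)] by simp
  with pq(1) t have e': "ty S \<Gamma> e (Tot ?t)" using ty_conv by blast
  from alt show "ty S \<Gamma> (sub1 e ?b) c0"
  proof (elim disjE exE conjE)
    assume "ty S (t1 # \<Gamma>) e1 (Tot (sub (via CInl) r))" "ty S (t2 # \<Gamma>) e2 (Tot (sub (via CInr) r))"
      and c0: "c0 = Tot (sub1 (App (Const k) e) r)"
    with assms(2) have "ty S (?t # \<Gamma>) ?b (Tot (sub (via k) r))" by auto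
    from ty_sub1(1)[OF cs e' this] show ?thesis unfolding c0 by (simp add: sub1_via)
  next
    fix t0 M wp1 wp2 W
    assume r: "r = shift t0" and "ty S (t1 # \<Gamma>) e1 (Cmp M r wp1)" "ty S (t2 # \<Gamma>) e2 (Cmp M r wp2)"
      and c0: "c0 = Cmp M t0 (Case (shift (App W t0)) (App (Const k) e) wp1 wp2)"
    with assms(2) have "ty S (?t # \<Gamma>) ?b (Cmp M (shift t0) (if k = CInl then wp1 else wp2))" by auto
    from ty_sub1(1)[OF cs e' this] have "ty S \<Gamma> (sub1 e ?b) (Cmp M t0 (sub1 e (if k = CInl then wp1 else wp2)))"
      by simp
    moreover have "conv S (Case (shift (App W t0)) (App (Const k) e) wp1 wp2) (sub1 e (if k = CInl then wp1 else wp2))"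
      using assms(2) by (auto intro: conv_red R_CaseInl R_CaseInr)
    ultimately have "convc S (Cmp M t0 (sub1 e (if k = CInl then wp1 else wp2))) c0"
      unfolding c0 by (simp add: conv_sym)
    moreover have "ty S \<Gamma> (sub1 e ?b) (Cmp M t0 (sub1 e (if k = CInl then wp1 else wp2)))" by fact
    ultimately show ?thesis using w ty_convc[OF ok] by blast
  qed
qed

lemma sr_ctr:
  assumes "ctr S t u" "ty S \<Gamma> t c"
  shows "ty S \<Gamma> u c"
  using assms(1)
proof cases
  note cs = ok_closed[OF ok]
  case (ctr_Bind t1 t2 wp1 t e1 wp2 e2)
  then show ?thesis using assms(2) sr_pure_bind[OF ok] by blast
next
  case (ctr_Beta s e a)
  show ?thesis
  proof (rule ty_by_gen[OF ok assms(2)])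
    fix c0 assume "gen S \<Gamma> t c0"
    then show "ty S \<Gamma> u c0" using ctr_Beta Lam_inv[OF ok] by auto
  qed
next
  case (ctr_Fst e2)
  then show ?thesis using sr_proj[of \<Gamma> CFst] assms(2) by simp
next
  case (ctr_Snd e1)
  then show ?thesis using sr_proj[of \<Gamma> CSnd] assms(2) by simp
next
  case (ctr_Inl r e e1 e2)
  then show ?thesis using sr_case_inj[of \<Gamma> _ CInl] assms(2) by simp
next
  case (ctr_Inr r e e1 e2)
  then show ?thesis using sr_case_inj[of \<Gamma> _ CInr] assms(2) by simp
next
  case (ctr_Run r)
  show ?thesis
  proof (rule ty_by_gen[OF ok assms(2)])
    fix c0 assume "gen S \<Gamma> t c0"
    then obtain t' wp where r: "ty S \<Gamma> (Ret Pure r u) (Cmp Pure t' wp)" and c0: "c0 = Tot t'"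
      using ctr_Run by auto
    obtain c1 where "gen S \<Gamma> (Ret Pure r u) c1" "sbc S \<Gamma> c1 (Cmp Pure t' wp)" using ty_gen[OF r] by blast
    then have "ty S \<Gamma> u (Tot r)" "sbt S \<Gamma> r t'"
      using sbc_fin_all(6)[OF ok, of \<Gamma> c1 "Cmp Pure t' wp"] by auto
    moreover obtain i where "ty S \<Gamma> t' (Tot (Universe i))"
      using regular[OF ok r] wcmp_CmpD(2)[OF ok] by blast
    ultimately show "ty S \<Gamma> u c0" using c0 ty_sbt[OF ok] by blast
  qed
next
  case ctr_Reflect
  show ?thesis
  proof (rule ty_by_gen[OF ok assms(2)])
    fix c0 assume "gen S \<Gamma> t c0" and w: "\<exists>i. wcmp S \<Gamma> c0 i"
    then obtain F t' wp D where r: "ty S \<Gamma> (Reflect u) (Cmp (User F) t' wp)" "lookup_eff S F = Some D"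
      and c0: "c0 = Tot (apps (repr D) [t', wp])"
      using ctr_Reflect by (simp only: gen.simps) blast
    obtain c1 where "gen S \<Gamma> (Reflect u) c1" and s: "sbc S \<Gamma> c1 (Cmp (User F) t' wp)" using ty_gen[OF r(1)] by blast
    then obtain F1 t1 wp1 D1 where 1: "ty S \<Gamma> u (Tot (apps (repr D1) [t1, wp1]))" "lookup_eff S F1 = Some D1"
      "c1 = Cmp (User F1) t1 wp1" by (simp only: gen.simps) blast
    then have "sbt S \<Gamma> (apps (repr D) [t1, wp1]) (apps (repr D) [t', wp])" "D1 = D"
      using sbc_UserE[OF ok, of \<Gamma> F1 t1 wp1 "User F" t' wp D1] s r(2) by auto
    then show "ty S \<Gamma> u c0" using 1 c0 w t_Sub sc_Tot by blast
  qed
next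
  case (ctr_ReifyRet F D r e)
  show ?thesis
  proof (rule ty_by_gen[OF ok assms(2)])
    fix c0 assume "gen S \<Gamma> t c0" and w: "\<exists>i. wcmp S \<Gamma> c0 i"
    then obtain F' t' wp D' where r: "ty S \<Gamma> (Ret (User F) r e) (Cmp (User F') t' wp)" "lookup_eff S F' = Some D'"
      and c0: "c0 = Tot (apps (repr D') [t', wp])"
      using ctr_ReifyRet by (simp only: gen.simps) blast
    obtain c1 where "gen S \<Gamma> (Ret (User F) r e) c1" and s: "sbc S \<Gamma> c1 (Cmp (User F') t' wp)" using ty_gen[OF r(1)] by blast
    then have 1: "ty S \<Gamma> r (Tot (Universe 0))" "ty S \<Gamma> e (Tot r)" "c1 = Cmp (User F) r (apps (ret_star D) [r, e])"
      using ctr_ReifyRet(3) by auto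
    have "sbt S \<Gamma> (apps (repr D) [r, apps (ret_star D) [r, e]]) (apps (repr D') [t', wp])"
      using sbc_UserE[OF ok, of \<Gamma> F _ _ "User F'"] s r(2) 1(3) ctr_ReifyRet(3) by fastforce
    then show "ty S \<Gamma> u c0" using ret_impl_app[OF ok ctr_ReifyRet(3) 1(1,2)] c0 w ctr_ReifyRet(2) t_Sub sc_Tot by blast
  qed
next
  case (ctr_ReifyBind F D t1 t2 wp1 e1 wp2 e2)
  show ?thesis
  proof (rule ty_by_gen[OF ok assms(2)])
    fix c0 assume "gen S \<Gamma> t c0" and w: "\<exists>i. wcmp S \<Gamma> c0 i"
    let ?B = "Bind (User F) t1 t2 wp1 e1 wp2 e2"
    from \<open>gen S \<Gamma> t c0\<close> obtain F' t' wp D' where r: "ty S \<Gamma> ?B (Cmp (User F') t' wp)" "lookup_eff S F' = Some D'"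
      and c0: "c0 = Tot (apps (repr D') [t', wp])"
      using ctr_ReifyBind by (simp only: gen.simps) blast
    obtain c1 where "gen S \<Gamma> ?B c1" and s: "sbc S \<Gamma> c1 (Cmp (User F') t' wp)" using ty_gen[OF r(1)] by blast
    then have 1: "ty S \<Gamma> t2 (Tot (Universe 0))" "ty S \<Gamma> wp2 (Tot (arr t1 (App (wp_type D) t2)))"
      "ty S \<Gamma> e1 (Cmp (User F) t1 wp1)" "ty S (t1 # \<Gamma>) e2 (Cmp (User F) (shift t2) (App (shift wp2) (Var 0)))"
      "c1 = Cmp (User F) t2 (apps (bind_star D) [t1, t2, wp1, wp2])"
      using ctr_ReifyBind(3) by auto
    have 2: "ty S \<Gamma> t1 (Tot (Universe 0))" "ty S \<Gamma> wp1 (Tot (App (wp_type D) t1))"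
      using regular[OF ok 1(3)] wcmp_CmpD[OF ok, of \<Gamma> "User F" t1 wp1] ctr_ReifyBind(3) by auto
    have "ty S \<Gamma> (Reify e1) (Tot (apps (repr D) [t1, wp1]))" using t_Reify[OF 1(3) ctr_ReifyBind(3)] .
    moreover have "ty S \<Gamma> (Lam t1 (Reify e2)) (Tot (Pi t1 (Tot (apps (repr D) [shift t2, App (shift wp2) (Var 0)]))))"
      using t_Lam[OF 2(1) t_Reify[OF 1(4) ctr_ReifyBind(3)]] .
    ultimately have "ty S \<Gamma> u (Tot (apps (repr D) [t2, apps (bind_star D) [t1, t2, wp1, wp2]]))"
      unfolding ctr_ReifyBind(2) using bind_impl_app[OF ok ctr_ReifyBind(3) 2(1) 1(1) 2(2) 1(2)] by blast
    moreover have "sbt S \<Gamma> (apps (repr D) [t2, apps (bind_star D) [t1, t2, wp1, wp2]]) (apps (repr D') [t', wp])"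
      using sbc_UserE[OF ok, of \<Gamma> F _ _ "User F'"] s r(2) 1(5) ctr_ReifyBind(3) by fastforce
    ultimately show "ty S \<Gamma> u c0" using c0 w t_Sub sc_Tot by blast
  qed
next
  case (ctr_ReifyAct F D j es)
  show ?thesis
  proof (rule ty_by_gen[OF ok assms(2)])
    fix c0 assume "gen S \<Gamma> t c0" and w: "\<exists>i. wcmp S \<Gamma> c0 i" and wc: "wctx S \<Gamma>"
    then obtain F' t' wp D' where r: "ty S \<Gamma> (Act F j es) (Cmp (User F') t' wp)" "lookup_eff S F' = Some D'"
      and c0: "c0 = Tot (apps (repr D') [t', wp])"
      using ctr_ReifyAct by (simp only: gen.simps) blast
    let ?A = "actions D ! j"
    obtain c1 where "gen S \<Gamma> (Act F j es) c1" and s: "sbc S \<Gamma> c1 (Cmp (User F') t' wp)" using ty_gen[OF r(1)] by blast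
    then have 1: "length es = length (act_args ?A)"
      "\<And>i. i < length es \<Longrightarrow> ty S \<Gamma> (es ! i) (Tot (sub (inst (take i es)) (act_args ?A ! i)))"
      "c1 = csub (inst es) (Cmp (User F) (act_res ?A) (act_wp ?A))"
      using ctr_ReifyAct(3) by auto
    have "sbt S \<Gamma> (apps (repr D) [sub (inst es) (act_res ?A), sub (inst es) (act_wp ?A)]) (apps (repr D') [t', wp])"
      using sbc_UserE[OF ok, of \<Gamma> F _ _ "User F'"] s r(2) 1(3) ctr_ReifyAct(3) by fastforce
    then show "ty S \<Gamma> u c0"
      using act_impl_app[OF ok ctr_ReifyAct(3,4) refl wc 1(1,2)] c0 w ctr_ReifyAct(2) t_Sub sc_Tot by blast
  qed
next
  case (ctr_ReifyLift F F' l wl r wp e)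
  show ?thesis
  proof (rule ty_by_gen[OF ok assms(2)])
    fix c0 assume "gen S \<Gamma> t c0" and w: "\<exists>i. wcmp S \<Gamma> c0 i"
    then obtain G t' wp' D2 where r: "ty S \<Gamma> (Lift F F' r wp e) (Cmp (User G) t' wp')" "lookup_eff S G = Some D2"
      and c0: "c0 = Tot (apps (repr D2) [t', wp'])"
      using ctr_ReifyLift by (simp only: gen.simps) blast
    obtain c1 where "gen S \<Gamma> (Lift F F' r wp e) c1" and s: "sbc S \<Gamma> c1 (Cmp (User G) t' wp')" using ty_gen[OF r(1)] by blast
    then have 1: "ty S \<Gamma> e (Cmp (User F) r wp)" "c1 = Cmp (User F') r (apps wl [r, wp])"
      using ctr_ReifyLift(3) by auto
    obtain D D' where D: "lookup_eff S F = Some D" "lookup_eff S F' = Some D'"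
      using ok_liftD[OF ok ctr_ReifyLift(3)] by blast
    have 2: "ty S \<Gamma> r (Tot (Universe 0))" "ty S \<Gamma> wp (Tot (App (wp_type D) r))"
      using regular[OF ok 1(1)] wcmp_CmpD[OF ok, of \<Gamma> "User F" r wp] D by auto
    have "sbt S \<Gamma> (apps (repr D') [r, apps wl [r, wp]]) (apps (repr D2) [t', wp'])"
      using sbc_UserE[OF ok, of \<Gamma> F' _ _ "User G"] s r(2) 1(2) D by fastforce
    then show "ty S \<Gamma> u c0"
      using lift_impl_app[OF ok ctr_ReifyLift(3) D 2 t_Reify[OF 1(1) D(1)]] c0 w ctr_ReifyLift(2) t_Sub sc_Tot by blast
  qed
qed

end

text \<open>The return type of a case on computations is a shifted type. Induction on size, unlike
  structural induction, gives access to the type before shifting.\<close>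

lemma size_ren: "size (ren r t) = size t" "size (cren r c) = size c"
proof (induction t and c arbitrary: r and r)
  case (Act F j es)
  have "size_list size (map (ren r) es) = size_list size es"
    using Act by (induction es) auto
  then show ?case by simp
qed simp_all

section \<open>Inner parallel steps preserve types\<close>

context
  fixes S assumes ok: "ok_sig S"
begin

lemma ctx_conv:
  assumes "ty S \<Gamma> t (Tot (Universe i))" "ty S \<Gamma> t' (Tot (Universe j))" "conv S t t'"
  shows "ty S (t # \<Gamma>) e c \<Longrightarrow> ty S (t' # \<Gamma>) e c" "wcmp S (t # \<Gamma>) d k \<Longrightarrow> wcmp S (t' # \<Gamma>) d k"
  using ty_narrow(1,2)[OF ok_closed[OF ok] wctx_ConsI[OF ok_closed[OF ok] assms(1)] wctx_ConsI[OF ok_closed[OF ok] assms(2)]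
      s_Conv[OF conv_sym[OF assms(3)]]] by blast+

text \<open>The last assumption is subject reduction for the step from \<open>w\<close> to
  \<open>w'\<close>, as delivered by the induction hypothesis of \<open>sr_prn\<close>.\<close>

lemma wcmp_conv:
  assumes "wcmp S \<Gamma> (Cmp M u w) i" "ty S \<Gamma> u' (Tot (Universe 0))" "conv S u u'"
    and "\<And>c. ty S \<Gamma> w c \<Longrightarrow> ty S \<Gamma> w' c"
  shows "wcmp S \<Gamma> (Cmp M u' w') 0"
proof -
  obtain W where W: "wp_type_of S M = Some W" "ty S \<Gamma> w (Tot (App W u))"
    using wcmp_CmpD[OF ok assms(1)] by blast
  obtain k where "ty S \<Gamma> (App W u') (Tot (Universe k))" using AppW_ty[OF ok W(1) assms(2)] by blast
  then have "ty S \<Gamma> w' (Tot (App W u'))"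
    using assms(4)[OF W(2)] ty_conv conv_app[OF conv_refl assms(3)] by blast
  then show ?thesis using wcmp_CmpI[OF ok W(1) assms(2)] by blast
qed

lemma styp_via:
  assumes "k = CInl \<or> k = CInr" "ty S \<Gamma> t1 (Tot (Universe i))" "ty S \<Gamma> t2 (Tot (Universe j))"
  shows "styp S ((if k = CInl then t1 else t2) # \<Gamma>) (via k) (sumT t1 t2 # \<Gamma>)"
proof -
  note cs = ok_closed[OF ok]
  let ?t = "if k = CInl then t1 else t2"
  have t: "ty S \<Gamma> ?t (Tot (Universe (if k = CInl then i else j)))" using assms by simp
  have w: "wctx S (?t # \<Gamma>)" using t by (rule wctx_ConsI[OF cs])
  show ?thesis
    unfolding styp_def
  proof (intro conjI allI impI)
    fix n assume n: "n < length (sumT t1 t2 # \<Gamma>)"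
    show "ty S (?t # \<Gamma>) (via k n) (Tot (sub (via k) (at (sumT t1 t2 # \<Gamma>) n)))"
    proof (cases n)
      case 0
      have sh: "ty S (?t # \<Gamma>) (shift t1) (Tot (Universe i))" "ty S (?t # \<Gamma>) (shift t2) (Tot (Universe j))"
        using ty_shift(1)[OF cs w assms(2)] ty_shift(1)[OF cs w assms(3)] by simp_all
      have "ty S (?t # \<Gamma>) (Const k) (Tot (arr (shift ?t) (sumT (shift t1) (shift t2))))"
        using assms(1) t_Const[OF k_Inl[OF sh]] t_Const[OF k_Inr[OF sh]] by auto
      then have "ty S (?t # \<Gamma>) (App (Const k) (Var 0)) (Tot (sumT (shift t1) (shift t2)))"
        using ty_Var_n(1)[OF cs w] by (rule ty_app_arr[OF cs])
      moreover have "sub (via k) (shift x) = shift x" for x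
      proof -
        have "sub (via k) (shift x) = sub (\<lambda>k. Var (Suc k)) x" by (simp add: sub_ren)
        then show ?thesis by (simp only: sub_Suc)
      qed
      ultimately show ?thesis using 0 by (simp only: via_simps at_simps) simp
    next
      case (Suc m)
      have "ty S (?t # \<Gamma>) (Var (Suc m)) (Tot (at (?t # \<Gamma>) (Suc m)))" using n Suc w by (intro t_Var) auto
      moreover have "sub (via k) (shift x) = shift x" for x
      proof -
        have "sub (via k) (shift x) = sub (\<lambda>k. Var (Suc k)) x" by (simp add: sub_ren)
        then show ?thesis by (simp only: sub_Suc)
      qed
      ultimately show ?thesis using Suc by (simp only: via_simps at_simps)
    qed
  qed (rule w)
qed

lemma convc_csub1: "conv S a a' \<Longrightarrow> convc S (csub1 a' d) (csub1 a d)"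
  by (cases d) (auto intro: conv_hole conv_sym)

text \<open>Types mention the annotations, arguments and transformers that are being reduced. So the
  reduct is typed at the reduced type, and \<open>ty_convc\<close> leads back to the original type,
  which is well formed by regularity.\<close>

lemma sr_prn:
  assumes IH: "\<And>s X s' \<Gamma> c. size s < size t \<Longrightarrow> pr S X s s' \<Longrightarrow> ty S \<Gamma> s c \<Longrightarrow> ty S \<Gamma> s' c"
    and "prn S X t m" "ty S \<Gamma> t c"
  shows "ty S \<Gamma> m c"
proof (rule ty_by_gen[OF ok assms(3)])
  note cs = ok_closed[OF ok]
  note pc = pr_conv[OF cs]
  fix c0 assume g: "gen S \<Gamma> t c0" and w: "wctx S \<Gamma>" and wf: "\<exists>i. wcmp S \<Gamma> c0 i"
  show "ty S \<Gamma> m c0"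
    using assms(2)
  proof cases
    case (prn_Var k)
    then show ?thesis using gen_ty[OF ok g w] by simp
  next
    case (prn_Universe k)
    then show ?thesis using gen_ty[OF ok g w] by simp
  next
    case (prn_Const k)
    then show ?thesis using gen_ty[OF ok g w] by simp
  next
    case (prn_Refine a a' b b')
    then obtain i j where 1: "ty S \<Gamma> a (Tot (Universe i))" "ty S (a # \<Gamma>) b (Tot (Universe j))" "c0 = Tot (Universe i)"
      using g by auto
    have 2: "ty S \<Gamma> a' (Tot (Universe i))" "ty S (a # \<Gamma>) b' (Tot (Universe j))"
      using IH[OF _ prn_Refine(3) 1(1)] IH[OF _ prn_Refine(4) 1(2)] prn_Refine(1) by auto
    then show ?thesis
      using 1(3) prn_Refine(2) ctx_conv(1)[OF 1(1) 2(1) pc[OF prn_Refine(3)]] t_Refine by blast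
  next
    case (prn_Lam a a' b b')
    then obtain i d where 1: "ty S \<Gamma> a (Tot (Universe i))" "ty S (a # \<Gamma>) b d" "c0 = Tot (Pi a d)"
      using g by auto
    have 2: "ty S \<Gamma> a' (Tot (Universe i))" "ty S (a # \<Gamma>) b' d"
      using IH[OF _ prn_Lam(3) 1(1)] IH[OF _ prn_Lam(4) 1(2)] prn_Lam(1) by auto
    have "ty S \<Gamma> (Lam a' b') (Tot (Pi a' d))"
      using t_Lam[OF 2(1) ctx_conv(1)[OF 1(1) 2(1) pc[OF prn_Lam(3)] 2(2)]] .
    \<comment> \<open>\<open>red\<close> has no evaluation context for the domain of a product, so
      the conversion of the two product types is read off a parallel step.\<close>
    moreover have "pr S X (Pi a d) (Pi a' d)"
      by (rule pr_prn_prc.pr_cong, rule pr_prn_prc.prn_Pi[OF prn_Lam(3) pr_refl(2)])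
    then have "convc S (Tot (Pi a' d)) c0" using 1(3) pc conv_sym by auto
    ultimately show ?thesis using wf ty_convc[OF ok] prn_Lam(2) by blast
  next
    case (prn_Pi a a' d d')
    then obtain i j where 1: "ty S \<Gamma> a (Tot (Universe i))" "wcmp S (a # \<Gamma>) d j" "c0 = Tot (Universe (max i j))"
      using g by auto
    have 2: "ty S \<Gamma> a' (Tot (Universe i))" using IH[OF _ prn_Pi(3) 1(1)] prn_Pi(1) by auto
    have "wcmp S (a # \<Gamma>) d' j"
      using prn_Pi(4)
    proof cases
      case (prc_Tot b b')
      then show ?thesis using 1(2) ty_TotD[OF ok] IH[OF _ prc_Tot(3)] prn_Pi(1) c_Tot by fastforce
    next
      case (prc_Cmp b b' e e' M)
      have b': "ty S (a # \<Gamma>) b' (Tot (Universe 0))"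
        using IH[OF _ prc_Cmp(3)] wcmp_CmpD(2)[OF ok 1(2)[unfolded prc_Cmp(1)]] prc_Cmp(1) prn_Pi(1) by fastforce
      have "wcmp S (a # \<Gamma>) (Cmp M b' e') 0"
        by (rule wcmp_conv[OF 1(2)[unfolded prc_Cmp(1)] b' pc[OF prc_Cmp(3)]])
          (use IH[OF _ prc_Cmp(4)] prc_Cmp(1) prn_Pi(1) in auto)
      moreover have "j = 0" using wcmp_CmpD(1)[OF ok 1(2)[unfolded prc_Cmp(1)]] .
      ultimately show ?thesis using prc_Cmp by simp
    qed
    then have "wcmp S (a' # \<Gamma>) d' j" using ctx_conv(2)[OF 1(1) 2(1) pc[OF prn_Pi(3)]] by blast
    then show ?thesis using 2 1(3) prn_Pi(2) t_Pi by blast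
  next
    case (prn_App f f' a a')
    then obtain s d where 1: "ty S \<Gamma> f (Tot (Pi s d))" "ty S \<Gamma> a (Tot s)" "c0 = csub1 a d"
      using g by auto
    have "ty S \<Gamma> f' (Tot (Pi s d))" "ty S \<Gamma> a' (Tot s)"
      using IH[OF _ prn_App(3) 1(1)] IH[OF _ prn_App(4) 1(2)] prn_App(1) by auto
    then have "ty S \<Gamma> m (csub1 a' d)" unfolding prn_App(2) by (rule t_App)
    then show ?thesis using convc_csub1[OF pc[OF prn_App(4)]] wf 1(3) ty_convc[OF ok] by blast
  next
    case (prn_Case r r' e e' e1 e2 e1' e2')
    have sz: "size r < size t" "size e < size t" "size e1 < size t" "size e2 < size t" using prn_Case(1) by auto
    from g[unfolded prn_Case(1)] obtain t1 t2 where e: "ty S \<Gamma> e (Tot (sumT t1 t2))"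
      and w12: "wctx S (t1 # \<Gamma>)" "wctx S (t2 # \<Gamma>)" and
      alt: "wctx S (sumT t1 t2 # \<Gamma>) \<and> (\<exists>i. ty S (sumT t1 t2 # \<Gamma>) r (Tot (Universe i)) \<and>
        ty S (t1 # \<Gamma>) e1 (Tot (sub (via CInl) r)) \<and> ty S (t2 # \<Gamma>) e2 (Tot (sub (via CInr) r)) \<and>
        c0 = Tot (sub1 e r)) \<or>
     (\<exists>t0 M wp1 wp2 W. r = shift t0 \<and> ty S \<Gamma> t0 (Tot (Universe 0)) \<and>
        ty S (t1 # \<Gamma>) e1 (Cmp M r wp1) \<and> ty S (t2 # \<Gamma>) e2 (Cmp M r wp2) \<and>
        wp_type_of S M = Some W \<and> c0 = Cmp M t0 (Case (shift (App W t0)) e wp1 wp2))"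
      by (simp only: gen.simps) blast
    obtain i1 i2 where t12: "ty S \<Gamma> t1 (Tot (Universe i1))" "ty S \<Gamma> t2 (Tot (Universe i2))"
      using wctx_ConsD w12 by blast
    have e': "ty S \<Gamma> e' (Tot (sumT t1 t2))" using IH[OF sz(2) prn_Case(4) e] .
    from alt show ?thesis
    proof (elim disjE exE conjE)
      fix i
      assume ws: "wctx S (sumT t1 t2 # \<Gamma>)" and r: "ty S (sumT t1 t2 # \<Gamma>) r (Tot (Universe i))"
        and b: "ty S (t1 # \<Gamma>) e1 (Tot (sub (via CInl) r))" "ty S (t2 # \<Gamma>) e2 (Tot (sub (via CInr) r))"
        and c0: "c0 = Tot (sub1 e r)"
      have r': "ty S (sumT t1 t2 # \<Gamma>) r' (Tot (Universe i))" using IH[OF sz(1) prn_Case(3) r] .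
      have "ty S (t1 # \<Gamma>) e1' (Tot (sub (via CInl) r))" "ty S (t2 # \<Gamma>) e2' (Tot (sub (via CInr) r))"
        using IH[OF sz(3) prn_Case(5) b(1)] IH[OF sz(4) prn_Case(6) b(2)] by auto
      moreover have "ty S (t1 # \<Gamma>) (sub (via CInl) r') (Tot (Universe i))"
        "ty S (t2 # \<Gamma>) (sub (via CInr) r') (Tot (Universe i))"
        using ty_sub(1)[OF cs styp_via[of CInl, OF _ t12] r'] ty_sub(1)[OF cs styp_via[of CInr, OF _ t12] r'] by auto
      moreover have "conv S (sub (via k) r) (sub (via k) r')" for k
        using conv_sub[OF cs pc[OF prn_Case(3)]] .
      ultimately have "ty S (t1 # \<Gamma>) e1' (Tot (sub (via CInl) r'))" "ty S (t2 # \<Gamma>) e2' (Tot (sub (via CInr) r'))"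
        using ty_conv by blast+
      then have "ty S \<Gamma> m (Tot (sub1 e' r'))"
        unfolding prn_Case(2) using t_Case[OF e' ws w12 r'] by blast
      moreover
      have "conv S (sub1 e' r') (sub1 e r)"
        using conv_hole[OF pc[OF prn_Case(4)]] conv_sub[OF cs pc[OF prn_Case(3)]] conv_trans conv_sym by blast
      then have "convc S (Tot (sub1 e' r')) c0" using c0 by simp
      ultimately show ?thesis using wf ty_convc[OF ok] by blast
    next
      fix t0 M wp1 wp2 W
      assume r: "r = shift t0" and t0: "ty S \<Gamma> t0 (Tot (Universe 0))"
        and b: "ty S (t1 # \<Gamma>) e1 (Cmp M r wp1)" "ty S (t2 # \<Gamma>) e2 (Cmp M r wp2)"
        and W: "wp_type_of S M = Some W" and c0: "c0 = Cmp M t0 (Case (shift (App W t0)) e wp1 wp2)"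
      \<comment> \<open>The return type of a case on computations is a shift, and so is its reduct,
        because a step creates no free variables. Substituting for the absent index extracts the
        step between the types before shifting, and the induction hypothesis applies to these
        because shifting keeps the size.\<close>
      define t0' where "t0' = sub1 (Universe 0) r'"
      have "0 \<notin> fv r'" using fv_pr(1)[OF cs prn_Case(3)] r by (auto simp: fv_ren)
      then have r': "r' = shift t0'" unfolding t0'_def by (rule unshift)
      have pt0: "pr S X t0 t0'"
        using pr_sub1[OF cs prn_Case(3) pr_refl(1)[of S X "Universe 0"]] by (simp add: r t0'_def)
      have t0': "ty S \<Gamma> t0' (Tot (Universe 0))"
        using IH[OF _ pt0 t0] sz(1) r by (simp add: size_ren)
      have cv: "conv S r r'" using pc[OF prn_Case(3)] .
      have b': "ty S (t1 # \<Gamma>) e1' (Cmp M r wp1)" "ty S (t2 # \<Gamma>) e2' (Cmp M r wp2)"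
        using IH[OF sz(3) prn_Case(5) b(1)] IH[OF sz(4) prn_Case(6) b(2)] by auto
      have "ty S (t1 # \<Gamma>) r' (Tot (Universe 0))" "ty S (t2 # \<Gamma>) r' (Tot (Universe 0))"
        unfolding r' using ty_shift(1)[OF cs w12(1) t0'] ty_shift(1)[OF cs w12(2) t0'] by auto
      then have "wcmp S (t1 # \<Gamma>) (Cmp M r' wp1) 0" "wcmp S (t2 # \<Gamma>) (Cmp M r' wp2) 0"
        using regular[OF ok b(1)] regular[OF ok b(2)] wcmp_conv[OF _ _ cv] by blast+
      then have "ty S (t1 # \<Gamma>) e1' (Cmp M (shift t0') wp1)" "ty S (t2 # \<Gamma>) e2' (Cmp M (shift t0') wp2)"
        using ty_convc[OF ok b'(1)] ty_convc[OF ok b'(2)] cv unfolding r' by auto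
      then have "ty S \<Gamma> m (Cmp M t0' (Case (shift (App W t0')) e' wp1 wp2))"
        unfolding prn_Case(2) r' using t_CaseM[OF e' w12 t0' _ _ W] by blast
      moreover have "pr S X (Case (shift (App W t0)) e wp1 wp2) (Case (shift (App W t0')) e' wp1 wp2)"
        using prn_Case(3,4) unfolding r r'
        by (intro pr_prn_prc.pr_cong[OF pr_prn_prc.prn_Case]) (auto intro!: pr_prn_prc.pr_cong[OF pr_prn_prc.prn_App] pr_refl)
      ultimately show ?thesis
        using c0 wf ty_convc[OF ok] conv_sym[OF pc] pt0 by (metis convc_simps(3))
    qed
  next
    case (prn_Run e e')
    then show ?thesis using g IH[OF _ prn_Run(3)] t_Run by fastforce
  next
    case (prn_Reify e e')
    then show ?thesis using g IH[OF _ prn_Reify(3)] t_Reify by fastforce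
  next
    case (prn_Reflect e e')
    then show ?thesis using g IH[OF _ prn_Reflect(3)] t_Reflect by fastforce
  next
    case (prn_Lift r r' wp wp' e e' F F')
    then obtain l wl where 1: "ty S \<Gamma> e (Cmp (User F) r wp)" "lookup_lift S F F' = Some (l, wl)"
      "c0 = Cmp (User F') r (apps wl [r, wp])" using g by auto
    obtain i where wc: "wcmp S \<Gamma> (Cmp (User F) r wp) i" using regular[OF ok 1(1)] by blast
    have r': "ty S \<Gamma> r' (Tot (Universe 0))"
      using IH[OF _ prn_Lift(3) wcmp_CmpD(2)[OF ok wc]] prn_Lift(1) by simp
    have "wcmp S \<Gamma> (Cmp (User F) r' wp') 0"
      by (rule wcmp_conv[OF wc r' pc[OF prn_Lift(3)]]) (use IH[OF _ prn_Lift(4)] prn_Lift(1) in auto)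
    moreover have "ty S \<Gamma> e' (Cmp (User F) r wp)" using IH[OF _ prn_Lift(5) 1(1)] prn_Lift(1) by simp
    ultimately have "ty S \<Gamma> e' (Cmp (User F) r' wp')"
      using ty_convc[OF ok] pc[OF prn_Lift(3)] pc[OF prn_Lift(4)] by simp
    then have "ty S \<Gamma> m (Cmp (User F') r' (apps wl [r', wp']))"
      unfolding prn_Lift(2) using 1(2) by (rule t_Lift)
    moreover have "convc S (Cmp (User F') r' (apps wl [r', wp'])) c0"
      using 1(3) pc[OF prn_Lift(3)] pc[OF prn_Lift(4)] by (auto intro!: conv_app conv_refl intro: conv_sym)
    ultimately show ?thesis using wf ty_convc[OF ok] by blast
  next
    case (prn_Act es es' F j)
    then obtain D A where 1: "lookup_eff S F = Some D" "j < length (actions D)" "A = actions D ! j"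
      "length es = length (act_args A)"
      "\<And>i. i < length es \<Longrightarrow> ty S \<Gamma> (es ! i) (Tot (sub (inst (take i es)) (act_args A ! i)))"
      "c0 = csub (inst es) (Cmp (User F) (act_res A) (act_wp A))"
      using g by auto
    have len: "length es' = length es" using prn_Act(3) by (simp add: list_all2_lengthD)
    have pri: "pr S X (es ! i) (es' ! i)" if "i < length es" for i
      using prn_Act(3) that by (simp add: list_all2_conv_all_nth)
    \<comment> \<open>Several arguments change at once; the substitution lemma of parallel
      reduction, with nothing frozen, covers them in one step.\<close>
    have cvi: "conv S (sub (inst (take i es)) u) (sub (inst (take i es')) u)" if "i \<le> length es" for i u
    proof -
      have "pr S {} (inst (take i es) k) (inst (take i es') k)" for k
        using that len pr_mono(1)[OF pri] by (auto simp: inst_def rev_nth pr_refl)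
      then show ?thesis using pc[OF pr_sub(1)[OF cs pr_refl(1)[of S "{}" u], of "inst (take i es)" "{}" "inst (take i es')"]] by simp
    qed
    have wA: "wctx S (rev (act_args A))" using ok_sigD(7)[OF ok 1(1,2,3)] by (rule ty_wctx)
    \<comment> \<open>Arguments are retyped from left to right: the type required of one argument
      already contains the reduced earlier ones.\<close>
    have es': "ty S \<Gamma> (es' ! i) (Tot (sub (inst (take i es')) (act_args A ! i)))" if "i < length es" for i
      using that
    proof (induction i rule: less_induct)
      case (less i)
      have "size (es ! i) < size t" using prn_Act(1) less(2) nth_mem[of i es]
        by (auto simp: less_Suc_eq_le intro: size_list_estimation'[of "es ! i"] trans_le_add1)
      then have "ty S \<Gamma> (es' ! i) (Tot (sub (inst (take i es)) (act_args A ! i)))"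
        using IH[OF _ pri[OF less(2)] 1(5)[OF less(2)]] by blast
      moreover obtain k where wi: "wctx S (rev (take i (act_args A)))"
        "ty S (rev (take i (act_args A))) (act_args A ! i) (Tot (Universe k))"
        using wctx_rev_nth[OF ok wA] less(2) 1(4) by auto
      have "styp S \<Gamma> (inst (take i es')) (rev (take i (act_args A)))"
      proof (rule styp_inst[OF ok wi(1) w])
        fix n assume "n < length (take i es')"
        then show "ty S \<Gamma> (take i es' ! n) (Tot (sub (inst (take n (take i es'))) (take i (act_args A) ! n)))"
          using less.IH[of n] less(2) len by (simp add: min_def)
      qed (use less(2) len 1(4) in simp)
      from ty_sub(1)[OF cs this wi(2)] have "ty S \<Gamma> (sub (inst (take i es')) (act_args A ! i)) (Tot (Universe k))" by simp
      ultimately show ?case using cvi[of i] less(2) ty_conv by fastforce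
    qed
    have "ty S \<Gamma> m (csub (inst es') (Cmp (User F) (act_res A) (act_wp A)))"
      unfolding prn_Act(2) using t_Act[OF w 1(1,2,3)] es' 1(4) len by auto
    moreover have "convc S (csub (inst es') (Cmp (User F) (act_res A) (act_wp A))) c0"
      using cvi[of "length es"] len 1(6) conv_sym by simp
    ultimately show ?thesis using wf ty_convc[OF ok] by blast
  next
    case (prn_Ret r r' e e' M)
    then obtain R where 1: "ty S \<Gamma> r (Tot (Universe 0))" "ty S \<Gamma> e (Tot r)" "ret_star_of S M = Some R"
      "c0 = Cmp M r (apps R [r, e])" using g by auto
    have r': "ty S \<Gamma> r' (Tot (Universe 0))" using IH[OF _ prn_Ret(3) 1(1)] prn_Ret(1) by simp
    have "ty S \<Gamma> e' (Tot r')"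
      using IH[OF _ prn_Ret(4) 1(2)] prn_Ret(1) ty_conv[OF _ pc[OF prn_Ret(3)] r'] by simp
    then have "ty S \<Gamma> m (Cmp M r' (apps R [r', e']))" unfolding prn_Ret(2) using t_Ret[OF r' _ 1(3)] by blast
    moreover have "convc S (Cmp M r' (apps R [r', e'])) c0"
      using 1(4) pc[OF prn_Ret(3)] pc[OF prn_Ret(4)] by (auto intro!: conv_app conv_refl intro: conv_sym)
    ultimately show ?thesis using wf ty_convc[OF ok] by blast
  next
    case (prn_Bind t1 t1' t2 t2' wp1 wp1' e1 e1' wp2 wp2' e2 e2' M)
    then obtain W B where 1: "ty S \<Gamma> t2 (Tot (Universe 0))" "wp_type_of S M = Some W" "bind_star_of S M = Some B"
      "ty S \<Gamma> wp2 (Tot (arr t1 (App W t2)))" "ty S \<Gamma> e1 (Cmp M t1 wp1)"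
      "ty S (t1 # \<Gamma>) e2 (Cmp M (shift t2) (App (shift wp2) (Var 0)))"
      "c0 = Cmp M t2 (apps B [t1, t2, wp1, wp2])" using g by auto
    note cv = pc[OF prn_Bind(3)] pc[OF prn_Bind(4)] pc[OF prn_Bind(5)] pc[OF prn_Bind(7)]
    obtain i where wc: "wcmp S \<Gamma> (Cmp M t1 wp1) i" using regular[OF ok 1(5)] by blast
    note t1 = wcmp_CmpD(2)[OF ok wc]
    have t1': "ty S \<Gamma> t1' (Tot (Universe 0))" using IH[OF _ prn_Bind(3) t1] prn_Bind(1) by simp
    have t2': "ty S \<Gamma> t2' (Tot (Universe 0))" using IH[OF _ prn_Bind(4) 1(1)] prn_Bind(1) by simp
    have w1': "wctx S (t1' # \<Gamma>)" using t1' by (rule wctx_ConsI[OF cs])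
    have wc': "wcmp S \<Gamma> (Cmp M t1' wp1') 0"
      by (rule wcmp_conv[OF wc t1' cv(1)]) (use IH[OF _ prn_Bind(5)] prn_Bind(1) in auto)
    have e1': "ty S \<Gamma> e1' (Cmp M t1' wp1')"
      using ty_convc[OF ok _ _ wc'] IH[OF _ prn_Bind(6) 1(5)] prn_Bind(1) cv by simp
    obtain k where Wt2: "ty S \<Gamma> (App W t2') (Tot (Universe k))" using AppW_ty[OF ok 1(2) t2'] by blast
    have clW: "ren f W = W" for f using fv_stars(1)[OF cs 1(2)] by (simp add: ren_closed)
    have "pr S X (arr t1 (App W t2)) (arr t1' (App W t2'))"
    proof -
      have "pr S (fz X) (shift t2) (shift t2')"
        by (rule pr_ren(1)[OF cs prn_Bind(4)]) (auto simp: fz_def)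
      then show ?thesis using prn_Bind(3)
        by (simp add: pr_prn_prc.intros(1,3-) pr_refl)
    qed
    then have wp2': "ty S \<Gamma> wp2' (Tot (arr t1' (App W t2')))"
      using ty_conv[OF _ pc ty_arr[OF cs t1' Wt2]] IH[OF _ prn_Bind(7) 1(4)] prn_Bind(1) by auto
    have "ty S (t1 # \<Gamma>) e2' (Cmp M (shift t2) (App (shift wp2) (Var 0)))"
      using IH[OF _ prn_Bind(8) 1(6)] prn_Bind(1) by simp
    then have "ty S (t1' # \<Gamma>) e2' (Cmp M (shift t2) (App (shift wp2) (Var 0)))"
      using ctx_conv(1)[OF t1 t1' cv(1)] by blast
    moreover have "wcmp S (t1' # \<Gamma>) (Cmp M (shift t2') (App (shift wp2') (Var 0))) 0"
    proof (rule wcmp_CmpI[OF ok 1(2)])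
      show "ty S (t1' # \<Gamma>) (shift t2') (Tot (Universe 0))" using ty_shift(1)[OF cs w1' t2'] by simp
      have "ty S (t1' # \<Gamma>) (shift wp2') (Tot (arr (shift t1') (App W (shift t2'))))"
        using ty_shift(1)[OF cs w1' wp2'] by (simp add: clW)
      then show "ty S (t1' # \<Gamma>) (App (shift wp2') (Var 0)) (Tot (App W (shift t2')))"
        using ty_Var_n(1)[OF cs w1'] by (rule ty_app_arr[OF cs])
    qed
    ultimately have "ty S (t1' # \<Gamma>) e2' (Cmp M (shift t2') (App (shift wp2') (Var 0)))"
      using ty_convc[OF ok] conv_shift[OF ok cv(2)] conv_app[OF conv_shift[OF ok cv(4)] conv_refl] by simp
    then have "ty S \<Gamma> m (Cmp M t2' (apps B [t1', t2', wp1', wp2']))"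
      unfolding prn_Bind(2) using t_Bind[OF t2' 1(2,3) wp2' e1' w1'] by blast
    moreover have "convc S (Cmp M t2' (apps B [t1', t2', wp1', wp2'])) c0"
      using 1(7) cv by (auto intro!: conv_app conv_refl intro: conv_sym)
    ultimately show ?thesis using wf ty_convc[OF ok] by blast
  qed
qed

lemma sr_pr: "pr S X t t' \<Longrightarrow> ty S \<Gamma> t c \<Longrightarrow> ty S \<Gamma> t' c"
proof (induction t arbitrary: X t' \<Gamma> c rule: measure_induct_rule[of size])
  case (less t)
  have prn: "prn S X t m \<Longrightarrow> ty S \<Gamma> m c" for m
    by (rule sr_prn[where t = t and X = X]) (use less in \<open>blast+\<close>)
  from less.prems(1) show ?case
    by cases (use prn sr_ctr[OF ok] in blast)+
qed

lemma sr_red: "red S t t' \<Longrightarrow> ty S \<Gamma> t c \<Longrightarrow> ty S \<Gamma> t' c"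
  using sr_pr red_pr by blast

text \<open>Stripping keeps the universe, because \<open>t_Refine\<close> assigns to a refinement
  the universe of its base.\<close>

lemma sr_qs:
  assumes "qs S A B" "ty S \<Gamma> A (Tot (Universe i))"
  shows "ty S \<Gamma> B (Tot (Universe i))"
  using assms
proof (induction rule: rtranclp_induct)
  case (step B C)
  then have B: "ty S \<Gamma> B (Tot (Universe i))" by blast
  from step(2) show ?case
  proof cases
    case qs_pr
    then show ?thesis using sr_pr B by blast
  next
    case (qs_strip phi)
    obtain c0 where "gen S \<Gamma> B c0" "sbc S \<Gamma> c0 (Tot (Universe i))" using ty_gen[OF B] by blast
    then obtain j where "ty S \<Gamma> C (Tot (Universe j))" "sbt S \<Gamma> (Universe j) (Universe i)"
      using qs_strip by auto
    then show ?thesis using sbt_Universe(1)[OF ok_closed[OF ok]] qs_Universe by fastforce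
  qed
qed simp

end

section \<open>Uniqueness of universes\<close>

text \<open>
  The relation between two types of the same term, closed under passing to supertypes. Types of a term
  are far from unique (constants are schematic, sums unannotated, codomains arbitrary supertypes), but two
  universes are related only if they are equal.
\<close>

inductive sim :: "signature \<Rightarrow> ctx \<Rightarrow> tm \<Rightarrow> tm \<Rightarrow> bool" for S where
  sim_small: "ty S \<Gamma> A (Tot (Universe 0)) \<Longrightarrow> ty S \<Gamma> B (Tot (Universe 0)) \<Longrightarrow> sim S \<Gamma> A B"
| sim_conv: "conv S A B \<Longrightarrow> ty S \<Gamma> A (Tot (Universe i)) \<Longrightarrow> ty S \<Gamma> B (Tot (Universe j)) \<Longrightarrow> sim S \<Gamma> A B"
| sim_sum: "sim S \<Gamma> (sumT a b) (sumT a' b')"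
| sim_prod: "sim S \<Gamma> a a' \<Longrightarrow> sim S \<Gamma> b b' \<Longrightarrow> sim S \<Gamma> (prodT a b) (prodT a' b')"
| sim_Pi: "ty S \<Gamma> s (Tot (Universe i)) \<Longrightarrow> sim S (s # \<Gamma>) u u' \<Longrightarrow> sim S \<Gamma> (Pi s (Tot u)) (Pi s (Tot u'))"
| sim_CmpL: "sim S \<Gamma> (Pi s (Cmp M t w)) (Pi s' c)"
| sim_CmpR: "sim S \<Gamma> (Pi s c) (Pi s' (Cmp M t w))"
| sim_arr: "ty S \<Gamma> s (Tot (Universe i)) \<Longrightarrow> ty S \<Gamma> s' (Tot (Universe j)) \<Longrightarrow> sim S \<Gamma> u u' \<Longrightarrow>
    sim S \<Gamma> (arr s u) (arr s' u')"
| sim_Pair: "ty S \<Gamma> a (Tot (Universe i)) \<Longrightarrow> ty S \<Gamma> b (Tot (Universe j)) \<Longrightarrow>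
    ty S \<Gamma> a' (Tot (Universe i')) \<Longrightarrow> ty S \<Gamma> b' (Tot (Universe j')) \<Longrightarrow>
    sim S \<Gamma> (arr a (arr b (prodT a b))) (arr a' (arr b' (prodT a' b')))"
| sim_Pair1: "sim S \<Gamma> a a' \<Longrightarrow> ty S \<Gamma> b (Tot (Universe j)) \<Longrightarrow> ty S \<Gamma> b' (Tot (Universe j')) \<Longrightarrow>
    sim S \<Gamma> (arr b (prodT a b)) (arr b' (prodT a' b'))"
| sim_Fst: "ty S \<Gamma> a (Tot (Universe i)) \<Longrightarrow> ty S \<Gamma> b (Tot (Universe j)) \<Longrightarrow>
    ty S \<Gamma> a' (Tot (Universe i')) \<Longrightarrow> ty S \<Gamma> b' (Tot (Universe j')) \<Longrightarrow>
    sim S \<Gamma> (arr (prodT a b) a) (arr (prodT a' b') a')"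
| sim_Snd: "ty S \<Gamma> a (Tot (Universe i)) \<Longrightarrow> ty S \<Gamma> b (Tot (Universe j)) \<Longrightarrow>
    ty S \<Gamma> a' (Tot (Universe i')) \<Longrightarrow> ty S \<Gamma> b' (Tot (Universe j')) \<Longrightarrow>
    sim S \<Gamma> (arr (prodT a b) b) (arr (prodT a' b') b')"
| sim_Form: "sim S \<Gamma> (arr (Universe i) (arr (Universe j) (Universe (max i j))))
    (arr (Universe i') (arr (Universe j') (Universe (max i' j'))))"
| sim_Form1: "sim S \<Gamma> (arr (Universe j) (Universe (max i j))) (arr (Universe j') (Universe (max i j')))"
| sim_Eq: "sim S \<Gamma> (Pi (Universe i) (Tot (arr (Var 0) (arr (Var 0) (Universe 0)))))
    (Pi (Universe i') (Tot (arr (Var 0) (arr (Var 0) (Universe 0)))))"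
| sim_Ex: "sim S \<Gamma> (Pi (Universe i) (Tot (arr (arr (Var 0) (Universe j)) (Universe 0))))
    (Pi (Universe i') (Tot (arr (arr (Var 0) (Universe j')) (Universe 0))))"
| sim_up: "sim S \<Gamma> A B \<Longrightarrow> sbt S \<Gamma> A A' \<Longrightarrow> sbt S \<Gamma> B B' \<Longrightarrow> sim S \<Gamma> A' B'"

lemma csx_to_Tot: "csx S \<Gamma> c c' \<Longrightarrow> c' = Tot b \<Longrightarrow> \<exists>a. c = Tot a"
proof (induction arbitrary: b rule: csx.induct)
  case (csx_sub c c')
  then show ?case using sbc_to_Tot by blast
qed auto

lemma csub_TotE: "Tot t = csub s c \<Longrightarrow> (\<And>u. c = Tot u \<Longrightarrow> t = sub s u \<Longrightarrow> P) \<Longrightarrow> P"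
  by (cases c) auto

section \<open>Inversion of the relation between types of one term\<close>

context
  fixes S assumes ok: "ok_sig S"
begin

lemma ty_sub_Universe:
  "ty S \<Gamma> e (Tot (Universe i)) \<Longrightarrow> styp S \<Delta> s \<Gamma> \<Longrightarrow> ty S \<Delta> (sub s e) (Tot (Universe i))"
  using ty_sub(1)[OF ok_closed[OF ok], of \<Delta> s \<Gamma> e "Tot (Universe i)"] unfolding csub.simps sub.simps by blast

lemma sim_sub: "sim S \<Gamma> A B \<Longrightarrow> styp S \<Delta> s \<Gamma> \<Longrightarrow> sim S \<Delta> (sub s A) (sub s B)"
proof (induction arbitrary: \<Delta> s rule: sim.induct)
  case (sim_small \<Gamma> A B)
  show ?case using sim.sim_small[OF ty_sub_Universe[OF sim_small(1,3)] ty_sub_Universe[OF sim_small(2,3)]] .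
next
  case (sim_conv A B \<Gamma> i j)
  show ?case
    using sim.sim_conv[OF conv_sub[OF ok_closed[OF ok] sim_conv(1)] ty_sub_Universe[OF sim_conv(2,4)] ty_sub_Universe[OF sim_conv(3,4)]] .
next
  case (sim_Pi \<Gamma> r i u u')
  have r: "ty S \<Delta> (sub s r) (Tot (Universe i))" using ty_sub_Universe[OF sim_Pi(1,4)] .
  have "styp S (sub s r # \<Delta>) (ups s) (r # \<Gamma>)" by (rule styp_ups[OF ok_closed[OF ok] sim_Pi(4) r])
  then have "sim S (sub s r # \<Delta>) (sub (ups s) u) (sub (ups s) u')" by (rule sim_Pi(3))
  then show ?case unfolding sub.simps csub.simps by (rule sim.sim_Pi[OF r])
next
  case (sim_arr \<Gamma> r i r' j u0 u0')
  show ?case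
    using sim.sim_arr[OF ty_sub_Universe[OF sim_arr(1,5)] ty_sub_Universe[OF sim_arr(2,5)] sim_arr(4)[OF sim_arr(5)]] by simp
next
  case (sim_Pair \<Gamma> a i b j a' i' b' j')
  show ?case
    using sim.sim_Pair[OF sim_Pair(1-4)[THEN ty_sub_Universe, OF sim_Pair(5)]] by simp
next
  case (sim_Pair1 \<Gamma> a a' b j b' j')
  show ?case
    using sim.sim_Pair1[OF sim_Pair1(4)[OF sim_Pair1(5)] sim_Pair1(2,3)[THEN ty_sub_Universe, OF sim_Pair1(5)]] by simp
next
  case (sim_Fst \<Gamma> a i b j a' i' b' j')
  show ?case
    using sim.sim_Fst[OF sim_Fst(1-4)[THEN ty_sub_Universe, OF sim_Fst(5)]] by simp
next
  case (sim_Snd \<Gamma> a i b j a' i' b' j')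
  show ?case
    using sim.sim_Snd[OF sim_Snd(1-4)[THEN ty_sub_Universe, OF sim_Snd(5)]] by simp
next
  case (sim_up \<Gamma> A B A' B')
  show ?case
    using sim.sim_up[OF sim_up(4)[OF sim_up(5)] ty_sub(3)[OF ok_closed[OF ok] sim_up(5,2)] ty_sub(3)[OF ok_closed[OF ok] sim_up(5,3)]] .
next
  case sim_sum
  show ?case unfolding sub.simps by (rule sim.sim_sum)
next
  case (sim_prod \<Gamma> a a' b b')
  show ?case unfolding sub.simps by (rule sim.sim_prod[OF sim_prod(3)[OF sim_prod(5)] sim_prod(4)[OF sim_prod(5)]])
next
  case sim_CmpL
  show ?case unfolding sub.simps csub.simps by (rule sim.sim_CmpL)
next
  case sim_CmpR
  show ?case unfolding sub.simps csub.simps by (rule sim.sim_CmpR)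
next
  case (sim_Form \<Gamma> i j i' j')
  show ?case using sim.sim_Form[of S \<Delta> i j i' j'] by simp
next
  case (sim_Form1 \<Gamma> j i j')
  show ?case using sim.sim_Form1[of S \<Delta> j i j'] by simp
next
  case (sim_Eq \<Gamma> i i')
  show ?case using sim.sim_Eq[of S \<Delta> i i'] by simp
next
  case (sim_Ex \<Gamma> i j i' j')
  show ?case using sim.sim_Ex[of S \<Delta> i j i' j'] by simp
qed

lemma qs_absurd [simp]:
  "\<not> qs S (Pi s c) (Universe i)" "\<not> qs S (Pi s c) (app2 (Const k) a b)"
  "k \<noteq> CFst \<Longrightarrow> k \<noteq> CSnd \<Longrightarrow> \<not> qs S (app2 (Const k) a b) (Universe i)"
  "k \<noteq> CFst \<Longrightarrow> k \<noteq> CSnd \<Longrightarrow> \<not> qs S (app2 (Const k) a b) (Pi s c)"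
  "k \<noteq> CFst \<Longrightarrow> k \<noteq> CSnd \<Longrightarrow> k \<noteq> k' \<Longrightarrow> \<not> qs S (app2 (Const k) a b) (app2 (Const k') a' b')"
  using qs_Pi[OF ok_closed[OF ok]] qs_const_App2[OF ok_closed[OF ok]] by fastforce+

lemma Universe_sub_iff: "sbt S \<Gamma> (Universe i) (Universe j) \<longleftrightarrow> i = j"
  using sbt_Universe(1)[OF ok_closed[OF ok]] qs_Universe s_Refl by blast

lemma conv_qs_join:
  assumes "conv S A B" and X: "qs S A X" and Y: "qs S B Y"
  shows "\<exists>K. qs S X K \<and> qs S Y K"
proof -
  obtain H where H: "qs S A H" "qs S B H" using conv_joinable[OF ok_closed[OF ok] assms(1)] by (auto simp: joinable_def)
  obtain K where K: "qs S X K" "qs S H K" using qs_confluent[OF ok_closed[OF ok] X H(1)] by blast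
  have "qs S B K" using H(2) K(2) by (rule rtranclp_trans)
  then obtain L where "qs S Y L" "qs S K L" using qs_confluent[OF ok_closed[OF ok] Y] by blast
  then show ?thesis using K(1) by (meson rtranclp_trans)
qed

lemma sbt_Universe_absurd [simp]:
  "\<not> sbt S \<Gamma> (sumT x y) (Universe i)" "\<not> sbt S \<Gamma> (prodT x y) (Universe i)" "\<not> sbt S \<Gamma> (Pi s c) (Universe i)"
  using sbt_Universe(1)[OF ok_closed[OF ok]] qs_absurd by blast+

text \<open>Two small types cannot both lie below universes, since by subject reduction a universe
  would inhabit \<open>Type0\<close>. Convertible types have joinable reducts, and reducts that are
  universes never change. The other generators are sums, pairs and products, none of which lies
  below a universe.\<close>

lemma sim_Universe: "sim S \<Gamma> A B \<Longrightarrow> sbt S \<Gamma> A (Universe i) \<Longrightarrow> sbt S \<Gamma> B (Universe j) \<Longrightarrow> i = j"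
proof (induction rule: sim.induct)
  case (sim_small \<Gamma> A B)
  then have "ty S \<Gamma> (Universe i) (Tot (Universe 0))"
    using sbt_Universe(1)[OF ok_closed[OF ok]] sr_qs[OF ok] by blast
  then obtain c0 where "gen S \<Gamma> (Universe i) c0" "sbc S \<Gamma> c0 (Tot (Universe 0))" using ty_gen by blast
  then show ?case using Universe_sub_iff by simp
next
  case (sim_conv A B \<Gamma> k l)
  then obtain K where "qs S (Universe i) K" "qs S (Universe j) K"
    using conv_qs_join sbt_Universe(1)[OF ok_closed[OF ok]] by blast
  then have "K = Universe i" "K = Universe j" using qs_Universe by blast+
  then show ?case by simp
next
  case (sim_up \<Gamma> A B A' B')
  show ?case by (rule sim_up(4)[OF s_Trans[OF sim_up(2,5)] s_Trans[OF sim_up(3,6)]])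
qed (erule notE[OF sbt_Universe_absurd(1)] notE[OF sbt_Universe_absurd(2)] notE[OF sbt_Universe_absurd(3)])+

lemma prod_small:
  assumes "ty S \<Gamma> A (Tot (Universe k))" "qs S A (prodT a b)"
  shows "\<exists>i j. max i j = k \<and> ty S \<Gamma> a (Tot (Universe i)) \<and> ty S \<Gamma> b (Tot (Universe j))"
  using formation_inv[OF ok sr_qs[OF ok assms(2,1)]] Universe_sub_iff by auto

lemma qs_conv:
  assumes "conv S A B"
  shows "qs S A (app2 (Const k) a b) \<Longrightarrow> qs S B (app2 (Const k) a' b') \<Longrightarrow> k \<noteq> CFst \<Longrightarrow> k \<noteq> CSnd \<Longrightarrow>
      conv S a a' \<and> conv S b b'"
    "qs S A (Pi s c) \<Longrightarrow> qs S B (Pi s' c') \<Longrightarrow> conv S s s' \<and> convc S c c'"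
proof -
  note * = conv_qs_join[OF assms]
  show "conv S a a' \<and> conv S b b'" if 1: "qs S A (app2 (Const k) a b)" and 2: "qs S B (app2 (Const k) a' b')" and k: "k \<noteq> CFst" "k \<noteq> CSnd"
  proof -
    obtain K where "qs S (app2 (Const k) a b) K" "qs S (app2 (Const k) a' b') K" using *[OF 1 2] by blast
    from qs_const_App2[OF ok_closed[OF ok] this(1) k] qs_const_App2[OF ok_closed[OF ok] this(2) k]
    obtain x y where "conv S a x" "conv S b y" "conv S a' x" "conv S b' y" by blast
    then show ?thesis using conv_sym conv_trans by meson
  qed
  show "conv S s s' \<and> convc S c c'" if 1: "qs S A (Pi s c)" and 2: "qs S B (Pi s' c')"
  proof -
    obtain K where "qs S (Pi s c) K" "qs S (Pi s' c') K" using *[OF 1 2] by blast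
    from qs_Pi[OF ok_closed[OF ok] this(1)] qs_Pi[OF ok_closed[OF ok] this(2)]
    obtain x y where "conv S s x" "convc S c y" "conv S s' x" "convc S c' y" by blast
    then show ?thesis using conv_sym conv_trans convc_sym convc_trans by meson
  qed
qed

lemma sbt_prod_absurd: "\<not> sbt S \<Gamma> (sumT x y) (prodT a b)" "\<not> sbt S \<Gamma> (Pi s c) (prodT a b)"
  using sbt_const2[OF ok_closed[OF ok], where k = CProd] qs_absurd by (metis const.distinct)+

text \<open>Needed for the projections, whose result types are components of the type of their
  argument.\<close>

lemma sim_prodE:
  "sim S \<Gamma> A B \<Longrightarrow> sbt S \<Gamma> A (prodT a b) \<Longrightarrow> sbt S \<Gamma> B (prodT a' b') \<Longrightarrow> sim S \<Gamma> a a' \<and> sim S \<Gamma> b b'"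
proof (induction rule: sim.induct)
  case (sim_small \<Gamma> A B)
  obtain a1 b1 where 1: "qs S A (prodT a1 b1)" "conv S a a1" "conv S b b1"
    using sbt_const2[OF ok_closed[OF ok]] sim_small(3) by blast
  obtain a2 b2 where 2: "qs S B (prodT a2 b2)" "conv S a' a2" "conv S b' b2"
    using sbt_const2[OF ok_closed[OF ok]] sim_small(4) by blast
  have "sim S \<Gamma> a1 a2" "sim S \<Gamma> b1 b2"
    using prod_small[OF sim_small(1) 1(1)] prod_small[OF sim_small(2) 2(1)] sim.sim_small by auto
  then show ?case using 1 2 by (meson sim_up s_Conv conv_sym)
next
  case (sim_conv A B \<Gamma> k l)
  obtain a1 b1 where 1: "qs S A (prodT a1 b1)" "conv S a a1" "conv S b b1"
    using sbt_const2[OF ok_closed[OF ok]] sim_conv(4) by blast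
  obtain a2 b2 where 2: "qs S B (prodT a2 b2)" "conv S a' a2" "conv S b' b2"
    using sbt_const2[OF ok_closed[OF ok]] sim_conv(5) by blast
  have "conv S a1 a2" "conv S b1 b2" using qs_conv(1)[OF sim_conv(1) 1(1) 2(1)] by simp_all
  then have "sim S \<Gamma> a1 a2" "sim S \<Gamma> b1 b2"
    using prod_small[OF sim_conv(2) 1(1)] prod_small[OF sim_conv(3) 2(1)] sim.sim_conv by blast+
  then show ?case using 1 2 by (meson sim_up s_Conv conv_sym)
next
  case (sim_prod \<Gamma> a0 a0' b0 b0')
  then have "conv S a0 a" "conv S b0 b" "conv S a0' a'" "conv S b0' b'"
    using const2_conv[OF ok, of \<Gamma> CProd] by blast+
  then show ?case using sim_prod(1,2) by (blast intro: sim_up s_Conv)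
next
  case (sim_up \<Gamma> A B A' B')
  show ?case by (rule sim_up(4)[OF s_Trans[OF sim_up(2,5)] s_Trans[OF sim_up(3,6)]])
qed (erule notE[OF sbt_prod_absurd(1)] notE[OF sbt_prod_absurd(2)])+

lemma sbt_Pi_absurd: "\<not> sbt S \<Gamma> (sumT a b) (Pi t c)" "\<not> sbt S \<Gamma> (prodT a b) (Pi t c)"
  by (rule notI, erule sbt_PiE[OF ok_closed[OF ok]], simp)+

lemma app_Tot:
  assumes "sbt S \<Gamma> (Pi t0 (Tot u0)) (Pi t (Tot u))" "ty S \<Gamma> x (Tot t)" "ty S \<Gamma> t0 (Tot (Universe i))"
  shows "ty S \<Gamma> x (Tot t0) \<and> sbt S \<Gamma> (sub1 x u0) (sub1 x u)"
  using pi_app[OF ok assms] by simp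

lemma Pi_dom: "sbt S \<Gamma> (Pi t0 c) (Pi t c') \<Longrightarrow> sbt S \<Gamma> t t0"
  using sbt_Pi_Pi[OF ok_closed[OF ok]] by (simp add: pirel_def)

lemma Pi_Tot:
  assumes "sbt S \<Gamma> (Pi t0 c) (Pi t (Tot u))" "ty S \<Gamma> x (Tot t)"
  shows "\<exists>u0. c = Tot u0"
proof -
  have "wctx S (t # \<Gamma>)" using regular_Tot[OF ok assms(2)] wctx_ConsI[OF ok_closed[OF ok]] by blast
  then have "csx S (t # \<Gamma>) c (Tot u)" using sbt_Pi_Pi[OF ok_closed[OF ok] assms(1)] s_Refl by (simp add: pirel_def)
  then show ?thesis using csx_to_Tot by blast
qed

text \<open>The bound \<open>j \<le> k\<close> matters at \<open>k = 0\<close>: the codomain of a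
  small product is again small, as \<open>sim_small\<close> requires.\<close>

lemma Pi_head:
  assumes A: "ty S \<Gamma> A (Tot (Universe k))" and P: "sbt S \<Gamma> A (Pi t (Tot u))" and x: "ty S \<Gamma> x (Tot t)"
  shows "\<exists>s u0 j. qs S A (Pi s (Tot u0)) \<and> sbt S \<Gamma> (sub1 x u0) (sub1 x u) \<and>
      j \<le> k \<and> ty S \<Gamma> (sub1 x u0) (Tot (Universe j))"
proof -
  note cs = ok_closed[OF ok]
  obtain s c where s: "qs S A (Pi s c)" "pirel S \<Gamma> s c t (Tot u)" using sbt_PiE[OF cs P] by blast
  have "wctx S (t # \<Gamma>)" using regular_Tot[OF ok x] wctx_ConsI[OF cs] by blast
  then have cx: "csx S (t # \<Gamma>) c (Tot u)" using s(2) s_Refl by (simp add: pirel_def)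
  then obtain u0 where c: "c = Tot u0" using csx_to_Tot by blast
  then have sb: "sbt S (t # \<Gamma>) u0 u" using csx_TotE[OF cx] by auto
  obtain c0 where "gen S \<Gamma> (Pi s c) c0" "sbc S \<Gamma> c0 (Tot (Universe k))" using ty_gen[OF sr_qs[OF ok s(1) A]] by blast
  then obtain i j where ij: "ty S \<Gamma> s (Tot (Universe i))" "wcmp S (s # \<Gamma>) c j" "max i j = k"
    using Universe_sub_iff by auto
  have xs: "ty S \<Gamma> x (Tot s)" using ty_sbt[OF ok x _ ij(1)] s(2) by (simp add: pirel_def)
  have "ty S (s # \<Gamma>) u0 (Tot (Universe j))" using ij(2) ty_TotD[OF ok] c by blast
  from ty_sub1(1)[OF cs xs this] have "ty S \<Gamma> (sub1 x u0) (Tot (Universe j))" by simp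
  moreover have "j \<le> k" using ij(3) by auto
  ultimately show ?thesis using s(1) c ty_sub1(3)[OF cs x sb] by blast
qed

text \<open>Related function types give related result types. That \<open>x\<close> inhabits both
  domains and that these are related fixes the schematic parameters: equal universes for the
  formation constants, related components for pairs and projections. A binary constant passes to the
  generator for its partial application, as from \<open>sim_Form\<close> to
  \<open>sim_Form1\<close>.\<close>

lemma sim_PiE:
  "sim S \<Gamma> A B \<Longrightarrow> sbt S \<Gamma> A (Pi t (Tot u)) \<Longrightarrow> sbt S \<Gamma> B (Pi t' (Tot u')) \<Longrightarrow>
    ty S \<Gamma> x (Tot t) \<Longrightarrow> ty S \<Gamma> x (Tot t') \<Longrightarrow> sim S \<Gamma> t t' \<Longrightarrow> sim S \<Gamma> (sub1 x u) (sub1 x u')"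
proof (induction rule: sim.induct)
  case (sim_small \<Gamma> A B)
  obtain u0 where 1: "sbt S \<Gamma> (sub1 x u0) (sub1 x u)" "ty S \<Gamma> (sub1 x u0) (Tot (Universe 0))"
    using Pi_head[OF sim_small(1,3,5)] unfolding le_zero_eq by blast
  obtain u0' where 2: "sbt S \<Gamma> (sub1 x u0') (sub1 x u')" "ty S \<Gamma> (sub1 x u0') (Tot (Universe 0))"
    using Pi_head[OF sim_small(2,4,6)] unfolding le_zero_eq by blast
  show ?case by (rule sim_up[OF sim.sim_small[OF 1(2) 2(2)] 1(1) 2(1)])
next
  case (sim_conv A B \<Gamma> k l)
  obtain s u0 j where 1: "qs S A (Pi s (Tot u0))" "sbt S \<Gamma> (sub1 x u0) (sub1 x u)" "ty S \<Gamma> (sub1 x u0) (Tot (Universe j))"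
    using Pi_head[OF sim_conv(2,4,6)] by blast
  obtain s' u0' j' where 2: "qs S B (Pi s' (Tot u0'))" "sbt S \<Gamma> (sub1 x u0') (sub1 x u')"
    "ty S \<Gamma> (sub1 x u0') (Tot (Universe j'))"
    using Pi_head[OF sim_conv(3,5,7)] by blast
  have "conv S u0 u0'" using qs_conv(2)[OF sim_conv(1) 1(1) 2(1)] by simp
  then have "conv S (sub1 x u0) (sub1 x u0')" by (rule conv_sub[OF ok_closed[OF ok]])
  then show ?case by (rule sim_up[OF sim.sim_conv[OF _ 1(3) 2(3)] 1(2) 2(2)])
next
  case (sim_sum \<Gamma> a b a' b')
  show ?case using sbt_Pi_absurd sim_sum(1) by blast
next
  case (sim_prod \<Gamma> a b a' b')
  show ?case using sbt_Pi_absurd sim_prod(5) by blast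
next
  case (sim_Pi \<Gamma> s i u0 u0')
  note 1 = app_Tot[OF sim_Pi(4,6,1)] app_Tot[OF sim_Pi(5,7,1)]
  have "sim S \<Gamma> (sub1 x u0) (sub1 x u0')"
    by (rule sim_sub[OF sim_Pi(2) styp_inst1]) (use 1 in blast)
  then show ?case by (rule sim_up) (use 1 in blast)+
next
  case (sim_CmpL \<Gamma> s M t0 w s' c)
  then show ?case using Pi_Tot by blast
next
  case (sim_CmpR \<Gamma> s c s' M t0 w)
  then show ?case using Pi_Tot by blast
next
  case (sim_arr \<Gamma> s i s' j u0 u0')
  note 1 = app_Tot[OF sim_arr(5,7,1)] app_Tot[OF sim_arr(6,8,2)]
  show ?case by (rule sim_up[OF sim_arr(3)]) (use 1 in simp_all)
next
  case (sim_Pair \<Gamma> a i b j a' i' b' j')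
  note 1 = app_Tot[OF sim_Pair(5,7,1)] app_Tot[OF sim_Pair(6,8,3)]
  have "sim S \<Gamma> a a'" by (rule sim_up[OF sim_Pair(9) Pi_dom[OF sim_Pair(5)] Pi_dom[OF sim_Pair(6)]])
  from sim.sim_Pair1[OF this sim_Pair(2,4)] show ?case by (rule sim_up) (use 1 in simp_all)
next
  case (sim_Pair1 \<Gamma> a a' b j b' j')
  note 1 = app_Tot[OF sim_Pair1(5,7,2)] app_Tot[OF sim_Pair1(6,8,3)]
  have "sim S \<Gamma> b b'" by (rule sim_up[OF sim_Pair1(9) Pi_dom[OF sim_Pair1(5)] Pi_dom[OF sim_Pair1(6)]])
  from sim.sim_prod[OF sim_Pair1(1) this] show ?case by (rule sim_up) (use 1 in simp_all)
next
  case (sim_Fst \<Gamma> a i b j a' i' b' j')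
  note 1 = app_Tot[OF sim_Fst(5,7) ty_const2(1)[OF ok_closed[OF ok] sim_Fst(1,2)]] app_Tot[OF sim_Fst(6,8) ty_const2(1)[OF ok_closed[OF ok] sim_Fst(3,4)]]
  have "sim S \<Gamma> a a'" using sim_prodE[OF sim_Fst(9) Pi_dom[OF sim_Fst(5)] Pi_dom[OF sim_Fst(6)]] by blast
  then show ?case by (rule sim_up) (use 1 in simp_all)
next
  case (sim_Snd \<Gamma> a i b j a' i' b' j')
  note 1 = app_Tot[OF sim_Snd(5,7) ty_const2(1)[OF ok_closed[OF ok] sim_Snd(1,2)]] app_Tot[OF sim_Snd(6,8) ty_const2(1)[OF ok_closed[OF ok] sim_Snd(3,4)]]
  have "sim S \<Gamma> b b'" using sim_prodE[OF sim_Snd(9) Pi_dom[OF sim_Snd(5)] Pi_dom[OF sim_Snd(6)]] by blast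
  then show ?case by (rule sim_up) (use 1 in simp_all)
next
  case (sim_Form \<Gamma> i j i' j')
  have w: "ty S \<Gamma> (Universe k) (Tot (Universe (Suc k)))" for k using t_Universe[OF ty_wctx(3)[OF sim_Form(3)]] .
  note 1 = app_Tot[OF sim_Form(1,3) w] app_Tot[OF sim_Form(2,4) w]
  have "i = i'" by (rule sim_Universe[OF sim_Form(5) Pi_dom[OF sim_Form(1)] Pi_dom[OF sim_Form(2)]])
  then show ?case by (intro sim_up[OF sim.sim_Form1[where i = i and j = j and j' = j']]) (use 1 in simp_all)
next
  case (sim_Form1 \<Gamma> j i j')
  have w: "ty S \<Gamma> (Universe k) (Tot (Universe (Suc k)))" for k using t_Universe[OF ty_wctx(3)[OF sim_Form1(3)]] .
  note 1 = app_Tot[OF sim_Form1(1,3) w] app_Tot[OF sim_Form1(2,4) w]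
  have "j = j'" by (rule sim_Universe[OF sim_Form1(5) Pi_dom[OF sim_Form1(1)] Pi_dom[OF sim_Form1(2)]])
  then show ?case by (intro sim_up[OF sim.sim_conv[OF conv_refl w[of "max i j"] w]]) (use 1 in simp_all)
next
  case (sim_Eq \<Gamma> i i')
  have w: "ty S \<Gamma> (Universe k) (Tot (Universe (Suc k)))" for k using t_Universe[OF ty_wctx(3)[OF sim_Eq(3)]] .
  note 1 = app_Tot[OF sim_Eq(1,3) w] app_Tot[OF sim_Eq(2,4) w]
  have x: "ty S \<Gamma> x (Tot (Universe i))" using 1 by blast
  have a: "ty S \<Gamma> (arr x (arr x (Universe 0))) (Tot (Universe (max i (max i (Suc 0)))))"
    by (rule ty_arr[OF ok_closed[OF ok] x ty_arr[OF ok_closed[OF ok] x w]])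
  show ?case by (rule sim_up[OF sim.sim_conv[OF conv_refl a a]]) (use 1 in simp_all)
next
  case (sim_Ex \<Gamma> i j i' j')
  have w: "ty S \<Gamma> (Universe k) (Tot (Universe (Suc k)))" for k using t_Universe[OF ty_wctx(3)[OF sim_Ex(3)]] .
  note 1 = app_Tot[OF sim_Ex(1,3) w] app_Tot[OF sim_Ex(2,4) w]
  have x: "ty S \<Gamma> x (Tot (Universe i))" using 1 by blast
  show ?case
    by (rule sim_up[OF sim.sim_arr[OF ty_arr[OF ok_closed[OF ok] x w[of j]] ty_arr[OF ok_closed[OF ok] x w[of j']] sim.sim_conv[OF conv_refl w[of 0] w]]]) (use 1 in simp_all)
next
  case (sim_up \<Gamma> A B A' B')
  show ?case by (rule sim_up(4)[OF s_Trans[OF sim_up(2,5)] s_Trans[OF sim_up(3,6)] sim_up(7-9)])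
qed

lemma ktyp_sim:
  assumes "ktyp S \<Gamma> k A" "ktyp S \<Gamma> k B"
  shows "sim S \<Gamma> A B"
proof -
  obtain i j where "ty S \<Gamma> A (Tot (Universe i))" "ty S \<Gamma> B (Tot (Universe j))"
    using ktyp_regular[OF ok assms(1)] ktyp_regular[OF ok assms(2)] by blast
  note refl = sim_conv[OF conv_refl this(1,1)]
  note inj = sim_arr[where u = "sumT _ _" and u' = "sumT _ _", OF _ _ sim_sum]
  from assms(1) show ?thesis
    by cases (use assms(2) refl in \<open>auto elim!: ktyp.cases intro: sim_Pair[simplified] sim_Fst[simplified] sim_Snd[simplified]
        sim_Form[simplified] sim_Eq[simplified] sim_Ex[simplified] inj[simplified]\<close>)
qed

text \<open>Both typings are analysed by generation. \<open>Run\<close> and \<open>Reify\<close>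
  yield small types, since well-formed computation types are built over \<open>Type0\<close>. An
  application combines the hypotheses for function and argument through \<open>sim_PiE\<close>.
  Abstractions with an effectful codomain are related outright, because applying one does not give a
  total term.\<close>

lemma ty_sim: "ty S \<Gamma> e (Tot A) \<Longrightarrow> ty S \<Gamma> e (Tot B) \<Longrightarrow> sim S \<Gamma> A B"
proof (induction e arbitrary: \<Gamma> A B rule: measure_induct_rule[of size])
  case (less e)
  obtain A0 where A: "gen S \<Gamma> e (Tot A0)" "sbt S \<Gamma> A0 A"
    using ty_gen[OF less.prems(1)] sbc_to_Tot by blast
  obtain B0 where B: "gen S \<Gamma> e (Tot B0)" "sbt S \<Gamma> B0 B"
    using ty_gen[OF less.prems(2)] sbc_to_Tot by blast
  have w: "wctx S \<Gamma>" using ty_wctx(3)[OF less.prems(1)] .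
  obtain i where "ty S \<Gamma> A0 (Tot (Universe i))" using regular_Tot[OF ok gen_ty[OF ok A(1) w]] by blast
  note refl = sim_conv[OF conv_refl this this]
  \<comment> \<open>Uniqueness of universes for smaller terms, on which the universes assigned to
    refinements and products depend.\<close>
  have U: "i = j" if "size t < size e" "ty S \<Delta> t (Tot (Universe i))" "ty S \<Delta> t (Tot (Universe j))" for t \<Delta> i j
    by (rule sim_Universe[OF less.IH[OF that] s_Refl s_Refl])
  have "sim S \<Gamma> A0 B0"
  proof (cases e)
    case (Const k)
    then show ?thesis using A(1) B(1) ktyp_sim by simp
  next
    case (Refine t phi)
    then have "A0 = B0" using A(1) B(1) U[of t] by auto
    then show ?thesis using refl by simp
  next
    case (Lam t b)
    then obtain i d d' where *: "ty S \<Gamma> t (Tot (Universe i))" "ty S (t # \<Gamma>) b d" "ty S (t # \<Gamma>) b d'"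
      "A0 = Pi t d" "B0 = Pi t d'"
      using A(1) B(1) by auto
    show ?thesis
    proof (cases "\<exists>u u'. d = Tot u \<and> d' = Tot u'")
      case True
      then obtain u u' where d: "d = Tot u" "d' = Tot u'" by blast
      show ?thesis unfolding *(4,5) d by (rule sim_Pi[OF *(1) less.IH]) (use * d Lam in simp_all)
    next
      case False
      then show ?thesis unfolding *(4,5) by (cases d; cases d') (simp_all add: sim_CmpL sim_CmpR)
    qed
  next
    case (Pi t d)
    then obtain i j i' j' where *: "ty S \<Gamma> t (Tot (Universe i))" "wcmp S (t # \<Gamma>) d j" "A0 = Universe (max i j)"
      "ty S \<Gamma> t (Tot (Universe i'))" "wcmp S (t # \<Gamma>) d j'" "B0 = Universe (max i' j')"
      using A(1) B(1) by auto
    have "i = i'" using U[OF _ *(1,4)] Pi by simp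
    moreover have "j = j'"
    proof (cases d)
      case (Tot u)
      then show ?thesis using U[of u, OF _ ty_TotD[OF ok] ty_TotD[OF ok]] *(2,5) Pi by simp
    next
      case (Cmp M u v)
      then show ?thesis using *(2,5) wcmp_CmpD(1)[OF ok] by blast
    qed
    ultimately show ?thesis using refl * by simp
  next
    case (App f a)
    then obtain t u t' u' where *: "ty S \<Gamma> f (Tot (Pi t (Tot u)))" "ty S \<Gamma> a (Tot t)" "A0 = sub1 a u"
      "ty S \<Gamma> f (Tot (Pi t' (Tot u')))" "ty S \<Gamma> a (Tot t')" "B0 = sub1 a u'"
      using A(1) B(1) by (auto elim!: csub_TotE)
    show ?thesis unfolding *(3,6)
      by (rule sim_PiE[OF less.IH[OF _ *(1,4)] s_Refl s_Refl *(2,5) less.IH[OF _ *(2,5)]]) (use App in simp_all)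
  next
    case (Run x)
    then obtain wp wp' where "ty S \<Gamma> x (Cmp Pure A0 wp)" "ty S \<Gamma> x (Cmp Pure B0 wp')" using A(1) B(1) by auto
    then show ?thesis using regular[OF ok] wcmp_CmpD(2)[OF ok] sim_small by meson
  next
    case (Reify x)
    have "ty S \<Gamma> C (Tot (Universe 0))" if C: "gen S \<Gamma> e (Tot C)" for C
    proof -
      obtain F t wp D where *: "ty S \<Gamma> x (Cmp (User F) t wp)" "lookup_eff S F = Some D" "C = apps (repr D) [t, wp]"
        using C Reify by auto
      obtain k where k: "wcmp S \<Gamma> (Cmp (User F) t wp) k" using regular[OF ok *(1)] by blast
      show ?thesis unfolding *(3)
        by (rule repr_app[OF ok *(2)]) (use wcmp_CmpD(2,3)[OF ok k] *(2) in auto)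
    qed
    then show ?thesis using A(1) B(1) sim_small by blast
  qed (use A(1) B(1) refl in auto)
  then show ?case using A(2) B(2) by (rule sim_up)
qed

lemma universe_unique: "ty S \<Gamma> t (Tot (Universe i)) \<Longrightarrow> ty S \<Gamma> t (Tot (Universe j)) \<Longrightarrow> i = j"
  using sim_Universe[OF ty_sim s_Refl s_Refl] .

end

section \<open>Equivalence of the two systems\<close>

lemma reds_conv: "reds S t u \<Longrightarrow> conv S t u"
  by (induction rule: rtranclp_induct) (auto intro: conv.intros)

text \<open>The two subtyping clauses are strengthened by a dichotomy: either the context is well
  formed, or the derivation used only context-free rules and belongs to \<open>rs\<close>. The rules
  with a validity premise fall under the first alternative, as validity guarantees a well-formed
  context.\<close>

lemma embed:
  assumes ok: "ok_sig S"
  shows "wf_ctx S \<Gamma> \<Longrightarrow> wctx S \<Gamma>"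
    "const_type S \<Gamma> k t \<Longrightarrow> ktyp S \<Gamma> k t"
    "has_type S \<Gamma> e c \<Longrightarrow> ty S \<Gamma> e c"
    "wf_comp S \<Gamma> c i \<Longrightarrow> wcmp S \<Gamma> c i"
    "sub_type S \<Gamma> t1 t2 \<Longrightarrow> sbt S \<Gamma> t1 t2 \<and> (rs S t1 t2 \<or> wctx S \<Gamma>)"
    "sub_comp S \<Gamma> c1 c2 \<Longrightarrow> sbc S \<Gamma> c1 c2 \<and> (rsc S c1 c2 \<or> wctx S \<Gamma>)"
    "valid S \<Gamma> phi \<Longrightarrow> val S \<Gamma> phi"
proof (induction rule: wf_ctx_const_type_has_type_wf_comp_sub_type_sub_comp_valid.inducts)
  case (T_Case \<Gamma> e t1 t2 t i e1 e2)
  then show ?case using ty_wctx(3) by (blast intro: t_Case)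
next
  case (T_CaseM \<Gamma> e t1 t2 t i e1 M wp1 e2 wp2 W)
  have b: "ty S (t1 # \<Gamma>) e1 (Cmp M (shift t) wp1)" "ty S (t2 # \<Gamma>) e2 (Cmp M (shift t) wp2)"
    "ty S \<Gamma> e (Tot (sumT t1 t2))" "ty S \<Gamma> t (Tot (Universe i))"
    using T_CaseM by blast+
  have w: "wctx S (t1 # \<Gamma>)" "wctx S (t2 # \<Gamma>)" using ty_wctx(3) b(1,2) by blast+
  \<comment> \<open>Regularity of a branch puts its shifted return type into \<open>Type0\<close>,
    and weakening the given typing puts the same type into universe \<open>i\<close>; uniqueness of
    universes then forces \<open>i = 0\<close>.\<close>
  have "ty S (t1 # \<Gamma>) (shift t) (Tot (Universe 0))" using regular[OF ok b(1)] wcmp_CmpD(2)[OF ok] by blast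
  moreover have "ty S (t1 # \<Gamma>) (shift t) (Tot (Universe i))" using ty_shift(1)[OF ok_closed[OF ok] w(1) b(4)] by simp
  ultimately have "i = 0" using universe_unique[OF ok] by blast
  then show ?case using t_CaseM[OF b(3) w _ b(1,2)] b(4) T_CaseM by blast
next
  case (T_Bind \<Gamma> t2 M W B wp2 t1 e1 wp1 e2)
  then show ?case using ty_wctx(3) by (blast intro: t_Bind)
next
  case (S_Pi \<Gamma> t t' c' c)
  \<comment> \<open>If the extended context is well formed, so is \<open>\<Gamma>\<close>, and
    \<open>s_Pi\<close> applies; otherwise the comparison of codomains is context free and
    \<open>s_PiRaw\<close> applies.\<close>
  then show ?case using wctx_ConsD by (blast intro: s_Pi s_PiRaw rs_Pi)
next
  case (V_ExE \<Gamma> t phi r i)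
  then have "wctx S (phi # t # \<Gamma>)" using ty_wctx(7) by blast
  with V_ExE show ?case using wctx_ConsD by (blast intro: v_ExE)
next
  case (V_DisjE \<Gamma> p q r i)
  then show ?case using ty_wctx(7) by (blast intro: v_DisjE)
next
  case (V_Classical \<Gamma> phi i)
  then show ?case using ty_wctx(7) by (blast intro: v_Classical)
next
  case (V_ExI t \<Gamma> phi i e)
  then show ?case using ty_wctx(3) by (blast intro: v_ExI)
next
  case (V_EqSubst t \<Gamma> phi i a b)
  then show ?case using ty_wctx(3) by (blast intro: v_EqSubst)
next
  case (V_SumCase \<Gamma> e t1 t2 phi i)
  then show ?case using ty_wctx(3,7) by (blast intro: v_SumCase)
next
  case (S_RefineR t \<Gamma> phi)
  then have "wctx S (t # \<Gamma>)" using ty_wctx(7) by blast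
  then show ?case using S_RefineR wctx_ConsD by (blast intro: s_RefineR)
next
  case (SC_Pure \<Gamma> t' t wp wp')
  then show ?case using ty_wctx(7) by (blast intro: sc_Pure)
next
  case (SC_User F D \<Gamma> t' wp' t wp)
  then show ?case by (blast intro: sc_User rsc_User)
next
  case (SC_Trans \<Gamma> c1 c2 c3)
  then show ?case by (blast intro: sc_Trans rsc_Trans)
next
  case (S_Trans \<Gamma> t1 t2 t3)
  then show ?case by (blast intro: s_Trans rs_Trans)
next
  case (S_Red t' t \<Gamma>)
  then show ?case by (blast intro: s_Conv rs_Conv reds_conv)
next
  case (S_Exp t t' \<Gamma>)
  then show ?case by (blast intro: s_Conv rs_Conv reds_conv conv_sym)
next
  case (SC_Tot \<Gamma> t' t)
  then show ?case by (blast intro: sc_Tot rsc_Tot)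
next
  case (S_Refl \<Gamma> t)
  show ?case by (blast intro: s_Refl rs_Refl)
next
  case (SC_Refl \<Gamma> c)
  show ?case by (blast intro: sc_Refl rsc_Refl)
next
  case (S_RefineL \<Gamma> t phi)
  show ?case by (blast intro: s_RefineL rs_RefineL)
next
  case (T_Act \<Gamma> F D j A es)
  then show ?case using t_Act[of S \<Gamma> F D j A es] by blast
next
  case (T_Sub \<Gamma> e c' c i)
  then show ?case by (blast intro: t_Sub)
next
  case (V_EqRed a b \<Gamma> e t)
  then show ?case using v_EqRed[of S a b \<Gamma> e t] by blast
qed ((rule t_App t_Ret t_Lift t_Reify t_Reflect t_Run w_Nil w_Cons k_UnitT k_Unit k_Prod k_Pair k_Fst k_Snd k_Sum k_Inl k_Inr k_False k_Eq k_Ex t_Var t_Const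
    t_Universe t_Refine t_Pi t_Lam c_Tot c_Pure c_User v_ConjI v_DisjI1 v_DisjI2 v_ImpI v_AllI v_EqRefl v_EqExt
    v_Refine v_AllE v_ConjE1 v_ConjE2 v_ImpE v_FalseE v_Hyp; assumption))+

lemma conv_sub_type: "conv S t u \<Longrightarrow> sub_type S \<Gamma> t u \<and> sub_type S \<Gamma> u t"
proof (induction rule: conv.induct)
  case (conv_red t u)
  then have "reds S t u" by blast
  then show ?case using S_Red S_Exp by blast
next
  case (conv_trans t u v)
  then show ?case using S_Trans by blast
qed (simp_all add: S_Refl)

lemma rs_sub_type: "rs S t u \<Longrightarrow> sub_type S \<Gamma> t u" "rsc S c d \<Longrightarrow> sub_comp S \<Gamma> c d"
proof (induction arbitrary: \<Gamma> and \<Gamma> rule: rs_rsc.inducts)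
  case (rs_Conv t t')
  then show ?case using conv_sub_type by blast
next
  case (rs_Trans t1 t2 t3)
  show ?case by (rule S_Trans[OF rs_Trans(2,4)])
next
  case (rsc_Trans c1 c2 c3)
  show ?case by (rule SC_Trans[OF rsc_Trans(2,4)])
qed (blast intro: S_Refl S_RefineL SC_Refl S_Pi SC_Tot SC_User)+

lemma unembed:
  "wctx S \<Gamma> \<Longrightarrow> wf_ctx S \<Gamma>"
  "ktyp S \<Gamma> k t \<Longrightarrow> const_type S \<Gamma> k t"
  "ty S \<Gamma> e c \<Longrightarrow> has_type S \<Gamma> e c"
  "wcmp S \<Gamma> c i \<Longrightarrow> wf_comp S \<Gamma> c i"
  "sbt S \<Gamma> t1 t2 \<Longrightarrow> sub_type S \<Gamma> t1 t2"
  "sbc S \<Gamma> c1 c2 \<Longrightarrow> sub_comp S \<Gamma> c1 c2"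
  "val S \<Gamma> phi \<Longrightarrow> valid S \<Gamma> phi"
proof (induction rule: wctx_ktyp_ty_wcmp_sbt_sbc_val.inducts)
  case (s_Conv t t' \<Gamma>)
  then show ?case using conv_sub_type by blast
next
  case (s_PiRaw \<Gamma> t t' c' c)
  show ?case by (rule S_Pi[OF s_PiRaw(2) rs_sub_type(2)[OF s_PiRaw(3)]])
next
  case (t_Act \<Gamma> F D j A es)
  then show ?case using T_Act[of S \<Gamma> F D j A es] by blast
next
  case (v_EqRed a b \<Gamma> e t)
  then show ?case using V_EqRed[of S a b \<Gamma> e t] by blast
next
  case (v_EqSubst t \<Gamma> phi i a b)
  then show ?case using V_EqSubst[where t = t and \<Gamma> = \<Gamma> and phi = phi and a = a and b = b] by blast
next
  case (v_SumCase \<Gamma> e t1 t2 phi i)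
  then show ?case using V_SumCase[of S \<Gamma> e t1 t2 phi i] by blast
next
  case (v_DisjE \<Gamma> p q r i)
  then show ?case using V_DisjE[of S \<Gamma> p q r i] by blast
next
  case (v_Classical phi \<Gamma> i)
  then show ?case using V_Classical[of S \<Gamma> phi i] by blast
next
  case (v_ExE \<Gamma> t phi r i)
  then show ?case using V_ExE[of S \<Gamma> t phi r i] by blast
qed (rule S_Refl S_RefineL SC_Refl | (rule T_App T_Ret T_Lift T_Reify T_Reflect T_Run T_Case T_CaseM T_Bind
    W_Nil W_Cons K_UnitT K_Unit K_Prod K_Pair K_Fst K_Snd K_Sum K_Inl K_Inr K_False K_Eq K_Ex T_Var T_Const
    T_Universe T_Refine T_Pi T_Lam C_Tot C_Pure C_User S_Pi S_RefineR SC_Tot SC_Pure SC_User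
    V_ConjI V_DisjI1 V_DisjI2 V_ImpI V_AllI V_ExI V_EqRefl V_EqExt
    S_Trans SC_Trans T_Sub V_Refine V_AllE V_ConjE1 V_ConjE2 V_ImpE V_FalseE V_Hyp; assumption))+

section \<open>Extension of signatures\<close>

definition sig_le :: "signature \<Rightarrow> signature \<Rightarrow> bool" where
  "sig_le S S' \<longleftrightarrow> (\<forall>F D. lookup_eff S F = Some D \<longrightarrow> lookup_eff S' F = Some D) \<and>
     (\<forall>F F' p. lookup_lift S F F' = Some p \<longrightarrow> lookup_lift S' F F' = Some p)"

context
  fixes S S' assumes le: "sig_le S S'"
begin

lemma sig_leD:
  "lookup_eff S F = Some D \<Longrightarrow> lookup_eff S' F = Some D"
  "lookup_lift S F F' = Some (l, w) \<Longrightarrow> lookup_lift S' F F' = Some (l, w)"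
  "wp_type_of S M = Some W \<Longrightarrow> wp_type_of S' M = Some W"
  "ret_star_of S M = Some W \<Longrightarrow> ret_star_of S' M = Some W"
  "bind_star_of S M = Some W \<Longrightarrow> bind_star_of S' M = Some W"
  using le unfolding sig_le_def by (blast, blast, (cases M; force)+)

lemma red_mono: "red S t u \<Longrightarrow> red S' t u"
  by (induction rule: red.induct) (rule red.intros; (assumption | erule sig_leD))+

lemma conv_mono: "conv S t u \<Longrightarrow> conv S' t u"
  by (induction rule: conv.induct) (auto intro: conv.intros red_mono)

lemma rs_mono: "rs S t u \<Longrightarrow> rs S' t u" "rsc S c d \<Longrightarrow> rsc S' c d"
  by (induction rule: rs_rsc.inducts) (auto intro: rs_rsc.intros conv_mono sig_leD(1))

lemma ty_mono:
  "wctx S \<Gamma> \<Longrightarrow> wctx S' \<Gamma>"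
  "ktyp S \<Gamma> k t \<Longrightarrow> ktyp S' \<Gamma> k t"
  "ty S \<Gamma> e c \<Longrightarrow> ty S' \<Gamma> e c"
  "wcmp S \<Gamma> c i \<Longrightarrow> wcmp S' \<Gamma> c i"
  "sbt S \<Gamma> t1 t2 \<Longrightarrow> sbt S' \<Gamma> t1 t2"
  "sbc S \<Gamma> c1 c2 \<Longrightarrow> sbc S' \<Gamma> c1 c2"
  "val S \<Gamma> phi \<Longrightarrow> val S' \<Gamma> phi"
proof (induction rule: wctx_ktyp_ty_wcmp_sbt_sbc_val.inducts)
  case (s_Conv t t' \<Gamma>)
  then show ?case using conv_mono wctx_ktyp_ty_wcmp_sbt_sbc_val.s_Conv by blast
next
  case (s_PiRaw \<Gamma> t t' c' c)
  show ?case by (rule wctx_ktyp_ty_wcmp_sbt_sbc_val.s_PiRaw[OF s_PiRaw(2) rs_mono(2)[OF s_PiRaw(3)]])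
next
  case (t_Act \<Gamma> F D j A es)
  then show ?case using sig_leD(1) wctx_ktyp_ty_wcmp_sbt_sbc_val.t_Act[of S' \<Gamma> F D j A es] by blast
next
  case (v_EqRed a b \<Gamma> e t)
  then show ?case using red_mono wctx_ktyp_ty_wcmp_sbt_sbc_val.v_EqRed[of S' a b \<Gamma> e t] by blast
next
  case (v_EqSubst t \<Gamma> phi i a b)
  then show ?case using wctx_ktyp_ty_wcmp_sbt_sbc_val.v_EqSubst[where t = t and \<Gamma> = \<Gamma> and phi = phi and a = a and b = b] by blast
next
  case (v_SumCase \<Gamma> e t1 t2 phi i)
  then show ?case using wctx_ktyp_ty_wcmp_sbt_sbc_val.v_SumCase[of S' \<Gamma> e t1 t2 phi i] by blast
next
  case (v_DisjE \<Gamma> p q r i)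
  then show ?case using wctx_ktyp_ty_wcmp_sbt_sbc_val.v_DisjE[of S' \<Gamma> p q r i] by blast
next
  case (v_Classical phi \<Gamma> i)
  then show ?case using wctx_ktyp_ty_wcmp_sbt_sbc_val.v_Classical[of S' phi \<Gamma> i] by blast
next
  case (v_ExE \<Gamma> t phi r i)
  then show ?case using wctx_ktyp_ty_wcmp_sbt_sbc_val.v_ExE[of S' \<Gamma> t phi r i] by blast
qed (rule s_Refl s_RefineL sc_Refl | (rule t_App t_Ret t_Lift t_Reify t_Reflect t_Run t_Case t_CaseM t_Bind
    w_Nil w_Cons k_UnitT k_Unit k_Prod k_Pair k_Fst k_Snd k_Sum k_Inl k_Inr k_False k_Eq k_Ex t_Var t_Const
    t_Universe t_Refine t_Pi t_Lam c_Tot c_Pure c_User s_Pi s_RefineR sc_Tot sc_Pure sc_User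
    v_ConjI v_DisjI1 v_DisjI2 v_ImpI v_AllI v_ExI v_EqRefl v_EqExt
    s_Trans sc_Trans t_Sub v_Refine v_AllE v_ConjE1 v_ConjE2 v_ImpE v_FalseE v_Hyp; (assumption | erule sig_leD)))+

end

lemma ok_eff_mono: "sig_le S S' \<Longrightarrow> ok_eff S D \<Longrightarrow> ok_eff S' D"
  unfolding ok_eff_def using ty_mono(3) by blast

lemma ok_eff_closed:
  assumes ok: "ok_sig S" and D: "ok_eff S D"
  shows "fv (repr D) = {}" "fv (wp_type D) = {}" "fv (ret_star D) = {}" "fv (bind_star D) = {}"
    "fv (ret_impl D) = {}" "fv (bind_impl D) = {}"
    "A \<in> set (actions D) \<Longrightarrow> (\<forall>i < length (act_args A). fv (act_args A ! i) \<subseteq> {..<i}) \<and>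
      fv (act_res A) \<subseteq> {..<length (act_args A)} \<and> fv (act_wp A) \<subseteq> {..<length (act_args A)} \<and> fv (act_impl A) = {}"
proof -
  note cl = ty_closed(3)[OF ok_closed[OF ok]]
  have c0: "fv e = {}" if "ty S [] e c" for e c using cl[OF that] by simp
  show "fv (repr D) = {}" "fv (wp_type D) = {}" "fv (ret_star D) = {}" "fv (bind_star D) = {}"
    "fv (ret_impl D) = {}" "fv (bind_impl D) = {}"
    using D c0 unfolding ok_eff_def by blast+
  assume "A \<in> set (actions D)"
  then have A: "ty S (rev (act_args A)) (act_res A) (Tot (Universe 0))"
    "ty S (rev (act_args A)) (act_wp A) (Tot (App (wp_type D) (act_res A)))"
    "ty S [] (act_impl A) (Tot (act_impl_ty D A))"
    using D unfolding ok_eff_def by blast+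
  have "fv (act_args A ! i) \<subseteq> {..<i}" if i: "i < length (act_args A)" for i
  proof -
    obtain k where "ty S (rev (take i (act_args A))) (act_args A ! i) (Tot (Universe k))"
      using wctx_rev_nth[OF ok ty_wctx(3)[OF A(1)] i] by blast
    from cl[OF this] i show ?thesis by simp
  qed
  then show "(\<forall>i < length (act_args A). fv (act_args A ! i) \<subseteq> {..<i}) \<and>
      fv (act_res A) \<subseteq> {..<length (act_args A)} \<and> fv (act_wp A) \<subseteq> {..<length (act_args A)} \<and> fv (act_impl A) = {}"
    using cl[OF A(1)] cl[OF A(2)] c0[OF A(3)] by simp
qed

text \<open>An entry is typed over the earlier ones, which satisfy \<open>ok_sig\<close> by the
  induction hypothesis, so \<open>embed\<close> carries its typing into the auxiliary system. A new
  entry has a fresh name, hence shadows nothing, and all derivations persist in the larger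
  signature.\<close>

lemma wf_sig_ok: "wf_sig S \<Longrightarrow> ok_sig S"
proof (induction rule: wf_sig.induct)
  case WS_Nil
  then show ?case by (simp add: ok_sig_def closed_sig_def)
next
  case (WS_Eff S F D)
  let ?S = "EffDef F D # S"
  have le: "sig_le S ?S" using WS_Eff(2) by (auto simp: sig_le_def)
  have D: "ok_eff S D"
    using WS_Eff(3) embed(3)[OF WS_Eff.IH] unfolding wf_effect_def ok_eff_def by blast
  have cs: "closed_sig S" using WS_Eff.IH by simp
  have "closed_sig ?S"
    unfolding closed_sig_def
  proof ((rule conjI; intro allI impI), goal_cases)
    case (1 G E)
    then show ?case
    proof (cases "F = G")
      case True
      then have E: "E = D" using 1 by simp
      show ?thesis unfolding E using ok_eff_closed[OF WS_Eff.IH D] by blast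
    next
      case False
      then have "lookup_eff S G = Some E" using 1 by simp
      then show ?thesis by (rule cs[unfolded closed_sig_def, THEN conjunct1, THEN spec, THEN spec, THEN mp])
    qed
  next
    case (2 G G' l w)
    then have "lookup_lift S G G' = Some (l, w)" by simp
    then show ?case using closed_sigD(11,12)[OF cs] by blast
  qed
  moreover have "ok_eff ?S D'" if "lookup_eff ?S G = Some D'" for G D'
    using that WS_Eff.IH ok_eff_mono[OF le] D by (auto simp: ok_sig_def split: if_splits)
  moreover have "\<exists>D1 D2. lookup_eff ?S G = Some D1 \<and> lookup_eff ?S G' = Some D2 \<and>
      ty ?S [] w (Tot (lift_star_ty D1 D2)) \<and> ty ?S [] l (Tot (lift_impl_ty D1 D2 w))"
    if "lookup_lift ?S G G' = Some (l, w)" for G G' l w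
  proof -
    have "lookup_lift S G G' = Some (l, w)" using that by simp
    then show ?thesis
      by (rule ok_liftD[OF WS_Eff.IH]) (intro exI conjI sig_leD(1)[OF le] ty_mono(3)[OF le])
  qed
  ultimately show ?case unfolding ok_sig_def by blast
next
  case (WS_Lift S F F' D D' w l)
  let ?S = "LiftDef F F' l w # S"
  have ok: "ok_sig S" using WS_Lift by blast
  have le: "sig_le S ?S" using WS_Lift(2) by (auto simp: sig_le_def)
  have t: "ty S [] w (Tot (lift_star_ty D D'))" "ty S [] l (Tot (lift_impl_ty D D' w))"
    using embed(3)[OF ok WS_Lift(5)] embed(3)[OF ok WS_Lift(6)] .
  have cs: "closed_sig S" using ok by simp
  have fv: "fv l = {}" "fv w = {}" using ty_closed(3)[OF cs t(1)] ty_closed(3)[OF cs t(2)] by auto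
  have "closed_sig ?S"
    unfolding closed_sig_def
  proof ((rule conjI; intro allI impI), goal_cases)
    case (1 G E)
    then have "lookup_eff S G = Some E" by simp
    then show ?case by (rule cs[unfolded closed_sig_def, THEN conjunct1, THEN spec, THEN spec, THEN mp])
  next
    case (2 G G' l' w')
    show ?case
    proof (cases "F = G \<and> F' = G'")
      case True
      then show ?thesis using 2 fv by simp
    next
      case False
      then have "lookup_lift S G G' = Some (l', w')" using 2 by auto
      then show ?thesis using closed_sigD(11,12)[OF cs] by blast
    qed
  qed
  moreover have "ok_eff ?S E" if "lookup_eff ?S G = Some E" for G E
    using that ok ok_eff_mono[OF le] by (auto simp: ok_sig_def)
  moreover have "\<exists>D1 D2. lookup_eff ?S G = Some D1 \<and> lookup_eff ?S G' = Some D2 \<and>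
      ty ?S [] w' (Tot (lift_star_ty D1 D2)) \<and> ty ?S [] l' (Tot (lift_impl_ty D1 D2 w'))"
    if L: "lookup_lift ?S G G' = Some (l', w')" for G G' l' w'
  proof (cases "F = G \<and> F' = G'")
    case True
    then show ?thesis
      using L ty_mono(3)[OF le t(1)] ty_mono(3)[OF le t(2)] sig_leD(1)[OF le WS_Lift(3)] sig_leD(1)[OF le WS_Lift(4)]
      by auto
  next
    case False
    then have "lookup_lift S G G' = Some (l', w')" using L by auto
    then show ?thesis
      by (rule ok_liftD[OF ok]) (intro exI conjI sig_leD(1)[OF le] ty_mono(3)[OF le])
  qed
  ultimately show ?case unfolding ok_sig_def by blast
qed

section \<open>Progress\<close>

lemma sbc_CmpE: "sbc S \<Gamma> (Cmp M a w) c \<Longrightarrow> \<exists>a' w'. c = Cmp M a' w'"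
  using sbc_Tot_all(6)[of S \<Gamma> "Cmp M a w" c] by auto

section \<open>Canonical forms of closed normal terms\<close>

fun arity :: "const \<Rightarrow> nat" where
  "arity CInl = 1" | "arity CInr = 1" | "arity CFst = 1" | "arity CSnd = 1" | "arity CPair = 2"
| "arity CProd = 2" | "arity CSum = 2" | "arity CEx = 2" | "arity CEq = 3" | "arity _ = 0"

text \<open>The shape of the type of a saturated constant. Projections are left unconstrained, since
  their result type is arbitrary.\<close>

fun fin_ty :: "const \<Rightarrow> tm \<Rightarrow> bool" where
  "fin_ty CInl G \<longleftrightarrow> (\<exists>a b. G = sumT a b)"
| "fin_ty CInr G \<longleftrightarrow> (\<exists>a b. G = sumT a b)"
| "fin_ty CPair G \<longleftrightarrow> (\<exists>a b. G = prodT a b)"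
| "fin_ty CUnit G \<longleftrightarrow> G = unitT"
| "fin_ty CFst G \<longleftrightarrow> True"
| "fin_ty CSnd G \<longleftrightarrow> True"
| "fin_ty _ G \<longleftrightarrow> (\<exists>i. G = Universe i)"

fun spine_ty :: "nat \<Rightarrow> const \<Rightarrow> tm \<Rightarrow> bool" where
  "spine_ty 0 k G \<longleftrightarrow> fin_ty k G"
| "spine_ty (Suc n) k G \<longleftrightarrow> (\<exists>t u. G = Pi t (Tot u) \<and> spine_ty n k u)"

lemma fin_ty_sub: "fin_ty k G \<Longrightarrow> fin_ty k (sub s G)"
  by (cases k) auto

lemma spine_ty_sub: "spine_ty n k G \<Longrightarrow> spine_ty n k (sub s G)"
  by (induction n arbitrary: G s) (auto intro: fin_ty_sub)

lemma ktyp_spine: "ktyp S \<Gamma> k G \<Longrightarrow> spine_ty (arity k) k G"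
  by (cases rule: ktyp.cases) (auto simp: numeral_2_eq_2 numeral_3_eq_3)

text \<open>Shapes of closed normal total terms. An applied projection is left out: its argument
  would be a pair, and the projection could be contracted.\<close>

definition canon :: "tm \<Rightarrow> bool" where
  "canon e \<longleftrightarrow> (\<exists>t b. e = Lam t b) \<or> (\<exists>i. e = Universe i) \<or> (\<exists>t c. e = Pi t c) \<or> (\<exists>t b. e = Refine t b) \<or>
     (\<exists>k es. e = apps (Const k) es \<and> (k = CFst \<or> k = CSnd \<longrightarrow> es = []))"

text \<open>Computations of a user effect wait until they are reified, so all their operations are
  normal shapes. For \<open>Pure\<close> only a returned value is.\<close>

definition ccanon :: "eff \<Rightarrow> tm \<Rightarrow> bool" where
  "ccanon M e \<longleftrightarrow> (\<exists>t v. e = Ret M t v) \<or> (\<exists>F. M = User F \<and>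
     ((\<exists>t1 t2 w1 e1 w2 e2. e = Bind M t1 t2 w1 e1 w2 e2) \<or> (\<exists>j es. e = Act F j es) \<or>
      (\<exists>F' t w e'. e = Lift F' F t w e') \<or> (\<exists>e'. e = Reflect e')))"

context
  fixes S assumes ok: "ok_sig S"
begin

lemma sbt_const2_absurd:
  assumes "k = CSum \<or> k = CProd"
  shows "\<not> sbt S \<Gamma> (Universe i) (app2 (Const k) a b)" "\<not> sbt S \<Gamma> (Pi t c) (app2 (Const k) a b)"
    "\<not> sbt S \<Gamma> (Const k') (app2 (Const k) a b)"
    "sbt S \<Gamma> (app2 (Const k') x y) (app2 (Const k) a b) \<Longrightarrow> k' = CProd \<or> k' = CSum \<Longrightarrow> k' = k"
proof -
  have *: "\<exists>a' b'. qs S A (app2 (Const k) a' b')" if "sbt S \<Gamma> A (app2 (Const k) a b)" for A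
    using sbt_const2[OF ok_closed[OF ok], of \<Gamma> A k a b] that assms by auto
  show "\<not> sbt S \<Gamma> (Universe i) (app2 (Const k) a b)" using * qs_Universe by blast
  show "\<not> sbt S \<Gamma> (Pi t c) (app2 (Const k) a b)" using * qs_absurd(2)[OF ok] by blast
  show "\<not> sbt S \<Gamma> (Const k') (app2 (Const k) a b)" using * qs_Const by blast
  assume "sbt S \<Gamma> (app2 (Const k') x y) (app2 (Const k) a b)" "k' = CProd \<or> k' = CSum"
  then show "k' = k" using * qs_absurd(5)[OF ok, of k' k] by blast
qed

lemma sbt_Pi_absurd':
  "\<not> sbt S \<Gamma> (Universe i) (Pi t c)" "\<not> sbt S \<Gamma> (Const k) (Pi t c)"
  "\<not> sbt S \<Gamma> (sumT a b) (Pi t c)" "\<not> sbt S \<Gamma> (prodT a b) (Pi t c)"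
  by (rule notI, erule sbt_PiE[OF ok_closed[OF ok]], use qs_Universe qs_Const in blast)+
    (use sbt_Pi_absurd[OF ok] in blast)+

text \<open>A constant takes no more arguments than its arity, because the type of a saturated
  constant is a universe, the unit type, a pair type or a sum, and none of these lies below a
  product. Projections are excluded because their result may be a function.\<close>

lemma spine_typing:
  assumes "k \<noteq> CFst" "k \<noteq> CSnd"
  shows "ty S \<Gamma> (apps (Const k) es) c \<Longrightarrow> length es \<le> arity k \<and>
    (\<exists>G i. spine_ty (arity k - length es) k G \<and> ty S \<Gamma> G (Tot (Universe i)) \<and> sbc S \<Gamma> (Tot G) c)"
proof (induction es arbitrary: c rule: rev_induct)
  case Nil
  then have "ty S \<Gamma> (Const k) c" by simp
  from ty_gen[OF this] obtain G where G: "ktyp S \<Gamma> k G" "sbc S \<Gamma> (Tot G) c" by auto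
  obtain i where "ty S \<Gamma> G (Tot (Universe i))" using ktyp_regular[OF ok G(1)] by blast
  then show ?case using ktyp_spine[OF G(1)] G(2) by auto
next
  case (snoc a es)
  then have "ty S \<Gamma> (App (apps (Const k) es) a) c" by simp
  from ty_gen[OF this] obtain c0 where c0: "gen S \<Gamma> (App (apps (Const k) es) a) c0" "sbc S \<Gamma> c0 c" by blast
  then obtain t d where f: "ty S \<Gamma> (apps (Const k) es) (Tot (Pi t d))" and a: "ty S \<Gamma> a (Tot t)" and d: "c0 = csub1 a d"
    by auto
  obtain G i where G: "length es \<le> arity k" "spine_ty (arity k - length es) k G" "ty S \<Gamma> G (Tot (Universe i))"
    "sbt S \<Gamma> G (Pi t d)"
    using snoc.IH[OF f] by auto
  show ?case
  proof (cases "arity k - length es")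
    case 0
    then have "fin_ty k G" using G(2) by simp
    then show ?thesis using G(4) assms sbt_Pi_absurd' by (cases k) auto
  next
    case (Suc n)
    then obtain t0 u0 where t0: "G = Pi t0 (Tot u0)" "spine_ty n k u0" using G(2) by auto
    obtain j l where j: "ty S \<Gamma> t0 (Tot (Universe j))" "ty S (t0 # \<Gamma>) u0 (Tot (Universe l))"
      using ty_PiD[OF ok G(3)[unfolded t0(1)]] ty_TotD[OF ok] by blast
    obtain u where u: "ty S \<Gamma> a (Tot t0)" "csub1 a d = Tot u" "sbt S \<Gamma> (sub1 a u0) u"
      using pi_app[OF ok G(4)[unfolded t0(1)] a j(1)] by blast
    have "ty S \<Gamma> (sub1 a u0) (Tot (Universe l))" using ty_sub1(1)[OF ok_closed[OF ok] u(1) j(2)] by simp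
    moreover have "sbc S \<Gamma> (Tot (sub1 a u0)) c" using sc_Trans[OF sc_Tot[OF u(3)]] c0(2) d u(2) by simp
    moreover have "arity k - length (es @ [a]) = n" using Suc by simp
    moreover have "length (es @ [a]) \<le> arity k" using Suc by simp
    ultimately show ?thesis using spine_ty_sub[OF t0(2)] by blast
  qed
qed

lemma canon_const2:
  assumes "canon e" "ty S \<Gamma> e (Tot (app2 (Const k) a b))" "k = CSum \<or> k = CProd"
  shows "\<exists>k' es. e = apps (Const k') es \<and> length es = arity k' \<and> k' \<noteq> CFst \<and> k' \<noteq> CSnd \<and>
    (\<exists>x y. fin_ty k' (app2 (Const k) x y))"
proof -
  obtain c0 where g: "gen S \<Gamma> e c0" "sbc S \<Gamma> c0 (Tot (app2 (Const k) a b))" using ty_gen[OF assms(2)] by blast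
  note ab = sbt_const2_absurd[OF assms(3)]
  from assms(1)[unfolded canon_def] show ?thesis
  proof (elim disjE exE conjE)
    fix k' es assume e: "e = apps (Const k') es" and proj: "k' = CFst \<or> k' = CSnd \<longrightarrow> es = []"
    show ?thesis
    proof (cases "k' = CFst \<or> k' = CSnd")
      case True
      then have "e = Const k'" using e proj by simp
      then show ?thesis using g True ab(2) by (auto elim!: ktyp.cases)
    next
      case False
      then obtain G where G: "length es \<le> arity k'" "spine_ty (arity k' - length es) k' G" "sbt S \<Gamma> G (app2 (Const k) a b)"
        using spine_typing[OF _ _ assms(2)[unfolded e]] False by auto
      have n: "arity k' - length es = 0"
      proof (rule ccontr)
        assume "arity k' - length es \<noteq> 0"
        then obtain n where "arity k' - length es = Suc n" using not0_implies_Suc by blast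
        then show False using G(2,3) ab(2) by auto
      qed
      then have fin: "fin_ty k' G" using G(2) by simp
      then have "\<exists>x y. G = app2 (Const k) x y"
        using G(3) ab False by (cases k') auto
      moreover have "length es = arity k'" using n G(1) by simp
      ultimately show ?thesis using e fin False by blast
    qed
  qed (use g ab in auto)
qed

lemma canon_sum:
  assumes "canon e" "ty S \<Gamma> e (Tot (sumT a b))"
  shows "\<exists>x. e = App (Const CInl) x \<or> e = App (Const CInr) x"
proof -
  obtain k es x y where *: "e = apps (Const k) es" "length es = arity k" "k \<noteq> CFst" "k \<noteq> CSnd" "fin_ty k (sumT x y)"
    using canon_const2[OF assms] by blast
  from *(5,3,4) have "k = CInl \<or> k = CInr" by (cases k) auto
  then show ?thesis using *(1,2) by (auto simp: length_Suc_conv)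
qed

lemma canon_prod:
  assumes "canon e" "ty S \<Gamma> e (Tot (prodT a b))"
  shows "\<exists>x y. e = app2 (Const CPair) x y"
proof -
  obtain k es x y where *: "e = apps (Const k) es" "length es = arity k" "k \<noteq> CFst" "k \<noteq> CSnd" "fin_ty k (prodT x y)"
    using canon_const2[OF assms] by blast
  from *(5,3,4) have "k = CPair" by (cases k) auto
  then show ?thesis using *(1,2) by (auto simp: length_Suc_conv numeral_2_eq_2)
qed

text \<open>The empty context rules out variables, so the principal argument of each elimination is
  canonical at its type and the elimination would be a redex.\<close>

lemma progress:
  "is_value S e \<Longrightarrow> ty S [] e c \<Longrightarrow> (case c of Tot A \<Rightarrow> canon e | Cmp M t w \<Rightarrow> ccanon M e)"
proof (induction e arbitrary: c rule: measure_induct_rule[of size])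
  case (less e)
  note nf = less.prems(1)[unfolded is_value_def]
  obtain c0 where g: "gen S [] e c0" and c0: "sbc S [] c0 c" using ty_gen[OF less.prems(2)] by blast
  have tot: ?case if "c0 = Tot A" "canon e" for A
    using that c0 sbc_TotE by fastforce
  have cmp: ?case if "c0 = Cmp M t w" "ccanon M e" for M t w
    using that c0 sbc_CmpE by fastforce
  show ?case
  proof (cases e)
    case (App f a)
    then obtain t d where fa: "ty S [] f (Tot (Pi t d))" "ty S [] a (Tot t)" using g by auto
    have vf: "is_value S f" "is_value S a" using nf App unfolding is_value_def by (auto intro: red.intros)
    have "canon f" using less.IH[OF _ vf(1) fa(1)] App by simp
    moreover have "\<nexists>t b. f = Lam t b" using nf App R_Beta by blast
    moreover have "gen S [] f (Tot (Universe i)) \<Longrightarrow> False" if "\<And>c. gen S [] f c \<Longrightarrow> \<exists>i. c = Tot (Universe i)" for i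
      using ty_gen[OF fa(1)] that sbt_Pi_absurd'(1) by fastforce
    \<comment> \<open>A universe, a product or a refinement has a universe as its type, which lies
      below no product; so the function is a constant applied to some arguments.\<close>
    ultimately obtain k es where f: "f = apps (Const k) es" "k = CFst \<or> k = CSnd \<longrightarrow> es = []"
      using ty_gen[OF fa(1)] sbt_Pi_absurd'(1) unfolding canon_def by fastforce
    show ?thesis
    proof (cases "k = CFst \<or> k = CSnd")
      case True
      then obtain p q where "ty S [] a (Tot (prodT p q))"
        using Proj_any[OF ok, of "[]" k a c] less.prems(2) App f by auto
      then obtain x y where "a = app2 (Const CPair) x y"
        using canon_prod less.IH[OF _ vf(2)] App by fastforce
      then have False using nf App f True R_Fst R_Snd by fastforce
      then show ?thesis ..
    next
      case False
      have e: "e = apps (Const k) (es @ [a])" using App f by simp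
      then obtain A where "c = Tot A" using spine_typing[of k "[]" "es @ [a]" c] False less.prems(2) sbc_TotE by blast
      moreover have "canon e" using e False unfolding canon_def by blast
      ultimately show ?thesis by simp
    qed
  next
    case (Case t x e1 e2)
    then obtain t1 t2 where x: "ty S [] x (Tot (sumT t1 t2))" using g by auto
    have v: "is_value S x" using nf Case unfolding is_value_def by (auto intro: red.intros)
    obtain y where "x = App (Const CInl) y \<or> x = App (Const CInr) y"
      using canon_sum[OF _ x] less.IH[OF _ v x] Case by auto
    then have False using nf Case R_CaseInl R_CaseInr by blast
    then show ?thesis ..
  next
    case (Run x)
    then obtain t w where x: "ty S [] x (Cmp Pure t w)" using g by auto
    have v: "is_value S x" using nf Run unfolding is_value_def by (auto intro: red.intros)
    obtain t v where "x = Ret Pure t v" using less.IH[OF _ v x] Run by (auto simp: ccanon_def)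
    then have False using nf Run R_RunRet by blast
    then show ?thesis ..
  next
    case (Reify x)
    then obtain F t w D where x: "ty S [] x (Cmp (User F) t w)" "lookup_eff S F = Some D" using g by auto
    have v: "is_value S x" using nf Reify unfolding is_value_def by (auto intro: red.intros)
    have "ccanon (User F) x" using less.IH[OF _ v x(1)] Reify by simp
    \<comment> \<open>Generation for \<open>x\<close> supplies the lookups of actions and lifts that
      the reification rules ask for.\<close>
    moreover obtain c1 where g1: "gen S [] x c1" using ty_gen[OF x(1)] by blast
    ultimately have "\<exists>y. red S (Reify x) y"
      unfolding ccanon_def
      by (elim disjE exE conjE) (use x(2) g1 in \<open>auto simp del: foldl_Cons intro: red.intros(8-12)\<close>)
    then have False using nf Reify by blast
    then show ?thesis ..
  next
    case (Bind M t1 t2 w1 e1 w2 e2)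
    show ?thesis
    proof (cases M)
      case Pure
      then have x: "ty S [] e1 (Cmp Pure t1 w1)" using g Bind by auto
      have v: "is_value S e1" using nf Bind unfolding is_value_def by (auto intro: red.intros)
      obtain t v where "e1 = Ret Pure t v" using less.IH[OF _ v x] Bind by (auto simp: ccanon_def)
      then have False using nf Bind Pure R_PureBind by blast
      then show ?thesis ..
    next
      case (User F)
      then have "ccanon M e" using Bind by (simp add: ccanon_def)
      then show ?thesis using cmp g Bind by auto
    qed
  next
    case (Const k)
    have "e = apps (Const k) []" using Const by simp
    then have "canon e" unfolding canon_def by blast
    then show ?thesis using tot g Const by auto
  qed (use g tot cmp in \<open>auto simp: canon_def ccanon_def\<close>)
qed

lemma progress_Pure: "is_value S e \<Longrightarrow> ty S [] e (Cmp Pure t w) \<Longrightarrow> \<exists>t' v. e = Ret Pure t' v"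
  using progress by (fastforce simp: ccanon_def)

end

section \<open>Total correctness\<close>

lemma termip_value: "termip (red S) e \<Longrightarrow> \<exists>v. reds S e v \<and> is_value S v"
proof (induction rule: accp.induct)
  case (accI e)
  show ?case
  proof (cases "is_value S e")
    case False
    then obtain e' where "red S e e'" unfolding is_value_def by blast
    then show ?thesis using accI(2)[of e'] by (meson conversep.intros converse_rtranclp_into_rtranclp)
  qed blast
qed

lemma reds_Run: "reds S e e' \<Longrightarrow> reds S (Run e) (Run e')"
  by (induction rule: rtranclp_induct) (blast intro: E_Run rtranclp.rtrancl_into_rtrancl)+

text \<open>The predicate \<open>p\<close> on \<open>t\<close> restricts to the subtype
  \<open>t'\<close> by contravariance; this types the precondition of the return, as
  \<open>val_conv\<close> requires.\<close>

lemma ret_pure_post: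
  assumes ok: "ok_sig S" and e: "ty S \<Gamma> (Ret Pure t' v) (Cmp Pure t wp)"
    and p: "ty S \<Gamma> p (Tot (arr t (Universe 0)))" and wp: "val S \<Gamma> (App wp p)"
  shows "val S \<Gamma> (App p v)"
proof -
  note cs = ok_closed[OF ok]
  obtain c0 where g: "gen S \<Gamma> (Ret Pure t' v) c0" and sb: "sbc S \<Gamma> c0 (Cmp Pure t wp)" using ty_gen[OF e] by blast
  have w: "wctx S \<Gamma>" using e by (rule ty_wctx)
  have t': "ty S \<Gamma> t' (Tot (Universe 0))" "ty S \<Gamma> v (Tot t')" and c0: "c0 = Cmp Pure t' (apps pure_ret_star [t', v])"
    using g by auto
  obtain i where i: "wcmp S \<Gamma> c0 i" using regular[OF ok gen_ty[OF ok g w]] by blast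
  obtain j where j: "wcmp S \<Gamma> (Cmp Pure t wp) j" using regular[OF ok e] by blast
  note sub = sbc_PureE[OF ok sb[unfolded c0] i[unfolded c0] j]
  have ret: "val S \<Gamma> (App (apps pure_ret_star [t', v]) p)" by (rule val_pure_mono[OF ok sub(2) p wp])
  have v: "ty S \<Gamma> v (Tot t)" by (rule ty_sbt[OF ok t'(2) sub(1) wcmp_CmpD(2)[OF ok j]])
  have p': "ty S \<Gamma> p (Tot (arr t' (Universe 0)))" using ty_weaken_pred[OF ok p] t'(1) sub(1) by blast
  have "ty S \<Gamma> (apps pure_ret_star [t', v]) (Tot (App pure_wp_type t'))"
    by (rule ret_star_app[OF ok _ _ t', where M = Pure]) simp_all
  then have "ty S \<Gamma> (apps pure_ret_star [t', v]) (Tot (arr (arr t' (Universe 0)) (Universe 0)))"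
    using ty_pure_wp_conv[OF cs t'(1)] by blast
  then have "ty S \<Gamma> (App (apps pure_ret_star [t', v]) p) (Tot (Universe 0))" using p' by (rule ty_app_arr[OF cs])
  moreover have "ty S \<Gamma> (App p v) (Tot (Universe 0))" using p v by (rule ty_app_arr[OF cs])
  ultimately show ?thesis using val_conv[OF ok ret conv_ret_star[OF ok]] by blast
qed

theorem corollary3:
  fixes S :: signature and e t wp p :: tm
  assumes "wf_sig S"
    and "strongly_normalizing S"
    and "has_type S [] e (Cmp Pure t wp)"
    and "has_type S [] p (Tot (arr t (Universe 0)))"
    and "valid S [] (App wp p)"
  shows "\<exists>v. is_value S v \<and> reds S (Run e) v \<and> valid S [] (App p v)"
proof -
  have ok: "ok_sig S" using assms(1) by (rule wf_sig_ok)
  obtain e' where e': "reds S e e'" "is_value S e'"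
    using assms(2,3) termip_value unfolding strongly_normalizing_def by blast
  have "ty S [] e' (Cmp Pure t wp)"
    using e'(1) by (induction rule: rtranclp_induct) (use embed(3)[OF ok assms(3)] sr_red[OF ok] in blast)+
  moreover from progress_Pure[OF ok e'(2) this] obtain t' v where v: "e' = Ret Pure t' v" by blast
  ultimately have "val S [] (App p v)"
    using ret_pure_post[OF ok _ embed(3)[OF ok assms(4)] embed(7)[OF ok assms(5)]] by blast
  moreover have "reds S (Run e) v"
    using reds_Run[OF e'(1)] R_RunRet unfolding v by (rule rtranclp.rtrancl_into_rtrancl)
  \<comment> \<open>The argument of a return is an evaluation position, so a step of
    \<open>v\<close> would be a step of the normal form \<open>e'\<close>.\<close>
  moreover have "is_value S v" using e'(2) E_Ret unfolding v is_value_def by blast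
  ultimately show ?thesis using unembed(7) by blast
qed

end
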